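(* Assume that $\lambda$ and $x_0$ are such that the relative positions of the two slits change at the two critical jumps, i.e. either (lower chamber trapping) $f_L(t_1^* )<f_R(t_1^* )$ and $f_L(t_2^* )>f_R(t_2^* )$, or (upper chamber trapping) $f_L(t_1^* )>f_R(t_1^* )$ and $f_L(t_2^* )<f_R(t_2^* )$. Assume moreover that $|Tr|>2$, where $Tr=Tr^U$ if the lower chamber is trapping and $Tr=Tr^L$ if the upper chamber is trapping. Then there are constants $K,\zeta>0$ such that for any $\epsilon>0$ there exist $V_0=V_0(\epsilon)$ and $T=T(\epsilon)$ such that for each $V\ge V_0$ the complement, within $\{(t_0,v_0): |v_0|\in[V,V+1]\}$, of the set $$\left\{(t_0,v_0):\ |v_0|\in[V,V+1],\ \ |v(t)|\ge \frac{|v(T)|}{K}\,e^{\zeta (t-T)}\ \text{ for all } t\ge T\right\}$$ has measure less than $\epsilon$.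
   Context: Setting (rectangular billiard with two moving slits). The table is the unit square $[0,1]\times[0,1]$ with coordinates $(x,y)$. Fix $\lambda\in(0,1)$ and $x_0$ with $0\le x_0<\lambda$. Let $f_L,f_R:\mathbb{R}\to(0,1)$ be $C^2$ functions, periodic with period $2$. At time $t$ there are two horizontal slits of zero thickness: the left slit $\{0\le x\le\lambda,\ y=f_L(t)\}$ and the right slit $\{\lambda\le x\le 1,\ y=f_R(t)\}$. A massless ball moves freely between collisions, with horizontal speed always equal to $1$. It reflects elastically from the boundary of the square and from the slits: the vertical velocity $w$ becomes $-w$ at the floor $y=0$ and at the ceiling $y=1$, and becomes $-w+2\dot f_\bullet(t)$ at a collision at time $t$ with the slit of height $f_\bullet$, $\bullet\in\{L,R\}$; the horizontal velocity is reversed at $x=0$ and $x=1$. The horizontal position is $x_0$ at time $0$, moving to the right, so it is $2$-periodic in time. Within each period the ball passes from the left part to the right part of the table at time $t_1^*=\lambda-x_0$ and from the right part to the left part at time $t_2^*=2-\lambda-x_0$ (mod $2$). Thus the slit relevant to the ball at time $t$ (mod $2$) has height $$f(t)=\begin{cases} f_L(t) & 0<t<t_1^*\ \text{or}\ t_2^*<t<2,\\ f_R(t) & t_1^*<t<t_2^*.\end{cases}$$ At the times $t_1^*,t_2^*$ the vertical position and velocity of the ball are continuous; after such a time the ball is in the upper (resp. lower) chamber, i.e. above (resp. below) the current slit, according to its height relative to the new slit. Orbits are recorded by $(t_n,v_n)$, $n\ge0$, where $t_n$ (mod $2$) is the time of the $n$-th collision with a slit and $v_n$ is the vertical velocity immediately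 after that collision; $(t_0,v_0)$ is the initial condition. Orbits having a collision at $x=\lambda$ (a set of measure zero) are excluded. Measure is Lebesgue measure in $(t_0,v_0)\in(\mathbb{R}/2\mathbb{Z})\times\mathbb{R}$. Write $v(t)$ for the vertical velocity of the ball after an elapsed time $t$ since the initial collision. Definition of $Tr$. For $i=1,2$ let $f_i^{\pm}=f(t_i^*\pm)$ and $\dot f_i^{\pm}=\dot f(t_i^*\pm)$ be the one-sided limits. If the lower chamber is trapping, put $a_i=\dot f_i^-(1-f_i^+)-\dot f_i^+(1-f_i^-)$, $$\alpha=\left(\int_0^{t_1^*}+\int_{t_2^*}^2\right)\frac{ds}{(1-f(s))^2},\qquad \beta=\int_{t_1^*}^{t_2^*}\frac{ds}{(1-f(s))^2},$$ $$Tr^U=\left(\frac{1-f_1^-}{1-f_1^+}-a_1\beta\right)\left(\frac{1-f_2^-}{1-f_2^+}-a_2\alpha\right)+\left(\frac{1-f_1^+}{1-f_1^-}-a_1\alpha\right)\left(\frac{1-f_2^+}{1-f_2^-}-a_2\beta\right)-a_1a_2\alpha\beta .$$ If the upper chamber is trapping, put $a_i'=\dot f_i^+f_i^--\dot f_i^-f_i^+$, $$\alpha'=\left(\int_0^{t_1^*}+\int_{t_2^*}^2\right)\frac{ds}{f(s)^2},\qquad \beta'=\int_{t_1^*}^{t_2^*}\frac{ds}{f(s)^2},$$ $$Tr^L=\left(\frac{f_1^-}{f_1^+}-a_1'\beta'\right)\left(\frac{f_2^-}{f_2^+}-a_2'\alpha'\right)+\left(\frac{f_1^+}{f_1^-}-a_1'\alpha'\right)\left(\frac{f_2^+}{f_2^-}-a_2'\beta'\right)-a_1'a_2'\alpha'\beta'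 .$$ *)

theory Defs
  imports "HOL-Analysis.Analysis" "HOL-Library.Real_Mod"
begin

definition C2 :: "(real \<Rightarrow> real) \<Rightarrow> bool" where
  "C2 g \<longleftrightarrow> (\<forall>t. g differentiable (at t)) \<and> (\<forall>t. deriv g differentiable (at t))
     \<and> continuous_on UNIV (deriv (deriv g))"

definition slit_motion :: "(real \<Rightarrow> real) \<Rightarrow> bool" where
  "slit_motion g \<longleftrightarrow> C2 g \<and> (\<forall>t. g (t + 2) = g t) \<and> (\<forall>t. 0 < g t \<and> g t < 1)"

text \<open>
  The horizontal position is the 2-periodic triangle wave through x0 at time 0 (moving right). It
  equals lam exactly at the times congruent modulo 2 to one of the following two.
\<close>

definition tcrit1 :: "real \<Rightarrow> real \<Rightarrow> real" where
  "tcrit1 lam x0 = lam - x0"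

definition tcrit2 :: "real \<Rightarrow> real \<Rightarrow> real" where
  "tcrit2 lam x0 = 2 - lam - x0"

definition critical :: "real \<Rightarrow> real \<Rightarrow> real \<Rightarrow> bool" where
  "critical lam x0 t \<longleftrightarrow> t rmod 2 = tcrit1 lam x0 \<or> t rmod 2 = tcrit2 lam x0"

text \<open>
  Height of the slit in the part of the table that contains the ball. The value at a critical time
  is immaterial: orbits that hit a slit at such a time are excluded below.
\<close>

definition slit :: "real \<Rightarrow> real \<Rightarrow> (real \<Rightarrow> real) \<Rightarrow> (real \<Rightarrow> real) \<Rightarrow> real \<Rightarrow> real" where
  "slit lam x0 fL fR t =
     (if t rmod 2 < tcrit1 lam x0 \<or> tcrit2 lam x0 < t rmod 2 then fL t else fR t)"

definition collides :: "(real \<Rightarrow> real) \<Rightarrow> (real \<Rightarrow> real) \<Rightarrow> real \<Rightarrow> bool" where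
  "collides f y t \<longleftrightarrow> y t = 0 \<or> y t = 1 \<or> y t = f t"

definition reflect :: "(real \<Rightarrow> real) \<Rightarrow> real \<Rightarrow> real \<Rightarrow> real \<Rightarrow> real" where
  "reflect f t h u =
     (if h = 0 \<or> h = 1 then - u else if h = f t then - u + 2 * deriv f t else u)"

text \<open>
  \<open>orbit lam x0 fL fR t0 v0 y w\<close>: on the time interval from t0 to infinity, y is the height and w
  the (right-continuous) vertical velocity of a ball that leaves the slit at time t0 with velocity
  v0. Only the values of y and w at times \<open>\<ge> t0\<close> are constrained.

  Orbits with a collision at x = lam are excluded, and only finitely many collisions occur in
  bounded time, so that y and w are determined by (t0, v0): starting from any time s, the ball flies
  freely until the first collision after s, where its velocity is changed by \<open>reflect\<close> (which is
  the identity if there is no collision at time t). The last clause says that slits are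
  impenetrable, which matters only for collisions with zero relative velocity; at the critical times
  the chamber is decided anew by comparing y with the new slit.
\<close>

definition orbit :: "real \<Rightarrow> real \<Rightarrow> (real \<Rightarrow> real) \<Rightarrow> (real \<Rightarrow> real) \<Rightarrow> real \<Rightarrow> real \<Rightarrow>
    (real \<Rightarrow> real) \<Rightarrow> (real \<Rightarrow> real) \<Rightarrow> bool" where
  "orbit lam x0 fL fR t0 v0 y w \<longleftrightarrow>
     (let f = slit lam x0 fL fR in
      y t0 = f t0 \<and> w t0 = v0 \<and>
      (\<forall>t\<ge>t0. 0 \<le> y t \<and> y t \<le> 1) \<and>
      (\<forall>t\<ge>t0. critical lam x0 t \<longrightarrow> y t \<noteq> fL t \<and> y t \<noteq> fR t) \<and>
      (\<forall>b. finite {t \<in> {t0..b}. collides f y t}) \<and>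
      (\<forall>s t. t0 \<le> s \<and> s < t \<and> (\<forall>r\<in>{s<..<t}. \<not> collides f y r) \<longrightarrow>
         y t = y s + (t - s) * w s \<and> w t = reflect f t (y t) (w s)) \<and>
      (\<forall>s t. t0 \<le> s \<and> s \<le> t \<and> (\<forall>r\<in>{s..t}. \<not> critical lam x0 r) \<longrightarrow>
         0 \<le> (y s - f s) * (y t - f t)))"

definition lower_trapping :: "real \<Rightarrow> real \<Rightarrow> (real \<Rightarrow> real) \<Rightarrow> (real \<Rightarrow> real) \<Rightarrow> bool" where
  "lower_trapping lam x0 fL fR \<longleftrightarrow>
     fL (tcrit1 lam x0) < fR (tcrit1 lam x0) \<and> fL (tcrit2 lam x0) > fR (tcrit2 lam x0)"

definition upper_trapping :: "real \<Rightarrow> real \<Rightarrow> (real \<Rightarrow> real) \<Rightarrow> (real \<Rightarrow> real) \<Rightarrow> bool" where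
  "upper_trapping lam x0 fL fR \<longleftrightarrow>
     fL (tcrit1 lam x0) > fR (tcrit1 lam x0) \<and> fL (tcrit2 lam x0) < fR (tcrit2 lam x0)"

definition TrU :: "real \<Rightarrow> real \<Rightarrow> (real \<Rightarrow> real) \<Rightarrow> (real \<Rightarrow> real) \<Rightarrow> real" where
  "TrU lam x0 fL fR =
     (let f = slit lam x0 fL fR; t1 = tcrit1 lam x0; t2 = tcrit2 lam x0;
          f1m = Lim (at_left t1) f; f1p = Lim (at_right t1) f;
          f2m = Lim (at_left t2) f; f2p = Lim (at_right t2) f;
          d1m = Lim (at_left t1) (deriv f); d1p = Lim (at_right t1) (deriv f);
          d2m = Lim (at_left t2) (deriv f); d2p = Lim (at_right t2) (deriv f);
          a1 = d1m * (1 - f1p) - d1p * (1 - f1m);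
          a2 = d2m * (1 - f2p) - d2p * (1 - f2m);
          \<alpha> = integral {0..t1} (\<lambda>s. 1 / (1 - f s)\<^sup>2) + integral {t2..2} (\<lambda>s. 1 / (1 - f s)\<^sup>2);
          \<beta> = integral {t1..t2} (\<lambda>s. 1 / (1 - f s)\<^sup>2)
      in ((1 - f1m) / (1 - f1p) - a1 * \<beta>) * ((1 - f2m) / (1 - f2p) - a2 * \<alpha>)
         + ((1 - f1p) / (1 - f1m) - a1 * \<alpha>) * ((1 - f2p) / (1 - f2m) - a2 * \<beta>)
         - a1 * a2 * \<alpha> * \<beta>)"

definition TrL :: "real \<Rightarrow> real \<Rightarrow> (real \<Rightarrow> real) \<Rightarrow> (real \<Rightarrow> real) \<Rightarrow> real" where
  "TrL lam x0 fL fR =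
     (let f = slit lam x0 fL fR; t1 = tcrit1 lam x0; t2 = tcrit2 lam x0;
          f1m = Lim (at_left t1) f; f1p = Lim (at_right t1) f;
          f2m = Lim (at_left t2) f; f2p = Lim (at_right t2) f;
          d1m = Lim (at_left t1) (deriv f); d1p = Lim (at_right t1) (deriv f);
          d2m = Lim (at_left t2) (deriv f); d2p = Lim (at_right t2) (deriv f);
          a1 = d1p * f1m - d1m * f1p;
          a2 = d2p * f2m - d2m * f2p;
          \<alpha> = integral {0..t1} (\<lambda>s. 1 / (f s)\<^sup>2) + integral {t2..2} (\<lambda>s. 1 / (f s)\<^sup>2);
          \<beta> = integral {t1..t2} (\<lambda>s. 1 / (f s)\<^sup>2)
      in (f1m / f1p - a1 * \<beta>) * (f2m / f2p - a2 * \<alpha>)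
         + (f1p / f1m - a1 * \<alpha>) * (f2p / f2m - a2 * \<beta>)
         - a1 * a2 * \<alpha> * \<beta>)"

text \<open>
  The trace belongs to the chamber that is not trapping.
\<close>

definition Tr :: "real \<Rightarrow> real \<Rightarrow> (real \<Rightarrow> real) \<Rightarrow> (real \<Rightarrow> real) \<Rightarrow> real" where
  "Tr lam x0 fL fR =
     (if lower_trapping lam x0 fL fR then TrU lam x0 fL fR else TrL lam x0 fL fR)"

text \<open>
  Initial conditions; the circle of length 2 is represented by its fundamental domain.
\<close>

definition initial_conds :: "real \<Rightarrow> (real \<times> real) set" where
  "initial_conds V = {(t0, v0). t0 \<in> {0..<2} \<and> \<bar>v0\<bar> \<in> {V..V + 1}}"

text \<open>
  Here t is the time elapsed since t0, so the set is meaningful only for \<open>T \<ge> 0\<close>.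
\<close>

definition growing_conds :: "real \<Rightarrow> real \<Rightarrow> (real \<Rightarrow> real) \<Rightarrow> (real \<Rightarrow> real) \<Rightarrow>
    real \<Rightarrow> real \<Rightarrow> real \<Rightarrow> real \<Rightarrow> (real \<times> real) set" where
  "growing_conds lam x0 fL fR K \<zeta> T V =
     {(t0, v0) \<in> initial_conds V. \<exists>y w. orbit lam x0 fL fR t0 v0 y w \<and>
        (\<forall>t\<ge>T. \<bar>w (t0 + t)\<bar> \<ge> \<bar>w (t0 + T)\<bar> / K * exp (\<zeta> * (t - T)))}"

end

theory Submission
  imports Defs
begin

text \<open>Turning the table upside down exchanges the two trapping cases and turns
  \<open>TrU\<close> into \<open>TrL\<close> (\<open>orbit_flip\<close>, \<open>TrL_flip\<close>),
  so let the upper chamber be trapping. At every critical time the slit over which the ball moves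
  then drops from height \<open>hm i\<close> to \<open>hp i < hm i\<close>, and a ball above the
  slit stays above it forever (\<open>trapped_stay\<close>). In that chamber the action, which is
  chamber height times velocity corrected for the motion of the slit, changes by a bounded amount
  between critical times, while each critical time multiplies it by about
  \<open>(1 - hp i) / (1 - hm i) > 1\<close>. At high energy this is exponential growth
  (\<open>trapped_growth\<close>). It remains to show that most fast balls are trapped within a
  bounded time.

  A ball below the slit remains below at a critical time only if its height is less than
  \<open>hp i\<close>. In terms of its phase (the height divided by the chamber height, signed by
  the direction of motion, a point of the circle R/2Z) this forces the phase into a strip of
  half-width \<kappa>0 < 1 around 0. While the ball stays below, phase and action evolve at high
  energy by an almost linear rule. Between critical times the action is an adiabatic invariant and
  the phase advances by action times the integral of the inverse square of the slit height
  (\<open>adiabatic\<close>); at a critical time both change by an exact linear formula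
  (\<open>low_jump\<close>). The resulting matrices have determinant 1 and alternate between two
  values, and the trace of their product over one period is \<open>TrL\<close>
  (\<open>TrL_eq\<close>). Hence |Tr| > 2 means hyperbolicity: some linear functional is expanded in
  every period (\<open>expanded_functional\<close>).

  Fix the initial time and let the initial velocity vary. Phase and action then run through a line
  segment, and for all but a small set of initial times its direction is bounded away from the
  kernel of the functional (\<open>exceptional_times\<close>). Its images under the linear maps
  become long in the phase direction. Whenever a piece meets several strips around the even
  integers, at most the proportion 2\<kappa>/(1+\<kappa>) of it lies in strips, so the set surviving
  n passages has measure tending to 0 (\<open>surv_bound_step\<close>,
  \<open>survivors_vanish\<close>, \<open>survivors_small\<close>). For a fixed number of passages
  and large V, true orbits below the slit are shadowed by linear ones (\<open>LS_shadow\<close>,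
  \<open>surv_LS\<close>). So apart from a small set of velocities the ball is trapped after a fixed
  number of passages (\<open>growth_criterion\<close>, \<open>small_slices\<close>).

  Two foundational points remain. Under a priori speed bounds an orbit exists off a null set: the
  only obstruction is a hit of a slit exactly at a critical time, and the states leading to one form
  a null set because collision maps are Lipschitz backwards in time
  (\<open>negligible_Null_set\<close>, \<open>orb_exists\<close>). Moreover the orbit is unique and
  agrees with an explicitly simulated trajectory, so the bad set is described by countably many
  Borel conditions (\<open>growing_conds_iff\<close>, \<open>borel_bad_conds\<close>). Integrating
  the slice estimates then gives the planar estimate (\<open>measure_from_slices\<close>).\<close>

lemma slit_motionD:
  assumes "slit_motion h"
  shows "(h has_real_derivative deriv h t) (at t)"
    "(deriv h has_real_derivative deriv (deriv h) t) (at t)"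
    "continuous_on UNIV (deriv (deriv h))"
    "h (t + 2) = h t" "0 < h t" "h t < 1"
  using assms by (auto simp: slit_motion_def C2_def DERIV_deriv_iff_real_differentiable)

section \<open>Critical times and the slit seen by the ball\<close>

locale slits =
  fixes lam x0 :: real and fL fR :: "real \<Rightarrow> real"
  assumes lam: "0 < lam" "lam < 1" and x0: "0 \<le> x0" "x0 < lam"
    and motL: "slit_motion fL" and motR: "slit_motion fR"
begin

abbreviation "t1 \<equiv> tcrit1 lam x0"
abbreviation "t2 \<equiv> tcrit2 lam x0"
abbreviation "f \<equiv> slit lam x0 fL fR"
abbreviation "crit \<equiv> critical lam x0"

text \<open>The critical times in increasing order, beginning with the last one before time 0, so
  that every initial time in [0,2) lies in one of the first three intervals. Between
  \<open>c n\<close> and \<open>c (Suc n)\<close> the discontinuous \<open>f\<close> equals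
  \<open>g n\<close>, which is smooth on the whole line and hence has values and derivatives at both
  end points.\<close>

definition c :: "nat \<Rightarrow> real" where
  "c n = (if even n then t2 - 2 + real n else t1 + (real n - 1))"

definition g :: "nat \<Rightarrow> real \<Rightarrow> real" where
  "g n = (if even n then fL else fR)"

lemma t12: "0 < t1" "t1 < t2" "t2 < 2"
  using lam x0 by (auto simp: tcrit1_def tcrit2_def)

lemma c_less_Suc: "c n < c (Suc n)"
  using t12 by (auto simp: c_def)

lemma c_Suc_Suc: "c (Suc (Suc n)) = c n + 2"
  by (auto simp: c_def)

lemma g_Suc_Suc: "g (Suc (Suc n)) = g n"
  by (auto simp: g_def)

lemma c0_neg: "c 0 < 0"
  using t12 by (auto simp: c_def)

lemma strict_mono_c: "strict_mono c"
  using c_less_Suc strict_mono_Suc_iff by blast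

lemma c_mono: "m \<le> n \<Longrightarrow> c m \<le> c n"
  using strict_mono_c by (simp add: strict_mono_less_eq)

lemma c_pos: "0 < c (Suc n)"
proof (cases n)
  case 0
  then show ?thesis using t12 by (simp add: c_def)
next
  case (Suc m)
  have "c (Suc (Suc 0)) > 0" using t12 by (simp add: c_def)
  then show ?thesis using c_mono[of "Suc (Suc 0)" "Suc (Suc m)"] Suc by simp
qed

lemma c_Suc_le: "c (Suc n) \<le> c n + 2"
  using c_less_Suc[of "Suc n"] c_Suc_Suc[of n] by simp

lemma c_ge: "real n - 2 \<le> c n"
  using t12 by (auto simp: c_def)

lemma c_le_real: "c n \<le> real n + 2"
  using t12 by (auto simp: c_def)

lemma rmod2: "t rmod 2 = t - 2 * of_int \<lfloor>t / 2\<rfloor>"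
  by (simp add: rmod_def)

lemma rmod2_eqI:
  assumes "2 * real_of_int m \<le> t" "t < 2 * real_of_int m + 2"
  shows "t rmod 2 = t - 2 * real_of_int m"
proof -
  have "\<lfloor>t / 2\<rfloor> = m" using assms by (intro floor_unique) auto
  then show ?thesis by (simp add: rmod2)
qed

lemma crit_c: "crit (c n)"
proof (cases "even n")
  case True
  then obtain m where m: "n = 2 * m" by (auto elim: evenE)
  have "c n rmod 2 = c n - 2 * real_of_int (int m - 1)"
    using t12 by (intro rmod2_eqI) (auto simp: c_def m)
  then show ?thesis using True by (auto simp: critical_def c_def m)
next
  case False
  then obtain m where m: "n = 2 * m + 1" by (auto elim: oddE)
  have "c n rmod 2 = c n - 2 * real_of_int (int m)"
    using t12 by (intro rmod2_eqI) (auto simp: c_def m)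
  then show ?thesis using False by (auto simp: critical_def c_def m)
qed

lemma between_c:
  assumes "c n < t" "t < c (Suc n)"
  shows "\<not> crit t" "f t = g n t"
proof -
  have "\<not> crit t \<and> f t = g n t"
  proof (cases "even n")
    case True
    then obtain m where m: "n = 2 * m" by (auto elim: evenE)
    \<comment> \<open>An even interval straddles the multiple 2m of the period, so two residues have
      to be considered.\<close>
    show ?thesis
    proof (cases "2 * real m \<le> t")
      case t: True
      have "t rmod 2 = t - 2 * real_of_int (int m)"
        using t12 assms t by (intro rmod2_eqI) (auto simp: c_def m)
      then show ?thesis using t12 assms t by (auto simp: c_def m critical_def slit_def g_def)
    next
      case t: False
      have "t rmod 2 = t - 2 * real_of_int (int m - 1)"
        using t12 assms t by (intro rmod2_eqI) (auto simp: c_def m)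
      then show ?thesis using t12 assms t by (auto simp: c_def m critical_def slit_def g_def)
    qed
  next
    case False
    then obtain m where m: "n = 2 * m + 1" by (auto elim: oddE)
    have "t rmod 2 = t - 2 * real_of_int (int m)"
      using t12 assms by (intro rmod2_eqI) (auto simp: c_def m)
    then show ?thesis using t12 assms by (auto simp: c_def m critical_def slit_def g_def)
  qed
  then show "\<not> crit t" "f t = g n t" by auto
qed

lemma locate_c:
  assumes "c 0 \<le> t"
  obtains n where "c n \<le> t" "t < c (Suc n)"
proof -
  obtain k :: nat where "t < real k" using reals_Archimedean2 by blast
  then have "t < c (k + 2)" using c_ge[of "k+2"] by simp
  then have ex: "\<exists>k. t < c k" by blast
  define k where "k = (LEAST k. t < c k)"
  have k: "t < c k" unfolding k_def using ex by (rule LeastI_ex)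
  moreover have "k \<noteq> 0" using k assms by (cases k) auto
  then obtain n where n: "k = Suc n" using not0_implies_Suc by blast
  have "\<not> t < c n" using not_less_Least[of n "\<lambda>k. t < c k"] n by (auto simp: k_def)
  ultimately show thesis using that[of n] n by auto
qed

lemma crit_iff_c:
  assumes "c 0 \<le> t" shows "crit t \<longleftrightarrow> (\<exists>n. t = c n)"
proof -
  obtain n where n: "c n \<le> t" "t < c (Suc n)" using locate_c[OF assms] by blast
  show ?thesis using between_c[of n t] n crit_c by (cases "t = c n") auto
qed

lemma no_crit_in_segment:
  assumes "c 0 \<le> s" "s \<le> e" "\<And>r. s \<le> r \<Longrightarrow> r \<le> e \<Longrightarrow> \<not> crit r"
  obtains n where "c n < s" "e < c (Suc n)"
proof -
  obtain n where n: "c n \<le> s" "s < c (Suc n)" using locate_c[OF assms(1)] by blast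
  have "c n < s" using n crit_c[of n] assms(3)[of s] assms(2) by (cases "c n = s") auto
  moreover have "e < c (Suc n)"
    using n crit_c[of "Suc n"] assms(3)[of "c (Suc n)"] by (meson less_imp_le not_less)
  ultimately show thesis using that by blast
qed

lemma eventually_between_c:
  assumes "c n < t" "t < c (Suc n)"
  shows "\<forall>\<^sub>F r in nhds t. f r = g n r"
proof -
  have "\<forall>\<^sub>F r in nhds t. r \<in> {c n<..<c (Suc n)}"
    using assms by (intro eventually_nhds_in_open) auto
  then show ?thesis by (rule eventually_mono) (use between_c in auto)
qed

lemma deriv_f_between_c:
  assumes "c n < t" "t < c (Suc n)"
  shows "deriv f t = deriv (g n) t"
  using eventually_between_c[OF assms] by (rule deriv_cong_ev) simp

lemma g_cases: "g n = fL \<or> g n = fR"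
  by (simp add: g_def)

lemma g_Suc_cases: "(g n = fL \<and> g (Suc n) = fR) \<or> (g n = fR \<and> g (Suc n) = fL)"
  by (simp add: g_def)

lemma f_cases: "f t = fL t \<or> f t = fR t"
  by (simp add: slit_def)

lemma mot_g: "slit_motion (g n)"
  using motL motR by (simp add: g_def)

lemma mot_f_bounds: "0 < f t" "f t < 1"
  using f_cases[of t] slit_motionD(5,6)[OF motL, of t] slit_motionD(5,6)[OF motR, of t] by auto

end

section \<open>Uniform bounds for the slit motions\<close>

lemma periodic2_bounded:
  fixes F :: "real \<Rightarrow> real"
  assumes "continuous_on UNIV F" "\<And>t. F (t + 2) = F t"
  obtains t0 t1 where "\<And>t. F t0 \<le> F t" "\<And>t. F t \<le> F t1"
proof -
  have shift: "F t = F (t + 2 * real_of_int k)" for t k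
  proof -
    have nat: "F (t + 2 * real n) = F t" for t n
      by (induction n) (use assms(2)[of "t + 2 * real _"] in \<open>auto simp: algebra_simps\<close>)
    show ?thesis
    proof (cases "k \<ge> 0")
      case True
      then show ?thesis using nat[of t "nat k"] by simp
    next
      case False
      then show ?thesis using nat[of "t + 2 * real_of_int k" "nat (-k)"] by simp
    qed
  qed
  have red: "\<exists>s\<in>{0..2}. F t = F s" for t
  proof -
    have "t - 2 * of_int \<lfloor>t / 2\<rfloor> \<in> {0..2}"
      using of_int_floor_le[of "t/2"] floor_correct[of "t/2"] by (auto simp: field_simps)
    then show ?thesis using shift[of t "- \<lfloor>t / 2\<rfloor>"] by (intro bexI[of _ "t - 2 * of_int \<lfloor>t / 2\<rfloor>"]) auto
  qed
  have con: "continuous_on {0..2} F" using assms(1) continuous_on_subset by blast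
  obtain a where a: "a \<in> {0..2}" "\<forall>t\<in>{0..2}. F a \<le> F t"
    using continuous_attains_inf[OF _ _ con] by auto
  obtain b where b: "b \<in> {0..2}" "\<forall>t\<in>{0..2}. F t \<le> F b"
    using continuous_attains_sup[OF _ _ con] by auto
  show thesis using that[of a b] a b red by metis
qed

lemma slit_motion_continuous:
  assumes "slit_motion h"
  shows "continuous_on S h" "continuous_on S (deriv h)" "continuous_on S (deriv (deriv h))"
    "isCont h t" "isCont (deriv h) t"
proof -
  have d: "h differentiable (at t)" "deriv h differentiable (at t)" for t
    using assms by (auto simp: slit_motion_def C2_def)
  show "isCont h t" "isCont (deriv h) t" for t using d differentiable_imp_continuous_within by blast+
  then show "continuous_on S h" "continuous_on S (deriv h)"
    by (simp_all add: continuous_at_imp_continuous_on)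
  show "continuous_on S (deriv (deriv h))"
    using assms continuous_on_subset[of UNIV _ S] by (auto simp: slit_motion_def C2_def)
qed

lemma slit_motion_periodic_deriv:
  assumes "slit_motion h"
  shows "deriv h (t + 2) = deriv h t" "deriv (deriv h) (t + 2) = deriv (deriv h) t"
proof -
  have per: "deriv F (t + 2) = deriv F t"
    if "\<And>t. (F has_real_derivative deriv F t) (at t)" "\<And>t. F (t + 2) = F t" for F :: "real \<Rightarrow> real" and t
  proof -
    have "((\<lambda>s. F (s + 2)) has_real_derivative deriv F (t + 2)) (at t)"
      using that(1)[of "t + 2"] DERIV_shift by blast
    then have "(F has_real_derivative deriv F (t + 2)) (at t)" using that(2) by simp
    then show ?thesis using DERIV_imp_deriv by fastforce
  qed
  have h: "(h has_real_derivative deriv h t) (at t)"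
    "(deriv h has_real_derivative deriv (deriv h) t) (at t)" "h (t + 2) = h t" for t
    using assms by (auto simp: slit_motion_def C2_def DERIV_deriv_iff_real_differentiable)
  have p1: "deriv h (t + 2) = deriv h t" for t by (rule per) (use h in auto)
  show "deriv h (t + 2) = deriv h t" by (rule p1)
  show "deriv (deriv h) (t + 2) = deriv (deriv h) t" by (rule per) (use h p1 in auto)
qed

text \<open>The quantitative data of a slit: m keeps it away from floor and ceiling, C bounds its
  speed and acceleration. The condition is symmetric under h to 1 - h.\<close>

definition slit_bounds :: "real \<Rightarrow> real \<Rightarrow> (real \<Rightarrow> real) \<Rightarrow> bool" where
  "slit_bounds m C h \<longleftrightarrow> 0 < m \<and> m < 1 \<and> 0 \<le> C \<and>
     (\<forall>t. m \<le> h t \<and> h t \<le> 1 - m \<and> \<bar>deriv h t\<bar> \<le> C \<and> \<bar>deriv (deriv h) t\<bar> \<le> C)"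

lemma slit_motion_bounds:
  assumes "slit_motion h"
  obtains m C where "slit_bounds m C h"
proof -
  have per: "h (t + 2) = h t" "0 < h t" "h t < 1" for t using assms by (auto simp: slit_motion_def)
  obtain a b where ab: "\<And>t. h a \<le> h t" "\<And>t. h t \<le> h b"
    using periodic2_bounded[of h] slit_motion_continuous(1)[OF assms] per by metis
  obtain a1 b1 where ab1: "\<And>t. \<bar>deriv h a1\<bar> \<le> \<bar>deriv h t\<bar>" "\<And>t. \<bar>deriv h t\<bar> \<le> \<bar>deriv h b1\<bar>"
    using periodic2_bounded[of "\<lambda>t. \<bar>deriv h t\<bar>"] slit_motion_continuous(2)[OF assms]
      slit_motion_periodic_deriv[OF assms] continuous_on_rabs by metis
  obtain a2 b2 where ab2: "\<And>t. \<bar>deriv (deriv h) a2\<bar> \<le> \<bar>deriv (deriv h) t\<bar>"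
    "\<And>t. \<bar>deriv (deriv h) t\<bar> \<le> \<bar>deriv (deriv h) b2\<bar>"
    using periodic2_bounded[of "\<lambda>t. \<bar>deriv (deriv h) t\<bar>"] slit_motion_continuous(3)[OF assms]
      slit_motion_periodic_deriv[OF assms] continuous_on_rabs by metis
  have "slit_bounds (min (h a) (1 - h b)) (max \<bar>deriv h b1\<bar> \<bar>deriv (deriv h) b2\<bar>) h"
    unfolding slit_bounds_def using ab ab1 ab2 per[of a] per[of b]
    by (auto simp: min_le_iff_disj le_max_iff_disj min_less_iff_disj intro: ab ab1 ab2)
      (smt (verit) ab)
  then show thesis using that by blast
qed

lemma slit_bounds_mono:
  "slit_bounds m C h \<Longrightarrow> 0 < m' \<Longrightarrow> m' \<le> m \<Longrightarrow> C \<le> C' \<Longrightarrow> slit_bounds m' C' h"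
  unfolding slit_bounds_def by (smt (verit))

lemma slit_motion_common_bounds:
  assumes "slit_motion h1" "slit_motion h2"
  obtains m C where "slit_bounds m C h1" "slit_bounds m C h2"
proof -
  obtain m1 C1 m2 C2 where b: "slit_bounds m1 C1 h1" "slit_bounds m2 C2 h2"
    using slit_motion_bounds assms by metis
  have "slit_bounds (min m1 m2) (max C1 C2) h1" "slit_bounds (min m1 m2) (max C1 C2) h2"
    using b slit_bounds_mono[OF b(1), of "min m1 m2" "max C1 C2"]
      slit_bounds_mono[OF b(2), of "min m1 m2" "max C1 C2"] by (auto simp: slit_bounds_def)
  then show thesis using that by blast
qed

locale slits_bd = slits +
  fixes m C :: real
  assumes bdL: "slit_bounds m C fL" and bdR: "slit_bounds m C fR"
begin

lemma bd_g: "slit_bounds m C (g n)"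
  using bdL bdR by (simp add: g_def)

lemma mC: "0 < m" "m < 1" "0 \<le> C"
  using bdL by (auto simp: slit_bounds_def)

lemma g_bd: "m \<le> g n t" "g n t \<le> 1 - m" "\<bar>deriv (g n) t\<bar> \<le> C" "\<bar>deriv (deriv (g n)) t\<bar> \<le> C"
  using bd_g[of n] by (auto simp: slit_bounds_def)

lemma f_bd: "m \<le> f t" "f t \<le> 1 - m"
  using f_cases[of t] bdL bdR by (auto simp: slit_bounds_def)

lemma Lip_g: "\<bar>g n s - g n t\<bar> \<le> C * \<bar>s - t\<bar>"
proof -
  have "norm (g n s - g n t) \<le> C * norm (s - t)"
    by (rule field_differentiable_bound[of UNIV "g n" "deriv (g n)"])
      (use slit_motionD(1)[OF mot_g] g_bd in auto)
  then show ?thesis by simp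
qed

end

section \<open>Orbit pieces on bounded time intervals\<close>

lemma finite_gap_right:
  fixes t b :: real
  assumes "finite S" "t < b"
  obtains e where "t < e" "e \<le> b" "\<And>r. t < r \<Longrightarrow> r < e \<Longrightarrow> r \<notin> S"
proof -
  let ?M = "insert b (S \<inter> {t<..b})"
  have fin: "finite ?M" using assms by simp
  have "Min ?M \<in> ?M" using fin by (intro Min_in) auto
  then have "t < Min ?M" "Min ?M \<le> b" using assms by auto
  moreover have "r \<notin> S" if "t < r" "r < Min ?M" for r
    using that fin Min_le[OF fin, of r] Min_le[OF fin, of b] by force
  ultimately show thesis using that by blast
qed

lemma finite_gap_left:
  fixes t a :: real
  assumes "finite S" "a < t"
  obtains s where "s < t" "a \<le> s" "\<And>r. s < r \<Longrightarrow> r < t \<Longrightarrow> r \<notin> S"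
proof -
  let ?M = "insert a (S \<inter> {a..<t})"
  have fin: "finite ?M" using assms by simp
  have "Max ?M \<in> ?M" using fin by (intro Max_in) auto
  then have "Max ?M < t" "a \<le> Max ?M" using assms by auto
  moreover have "r \<notin> S" if "Max ?M < r" "r < t" for r
    using that fin Max_ge[OF fin, of r] Max_ge[OF fin, of a] by force
  ultimately show thesis using that by blast
qed

context slits begin

definition flight :: "real \<Rightarrow> real \<Rightarrow> (real \<Rightarrow> real) \<Rightarrow> (real \<Rightarrow> real) \<Rightarrow> bool" where
  "flight t0 b y w \<longleftrightarrow> finite {t \<in> {t0..b}. collides f y t} \<and>
     (\<forall>s t. t0 \<le> s \<and> s < t \<and> t \<le> b \<and> (\<forall>r\<in>{s<..<t}. \<not> collides f y r) \<longrightarrow>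
         y t = y s + (t - s) * w s \<and> w t = reflect f t (y t) (w s))"

text \<open>The notion \<open>orbit\<close> cut off at a final time b. Existence is proved by
  extending such pieces, uniqueness by comparing them on their common interval.\<close>

definition orb :: "real \<Rightarrow> real \<Rightarrow> real \<Rightarrow> (real \<Rightarrow> real) \<Rightarrow> (real \<Rightarrow> real) \<Rightarrow> bool" where
  "orb t0 v0 b y w \<longleftrightarrow> t0 \<le> b \<and> y t0 = f t0 \<and> w t0 = v0 \<and>
      (\<forall>t. t0 \<le> t \<and> t \<le> b \<longrightarrow> 0 \<le> y t \<and> y t \<le> 1) \<and>
      (\<forall>t. t0 \<le> t \<and> t \<le> b \<and> crit t \<longrightarrow> y t \<noteq> fL t \<and> y t \<noteq> fR t) \<and>
      flight t0 b y w \<and>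
      (\<forall>s t. t0 \<le> s \<and> s \<le> t \<and> t \<le> b \<and> (\<forall>r\<in>{s..t}. \<not> crit r) \<longrightarrow>
         0 \<le> (y s - f s) * (y t - f t))"

lemma reflect_no_hit: "h \<noteq> 0 \<Longrightarrow> h \<noteq> 1 \<Longrightarrow> h \<noteq> f t \<Longrightarrow> reflect f t h u = u"
  by (simp add: reflect_def)

lemma reflect_not_collides: "\<not> collides f y t \<Longrightarrow> reflect f t (y t) u = u"
  by (simp add: collides_def reflect_def)

lemma flightD:
  assumes "flight t0 b y w" "t0 \<le> s" "s < t" "t \<le> b" "\<And>r. s < r \<Longrightarrow> r < t \<Longrightarrow> \<not> collides f y r"
  shows "y t = y s + (t - s) * w s" "w t = reflect f t (y t) (w s)"
  using assms unfolding flight_def by auto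

lemma flight_subset: "flight t0 b y w \<Longrightarrow> t0 \<le> t0' \<Longrightarrow> b' \<le> b \<Longrightarrow> flight t0' b' y w"
  unfolding flight_def by (auto elim!: finite_subset[rotated])

lemma flight_germ_right:
  assumes "flight t0 b y w" "t0 \<le> t" "t < b"
  obtains e where "t < e" "e \<le> b" "\<And>r. t < r \<Longrightarrow> r < e \<Longrightarrow> \<not> collides f y r"
    "\<And>r. t < r \<Longrightarrow> r < e \<Longrightarrow> y r = y t + (r - t) * w t"
    "\<And>r. t < r \<Longrightarrow> r < e \<Longrightarrow> w r = w t"
proof -
  let ?S = "{t \<in> {t0..b}. collides f y t}"
  have "finite ?S" using assms by (simp add: flight_def)
  then obtain e where e: "t < e" "e \<le> b" "\<And>r. t < r \<Longrightarrow> r < e \<Longrightarrow> r \<notin> ?S"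
    using finite_gap_right assms(3) by blast
  have nc: "\<not> collides f y r" if "t < r" "r < e" for r using e that assms by auto
  have "y r = y t + (r - t) * w t \<and> w r = w t" if r: "t < r" "r < e" for r
    using flightD[OF assms(1,2) r(1)] r e(2) nc reflect_not_collides[OF nc[OF r]] by simp
  then show thesis using that e(1,2) nc by blast
qed

lemma flight_germ_left:
  assumes "flight t0 b y w" "t0 < t" "t \<le> b"
  obtains s u where "t0 \<le> s" "s < t" "\<And>r. s < r \<Longrightarrow> r < t \<Longrightarrow> \<not> collides f y r"
    "\<And>r. s < r \<Longrightarrow> r < t \<Longrightarrow> y r = y t - (t - r) * u"
    "\<And>r. s < r \<Longrightarrow> r < t \<Longrightarrow> w r = u" "w t = reflect f t (y t) u" "w s = u"
proof -
  let ?S = "{t \<in> {t0..b}. collides f y t}"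
  have "finite ?S" using assms by (simp add: flight_def)
  then obtain s where e: "s < t" "t0 \<le> s" "\<And>r. s < r \<Longrightarrow> r < t \<Longrightarrow> r \<notin> ?S"
    using finite_gap_left assms(2) by blast
  have nc: "\<not> collides f y r" if "s < r" "r < t" for r using e that assms by auto
  have yt: "y t = y s + (t - s) * w s" "w t = reflect f t (y t) (w s)"
    using flightD[OF assms(1) e(2) e(1) assms(3)] nc by blast+
  have yr: "y r = y s + (r - s) * w s \<and> w r = w s" if r: "s < r" "r < t" for r
    using flightD[OF assms(1) e(2) r(1)] r nc assms(3) reflect_not_collides[OF nc[OF r]] by simp
  have "y r = y t - (t - r) * w s" if r: "s < r" "r < t" for r
    using yr[OF r] yt(1) by (simp add: algebra_simps)
  then show thesis using that[of s "w s"] e(1,2) nc yt yr by blast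
qed

text \<open>On each side of every time the height is affine with the same value at that time:
  collisions change only the velocity.\<close>

lemma flight_continuous:
  assumes fl: "flight t0 b y w"
  shows "continuous_on {t0..b} y"
  unfolding continuous_on_eq_continuous_within
proof
  fix t assume t: "t \<in> {t0..b}"
  obtain e u where e: "t < e" "\<And>r. t < r \<Longrightarrow> r < e \<Longrightarrow> r \<le> b \<Longrightarrow> y r = y t + (r - t) * u"
  proof (cases "t < b")
    case True
    then show thesis using flight_germ_right[OF fl, of t] t that[of _ "w t"] by (metis atLeastAtMost_iff)
  next
    case False
    then show thesis using that[of "t + 1"] by force
  qed
  obtain s v where s: "s < t" "\<And>r. s < r \<Longrightarrow> r < t \<Longrightarrow> t0 \<le> r \<Longrightarrow> y r = y t - (t - r) * v"
  proof (cases "t0 < t")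
    case True
    then show thesis using flight_germ_left[OF fl, of t] t that by (metis atLeastAtMost_iff)
  next
    case False
    then show thesis using that[of "t - 1"] by force
  qed
  have lim: "((\<lambda>r. y t + (r - t) * u) \<longlongrightarrow> y t) (at t within {t0..b})"
    "((\<lambda>r. y t - (t - r) * v) \<longlongrightarrow> y t) (at t within {t0..b})"
    by (auto intro!: tendsto_eq_intros)
  have "\<forall>\<^sub>F r in nhds t. r \<in> {s<..<e}"
    by (rule eventually_nhds_in_open) (use s e in auto)
  then have "\<forall>\<^sub>F r in at t within {t0..b}. r \<in> {s<..<e}"
    by (simp add: eventually_at_filter eventually_mono)
  moreover have "\<forall>\<^sub>F r in at t within {t0..b}. r \<in> {t0..b} - {t}"
    by (auto simp: eventually_at_filter)
  ultimately have ev: "\<forall>\<^sub>F r in at t within {t0..b}.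
      y r = y t + (r - t) * u \<or> y r = y t - (t - r) * v"
  proof eventually_elim
    case (elim r)
    then show ?case using s(2)[of r] e(2)[of r] by (cases "r < t") auto
  qed
  have ev2: "\<forall>\<^sub>F r in at t within {t0..b}. \<bar>y r - y t\<bar> \<le> \<bar>r - t\<bar> * (\<bar>u\<bar> + \<bar>v\<bar>)"
    using ev
  proof eventually_elim
    case (elim r)
    then have "\<bar>y r - y t\<bar> = \<bar>r - t\<bar> * \<bar>u\<bar> \<or> \<bar>y r - y t\<bar> = \<bar>r - t\<bar> * \<bar>v\<bar>"
      by (auto simp: abs_mult abs_minus_commute)
    then show ?case by (auto intro!: mult_left_mono)
  qed
  have "((\<lambda>r. \<bar>r - t\<bar> * (\<bar>u\<bar> + \<bar>v\<bar>)) \<longlongrightarrow> 0) (at t within {t0..b})"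
    by (auto intro!: tendsto_eq_intros)
  then have "((\<lambda>r. y r - y t) \<longlongrightarrow> 0) (at t within {t0..b})"
    by (rule Lim_null_comparison[rotated]) (use ev2 in simp)
  then show "continuous (at t within {t0..b}) y"
    by (simp add: continuous_within LIM_zero_iff)
qed

section \<open>The simulated trajectory and uniqueness of orbits\<close>

definition ph :: "real \<Rightarrow> nat" where "ph t = (LEAST n. t < c (Suc n))"

text \<open>Equals \<open>f\<close> off the critical times. At a critical time it is the slit about
  to become relevant; orbits never touch a slit there.\<close>

definition fl :: "real \<Rightarrow> real" where "fl t = g (ph t) t"

definition refl :: "real \<Rightarrow> real \<Rightarrow> real \<Rightarrow> real" where
  "refl t h u = (if h = 0 \<or> h = 1 then - u else if h = fl t then - u + 2 * deriv (g (ph t)) t else u)"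

definition hit :: "real \<Rightarrow> real \<Rightarrow> bool" where
  "hit t h \<longleftrightarrow> h = 0 \<or> h = 1 \<or> h = fl t"

text \<open>Time of the next event of a ball at height h with velocity u at time t. The cap t + 1
  makes the infimum exist; a capped event that is no collision leaves the velocity unchanged. The
  condition \<open>c 0 < r\<close> keeps to the times at which \<open>ph\<close> is meaningful. The
  simulation built on \<open>tau\<close> is total, so it can be studied as a Borel function of the
  initial condition whether or not an orbit exists.\<close>

definition tau :: "real \<times> real \<times> real \<Rightarrow> real" where
  "tau = (\<lambda>(t, h, u). Inf (insert (t + 1) {r. t < r \<and> c 0 < r \<and> hit r (h + (r - t) * u)}))"

definition nxt :: "real \<times> real \<times> real \<Rightarrow> real \<times> real \<times> real" where
  "nxt p = (case p of (t, h, u) \<Rightarrow>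
     (let r = tau (t, h, u); k = h + (r - t) * u in (r, k, refl r k u)))"

definition st :: "nat \<Rightarrow> real \<times> real \<Rightarrow> real \<times> real \<times> real" where
  "st n x = (nxt ^^ n) (fst x, fl (fst x), snd x)"

definition Ti :: "nat \<Rightarrow> real \<times> real \<Rightarrow> real" where "Ti n x = fst (st n x)"
definition Yi :: "nat \<Rightarrow> real \<times> real \<Rightarrow> real" where "Yi n x = fst (snd (st n x))"
definition Wi :: "nat \<Rightarrow> real \<times> real \<Rightarrow> real" where "Wi n x = snd (snd (st n x))"

definition idx :: "real \<times> real \<Rightarrow> real \<Rightarrow> nat" where "idx x t = (LEAST n. t < Ti (Suc n) x)"
definition Yc :: "real \<times> real \<Rightarrow> real \<Rightarrow> real" where
  "Yc x t = Yi (idx x t) x + (t - Ti (idx x t) x) * Wi (idx x t) x"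
definition Wc :: "real \<times> real \<Rightarrow> real \<Rightarrow> real" where "Wc x t = Wi (idx x t) x"

lemma ph_eq: "c n \<le> t \<Longrightarrow> t < c (Suc n) \<Longrightarrow> ph t = n"
  unfolding ph_def
  by (rule Least_equality) (auto, metis c_mono Suc_leI leD not_less order_less_le_trans)

lemma fl_eq_f: "c 0 \<le> t \<Longrightarrow> \<not> crit t \<Longrightarrow> fl t = f t"
  using locate_c[of t] between_c ph_eq crit_c fl_def by (metis less_eq_real_def)

lemma fl_cases: "fl t = fL t \<or> fl t = fR t"
  using g_cases[of "ph t"] by (auto simp: fl_def)

lemma refl_eq_reflect:
  assumes "c 0 \<le> t" "crit t \<Longrightarrow> h \<noteq> fL t \<and> h \<noteq> fR t"
  shows "refl t h u = reflect f t h u"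
proof (cases "crit t")
  case True
  then show ?thesis using assms fl_cases[of t] f_cases[of t] by (auto simp: refl_def reflect_def)
next
  case False
  obtain n where n: "c n \<le> t" "t < c (Suc n)" using locate_c assms by blast
  then have "c n < t" using False crit_c by (metis less_eq_real_def)
  then show ?thesis using n ph_eq[of n t] fl_eq_f[OF assms(1) False] deriv_f_between_c[of n t]
    by (auto simp: refl_def reflect_def)
qed

lemma hit_iff:
  assumes "c 0 \<le> t" "crit t \<Longrightarrow> y t \<noteq> fL t \<and> y t \<noteq> fR t"
  shows "hit t (y t) \<longleftrightarrow> collides f y t"
proof (cases "crit t")
  case True
  then show ?thesis using assms fl_cases[of t] f_cases[of t] by (auto simp: hit_def collides_def)
next
  case False
  then show ?thesis using assms fl_eq_f[of t] by (auto simp: hit_def collides_def)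
qed

lemma tau_set_props:
  fixes t h u :: real
  defines "S \<equiv> insert (t + 1) {r. t < r \<and> c 0 < r \<and> hit r (h + (r - t) * u)}"
  shows "S \<noteq> {}" "bdd_below S" "tau (t, h, u) = Inf S"
  by (auto simp: S_def tau_def intro!: bdd_belowI[of _ t])

lemma tau_ge: "t \<le> tau (t, h, u)"
  unfolding tau_set_props(3) by (intro cInf_greatest) auto

lemma tau_le: "tau (t, h, u) \<le> t + 1"
  unfolding tau_set_props(3) by (intro cInf_lower tau_set_props) auto

lemma tau_no_hit: "t < r \<Longrightarrow> c 0 < r \<Longrightarrow> r < tau (t, h, u) \<Longrightarrow> \<not> hit r (h + (r - t) * u)"
proof
  assume r: "t < r" "c 0 < r" "r < tau (t, h, u)" "hit r (h + (r - t) * u)"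
  have "tau (t, h, u) \<le> r" unfolding tau_set_props(3)
    using r by (intro cInf_lower tau_set_props) auto
  then show False using r by simp
qed

lemma tau_geI:
  assumes "a \<le> t + 1" "\<And>r. t < r \<Longrightarrow> r < a \<Longrightarrow> \<not> hit r (h + (r - t) * u)"
  shows "a \<le> tau (t, h, u)"
  unfolding tau_set_props(3) using assms by (intro cInf_greatest) (auto simp: not_less[symmetric])

lemma st_Suc:
  "Ti (Suc n) x = tau (Ti n x, Yi n x, Wi n x)"
  "Yi (Suc n) x = Yi n x + (Ti (Suc n) x - Ti n x) * Wi n x"
  "Wi (Suc n) x = refl (Ti (Suc n) x) (Yi (Suc n) x) (Wi n x)"
  by (auto simp: Ti_def Yi_def Wi_def st_def nxt_def Let_def split: prod.splits)

lemma st_0: "Ti 0 x = fst x" "Yi 0 x = fl (fst x)" "Wi 0 x = snd x"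
  by (simp_all add: Ti_def Yi_def Wi_def st_def)

lemma Ti_mono_Suc: "Ti n x \<le> Ti (Suc n) x"
  by (simp add: st_Suc tau_ge)

lemma Ti_mono: "n \<le> k \<Longrightarrow> Ti n x \<le> Ti k x"
  using lift_Suc_mono_le[of "\<lambda>n. Ti n x"] Ti_mono_Suc by auto

lemma idx_eq: "Ti n x \<le> t \<Longrightarrow> t < Ti (Suc n) x \<Longrightarrow> idx x t = n"
  unfolding idx_def
  by (rule Least_equality) (auto, metis Ti_mono Suc_leI leD not_less order_less_le_trans)

lemma YWc_eq:
  assumes "Ti n x \<le> t" "t < Ti (Suc n) x"
  shows "Yc x t = Yi n x + (t - Ti n x) * Wi n x" "Wc x t = Wi n x"
  using idx_eq[OF assms] by (auto simp: Yc_def Wc_def)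

lemma orbD:
  assumes "orb t0 v0 b y w"
  shows "t0 \<le> b" "y t0 = f t0" "w t0 = v0" "flight t0 b y w"
    "\<And>t. t0 \<le> t \<Longrightarrow> t \<le> b \<Longrightarrow> 0 \<le> y t \<and> y t \<le> 1"
    "\<And>t. t0 \<le> t \<Longrightarrow> t \<le> b \<Longrightarrow> crit t \<Longrightarrow> y t \<noteq> fL t \<and> y t \<noteq> fR t"
    "\<And>s t. t0 \<le> s \<Longrightarrow> s \<le> t \<Longrightarrow> t \<le> b \<Longrightarrow> (\<And>r. s \<le> r \<Longrightarrow> r \<le> t \<Longrightarrow> \<not> crit r) \<Longrightarrow>
       0 \<le> (y s - f s) * (y t - f t)"
  using assms by (auto simp: orb_def)

lemma orb_not_crit_start: "orb t0 v0 b y w \<Longrightarrow> \<not> crit t0"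
  using orbD(1,2,6)[of t0 v0 b y w] f_cases[of t0] by (metis order_refl)

lemma orb_restrict: "orb t0 v0 b y w \<Longrightarrow> t0 \<le> b' \<Longrightarrow> b' \<le> b \<Longrightarrow> orb t0 v0 b' y w"
  unfolding orb_def using flight_subset[of t0 b y w t0 b'] by auto

text \<open>An orbit that agrees with the simulation at one event follows it to the next, and an
  event before the cap is a genuine collision. Finiteness of the collisions in bounded time makes
  the infimum in \<open>tau\<close> a true next collision time.\<close>

lemma orb_step:
  assumes o: "orb t0 v0 b y w" and t0: "0 \<le> t0" and lt: "Ti n (t0, v0) < b"
    and m: "t0 \<le> Ti n (t0, v0)" "y (Ti n (t0, v0)) = Yi n (t0, v0)" "w (Ti n (t0, v0)) = Wi n (t0, v0)"
  shows "Ti n (t0, v0) < Ti (Suc n) (t0, v0)"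
    and "\<And>r. Ti n (t0, v0) < r \<Longrightarrow> r < Ti (Suc n) (t0, v0) \<Longrightarrow> r \<le> b \<Longrightarrow>
      \<not> collides f y r \<and> y r = Yi n (t0, v0) + (r - Ti n (t0, v0)) * Wi n (t0, v0) \<and> w r = Wi n (t0, v0)"
    and "Ti (Suc n) (t0, v0) \<le> b \<Longrightarrow> y (Ti (Suc n) (t0, v0)) = Yi (Suc n) (t0, v0)
      \<and> w (Ti (Suc n) (t0, v0)) = Wi (Suc n) (t0, v0)"
    and "Ti (Suc n) (t0, v0) < b \<Longrightarrow> Ti (Suc n) (t0, v0) < Ti n (t0, v0) + 1 \<Longrightarrow>
      collides f y (Ti (Suc n) (t0, v0))"
proof -
  define x where "x = (t0, v0)"
  define t h u t' where "t = Ti n x" "h = Yi n x" "u = Wi n x" "t' = Ti (Suc n) x"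
  note d = this
  have m': "t0 \<le> t" "y t = h" "w t = u" "t < b" using m lt by (auto simp: d x_def)
  have t': "t' = tau (t, h, u)" by (simp add: d st_Suc)
  note fli = orbD(4)[OF o]
  have hc: "hit r (y r) \<longleftrightarrow> collides f y r" if "t \<le> r" "r \<le> b" for r
    by (rule hit_iff) (use that m' t0 c0_neg orbD(6)[OF o, of r] in auto)
  obtain e where e: "t < e" "e \<le> b" "\<And>r. t < r \<Longrightarrow> r < e \<Longrightarrow> \<not> collides f y r"
    "\<And>r. t < r \<Longrightarrow> r < e \<Longrightarrow> y r = y t + (r - t) * w t"
    using flight_germ_right[OF fli m'(1) m'(4)] by metis
  \<comment> \<open>The orbit is free of collisions just after t, so the next event is strictly
    later.\<close>
  have "min e (t + 1) \<le> t'" unfolding t'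
  proof (rule tau_geI)
    fix r assume r: "t < r" "r < min e (t + 1)"
    then show "\<not> hit r (h + (r - t) * u)" using e(3)[of r] e(4)[of r] hc[of r] e(2) m' by auto
  qed simp
  then have lt': "t < t'" using e by auto
  then show "Ti n (t0, v0) < Ti (Suc n) (t0, v0)" by (simp add: d x_def)
  have nc: "\<not> collides f y r" if r: "t < r" "r < t'" "r \<le> b" for r
  proof
    assume col: "collides f y r"
    \<comment> \<open>Up to the first collision q after t the orbit is the straight line of the
      simulation, which would then have hit before \<open>tau\<close>.\<close>
    let ?S = "{s \<in> {t0..b}. collides f y s} \<inter> {t<..r}"
    have fin: "finite ?S" using fli by (auto simp: flight_def)
    have "r \<in> ?S" using col r m' by simp
    then have mem: "Min ?S \<in> ?S" using Min_in[OF fin] by blast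
    define q where "q = Min ?S"
    have q: "t < q" "q \<le> r" "collides f y q" using mem by (auto simp: q_def)
    have "\<not> collides f y s" if "t < s" "s < q" for s
    proof
      assume "collides f y s"
      then have "s \<in> ?S" using that q r m' by auto
      then show False using Min_le[OF fin] that by (force simp: q_def)
    qed
    then have "y q = h + (q - t) * u" using flightD(1)[OF fli m'(1) q(1)] q r m' by auto
    moreover have "hit q (y q)" using hc q r by auto
    moreover have "\<not> hit q (h + (q - t) * u)"
      using tau_no_hit[of t q h u] q r m' t0 c0_neg t' by auto
    ultimately show False by simp
  qed
  have in_mid: "\<not> collides f y r \<and> y r = h + (r - t) * u \<and> w r = u" if r: "t < r" "r < t'" "r \<le> b" for r
    using flightD[OF fli m'(1) r(1) r(3)] nc r reflect_not_collides[OF nc[OF r]] m' by auto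
  then show "\<And>r. Ti n (t0, v0) < r \<Longrightarrow> r < Ti (Suc n) (t0, v0) \<Longrightarrow> r \<le> b \<Longrightarrow>
      \<not> collides f y r \<and> y r = Yi n (t0, v0) + (r - Ti n (t0, v0)) * Wi n (t0, v0) \<and> w r = Wi n (t0, v0)"
    by (simp add: d x_def)
  show "y (Ti (Suc n) (t0, v0)) = Yi (Suc n) (t0, v0) \<and> w (Ti (Suc n) (t0, v0)) = Wi (Suc n) (t0, v0)"
    if "Ti (Suc n) (t0, v0) \<le> b"
  proof -
    have b: "t' \<le> b" using that by (simp add: d x_def)
    have "y t' = h + (t' - t) * u" "w t' = reflect f t' (y t') u"
      using flightD[OF fli m'(1) lt' b] nc b m' by auto
    moreover have "refl t' (y t') u = reflect f t' (y t') u"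
      by (rule refl_eq_reflect) (use lt' m' t0 c0_neg orbD(6)[OF o, of t'] b in auto)
    ultimately have "y t' = Yi (Suc n) x" "w t' = Wi (Suc n) x"
      by (simp_all add: d st_Suc)
    then show ?thesis by (simp add: d x_def)
  qed
  show "collides f y (Ti (Suc n) (t0, v0))"
    if "Ti (Suc n) (t0, v0) < b" "Ti (Suc n) (t0, v0) < Ti n (t0, v0) + 1"
  proof (rule ccontr)
    assume "\<not> collides f y (Ti (Suc n) (t0, v0))"
    then have nc': "\<not> collides f y t'" and b: "t' < b" and lt1: "t' < t + 1"
      using that by (simp_all add: d x_def)
    have yt': "y t' = h + (t' - t) * u" "w t' = u"
      using flightD[OF fli m'(1) lt' less_imp_le[OF b]] nc b m' reflect_not_collides[OF nc'] by auto
    obtain e' where e': "t' < e'" "e' \<le> b" "\<And>r. t' < r \<Longrightarrow> r < e' \<Longrightarrow> \<not> collides f y r"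
      "\<And>r. t' < r \<Longrightarrow> r < e' \<Longrightarrow> y r = y t' + (r - t') * w t'"
      using flight_germ_right[OF fli _ b] m'(1) lt' by (metis less_imp_le order_trans)
    \<comment> \<open>If t' were no collision, the line would continue past it without a hit, and
      the infimum would be larger than t'.\<close>
    have "min e' (t + 1) \<le> t'" unfolding t'
    proof (rule tau_geI)
      fix r assume r: "t < r" "r < min e' (t + 1)"
      have eq: "y r = h + (r - t) * u"
        using in_mid[of r] e'(4)[of r] yt' r b by (cases "r < t'"; cases "r = t'") (auto simp: algebra_simps)
      have "\<not> collides f y r"
        using nc[of r] e'(3)[of r] nc' r b by (cases "r < t'"; cases "r = t'") auto
      then show "\<not> hit r (h + (r - t) * u)" using hc[of r] eq r e'(2) by auto
    qed simp
    then show False using e'(1) lt1 by auto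
  qed
qed

lemma orb_match:
  assumes o: "orb t0 v0 b y w" and t0: "0 \<le> t0"
  shows "Ti n (t0, v0) < b \<Longrightarrow>
    t0 \<le> Ti n (t0, v0) \<and> y (Ti n (t0, v0)) = Yi n (t0, v0) \<and> w (Ti n (t0, v0)) = Wi n (t0, v0)"
proof (induction n)
  case 0
  have "fl t0 = f t0" using fl_eq_f[of t0] orb_not_crit_start[OF o] t0 c0_neg by simp
  then show ?case using orbD(2,3)[OF o] by (simp add: st_0)
next
  case (Suc n)
  have lt: "Ti n (t0, v0) < b" using Suc.prems Ti_mono_Suc[of n "(t0, v0)"] by simp
  show ?case using orb_step(1,3)[OF o t0 lt] Suc.IH[OF lt] Suc.prems by auto
qed

lemma orb_strict:
  assumes o: "orb t0 v0 b y w" and t0: "0 \<le> t0" and n: "Ti n (t0, v0) < b"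
  shows "Ti n (t0, v0) < Ti (Suc n) (t0, v0)"
  using orb_step(1)[OF o t0 n] orb_match[OF o t0 n] by auto

text \<open>Events cannot accumulate: only finitely many are collisions before b, and all others
  advance the time by exactly 1.\<close>

lemma orb_passes:
  assumes o: "orb t0 v0 b y w" and t0: "0 \<le> t0" and t: "t < b"
  shows "\<exists>n. t < Ti n (t0, v0)"
proof (rule ccontr)
  assume "\<not> ?thesis"
  then have le: "Ti n (t0, v0) \<le> t" for n by (simp add: not_less)
  then have lt: "Ti n (t0, v0) < b" for n using t by (meson le_less_trans)
  have sm: "strict_mono (\<lambda>n. Ti n (t0, v0))"
    using orb_strict[OF o t0 lt] by (simp add: strict_mono_Suc_iff)
  let ?S = "{r \<in> {t0..b}. collides f y r}"
  have fin: "finite ?S" using orbD(4)[OF o] by (simp add: flight_def)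
  have "finite {n. Ti n (t0, v0) \<in> ?S}"
    using finite_vimageI[OF fin, of "\<lambda>n. Ti n (t0, v0)"] strict_mono_imp_inj_on[OF sm]
    by (simp add: vimage_def)
  then obtain N where N: "\<And>n. Ti n (t0, v0) \<in> ?S \<Longrightarrow> n < N"
    using finite_nat_bounded by (metis (no_types, lifting) lessThan_iff mem_Collect_eq subsetD)
  have one: "Ti (Suc n) (t0, v0) = Ti n (t0, v0) + 1" if "n \<ge> N" for n
  proof (rule ccontr)
    assume "Ti (Suc n) (t0, v0) \<noteq> Ti n (t0, v0) + 1"
    then have "Ti (Suc n) (t0, v0) < Ti n (t0, v0) + 1"
      using tau_le by (simp add: st_Suc order_less_le)
    then have "collides f y (Ti (Suc n) (t0, v0))"
      using orb_step(4)[OF o t0 lt[of n]] orb_match[OF o t0 lt[of n]] lt by blast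
    then have "Ti (Suc n) (t0, v0) \<in> ?S"
      using orb_match[OF o t0 lt[of "Suc n"]] less_imp_le[OF lt[of "Suc n"]] by simp
    then show False using N[of "Suc n"] that by simp
  qed
  have "Ti (N + k) (t0, v0) = Ti N (t0, v0) + real k" for k
    by (induction k) (use one in auto)
  moreover obtain k where "t - Ti N (t0, v0) < real k" using reals_Archimedean2 by blast
  ultimately show False using le[of "N + k"] by simp
qed

lemma orb_eq_cand:
  assumes o: "orb t0 v0 b y w" and t0: "0 \<le> t0" and t: "t0 \<le> t" "t < b"
  shows "y t = Yc (t0, v0) t" "w t = Wc (t0, v0) t"
proof -
  obtain k where k: "t < Ti k (t0, v0)" using orb_passes[OF o t0 t(2)] by blast
  define n where "n = (LEAST n. t < Ti (Suc n) (t0, v0))"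
  have ex: "\<exists>n. t < Ti (Suc n) (t0, v0)" using k Ti_mono_Suc[of k "(t0, v0)"] by (metis less_le_trans)
  have n1: "t < Ti (Suc n) (t0, v0)" unfolding n_def by (rule LeastI_ex[OF ex])
  have n2: "Ti n (t0, v0) \<le> t"
  proof (cases n)
    case 0
    then show ?thesis using t by (simp add: st_0)
  next
    case (Suc i)
    then show ?thesis using not_less_Least[of i "\<lambda>n. t < Ti (Suc n) (t0, v0)"] by (simp add: n_def)
  qed
  have lt: "Ti n (t0, v0) < b" using n2 t by simp
  have "y t = Yi n (t0, v0) + (t - Ti n (t0, v0)) * Wi n (t0, v0) \<and> w t = Wi n (t0, v0)"
  proof (cases "Ti n (t0, v0) = t")
    case True
    then show ?thesis using orb_match[OF o t0 lt] by auto
  next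
    case False
    then show ?thesis using orb_step(2)[OF o t0 lt, of t] orb_match[OF o t0 lt] n1 n2 t by auto
  qed
  then show "y t = Yc (t0, v0) t" "w t = Wc (t0, v0) t" using YWc_eq[OF n2 n1] by auto
qed

end

text \<open>Reduces conditions at all real times to countably many ones, as measurability requires;
  it also carries inequalities from an open interval to its end points.\<close>

lemma nonneg_from_rationals:
  fixes F :: "real \<Rightarrow> real"
  assumes "continuous_on {a..b} F" "\<And>q. q \<in> \<rat> \<Longrightarrow> a < q \<Longrightarrow> q < b \<Longrightarrow> 0 \<le> F q"
    and "a < b" "t \<in> {a..b}"
  shows "0 \<le> F t"
proof (rule ccontr)
  assume "\<not> ?thesis"
  then obtain d where d: "d > 0" "\<And>r. r \<in> {a..b} \<Longrightarrow> \<bar>r - t\<bar> < d \<Longrightarrow> \<bar>F r - F t\<bar> < - F t"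
    using assms(1,4) unfolding continuous_on_iff dist_real_def by (metis neg_0_less_iff_less not_le)
  have "max a (t - d) < min b (t + d)" using assms(3,4) d(1) by auto
  then obtain q where q: "q \<in> \<rat>" "max a (t - d) < q" "q < min b (t + d)"
    using Rats_dense_in_real by blast
  then have "0 \<le> F q" "\<bar>F q - F t\<bar> < - F t" using assms(2) d(2)[of q] by auto
  then show False by linarith
qed

context slits begin

lemma flight_cong:
  assumes "\<And>t. t0 \<le> t \<Longrightarrow> t \<le> b \<Longrightarrow> y t = y' t" "\<And>t. t0 \<le> t \<Longrightarrow> t \<le> b \<Longrightarrow> w t = w' t"
    and "flight t0 b y w"
  shows "flight t0 b y' w'"
proof -
  have col: "collides f y' t \<longleftrightarrow> collides f y t" if "t0 \<le> t" "t \<le> b" for t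
    using assms(1)[OF that] by (simp add: collides_def)
  have "{t \<in> {t0..b}. collides f y' t} = {t \<in> {t0..b}. collides f y t}"
    using col by auto
  moreover have "y' t = y' s + (t - s) * w' s \<and> w' t = reflect f t (y' t) (w' s)"
    if "t0 \<le> s" "s < t" "t \<le> b" "\<forall>r\<in>{s<..<t}. \<not> collides f y' r" for s t
    using flightD[OF assms(3) that(1-3)] that(4) col assms(1,2)[of s] assms(1,2)[of t] that by simp
  ultimately show ?thesis using assms(3) by (auto simp: flight_def)
qed

lemma orb_cong:
  assumes "\<And>t. t0 \<le> t \<Longrightarrow> t \<le> b \<Longrightarrow> y t = y' t" "\<And>t. t0 \<le> t \<Longrightarrow> t \<le> b \<Longrightarrow> w t = w' t"
    and "orb t0 v0 b y w"
  shows "orb t0 v0 b y' w'"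
proof -
  have le: "t0 \<le> b" using assms(3) by (simp add: orb_def)
  have "flight t0 b y' w'"
    by (rule flight_cong[of t0 b y y' w w']) (use assms(1,2) orbD(4)[OF assms(3)] in auto)
  moreover have "y' t0 = f t0" "w' t0 = v0"
    using orbD(2,3)[OF assms(3)] assms(1,2)[of t0] le by simp_all
  moreover have "0 \<le> y' t \<and> y' t \<le> 1" if "t0 \<le> t" "t \<le> b" for t
    using orbD(5)[OF assms(3) that] assms(1)[OF that] by simp
  moreover have "y' t \<noteq> fL t \<and> y' t \<noteq> fR t" if "t0 \<le> t" "t \<le> b" "crit t" for t
    using orbD(6)[OF assms(3) that] assms(1)[OF that(1,2)] by simp
  moreover have "0 \<le> (y' s - f s) * (y' t - f t)"
    if "t0 \<le> s" "s \<le> t" "t \<le> b" "\<forall>r\<in>{s..t}. \<not> crit r" for s t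
    using orbD(7)[OF assms(3) that(1-3)] assms(1)[of s] assms(1)[of t] that by simp
  ultimately show ?thesis using le unfolding orb_def by blast
qed

lemma orbit_iff_orb: "orbit lam x0 fL fR t0 v0 y w \<longleftrightarrow> (\<forall>b\<ge>t0. orb t0 v0 b y w)"
proof
  assume "orbit lam x0 fL fR t0 v0 y w"
  then show "\<forall>b\<ge>t0. orb t0 v0 b y w"
    unfolding orbit_def orb_def flight_def Let_def by blast
next
  assume all: "\<forall>b\<ge>t0. orb t0 v0 b y w"
  have "finite {t \<in> {t0..b}. collides f y t}" for b
    using all[rule_format, of b] by (cases "t0 \<le> b") (auto simp: orb_def flight_def)
  moreover have "y t = y s + (t - s) * w s \<and> w t = reflect f t (y t) (w s)"
    if "t0 \<le> s" "s < t" "\<forall>r\<in>{s<..<t}. \<not> collides f y r" for s t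
    using all[rule_format, of t] that flightD[of t0 t y w s t] by (auto simp: orb_def)
  moreover have "0 \<le> (y s - f s) * (y t - f t)"
    if "t0 \<le> s" "s \<le> t" "\<forall>r\<in>{s..t}. \<not> crit r" for s t
    using all[rule_format, of t] that orbD(7)[of t0 v0 t y w s t] by auto
  moreover have "y t0 = f t0" "w t0 = v0" using all by (auto simp: orb_def)
  moreover have "0 \<le> y t \<and> y t \<le> 1" "crit t \<longrightarrow> y t \<noteq> fL t \<and> y t \<noteq> fR t" if "t0 \<le> t" for t
    using all that orbD(5,6)[of t0 v0 t y w t] by auto
  ultimately show "orbit lam x0 fL fR t0 v0 y w"
    unfolding orbit_def Let_def by blast
qed

lemma orb_cand:
  assumes "orb t0 v0 b y w" "0 \<le> t0" "t0 \<le> b'" "b' < b"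
  shows "orb t0 v0 b' (Yc (t0, v0)) (Wc (t0, v0))"
  by (rule orb_cong[of t0 b' y _ w])
    (use orb_eq_cand[OF assms(1,2)] assms orb_restrict[OF assms(1)] in auto)

text \<open>By uniqueness all finite pieces are restrictions of the one simulated trajectory, so no
  compatibility has to be arranged between them.\<close>

lemma orbit_glue:
  assumes "\<And>b. t0 \<le> b \<Longrightarrow> \<exists>y w. orb t0 v0 b y w" "0 \<le> t0"
  shows "orbit lam x0 fL fR t0 v0 (Yc (t0, v0)) (Wc (t0, v0))"
  unfolding orbit_iff_orb
proof (intro allI impI)
  fix b assume "t0 \<le> b"
  moreover then obtain y w where "orb t0 v0 (b + 1) y w" using assms(1)[of "b + 1"] by auto
  ultimately show "orb t0 v0 b (Yc (t0, v0)) (Wc (t0, v0))"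
    using orb_cand[of t0 v0 "b+1" y w b] assms(2) by auto
qed

text \<open>Countably many conditions on the simulated trajectory that characterise, for nonnegative
  initial times, the existence of an orbit (\<open>orbit_imp_Good\<close>,
  \<open>Good_imp_orbit\<close>). All quantifiers range over naturals or rationals.\<close>

definition Good :: "real \<times> real \<Rightarrow> bool" where
  "Good x \<longleftrightarrow> (\<forall>n. Ti n x < Ti (Suc n) x) \<and> (\<forall>k::nat. \<exists>n. real k < Ti n x) \<and>
     (\<forall>n. fst x \<noteq> c n) \<and>
     (\<forall>q\<in>\<rat>. fst x \<le> q \<longrightarrow> 0 \<le> Yc x q \<and> Yc x q \<le> 1) \<and>
     (\<forall>n. fst x \<le> c n \<longrightarrow> Yc x (c n) \<noteq> fL (c n) \<and> Yc x (c n) \<noteq> fR (c n)) \<and>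
     (\<forall>n. \<forall>p\<in>\<rat>. \<forall>q\<in>\<rat>. fst x \<le> p \<and> p \<le> q \<and> c n < p \<and> q < c (Suc n) \<longrightarrow>
        0 \<le> (Yc x p - g n p) * (Yc x q - g n q))"

lemma orbit_imp_Good:
  assumes orbit: "orbit lam x0 fL fR t0 v0 y w" and t0: "0 \<le> t0"
  shows "Good (t0, v0)"
proof -
  have o: "orb t0 v0 b y w" if "t0 \<le> b" for b using orbit that by (simp add: orbit_iff_orb)
  have oc: "orb t0 v0 b (Yc (t0, v0)) (Wc (t0, v0))" if "t0 \<le> b" for b
    using orb_cand[OF o t0 that, of "b + 1"] that by simp
  have ge: "t0 \<le> Ti n (t0, v0)" for n using Ti_mono[of 0 n "(t0, v0)"] by (simp add: st_0)
  have "Ti n (t0, v0) < Ti (Suc n) (t0, v0)" for n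
    using orb_strict[OF o t0, of "Ti n (t0, v0) + 1" n] ge[of n] by simp
  moreover have "\<exists>n. real k < Ti n (t0, v0)" for k
    using orb_passes[OF o t0, of "t0 + real k + 1" "real k"] t0 by auto
  moreover have "\<not> crit t0" using orb_not_crit_start[OF o[of t0]] by simp
  then have "t0 \<noteq> c n" for n using crit_c by blast
  moreover have "0 \<le> Yc (t0, v0) q \<and> Yc (t0, v0) q \<le> 1" if "t0 \<le> q" for q
    using orbD(5)[OF oc[OF that]] that by auto
  moreover have "Yc (t0, v0) (c n) \<noteq> fL (c n) \<and> Yc (t0, v0) (c n) \<noteq> fR (c n)" if "t0 \<le> c n" for n
    using orbD(6)[OF oc[OF that]] that crit_c by auto
  moreover have "0 \<le> (Yc (t0, v0) p - g n p) * (Yc (t0, v0) q - g n q)"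
    if "t0 \<le> p" "p \<le> q" "c n < p" "q < c (Suc n)" for n p q
  proof -
    have "t0 \<le> q" using that by simp
    have "0 \<le> (Yc (t0, v0) p - f p) * (Yc (t0, v0) q - f q)"
      using orbD(7)[OF oc[OF \<open>t0 \<le> q\<close>] that(1,2) order_refl] between_c(1)[of n] that by auto
    then show ?thesis using between_c(2)[of n p] between_c(2)[of n q] that by auto
  qed
  ultimately show ?thesis by (auto simp: Good_def)
qed

lemma Good_imp_orbit:
  assumes Good: "Good (t0, v0)" and t0: "0 \<le> t0"
  shows "orbit lam x0 fL fR t0 v0 (Yc (t0, v0)) (Wc (t0, v0))"
proof -
  define x where "x = (t0, v0)"
  define T where "T n = Ti n x" for n
  define y where "y = Yc x"
  define w where "w = Wc x"
  have lt: "T n < T (Suc n)" for n using Good by (simp add: Good_def x_def T_def)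
  have unb: "\<exists>n. t < T n" for t
  proof -
    obtain k :: nat where "t < real k" using reals_Archimedean2 by blast
    then show ?thesis using Good by (simp add: Good_def x_def T_def) (metis less_trans)
  qed
  have T0: "T 0 = t0" by (simp add: T_def st_0 x_def)
  have sm: "strict_mono T" using lt by (simp add: strict_mono_Suc_iff)
  have ge: "t0 \<le> T n" for n using T0 sm by (metis le0 strict_mono_less_eq)
  have loc: "\<exists>n. T n \<le> t \<and> t < T (Suc n)" if "t0 \<le> t" for t
  proof -
    define k where "k = (LEAST k. t < T k)"
    have k: "t < T k" unfolding k_def using LeastI_ex[OF unb] .
    moreover have "k \<noteq> 0" using k that T0 by (cases k) auto
    then obtain n where n: "k = Suc n" using not0_implies_Suc by blast
    moreover have "\<not> t < T n" using not_less_Least[of n "\<lambda>k. t < T k"] n by (auto simp: k_def)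
    ultimately show ?thesis by (metis not_less)
  qed
  have seg: "y t = y (T n) + (t - T n) * w (T n)" "w t = w (T n)"
    if "T n \<le> t" "t < T (Suc n)" for t n
    using YWc_eq[of n x t] YWc_eq[of n x "T n"] that lt[of n] by (simp_all add: T_def y_def w_def)
  have yT: "y (T n) = Yi n x" "w (T n) = Wi n x" for n
    using YWc_eq[of n x "T n"] lt[of n] by (simp_all add: T_def y_def w_def)
  have endp: "y (T (Suc n)) = y (T n) + (T (Suc n) - T n) * w (T n)"
    "w (T (Suc n)) = refl (T (Suc n)) (y (T (Suc n))) (w (T n))" for n
    by (simp_all add: yT st_Suc) (simp_all add: T_def st_Suc)
  have ncrit: "\<not> crit t0" using Good crit_iff_c[of t0] c0_neg t0 by (auto simp: Good_def)
  have y_crit: "y t \<noteq> fL t \<and> y t \<noteq> fR t" if "t0 \<le> t" "crit t" for t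
    using Good that crit_iff_c[of t] c0_neg t0 by (auto simp: Good_def x_def y_def)
  have rf: "refl t (y t) u = reflect f t (y t) u" if "t0 \<le> t" for t u
    by (rule refl_eq_reflect) (use y_crit[OF that] that t0 c0_neg in auto)
  have hc: "hit t (y t) \<longleftrightarrow> collides f y t" if "t0 \<le> t" for t
    by (rule hit_iff) (use y_crit[OF that] that t0 c0_neg in auto)
  have nocol: "\<not> collides f y r" if "T n < r" "r < T (Suc n)" for n r
  proof -
    have "\<not> hit r (Yi n x + (r - Ti n x) * Wi n x)"
      using tau_no_hit[of "Ti n x" r "Yi n x" "Wi n x"] that ge[of n] t0 c0_neg
      by (auto simp: T_def st_Suc)
    then have "\<not> hit r (y r)" using seg[of n r] that yT[of n] by (simp add: T_def)
    then show ?thesis using hc[of r] ge[of n] that by auto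
  qed
  have fin: "finite {t \<in> {t0..b}. collides f y t}" for b
  proof -
    obtain N where N: "b < T N" using unb by blast
    have "{t \<in> {t0..b}. collides f y t} \<subseteq> T ` {..N}"
    proof
      fix t assume t: "t \<in> {t \<in> {t0..b}. collides f y t}"
      then obtain n where n: "T n \<le> t" "t < T (Suc n)" using loc by auto
      then have "t = T n" using nocol[of n t] t by fastforce
      moreover have "n < N" using n t N sm by (simp, meson le_less_trans order_trans strict_mono_less)
      ultimately show "t \<in> T ` {..N}" by auto
    qed
    then show ?thesis by (rule finite_subset) simp
  qed
  have fly: "y t = y s + (t - s) * w s \<and> w t = reflect f t (y t) (w s)"
    if s: "t0 \<le> s" "s < t" and nc: "\<And>r. s < r \<Longrightarrow> r < t \<Longrightarrow> \<not> collides f y r" for s t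
  proof -
    obtain n where n: "T n \<le> s" "s < T (Suc n)" using loc s by blast
    have ys: "y s = y (T n) + (s - T n) * w (T n)" "w s = w (T n)" using seg n by auto
    \<comment> \<open>Several events may lie between s and t' although no collision does, namely
      capped ones. The induction counts the event intervals; at an intermediate event a the absence
      of a collision gives w a = w s.\<close>
    have main: "s < t' \<Longrightarrow> t' \<le> T (Suc n + k) \<Longrightarrow> t' \<le> t \<Longrightarrow>
       y t' = y s + (t' - s) * w s \<and> w t' = reflect f t' (y t') (w s)" for t' k
    proof (induction k arbitrary: t')
      case 0
      show ?case
      proof (cases "t' = T (Suc n)")
        case True
        then show ?thesis using endp[of n] ys rf[of t'] s 0 by (simp add: algebra_simps)
      next
        case False
        then have lt': "t' < T (Suc n)" using 0 by simp
        then have "\<not> collides f y t'" using nocol[of n t'] n 0 by simp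
        then show ?thesis using seg[of n t'] ys lt' n 0 by (simp add: algebra_simps reflect_not_collides)
      qed
    next
      case (Suc k)
      define a where "a = T (Suc n + k)"
      have "T (Suc n) \<le> a" using sm by (simp add: a_def strict_mono_less_eq)
      then have a: "s < a" using n by simp
      show ?case
      proof (cases "t' \<le> a")
        case True
        then show ?thesis using Suc.IH[of t'] Suc.prems by (simp add: a_def)
      next
        case False
        have nca: "\<not> collides f y a" using nc[of a] a False Suc.prems by auto
        then have ya: "y a = y s + (a - s) * w s" "w a = w s"
          using Suc.IH[of a] a False Suc.prems by (auto simp: a_def reflect_not_collides)
        show ?thesis
        proof (cases "t' = T (Suc (Suc n + k))")
          case True
          then show ?thesis using endp[of "Suc n + k"] ya rf[of t'] s Suc.prems
            by (simp add: algebra_simps a_def)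
        next
          case ne: False
          then have lt': "t' < T (Suc (Suc n + k))" using Suc.prems by simp
          then have "\<not> collides f y t'" using nocol[of "Suc n + k" t'] False by (simp add: a_def)
          then show ?thesis using seg[of "Suc n + k" t'] ya lt' False
            by (simp add: algebra_simps reflect_not_collides a_def)
        qed
      qed
    qed
    obtain N where "t < T N" using unb by blast
    then have "t \<le> T (Suc n + N)" using strict_mono_less_eq[OF sm, of N "Suc n + N"] by simp
    then show ?thesis using main[of t N] s by simp
  qed
  have fli: "flight t0 b y w" for b using fin fly by (auto simp: flight_def)
  have con: "continuous_on {a..b} y" if "t0 \<le> a" for a b
    using flight_continuous[OF fli[of b]] by (rule continuous_on_subset) (use that in auto)
  have y01: "0 \<le> y t \<and> y t \<le> 1" if "t0 \<le> t" for t
  proof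
    have r: "0 \<le> y q" "0 \<le> 1 - y q" if "q \<in> \<rat>" "t < q" "q < t + 1" for q
      using Good that \<open>t0 \<le> t\<close> by (auto simp: Good_def y_def x_def)
    show "0 \<le> y t"
      by (rule nonneg_from_rationals[of t "t + 1"]) (use r con[of t "t+1"] that in auto)
    have "0 \<le> 1 - y t"
      by (rule nonneg_from_rationals[of t "t + 1" "\<lambda>t. 1 - y t"])
        (use r con[of t "t+1"] that in \<open>auto intro!: continuous_intros\<close>)
    then show "y t \<le> 1" by simp
  qed
  have sign: "0 \<le> (y s - f s) * (y t - f t)"
    if st: "t0 \<le> s" "s \<le> t" and nc: "\<And>r. s \<le> r \<Longrightarrow> r \<le> t \<Longrightarrow> \<not> crit r" for s t
  proof -
    obtain n where n: "c n < s" "t < c (Suc n)"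
      using no_crit_in_segment[of s t] nc st t0 c0_neg by (metis less_imp_le order_trans)
    obtain e where e: "t < e" "e < c (Suc n)" using n(2) dense by blast
    let ?D = "\<lambda>p. y p - g n p"
    have cD: "continuous_on {s..e'} ?D" for e'
      using con st slit_motion_continuous(1)[OF mot_g] by (intro continuous_intros) auto
    have rr: "0 \<le> ?D p * ?D q" if "p \<in> \<rat>" "q \<in> \<rat>" "s \<le> p" "p \<le> q" "q < e" for p q
      using Good that st e n unfolding Good_def x_def[symmetric] y_def[symmetric]
      by (simp add: x_def)
    \<comment> \<open>Density is used twice: first the left argument is moved from rationals to s,
      then the right one to t.\<close>
    have sr: "0 \<le> ?D s * ?D q" if q: "q \<in> \<rat>" "s < q" "q < e" for q
      by (rule nonneg_from_rationals[of s q "\<lambda>p. ?D p * ?D q"])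
        (use rr q in \<open>auto intro!: continuous_on_mult continuous_on_const cD\<close>)
    have "0 \<le> ?D s * ?D t"
      by (rule nonneg_from_rationals[of s e "\<lambda>q. ?D s * ?D q"])
        (use sr st e in \<open>auto intro!: continuous_on_mult continuous_on_const cD\<close>)
    then show ?thesis using between_c(2)[of n s] between_c(2)[of n t] n st by auto
  qed
  have st: "y t0 = f t0" "w t0 = v0"
    using yT[of 0] fl_eq_f[of t0] ncrit t0 c0_neg by (simp_all add: T0 st_0 x_def)
  show ?thesis
    unfolding orbit_iff_orb orb_def x_def[symmetric] y_def[symmetric] w_def[symmetric]
    using fli y01 y_crit sign st by auto
qed

text \<open>Removes the existential quantifier over orbits: the orbit, if any, is the simulated one,
  and rational times suffice because the velocity is right-continuous.\<close>

lemma growing_conds_iff: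
  assumes T: "0 \<le> T" and K: "0 < K" and z: "0 \<le> \<zeta>"
  shows "(t0, v0) \<in> growing_conds lam x0 fL fR K \<zeta> T V \<longleftrightarrow>
    (t0, v0) \<in> initial_conds V \<and> Good (t0, v0) \<and>
    (\<forall>q\<in>\<rat>. T \<le> q \<longrightarrow> \<bar>Wc (t0, v0) (t0 + q)\<bar> \<ge> \<bar>Wc (t0, v0) (t0 + T)\<bar> / K * exp (\<zeta> * (q - T)))"
    (is "?L \<longleftrightarrow> ?I \<and> ?G \<and> ?R")
proof
  assume ?L
  then obtain y w where I: ?I and o: "orbit lam x0 fL fR t0 v0 y w"
    and gr: "\<forall>t\<ge>T. \<bar>w (t0 + t)\<bar> \<ge> \<bar>w (t0 + T)\<bar> / K * exp (\<zeta> * (t - T))"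
    by (auto simp: growing_conds_def)
  have t0: "0 \<le> t0" using I by (auto simp: initial_conds_def)
  have "w t = Wc (t0, v0) t" if "t0 \<le> t" for t
    using orb_eq_cand(2)[of t0 v0 "t+1" y w t] o t0 that by (auto simp: orbit_iff_orb)
  then have ?R using gr T by auto
  then show "?I \<and> ?G \<and> ?R" using I orbit_imp_Good[OF o t0] by auto
next
  assume a: "?I \<and> ?G \<and> ?R"
  then have t0: "0 \<le> t0" by (auto simp: initial_conds_def)
  define y where "y = Yc (t0, v0)"
  define w where "w = Wc (t0, v0)"
  have o: "orbit lam x0 fL fR t0 v0 y w" using Good_imp_orbit a t0 by (auto simp: y_def w_def)
  have "\<bar>w (t0 + t)\<bar> \<ge> \<bar>w (t0 + T)\<bar> / K * exp (\<zeta> * (t - T))" if t: "T \<le> t" for t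
  proof -
    have fli: "flight t0 (t0 + t + 1) y w" using o t T by (auto simp: orbit_iff_orb orb_def)
    obtain e where e: "t0 + t < e" "\<And>r. t0 + t < r \<Longrightarrow> r < e \<Longrightarrow> w r = w (t0 + t)"
      using flight_germ_right[OF fli, of "t0 + t"] t T by (metis add_increasing2 less_add_one order_refl order_trans)
    \<comment> \<open>The velocity is still the same at a slightly later rational time q, where the
      required lower bound is at least as large since \<zeta> is nonnegative.\<close>
    obtain q where q: "q \<in> \<rat>" "t < q" "q < e - t0" using Rats_dense_in_real[of t "e - t0"] e by auto
    have "\<bar>w (t0 + T)\<bar> / K * exp (\<zeta> * (t - T)) \<le> \<bar>w (t0 + T)\<bar> / K * exp (\<zeta> * (q - T))"
      using q K z by (intro mult_left_mono) (auto intro!: mult_left_mono)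
    also have "\<dots> \<le> \<bar>w (t0 + q)\<bar>" using a q t by (auto simp: w_def)
    also have "\<dots> = \<bar>w (t0 + t)\<bar>" using e(2)[of "t0 + q"] q by simp
    finally show ?thesis .
  qed
  then show ?L using a o by (auto simp: growing_conds_def)
qed

section \<open>Measurability of the set of bad initial conditions\<close>

lemma continuous_g: "continuous_on S (g n)"
  using slit_motion_continuous(1)[OF mot_g] .

lemma measurable_ph [measurable]: "ph \<in> borel \<rightarrow>\<^sub>M count_space UNIV"
  unfolding ph_def by measurable

lemma measurable_g [measurable]: "g n \<in> borel_measurable borel" "deriv (g n) \<in> borel_measurable borel"
  using slit_motion_continuous(1,2)[OF mot_g] by (auto intro: borel_measurable_continuous_onI)

lemma measurable_fl [measurable]: "fl \<in> borel_measurable borel"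
  unfolding fl_def by (rule measurable_compose_countable[of g]) measurable

lemma measurable_dfl [measurable]: "(\<lambda>t. deriv (g (ph t)) t) \<in> borel_measurable borel"
  by (rule measurable_compose_countable[of "\<lambda>n. deriv (g n)"]) measurable

text \<open>In a fixed compact time window the hitting states are the projection, along a compact
  factor, of a closed set.\<close>

lemma closed_hit_between:
  "closed {p :: real \<times> real \<times> real. \<exists>r. r \<in> {a..b} \<and>
     (r, p) \<in> {z. (case z of (r, t, h, u) \<Rightarrow> h + (r - t) * u = 0 \<or> h + (r - t) * u = 1 \<or> h + (r - t) * u = g n r)}}"
proof (rule closed_compact_projection)
  have "continuous_on UNIV (\<lambda>z::real \<times> real \<times> real \<times> real. g n (fst z))"
    by (rule continuous_on_compose2[OF continuous_g[of UNIV]]) (auto intro!: continuous_intros)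
  then show "closed {z :: real \<times> real \<times> real \<times> real. (case z of (r, t, h, u) \<Rightarrow>
      h + (r - t) * u = 0 \<or> h + (r - t) * u = 1 \<or> h + (r - t) * u = g n r)}"
    unfolding case_prod_beta
    by (intro closed_Collect_disj closed_Collect_eq continuous_intros)
qed simp

lemma tau_less_iff:
  "tau (t, h, u) < a \<longleftrightarrow> t + 1 < a \<or> (\<exists>r. t < r \<and> c 0 < r \<and> r < a \<and> hit r (h + (r - t) * u))"
  unfolding tau_set_props(3) cInf_less_iff[OF tau_set_props(1,2)] by auto

text \<open>A hit occurs either at one of countably many critical times or inside a closed window
  with rational end points between two consecutive ones. This exhibits the sets
  \<open>tau < a\<close> as countable unions of Borel sets.\<close>

lemma hit_before_iff:
  "(\<exists>r. t < r \<and> c 0 < r \<and> r < a \<and> hit r (h + (r - t) * u)) \<longleftrightarrow>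
   (\<exists>n. t < c n \<and> c 0 < c n \<and> c n < a \<and> hit (c n) (h + (c n - t) * u)) \<or>
   (\<exists>n. \<exists>p\<in>\<rat>. \<exists>q\<in>\<rat>. c n < p \<and> q < c (Suc n) \<and> t < p \<and> q < a \<and>
      (t, h, u) \<in> {p'. \<exists>r. r \<in> {p..q} \<and>
     (r, p') \<in> {z. (case z of (r, t, h, u) \<Rightarrow> h + (r - t) * u = 0 \<or> h + (r - t) * u = 1 \<or> h + (r - t) * u = g n r)}})"
    (is "?L \<longleftrightarrow> ?A \<or> ?B")
proof
  assume ?L
  then obtain r where r: "t < r" "c 0 < r" "r < a" "hit r (h + (r - t) * u)" by blast
  obtain n where n: "c n \<le> r" "r < c (Suc n)" using locate_c[of r] r by auto
  show "?A \<or> ?B"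
  proof (cases "c n = r")
    case True
    then show ?thesis using r by blast
  next
    case False
    obtain p where p: "p \<in> \<rat>" "max t (c n) < p" "p < r"
      using Rats_dense_in_real[of "max t (c n)" r] r n False by auto
    obtain q where q: "q \<in> \<rat>" "r < q" "q < min a (c (Suc n))"
      using Rats_dense_in_real[of r "min a (c (Suc n))"] r n by auto
    have "fl r = g n r" using ph_eq[OF n] by (simp add: fl_def)
    then have "(t, h, u) \<in> {p'. \<exists>r. r \<in> {p..q} \<and>
       (r, p') \<in> {z. (case z of (r, t, h, u) \<Rightarrow> h + (r - t) * u = 0 \<or> h + (r - t) * u = 1 \<or> h + (r - t) * u = g n r)}}"
      using r(4) p q by (auto simp: hit_def intro!: exI[of _ r])
    then show ?thesis using p q by (intro disjI2 exI[of _ n] bexI[OF _ p(1)] bexI[OF _ q(1)]) auto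
  qed
next
  assume "?A \<or> ?B"
  then show ?L
  proof
    assume ?B
    then obtain n p q r where r: "c n < p" "q < c (Suc n)" "t < p" "q < a" "p \<le> r" "r \<le> q"
      "h + (r - t) * u = 0 \<or> h + (r - t) * u = 1 \<or> h + (r - t) * u = g n r" by auto
    have "fl r = g n r" using ph_eq[of n r] r by (simp add: fl_def)
    moreover have "c 0 < r" using c_mono[of 0 n] r by simp
    ultimately show ?L using r by (intro exI[of _ r]) (auto simp: hit_def)
  qed blast
qed

lemma measurable_tau [measurable]: "tau \<in> borel_measurable borel"
proof (rule borel_measurableI_less)
  fix a
  define H where "H n p q = {p' :: real \<times> real \<times> real. \<exists>r. r \<in> {p..q} \<and>
     (r, p') \<in> {z. (case z of (r, t, h, u) \<Rightarrow> h + (r - t) * u = 0 \<or> h + (r - t) * u = 1 \<or> h + (r - t) * u = g n r)}}" for n p q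
  have H: "H n p q \<in> sets borel" for n p q
    unfolding H_def using closed_hit_between by (rule borel_closed)
  define A where "A n = {x :: real \<times> real \<times> real. fst x < c n}
    \<inter> {x. hit (c n) (fst (snd x) + (c n - fst x) * snd (snd x))}" for n
  have fst_less: "{x :: real \<times> real \<times> real. fst x < r} \<in> sets borel" for r
    by (intro borel_open open_Collect_less continuous_intros)
  have A: "A n \<in> sets borel" for n
    unfolding A_def hit_def
    by (intro sets.Int fst_less) (intro borel_closed closed_Collect_disj closed_Collect_eq continuous_intros)
  have eq: "{p \<in> space borel. tau p < a} = {x. fst x < a - 1} \<union> (\<Union>n\<in>{n. c 0 < c n \<and> c n < a}. A n) \<union>
    (\<Union>n. \<Union>p\<in>{p\<in>\<rat>. c n < p}. \<Union>q\<in>{q\<in>\<rat>. q < c (Suc n) \<and> q < a}. {x. fst x < p} \<inter> H n p q)"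
    (is "?L = ?R")
  proof -
    have "x \<in> ?L \<longleftrightarrow> x \<in> ?R" for x
    proof (cases x)
      case (fields t h u)
      have "x \<in> ?L \<longleftrightarrow> t + 1 < a \<or> ((\<exists>n. t < c n \<and> c 0 < c n \<and> c n < a \<and> hit (c n) (h + (c n - t) * u)) \<or>
        (\<exists>n. \<exists>p\<in>\<rat>. \<exists>q\<in>\<rat>. c n < p \<and> q < c (Suc n) \<and> t < p \<and> q < a \<and> (t, h, u) \<in> H n p q))"
        unfolding fields H_def hit_before_iff[symmetric] tau_less_iff[symmetric] by simp
      also have "\<dots> \<longleftrightarrow> x \<in> ?R" unfolding fields A_def by auto
      finally show ?thesis .
    qed
    then show ?thesis by blast
  qed
  have cr: "countable {p\<in>\<rat>. P p}" for P :: "real \<Rightarrow> bool"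
    using countable_rat by (rule countable_subset[rotated]) auto
  show "{p \<in> space borel. tau p < a} \<in> sets borel"
    unfolding eq by (intro sets.Un sets.countable_UN'' sets.Int A H fst_less cr) auto
qed

lemma measurable_nxt [measurable]: "nxt \<in> borel_measurable borel"
proof -
  define k :: "real \<times> real \<times> real \<Rightarrow> real" where "k = (\<lambda>p. fst (snd p) + (tau p - fst p) * snd (snd p))"
  have [measurable]: "(\<lambda>p. fst (snd p)) \<in> borel_measurable (borel :: (real \<times> real \<times> real) measure)"
    "(\<lambda>p. snd (snd p)) \<in> borel_measurable (borel :: (real \<times> real \<times> real) measure)"
    "(\<lambda>p. fst p) \<in> borel_measurable (borel :: (real \<times> real \<times> real) measure)"
    by (intro borel_measurable_continuous_onI continuous_intros)+
  have [measurable]: "k \<in> borel_measurable borel" unfolding k_def by measurable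
  have [measurable]: "(\<lambda>p. refl (tau p) (k p) (snd (snd p))) \<in> borel_measurable borel"
    unfolding refl_def by measurable
  have "nxt = (\<lambda>p. (tau p, k p, refl (tau p) (k p) (snd (snd p))))"
    by (auto simp: nxt_def k_def Let_def split: prod.splits)
  then show ?thesis by (simp add: borel_measurable_Pair)
qed

lemma measurable_fst_snd_borel [measurable]:
  "(\<lambda>x. fst x) \<in> borel_measurable (borel :: (real \<times> real) measure)"
  "(\<lambda>x. snd x) \<in> borel_measurable (borel :: (real \<times> real) measure)"
  by (intro borel_measurable_continuous_onI continuous_intros)+

lemma measurable_st: "st n \<in> borel_measurable borel"
proof (induction n)
  case 0
  then show ?case unfolding st_def by (auto intro!: borel_measurable_Pair)
next
  case (Suc n)
  have "st (Suc n) = (\<lambda>x. nxt (st n x))" by (simp add: st_def fun_eq_iff)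
  then show ?case using Suc measurable_nxt by simp
qed

lemma measurable_Ti [measurable]: "Ti n \<in> borel_measurable borel" "Yi n \<in> borel_measurable borel"
  "Wi n \<in> borel_measurable borel"
proof -
  have "(\<lambda>p. fst (snd p)) \<in> borel_measurable (borel :: (real \<times> real \<times> real) measure)"
    "(\<lambda>p. snd (snd p)) \<in> borel_measurable (borel :: (real \<times> real \<times> real) measure)"
    "(\<lambda>p. fst p) \<in> borel_measurable (borel :: (real \<times> real \<times> real) measure)"
    by (intro borel_measurable_continuous_onI continuous_intros)+
  from this[THEN measurable_compose[OF measurable_st]]
  show "Ti n \<in> borel_measurable borel" "Yi n \<in> borel_measurable borel"
    "Wi n \<in> borel_measurable borel" by (simp_all add: Ti_def[abs_def] Yi_def[abs_def] Wi_def[abs_def])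
qed

lemma measurable_cand [measurable]:
  assumes [measurable]: "q \<in> borel_measurable borel"
  shows "(\<lambda>x. Yc x (q x)) \<in> borel_measurable borel" "(\<lambda>x. Wc x (q x)) \<in> borel_measurable borel"
proof -
  have [measurable]: "(\<lambda>x. idx x (q x)) \<in> borel \<rightarrow>\<^sub>M count_space UNIV"
    unfolding idx_def by measurable
  show "(\<lambda>x. Yc x (q x)) \<in> borel_measurable borel"
    unfolding Yc_def
    by (rule measurable_compose_countable[of "\<lambda>n x. Yi n x + (q x - Ti n x) * Wi n x"]) measurable
  show "(\<lambda>x. Wc x (q x)) \<in> borel_measurable borel"
    unfolding Wc_def by (rule measurable_compose_countable[of Wi]) measurable
qed

lemma pred_Ball_rat:
  assumes "\<And>q. Measurable.pred M (P q)"
  shows "Measurable.pred M (\<lambda>x. \<forall>q\<in>(\<rat>::real set). P q x)"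
proof -
  have "(\<forall>q\<in>(\<rat>::real set). P q x) \<longleftrightarrow> (\<forall>r::rat. P (of_rat r) x)" for x
    by (auto simp: Rats_def)
  then show ?thesis using assms by (simp add: pred_intros_countable)
qed

lemma measurable_Good [measurable]: "Measurable.pred borel Good"
proof -
  have [measurable]: "Measurable.pred borel (\<lambda>x :: real \<times> real. fst x \<noteq> r)" for r
  proof -
    have "open {x :: real \<times> real. fst x \<noteq> r}" by (intro open_Collect_neq continuous_intros)
    then show ?thesis by (simp add: pred_def borel_open)
  qed
  show ?thesis
    unfolding Good_def
    by (intro pred_intros_logic pred_intros_countable pred_Ball_rat) measurable
qed

lemma pred_borel_le:
  fixes u v :: "'a::topological_space \<Rightarrow> real"
  assumes "u \<in> borel_measurable borel" "v \<in> borel_measurable borel"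
  shows "Measurable.pred borel (\<lambda>x. u x \<le> v x)"
  using borel_measurable_le[OF assms] by (simp add: pred_def)

lemma borel_bad_conds:
  assumes T: "0 \<le> T" and K: "0 < K" and z: "0 \<le> \<zeta>"
  shows "initial_conds V \<in> sets borel"
    "initial_conds V - growing_conds lam x0 fL fR K \<zeta> T V \<in> sets borel"
proof -
  have I: "initial_conds V = {x. 0 \<le> fst x} \<inter> {x. fst x < 2} \<inter> {x. V \<le> \<bar>snd x\<bar>} \<inter> {x. \<bar>snd x\<bar> \<le> V + 1}"
    by (auto simp: initial_conds_def)
  show bI: "initial_conds V \<in> sets borel" unfolding I
    by (intro sets.Int borel_closed[OF closed_Collect_le] borel_open[OF open_Collect_less] continuous_intros)
  define R where "R x = (\<forall>q\<in>\<rat>. T \<le> q \<longrightarrow>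
      \<bar>Wc x (fst x + q)\<bar> \<ge> \<bar>Wc x (fst x + T)\<bar> / K * exp (\<zeta> * (q - T)))" for x
  have pR: "Measurable.pred borel R"
    unfolding R_def
    by (intro pred_Ball_rat pred_intros_logic pred_borel_le measurable_const borel_measurable_times
        borel_measurable_divide borel_measurable_abs borel_measurable_const measurable_cand
        borel_measurable_add measurable_fst_snd_borel)
  have eq: "initial_conds V - growing_conds lam x0 fL fR K \<zeta> T V =
    initial_conds V \<inter> {x. \<not> (Good x \<and> R x)}"
    using growing_conds_iff[OF T K z] by (auto simp: R_def)
  have "Measurable.pred borel (\<lambda>x. \<not> (Good x \<and> R x))"
    using pR measurable_Good by (intro pred_intros_logic)
  then show "initial_conds V - growing_conds lam x0 fL fR K \<zeta> T V \<in> sets borel"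
    unfolding eq using bI by (simp add: pred_def sets.Int)
qed

end

section \<open>Adiabatic invariance for a ball between a fixed and a moving wall\<close>

lemma sin_ge_linear:
  assumes "\<bar>\<theta>\<bar> \<le> 1"
  shows "\<bar>\<theta>\<bar> \<le> 2 * \<bar>sin (pi * \<theta> / 2)\<bar>"
proof -
  define z where "z = pi * \<theta> / 2"
  have pi: "3 < pi" "pi < 3.2" using pi_gt3 pi_less_4 pi_approx by auto
  have "\<bar>sin z - (\<Sum>m<3. sin_coeff m * z ^ m)\<bar> \<le> inverse (fact 3) * \<bar>z\<bar> ^ 3"
    by (rule Maclaurin_sin_bound)
  moreover have "(\<Sum>m<3. sin_coeff m * z ^ m) = z"
    by (simp add: sin_coeff_def numeral_3_eq_3)
  ultimately have b: "\<bar>sin z - z\<bar> \<le> \<bar>z\<bar> ^ 3 / 6" by (simp add: fact_numeral field_simps)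
  have zle: "\<bar>z\<bar> \<le> 8/5"
    using assms pi mult_mono[of pi "16/5" "\<bar>\<theta>\<bar>" 1] by (simp add: z_def abs_mult)
  then have "\<bar>z\<bar>\<^sup>2 \<le> (8/5)\<^sup>2" by (intro power_mono) auto
  then have "\<bar>z\<bar> ^ 3 \<le> \<bar>z\<bar> * (64/25)"
    using mult_left_mono[of "\<bar>z\<bar>\<^sup>2" "64/25" "\<bar>z\<bar>"] by (simp add: power3_eq_cube power2_eq_square)
  then have "\<bar>sin z\<bar> \<ge> \<bar>z\<bar> / 2" using b by linarith
  moreover have "\<bar>z\<bar> \<ge> 3 * \<bar>\<theta>\<bar> / 2" using pi by (simp add: z_def abs_mult mult_right_mono)
  ultimately show ?thesis by (simp add: z_def)
qed

text \<open>Phases are compared modulo 2 by comparing points of the unit circle; this converts a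
  small chord back into a small phase difference.\<close>

lemma cis_near_one:
  assumes "norm (cis (pi * \<theta>) - 1) \<le> d"
  shows "\<exists>k::int. \<bar>\<theta> - 2 * of_int k\<bar> \<le> d"
proof -
  define k where "k = round (\<theta> / 2)"
  define r where "r = \<theta> - 2 * of_int k"
  have "\<bar>r\<bar> \<le> 1" using of_int_round_abs_le[of "\<theta> / 2"] unfolding r_def k_def by linarith
  have "cis (pi * \<theta>) = cis (pi * r) * cis (2 * pi * of_int k)"
    by (simp add: cis_mult r_def algebra_simps)
  then have "cis (pi * \<theta>) = cis (pi * r)" by simp
  then have "norm (cis (pi * \<theta>) - 1) = 2 * \<bar>sin (pi * r / 2)\<bar>"
    using dist_exp_i_1[of "pi * r"] by (simp add: cis_conv_exp)
  then have "\<bar>r\<bar> \<le> d" using sin_ge_linear[OF \<open>\<bar>r\<bar> \<le> 1\<close>] assms by simp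
  then show ?thesis by (auto simp: r_def)
qed

text \<open>A mean value inequality that tolerates the finitely many collision times.\<close>

lemma norm_diff_le_finite_exceptions:
  fixes F :: "real \<Rightarrow> 'a::banach"
  assumes "finite S" "a \<le> b" "continuous_on {a..b} F" "0 \<le> B"
    and "\<And>t. a < t \<Longrightarrow> t < b \<Longrightarrow> t \<notin> S \<Longrightarrow> \<exists>D. (F has_vector_derivative D) (at t) \<and> norm D \<le> B"
  shows "norm (F b - F a) \<le> B * (b - a)"
proof -
  obtain D where D: "\<And>t. a < t \<Longrightarrow> t < b \<Longrightarrow> t \<notin> S \<Longrightarrow> (F has_vector_derivative D t) (at t) \<and> norm (D t) \<le> B"
    using assms(5) by metis
  define D' where "D' t = (if a < t \<and> t < b \<and> t \<notin> S then D t else 0)" for t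
  have "(D' has_integral (F b - F a)) {a..b}"
    by (rule fundamental_theorem_of_calculus_interior_strong[OF assms(1,2) _ assms(3)])
      (use D in \<open>auto simp: D'_def\<close>)
  then have "(D' has_integral (F b - F a)) (cbox a b)" by simp
  from has_integral_bound[OF assms(4) this] D assms(2,4) show ?thesis
    by (auto simp: D'_def)
qed

text \<open>
  A ball bouncing elastically between a wall at 0 and a wall at \<open>h\<close>, in either chamber of the
  table: x is the distance to the fixed wall. The velocity u is right-continuous.
\<close>

definition bounce :: "(real \<Rightarrow> real) \<Rightarrow> real \<Rightarrow> real \<Rightarrow> (real \<Rightarrow> real) \<Rightarrow> (real \<Rightarrow> real) \<Rightarrow> bool" where
  "bounce h s e x u \<longleftrightarrow> s \<le> e \<and> finite {t \<in> {s..e}. \<not> (0 < x t \<and> x t < h t)} \<and>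
     (\<forall>t. s \<le> t \<and> t \<le> e \<longrightarrow> 0 \<le> x t \<and> x t \<le> h t) \<and>
     (\<forall>t. s \<le> t \<and> t < e \<longrightarrow> (\<exists>b>t. \<forall>r. t < r \<and> r < b \<longrightarrow> x r = x t + (r - t) * u t \<and> u r = u t)) \<and>
     (\<forall>t. s < t \<and> t \<le> e \<longrightarrow> (\<exists>a<t. \<exists>v. (\<forall>r. a < r \<and> r < t \<longrightarrow> x r = x t + (r - t) * v \<and> u r = v) \<and>
        (u t = v \<and> 0 < x t \<and> x t < h t \<or> x t = 0 \<and> u t = - v \<or> x t = h t \<and> u t = - v + 2 * deriv h t)))"

text \<open>This is h^2 times the time derivative of x / h, the momentum in the coordinate in which
  the moving wall is at rest. It changes sign at a collision with either wall, so its absolute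
  value, the action, is continuous.\<close>

definition mom :: "(real \<Rightarrow> real) \<Rightarrow> (real \<Rightarrow> real) \<Rightarrow> (real \<Rightarrow> real) \<Rightarrow> real \<Rightarrow> real" where
  "mom h x u t = h t * u t - deriv h t * x t"

text \<open>The position x / h unfolded to the circle R/2Z: outgoing and returning motion are told
  apart by the sign, and 1 and -1 are the same point, the moving wall. On this circle the ball moves
  forward with speed |mom| / h^2.\<close>

definition ang :: "(real \<Rightarrow> real) \<Rightarrow> (real \<Rightarrow> real) \<Rightarrow> (real \<Rightarrow> real) \<Rightarrow> real \<Rightarrow> real" where
  "ang h x u t = sgn (mom h x u t) * x t / h t"

lemma bounceD:
  assumes "bounce h s e x u"
  shows "s \<le> e" "finite {t \<in> {s..e}. \<not> (0 < x t \<and> x t < h t)}"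
    "\<And>t. s \<le> t \<Longrightarrow> t \<le> e \<Longrightarrow> 0 \<le> x t \<and> x t \<le> h t"
    "\<And>t. s \<le> t \<Longrightarrow> t < e \<Longrightarrow> \<exists>b>t. \<forall>r. t < r \<and> r < b \<longrightarrow> x r = x t + (r - t) * u t \<and> u r = u t"
    "\<And>t. s < t \<Longrightarrow> t \<le> e \<Longrightarrow> \<exists>a<t. \<exists>v. (\<forall>r. a < r \<and> r < t \<longrightarrow> x r = x t + (r - t) * v \<and> u r = v) \<and>
        (u t = v \<and> 0 < x t \<and> x t < h t \<or> x t = 0 \<and> u t = - v \<or> x t = h t \<and> u t = - v + 2 * deriv h t)"
  using assms unfolding bounce_def by blast+

lemma bounce_subset:
  assumes "bounce h s e x u" "s \<le> s'" "s' \<le> e'" "e' \<le> e"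
  shows "bounce h s' e' x u"
proof -
  have "finite {t \<in> {s'..e'}. \<not> (0 < x t \<and> x t < h t)}"
    by (rule finite_subset[OF _ bounceD(2)[OF assms(1)]]) (use assms in auto)
  then show ?thesis using assms unfolding bounce_def by auto
qed

text \<open>A quantity invariant under both reflections is continuous along the trajectory, so a
  derivative bound during free flight bounds its total change. Continuity in flight is asked only
  for velocities with the action of the actual trajectory, which covers the incoming as well as the
  outgoing velocity.\<close>

lemma bounce_bound:
  fixes k :: "real \<Rightarrow> real \<Rightarrow> real \<Rightarrow> 'a::banach"
  assumes bo: "bounce h s e x u" and B: "0 \<le> B"
    and cont: "\<And>t U. s \<le> t \<Longrightarrow> t \<le> e \<Longrightarrow> \<bar>h t * U - deriv h t * x t\<bar> = \<bar>mom h x u t\<bar> \<Longrightarrow>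
       isCont (\<lambda>r. k r (x t + (r - t) * U) U) t"
    and inv0: "\<And>t v. s \<le> t \<Longrightarrow> t \<le> e \<Longrightarrow> x t = 0 \<Longrightarrow> k t 0 (- v) = k t 0 v"
    and invh: "\<And>t v. s \<le> t \<Longrightarrow> t \<le> e \<Longrightarrow> x t = h t \<Longrightarrow> k t (h t) (- v + 2 * deriv h t) = k t (h t) v"
    and der: "\<And>t. s < t \<Longrightarrow> t < e \<Longrightarrow> 0 < x t \<Longrightarrow> x t < h t \<Longrightarrow>
       \<exists>D. ((\<lambda>r. k r (x t + (r - t) * u t) (u t)) has_vector_derivative D) (at t) \<and> norm D \<le> B"
    and t12: "s \<le> t1" "t1 \<le> t2" "t2 \<le> e"
  shows "norm (k t2 (x t2) (u t2) - k t1 (x t1) (u t1)) \<le> B * (t2 - t1)"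
proof -
  let ?K = "\<lambda>r. k r (x r) (u r)"
  have con: "continuous_on {s..e} ?K"
    unfolding continuous_on_eq_continuous_within
  proof
    fix t assume t: "t \<in> {s..e}"
    have R: "\<forall>\<^sub>F r in at t within {s..e}. t < r \<longrightarrow> norm (?K r - ?K t) < \<epsilon>" if "\<epsilon> > 0" for \<epsilon>
    proof (cases "t < e")
      case True
      obtain b where b: "b > t" "\<And>r. t < r \<and> r < b \<Longrightarrow> x r = x t + (r - t) * u t \<and> u r = u t"
        using bounceD(4)[OF bo, of t] True t by auto
      have "isCont (\<lambda>r. k r (x t + (r - t) * u t) (u t)) t"
        by (rule cont) (use t in \<open>auto simp: mom_def\<close>)
      then have "\<forall>\<^sub>F r in at t. norm (k r (x t + (r - t) * u t) (u t) - ?K t) < \<epsilon>"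
        using that unfolding isCont_def tendsto_iff dist_norm by auto
      then have "\<forall>\<^sub>F r in at t within {s..e}. norm (k r (x t + (r - t) * u t) (u t) - ?K t) < \<epsilon>"
        using eventually_at_topological filter_leD[OF at_le[of "{s..e}" UNIV t]] by blast
      moreover have "\<forall>\<^sub>F r in at t within {s..e}. r < b"
        using b by (intro order_tendstoD[OF tendsto_ident_at])
      ultimately show ?thesis by eventually_elim (use b in auto)
    next
      case False
      then show ?thesis using t by (auto simp: eventually_at_filter)
    qed
    have L: "\<forall>\<^sub>F r in at t within {s..e}. r < t \<longrightarrow> norm (?K r - ?K t) < \<epsilon>" if "\<epsilon> > 0" for \<epsilon>
    proof (cases "s < t")
      case True
      obtain a v where a: "a < t" "\<And>r. a < r \<and> r < t \<Longrightarrow> x r = x t + (r - t) * v \<and> u r = v"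
        and v: "u t = v \<and> 0 < x t \<and> x t < h t \<or> x t = 0 \<and> u t = - v \<or> x t = h t \<and> u t = - v + 2 * deriv h t"
        using bounceD(5)[OF bo, of t] True t by (metis atLeastAtMost_iff)
      have kv: "k t (x t) v = ?K t" using v inv0[of t v] invh[of t v] t by auto
      have "isCont (\<lambda>r. k r (x t + (r - t) * v) v) t"
      proof (rule cont)
        \<comment> \<open>The reflection changes at most the sign of the momentum, so
          \<open>cont\<close> applies to the incoming velocity v.\<close>
        have "mom h x u t = h t * v - deriv h t * x t \<or> mom h x u t = - (h t * v - deriv h t * x t)"
          using v
        proof (elim disjE conjE)
          assume "x t = h t" "u t = - v + 2 * deriv h t"
          then show ?thesis by (simp only: mom_def) (simp add: algebra_simps)
        qed (auto simp: mom_def)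
        then show "\<bar>h t * v - deriv h t * x t\<bar> = \<bar>mom h x u t\<bar>"
          by (metis abs_minus_cancel)
      qed (use t in auto)
      then have "\<forall>\<^sub>F r in at t. norm (k r (x t + (r - t) * v) v - ?K t) < \<epsilon>"
        using that kv unfolding isCont_def tendsto_iff dist_norm by auto
      then have "\<forall>\<^sub>F r in at t within {s..e}. norm (k r (x t + (r - t) * v) v - ?K t) < \<epsilon>"
        using filter_leD[OF at_le[of "{s..e}" UNIV t]] by blast
      moreover have "\<forall>\<^sub>F r in at t within {s..e}. a < r"
        using a by (intro order_tendstoD[OF tendsto_ident_at])
      ultimately show ?thesis by eventually_elim (use a in auto)
    next
      case False
      then show ?thesis using t by (auto simp: eventually_at_filter)
    qed
    show "continuous (at t within {s..e}) ?K"
      unfolding continuous_within tendsto_iff dist_norm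
    proof (intro allI impI)
      fix \<epsilon> :: real assume "\<epsilon> > 0"
      from R[OF this] L[OF this]
      show "\<forall>\<^sub>F r in at t within {s..e}. norm (?K r - ?K t) < \<epsilon>"
      proof eventually_elim
        case (elim r)
        then show ?case using \<open>\<epsilon> > 0\<close> by (cases r t rule: linorder_cases) auto
      qed
    qed
  qed
  show ?thesis
  proof (rule norm_diff_le_finite_exceptions[OF bounceD(2)[OF bo] t12(2) _ B])
    show "continuous_on {t1..t2} ?K" by (rule continuous_on_subset[OF con]) (use t12 in auto)
    fix t assume t: "t1 < t" "t < t2" "t \<notin> {t \<in> {s..e}. \<not> (0 < x t \<and> x t < h t)}"
    then have t': "s < t" "t < e" "0 < x t" "x t < h t" using t12 by auto
    obtain D where D: "((\<lambda>r. k r (x t + (r - t) * u t) (u t)) has_vector_derivative D) (at t)" "norm D \<le> B"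
      using der[OF t'] by blast
    obtain b where b: "b > t" "\<And>r. t < r \<and> r < b \<Longrightarrow> x r = x t + (r - t) * u t \<and> u r = u t"
      using bounceD(4)[OF bo, of t] t' by auto
    obtain a where a: "a < t" "\<And>r. a < r \<and> r < t \<Longrightarrow> x r = x t + (r - t) * u t \<and> u r = u t"
      using bounceD(5)[OF bo, of t] t' by fastforce
    have "\<forall>\<^sub>F r in nhds t. r \<in> {a<..<b}" using a b by (intro eventually_nhds_in_open) auto
    then have "\<forall>\<^sub>F r in nhds t. r \<in> UNIV \<longrightarrow> k r (x t + (r - t) * u t) (u t) = ?K r"
      by eventually_elim (use a b in \<open>metis (no_types, lifting) add.right_neutral cancel_comm_monoid_add_class.diff_cancel greaterThanLessThan_iff linorder_neqE_linordered_idom mult_zero_left\<close>)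
    then have "(?K has_vector_derivative D) (at t)"
      using D(1) has_vector_derivative_cong_ev[of UNIV "\<lambda>r. k r (x t + (r - t) * u t) (u t)" ?K t D] by simp
    then show "\<exists>D. (?K has_vector_derivative D) (at t) \<and> norm D \<le> B" using D(2) by blast
  qed
qed

lemma periodic2_int:
  fixes F :: "real \<Rightarrow> 'a"
  assumes "\<And>t. F (t + 2) = F t"
  shows "F (t + 2 * of_int k) = F t"
proof -
  have nat: "F (t + 2 * real n) = F t" for t n
    by (induction n) (use assms[of "t + 2 * real _"] in \<open>auto simp: algebra_simps\<close>)
  show ?thesis
  proof (cases "k \<ge> 0")
    case True
    then show ?thesis using nat[of t "nat k"] by simp
  next
    case False
    then show ?thesis using nat[of "t + 2 * real_of_int k" "nat (-k)"] by simp
  qed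
qed

lemma periodic2_uniformly_continuous:
  fixes F :: "real \<Rightarrow> real"
  assumes con: "continuous_on UNIV F" and per: "\<And>t. F (t + 2) = F t" and "0 < \<epsilon>"
  obtains d where "0 < d" "d \<le> 1" "\<And>t r. \<bar>t - r\<bar> \<le> d \<Longrightarrow> \<bar>F t - F r\<bar> \<le> \<epsilon>"
proof -
  have "uniformly_continuous_on {-1..3} F"
    by (rule compact_uniformly_continuous) (use con continuous_on_subset in auto)
  then obtain d where d: "0 < d" "\<And>t r. t \<in> {-1..3} \<Longrightarrow> r \<in> {-1..3} \<Longrightarrow> \<bar>t - r\<bar> < d \<Longrightarrow> \<bar>F t - F r\<bar> < \<epsilon>"
    using \<open>0 < \<epsilon>\<close> unfolding uniformly_continuous_on_def dist_real_def by metis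
  have "\<bar>F t - F r\<bar> \<le> \<epsilon>" if "\<bar>t - r\<bar> \<le> min (d / 2) 1" for t r
  proof -
    define k where "k = - \<lfloor>t / 2\<rfloor>"
    have "t + 2 * of_int k \<in> {0..2}" using floor_correct[of "t / 2"] by (auto simp: k_def field_simps)
    then have "\<bar>F (t + 2 * of_int k) - F (r + 2 * of_int k)\<bar> < \<epsilon>"
      using that d(1) by (intro d(2)) (auto simp: abs_if split: if_splits)
    then show ?thesis using periodic2_int[of F, OF per] by simp
  qed
  then show thesis using that[of "min (d / 2) 1"] d(1) by auto
qed

lemma DERIV_sqrt_one_plus_square:
  fixes p :: "real \<Rightarrow> real"
  assumes "(p has_real_derivative D) (at t)"
  shows "((\<lambda>r. sqrt (1 + (p r)\<^sup>2)) has_real_derivative p t * D / sqrt (1 + (p t)\<^sup>2)) (at t)"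
proof -
  have pos: "0 < 1 + (p t)\<^sup>2" by (rule add_pos_nonneg) simp_all
  have "((\<lambda>r. 1 + (p r)\<^sup>2) has_real_derivative 2 * p t * D) (at t)"
    by (auto intro!: derivative_eq_intros assms)
  from DERIV_chain2[OF DERIV_real_sqrt[OF pos] this]
  show ?thesis by (simp add: field_simps)
qed

text \<open>In free flight the momentum has derivative -h'' x, bounded by C at every energy. The
  function sqrt(1 + p^2) replaces |p| because it is differentiable at 0; it differs from |p| by at
  most 1.\<close>

lemma mom_crude:
  assumes mot: "slit_motion h" and bd: "slit_bounds m C h" and bo: "bounce h s e x u"
    and t12: "s \<le> t1" "t1 \<le> t2" "t2 \<le> e"
  shows "\<bar>\<bar>mom h x u t2\<bar> - \<bar>mom h x u t1\<bar>\<bar> \<le> C * (t2 - t1) + 1"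
proof -
  note der = slit_motionD(1,2)[OF mot]
  have C: "0 \<le> C" using bd by (simp add: slit_bounds_def)
  define q where "q r X U = sqrt (1 + (h r * U - deriv h r * X)\<^sup>2)" for r X U
  have "norm (q t2 (x t2) (u t2) - q t1 (x t1) (u t1)) \<le> C * (t2 - t1)"
  proof (rule bounce_bound[where k = q, OF bo C _ _ _ _ t12])
    fix t U
    have "isCont (\<lambda>r. 1 + (h r * U - deriv h r * (x t + (r - t) * U))\<^sup>2) t"
      by (intro continuous_intros slit_motion_continuous(4,5)[OF mot])
    then show "isCont (\<lambda>r. q r (x t + (r - t) * U) U) t"
      unfolding q_def by (rule isCont_o2) (rule isCont_real_sqrt)
  next
    fix t v assume "x t = h t"
    show "q t (h t) (- v + 2 * deriv h t) = q t (h t) v"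
    proof -
      have "h t * (- v + 2 * deriv h t) - deriv h t * h t = - (h t * v - deriv h t * h t)"
        by (simp add: algebra_simps)
      then show ?thesis by (simp only: q_def power2_minus)
    qed
  next
    fix t assume t: "s < t" "t < e" "0 < x t" "x t < h t"
    define P where "P = h t * u t - deriv h t * x t"
    define S where "S = sqrt (1 + P\<^sup>2)"
    have S: "0 < S" unfolding S_def real_sqrt_gt_0_iff by (rule add_pos_nonneg) simp_all
    have PS: "\<bar>P\<bar> \<le> S" unfolding S_def by (rule real_le_rsqrt) simp
    let ?p = "\<lambda>r. h r * u t - deriv h r * (x t + (r - t) * u t)"
    have "(?p has_real_derivative - deriv (deriv h) t * x t) (at t)"
      by (rule derivative_eq_intros der refl | simp)+
    from DERIV_sqrt_one_plus_square[OF this]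
    have "((\<lambda>r. q r (x t + (r - t) * u t) (u t)) has_real_derivative P * (- deriv (deriv h) t * x t) / S) (at t)"
      by (simp add: q_def P_def S_def)
    moreover have "norm (P * (- deriv (deriv h) t * x t) / S) \<le> C"
    proof -
      have "\<bar>deriv (deriv h) t\<bar> \<le> C" "h t \<le> 1"
        using bd slit_motionD(6)[OF mot, of t] by (simp_all add: slit_bounds_def)
      then have "\<bar>P\<bar> * \<bar>deriv (deriv h) t\<bar> * \<bar>x t\<bar> \<le> S * C * 1"
        using S PS C t by (intro mult_mono) auto
      then show ?thesis using S by (simp add: abs_mult divide_le_eq mult_ac)
    qed
    ultimately show "\<exists>D. ((\<lambda>r. q r (x t + (r - t) * u t) (u t)) has_vector_derivative D) (at t) \<and> norm D \<le> C"
      using has_real_derivative_iff_has_vector_derivative by blast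
  qed (use C in \<open>simp_all only: q_def minus_zero mult_zero_right diff_zero mult_minus_right power2_minus\<close>)
  then have d: "\<bar>q t2 (x t2) (u t2) - q t1 (x t1) (u t1)\<bar> \<le> C * (t2 - t1)" by (simp only: real_norm_def)
  have b: "\<bar>mom h x u t\<bar> \<le> q t (x t) (u t) \<and> q t (x t) (u t) \<le> \<bar>mom h x u t\<bar> + 1" for t
  proof
    show "\<bar>mom h x u t\<bar> \<le> q t (x t) (u t)" unfolding q_def mom_def by (rule real_le_rsqrt) simp
    have "1 + (mom h x u t)\<^sup>2 \<le> (\<bar>mom h x u t\<bar> + 1)\<^sup>2" by (simp add: power2_sum)
    then have "sqrt (1 + (mom h x u t)\<^sup>2) \<le> \<bar>mom h x u t\<bar> + 1" by (rule real_le_lsqrt[rotated]) simp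
    then show "q t (x t) (u t) \<le> \<bar>mom h x u t\<bar> + 1" by (simp only: q_def mom_def)
  qed
  show ?thesis using d b[of t1] b[of t2] by linarith
qed

text \<open>The drift -\<sigma> h'' x of the action (\<sigma> the sign of the momentum P) need not
  be small, but a correction h k x^2 / (2|P|) has derivative \<sigma> k x up to terms of order
  1/|P|. With k close to h'' the two cancel, and the correction itself is of order 1/|P|.\<close>

lemma adiabatic_mom:
  assumes mot: "slit_motion h" and bd: "slit_bounds m C h" and eta: "0 < \<eta>"
  obtains J0 where "1 \<le> J0" "\<And>s e x u t. bounce h s e x u \<Longrightarrow> e - s \<le> 2 \<Longrightarrow> J0 \<le> \<bar>mom h x u s\<bar> \<Longrightarrow>
    s \<le> t \<Longrightarrow> t \<le> e \<Longrightarrow> \<bar>\<bar>mom h x u t\<bar> - \<bar>mom h x u s\<bar>\<bar> \<le> \<eta>"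
proof -
  note der = slit_motionD(1,2)[OF mot]
  have C: "0 \<le> C" and h: "\<And>t. 0 < h t" "\<And>t. h t < 1" "\<And>t. \<bar>deriv h t\<bar> \<le> C" "\<And>t. \<bar>deriv (deriv h) t\<bar> \<le> C"
    using bd slit_motionD(5,6)[OF mot] by (auto simp: slit_bounds_def)
  obtain d where d: "0 < d" "d \<le> 1"
    "\<And>t r. \<bar>t - r\<bar> \<le> d \<Longrightarrow> \<bar>deriv (deriv h) t - deriv (deriv h) r\<bar> \<le> \<eta> / 8"
    using periodic2_uniformly_continuous[of "deriv (deriv h)" "\<eta> / 8"] slit_motionD(3)[OF mot]
      slit_motion_periodic_deriv(2)[OF mot] eta by auto
  \<comment> \<open>The acceleration h'' is merely continuous, so it is replaced by a difference
    quotient of h', which is differentiable and, by uniform continuity, within \<eta>/8 of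
    h''.\<close>
  define k where "k t = (deriv h (t + d) - deriv h t) / d" for t
  have k_der: "(k has_real_derivative (deriv (deriv h) (t + d) - deriv (deriv h) t) / d) (at t)" for t
  proof -
    have "((\<lambda>t. deriv h (t + d)) has_real_derivative deriv (deriv h) (t + d)) (at t)"
      using der(2)[of "t + d"] DERIV_shift by blast
    then show ?thesis unfolding k_def using d(1) by (auto intro!: derivative_eq_intros der)
  qed
  have k_near: "\<bar>k t - deriv (deriv h) t\<bar> \<le> \<eta> / 8 \<and> \<bar>k t\<bar> \<le> C" for t
  proof -
    obtain z where z: "t < z" "z < t + d" "deriv h (t + d) - deriv h t = (t + d - t) * deriv (deriv h) z"
      using MVT2[of t "t + d" "deriv h" "deriv (deriv h)"] d(1) der(2) by auto
    then have "k t = deriv (deriv h) z" using d(1) by (simp add: k_def)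
    then show ?thesis using d(3)[of z t] z h(4)[of z] by auto
  qed
  define k' where "k' t = (deriv (deriv h) (t + d) - deriv (deriv h) t) / d" for t
  have k'_bd: "\<bar>k' t\<bar> \<le> 2 * C / d" for t
    using h(4)[of "t + d"] h(4)[of t] d(1) unfolding k'_def by (simp add: divide_right_mono)
  define B0 where "B0 = C\<^sup>2 + 2 * C / d + 2 * C\<^sup>2 + C\<^sup>2"
  have B0: "0 \<le> B0" using C d(1) by (simp add: B0_def)
  have B0e: "0 \<le> 8 * B0 / \<eta>" "0 \<le> 4 * C / \<eta>" using B0 C eta by simp_all
  \<comment> \<open>The first summand keeps the action at least 1 despite a drift of at most 2C + 1,
    and the drift leaves the others intact: 8 \<open>B0\<close> / \<eta> controls the remainder of
    the derivative, 4 C / \<eta> the size of the correction.\<close>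
  define J0 where "J0 = 2 * C + 2 + 8 * B0 / \<eta> + 4 * C / \<eta>"
  have J0: "1 \<le> J0" "2 * C + 2 + 8 * B0 / \<eta> \<le> J0" "2 * C + 2 + 4 * C / \<eta> \<le> J0"
    using B0e C unfolding J0_def by linarith+
  have "\<bar>\<bar>mom h x u t\<bar> - \<bar>mom h x u s\<bar>\<bar> \<le> \<eta>"
    if bo: "bounce h s e x u" and le2: "e - s \<le> 2" and J: "J0 \<le> \<bar>mom h x u s\<bar>" and t: "s \<le> t" "t \<le> e"
    for s e x u t
  proof -
    have Jlow: "1 \<le> \<bar>mom h x u r\<bar>" "8 * B0 / \<eta> \<le> \<bar>mom h x u r\<bar>" "4 * C / \<eta> \<le> \<bar>mom h x u r\<bar>"
      if r: "s \<le> r" "r \<le> e" for r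
    proof -
      have "\<bar>\<bar>mom h x u r\<bar> - \<bar>mom h x u s\<bar>\<bar> \<le> C * (r - s) + 1"
        by (rule mom_crude[OF mot bd bo]) (use r in auto)
      moreover have "C * (r - s) \<le> C * 2" using C r le2 by (intro mult_left_mono) auto
      ultimately show "1 \<le> \<bar>mom h x u r\<bar>" "8 * B0 / \<eta> \<le> \<bar>mom h x u r\<bar>" "4 * C / \<eta> \<le> \<bar>mom h x u r\<bar>"
        using J J0 B0e by linarith+
    qed
    \<comment> \<open>The corrected action.\<close>
    define q where "q r X U = \<bar>h r * U - deriv h r * X\<bar> + h r * k r * X\<^sup>2 / (2 * \<bar>h r * U - deriv h r * X\<bar>)" for r X U
    have "norm (q t (x t) (u t) - q s (x s) (u s)) \<le> \<eta> / 4 * (t - s)"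
    proof (rule bounce_bound[where k = q, OF bo])
      fix t U assume tt: "s \<le> t" "t \<le> e" "\<bar>h t * U - deriv h t * x t\<bar> = \<bar>mom h x u t\<bar>"
      have "h t * U - deriv h t * x t \<noteq> 0" using Jlow(1)[OF tt(1,2)] tt(3) by auto
      then show "isCont (\<lambda>r. q r (x t + (r - t) * U) U) t"
        unfolding q_def
        by (intro continuous_intros slit_motion_continuous(4,5)[OF mot] DERIV_isCont[OF k_der]) auto
    next
      fix t v assume "x t = h t"
      have "\<bar>h t * (- v + 2 * deriv h t) - deriv h t * h t\<bar> = \<bar>h t * v - deriv h t * h t\<bar>"
        by (simp add: algebra_simps)
      then show "q t (h t) (- v + 2 * deriv h t) = q t (h t) v" by (simp only: q_def)
    next
      fix t assume t: "s < t" "t < e" "0 < x t" "x t < h t"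
      define P where "P = h t * u t - deriv h t * x t"
      define \<sigma> where "\<sigma> = sgn P"
      have JP: "\<bar>P\<bar> = \<bar>mom h x u t\<bar>" by (simp add: P_def mom_def)
      have P: "1 \<le> \<bar>P\<bar>" "8 * B0 / \<eta> \<le> \<bar>P\<bar>" using Jlow[of t] t by (simp_all add: JP)
      then have P0: "P \<noteq> 0" by auto
      have s2: "\<sigma> * \<sigma> = 1" "\<bar>\<sigma>\<bar> = 1" "\<bar>P\<bar> = \<sigma> * P" using P0 by (auto simp: \<sigma>_def sgn_if)
      let ?p = "\<lambda>r. h r * u t - deriv h r * (x t + (r - t) * u t)"
      have cp: "isCont ?p t" by (intro continuous_intros slit_motion_continuous(4,5)[OF mot])
      have "isCont (\<lambda>r. \<sigma> * ?p r) t" by (intro continuous_intros cp)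
      moreover have "0 < \<sigma> * ?p t" using s2 P0 P(1) by (simp add: P_def[symmetric])
      ultimately have "\<forall>\<^sub>F r in at t. 0 < \<sigma> * ?p r"
        unfolding isCont_def by (rule order_tendstoD)
      then have "\<forall>\<^sub>F r in nhds t. 0 < \<sigma> * ?p r"
        using \<open>0 < \<sigma> * ?p t\<close> by (auto simp: eventually_nhds_conv_at)
      then have ev: "\<forall>\<^sub>F r in nhds t. q r (x t + (r - t) * u t) (u t) =
          \<sigma> * ?p r + h r * k r * (x t + (r - t) * u t)\<^sup>2 / (2 * (\<sigma> * ?p r))"
      proof eventually_elim
        case (elim r)
        then have "\<bar>?p r\<bar> = \<sigma> * ?p r" using s2(2) by (metis abs_mult abs_of_pos mult_1)
        then show ?case by (simp add: q_def)
      qed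
      define N where "N = (deriv h t * k t + h t * k' t) * (x t)\<^sup>2 + h t * k t * (2 * x t * u t)"
      define A where "A = h t * k t * (x t)\<^sup>2"
      define p' where "p' = - deriv (deriv h) t * x t"
      define D where "D = \<sigma> * p' + (N * (2 * (\<sigma> * P)) - A * (2 * (\<sigma> * p'))) / (2 * (\<sigma> * P) * (2 * (\<sigma> * P)))"
      have pt: "?p t = P" "x t + (t - t) * u t = x t" by (simp_all add: P_def)
      have pder: "(?p has_real_derivative p') (at t)" unfolding p'_def
        by (rule derivative_eq_intros der refl | simp)+
      have "((\<lambda>r. h r * k r * (x t + (r - t) * u t)\<^sup>2) has_real_derivative N) (at t)"
        unfolding N_def
        by (rule derivative_eq_intros der k_der[folded k'_def] refl | simp add: algebra_simps)+
      moreover have "((\<lambda>r. 2 * (\<sigma> * ?p r)) has_real_derivative 2 * (\<sigma> * p')) (at t)"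
        by (intro DERIV_cmult pder)
      moreover have "2 * (\<sigma> * ?p t) \<noteq> 0" using \<open>0 < \<sigma> * ?p t\<close> by linarith
      ultimately have "((\<lambda>r. h r * k r * (x t + (r - t) * u t)\<^sup>2 / (2 * (\<sigma> * ?p r))) has_real_derivative
        (N * (2 * (\<sigma> * ?p t)) - h t * k t * (x t + (t - t) * u t)\<^sup>2 * (2 * (\<sigma> * p'))) / (2 * (\<sigma> * ?p t) * (2 * (\<sigma> * ?p t)))) (at t)"
        by (rule DERIV_divide)
      from DERIV_add[OF DERIV_cmult[OF pder, of \<sigma>] this]
      have "((\<lambda>r. \<sigma> * ?p r + h r * k r * (x t + (r - t) * u t)\<^sup>2 / (2 * (\<sigma> * ?p r))) has_real_derivative D) (at t)"
        unfolding D_def A_def pt(2) P_def .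
      then have dq: "((\<lambda>r. q r (x t + (r - t) * u t) (u t)) has_real_derivative D) (at t)"
        using DERIV_cong_ev[OF refl ev refl] by blast
      \<comment> \<open>Writing h u as momentum plus h' x isolates in the derivative of the
        correction the leading term that cancels the drift.\<close>
      have hu: "h t * u t = P + deriv h t * x t" by (simp add: P_def)
      define J where "J = \<sigma> * P"
      have J: "J \<noteq> 0" "1 \<le> J" "8 * B0 / \<eta> \<le> J" "P = \<sigma> * J" using P P0 s2 by (auto simp: J_def)
      define E where "E = (deriv h t * k t + h t * k' t) * (x t)\<^sup>2 + 2 * k t * deriv h t * (x t)\<^sup>2
          + h t * k t * \<sigma> * deriv (deriv h) t * x t ^ 3 / J"
      have "D = \<sigma> * x t * (k t - deriv (deriv h) t) + E / (2 * J)"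
      proof -
        have D: "D = \<sigma> * p' + N / (2 * J) - A * \<sigma> * p' / (2 * J * J)"
          unfolding D_def J_def[symmetric] using J(1) by (simp add: field_simps)
        have "h t * k t * (2 * x t * u t) = 2 * k t * x t * (h t * u t)" by (simp only: mult_ac)
        then have "N = ((deriv h t * k t + h t * k' t) * (x t)\<^sup>2 + 2 * k t * deriv h t * (x t)\<^sup>2) + 2 * J * (k t * x t * \<sigma>)"
          unfolding N_def hu J(4) by (simp add: algebra_simps power2_eq_square)
        then have N: "N / (2 * J) = ((deriv h t * k t + h t * k' t) * (x t)\<^sup>2 + 2 * k t * deriv h t * (x t)\<^sup>2) / (2 * J) + k t * x t * \<sigma>"
          using J(1) by (simp add: add_divide_distrib)
        have A: "A * \<sigma> * p' / (2 * J * J) = - (h t * k t * \<sigma> * deriv (deriv h) t * x t ^ 3 / J) / (2 * J)"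
        proof -
          have "A * \<sigma> * p' = - (h t * k t * \<sigma> * deriv (deriv h) t * x t ^ 3)"
            by (simp add: A_def p'_def power2_eq_square power3_eq_cube)
          then show ?thesis by (simp add: mult_ac)
        qed
        show ?thesis unfolding D N A E_def by (simp add: p'_def add_divide_distrib algebra_simps)
      qed
      moreover have "\<bar>\<sigma> * x t * (k t - deriv (deriv h) t)\<bar> \<le> 1 * 1 * (\<eta> / 8)"
        unfolding abs_mult using t h(2)[of t] s2 k_near[of t] by (intro mult_mono) auto
      moreover have "\<bar>E\<bar> \<le> B0"
      proof -
        have x1: "0 \<le> x t" "x t \<le> 1" using t h(2)[of t] by simp_all
        have xp: "\<bar>(x t)\<^sup>2\<bar> \<le> 1" "\<bar>x t ^ 3\<bar> \<le> 1"
          using power_le_one[OF x1, of 2] power_le_one[OF x1, of 3] x1 by simp_all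
        have hb: "\<bar>h t\<bar> \<le> 1" using h(1,2)[of t] by auto
        have kb: "\<bar>k t\<bar> \<le> C" using k_near by blast
        have e1: "\<bar>deriv h t * k t * (x t)\<^sup>2\<bar> \<le> C * C * 1"
          unfolding abs_mult using h(3)[of t] kb xp C by (intro mult_mono) auto
        have e2: "\<bar>h t * k' t * (x t)\<^sup>2\<bar> \<le> 1 * (2 * C / d) * 1"
          unfolding abs_mult using hb k'_bd[of t] xp C d(1) by (intro mult_mono) auto
        have e3: "\<bar>k t * deriv h t * (x t)\<^sup>2\<bar> \<le> C * C * 1"
          unfolding abs_mult using h(3)[of t] kb xp C by (intro mult_mono) auto
        have "\<bar>h t * k t * \<sigma> * deriv (deriv h) t * x t ^ 3\<bar> \<le> 1 * C * 1 * C * 1"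
          unfolding abs_mult using h(4)[of t] kb xp(2) C hb s2 by (intro mult_mono) auto
        moreover have "\<bar>h t * k t * \<sigma> * deriv (deriv h) t * x t ^ 3 / J\<bar> \<le>
            \<bar>h t * k t * \<sigma> * deriv (deriv h) t * x t ^ 3\<bar> / 1"
          unfolding abs_divide by (rule divide_left_mono) (use J(2) in auto)
        ultimately have e4: "\<bar>h t * k t * \<sigma> * deriv (deriv h) t * x t ^ 3 / J\<bar> \<le> C\<^sup>2"
          unfolding power2_eq_square by linarith
        define E1 E2 E3 E4 where E: "E1 = deriv h t * k t * (x t)\<^sup>2" "E2 = h t * k' t * (x t)\<^sup>2"
          "E3 = k t * deriv h t * (x t)\<^sup>2" "E4 = h t * k t * \<sigma> * deriv (deriv h) t * x t ^ 3 / J"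
        have "E = E1 + E2 + 2 * E3 + E4" by (simp add: E_def E algebra_simps)
        moreover have "\<bar>E1\<bar> \<le> C\<^sup>2" "\<bar>E2\<bar> \<le> 2 * C / d" "\<bar>E3\<bar> \<le> C\<^sup>2" "\<bar>E4\<bar> \<le> C\<^sup>2"
          using e1 e2 e3 e4 by (simp_all add: E power2_eq_square)
        ultimately show ?thesis unfolding B0_def by linarith
      qed
      then have "\<bar>E / (2 * J)\<bar> \<le> \<eta> / 16"
      proof -
        have "B0 \<le> \<eta> / 8 * J" using J(3) eta by (simp add: field_simps)
        then have "\<bar>E\<bar> \<le> \<eta> / 16 * (2 * J)" using \<open>\<bar>E\<bar> \<le> B0\<close> by linarith
        then show ?thesis using J(2) by (simp add: abs_divide divide_le_eq mult_ac)
      qed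
      ultimately have "norm D \<le> \<eta> / 4" using eta unfolding real_norm_def by linarith
      then show "\<exists>D. ((\<lambda>r. q r (x t + (r - t) * u t) (u t)) has_vector_derivative D) (at t) \<and> norm D \<le> \<eta> / 4"
        using dq has_real_derivative_iff_has_vector_derivative by blast
    qed (use eta t in \<open>auto simp: q_def\<close>)
    moreover have "\<eta> / 4 * (t - s) \<le> \<eta> / 4 * 2" using eta t le2 by (intro mult_left_mono) auto
    moreover have "\<bar>q r (x r) (u r) - \<bar>mom h x u r\<bar>\<bar> \<le> \<eta> / 8" if r: "s \<le> r" "r \<le> e" for r
    proof -
      have "\<bar>h r * k r * (x r)\<^sup>2\<bar> \<le> 1 * C * 1"
      proof -
        have "\<bar>x r\<bar> \<le> 1" using bounceD(3)[OF bo r] h(2)[of r] by linarith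
        then have "\<bar>(x r)\<^sup>2\<bar> \<le> 1" by (simp add: abs_square_le_1)
        moreover have "\<bar>h r\<bar> \<le> 1" using h(1,2)[of r] by linarith
        moreover have "\<bar>k r\<bar> \<le> C" using k_near by blast
        ultimately show ?thesis unfolding abs_mult using C by (intro mult_mono) simp_all
      qed
      moreover have "C \<le> \<eta> / 4 * \<bar>mom h x u r\<bar>" using Jlow(3)[OF r] eta by (simp add: field_simps)
      ultimately have "\<bar>h r * k r * (x r)\<^sup>2\<bar> \<le> \<eta> / 8 * (2 * \<bar>mom h x u r\<bar>)" by linarith
      then have "\<bar>h r * k r * (x r)\<^sup>2 / (2 * \<bar>mom h x u r\<bar>)\<bar> \<le> \<eta> / 8"
        using Jlow(1)[OF r] by (simp add: abs_divide divide_le_eq)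
      then show ?thesis by (simp add: q_def mom_def)
    qed
    from this[of t] this[of s] have "\<bar>q t (x t) (u t) - \<bar>mom h x u t\<bar>\<bar> \<le> \<eta> / 8"
      "\<bar>q s (x s) (u s) - \<bar>mom h x u s\<bar>\<bar> \<le> \<eta> / 8" using t bounceD(1)[OF bo] by auto
    ultimately show ?thesis unfolding real_norm_def by linarith
  qed
  then show thesis using that[of J0] J0(1) by blast
qed

lemma isCont_cis: "isCont cis t"
proof -
  have "continuous_on UNIV (\<lambda>x. cis x)" by (rule continuous_on_cis[OF continuous_on_id])
  then show ?thesis using continuous_on_eq_continuous_at[OF open_UNIV, of cis] by blast
qed

lemma norm_cis_diff: "norm (cis a - cis b) = norm (cis (a - b) - 1)"
proof -
  have "cis b * cis (a - b) = cis a" by (simp add: cis_mult)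
  then have "cis a - cis b = cis b * (cis (a - b) - 1)" unfolding right_diff_distrib by simp
  then have "norm (cis a - cis b) = norm (cis b) * norm (cis (a - b) - 1)" by (simp only: norm_mult)
  then show ?thesis by (simp only: norm_cis mult_1)
qed

text \<open>The phase moves with speed |mom| / h^2 and the action is nearly constant, so the phase
  advances by the initial action times the integral of h^(-2), up to a small error and up to
  winding.\<close>

lemma adiabatic:
  assumes mot: "slit_motion h" and bd: "slit_bounds m C h" and eta: "0 < \<eta>"
  obtains J0 where "1 \<le> J0" "\<And>s e x u. bounce h s e x u \<Longrightarrow> e - s \<le> 2 \<Longrightarrow> J0 \<le> \<bar>mom h x u s\<bar> \<Longrightarrow>
    \<bar>\<bar>mom h x u e\<bar> - \<bar>mom h x u s\<bar>\<bar> \<le> \<eta> \<and>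
    (\<exists>k::int. \<bar>ang h x u e - ang h x u s - \<bar>mom h x u s\<bar> * integral {s..e} (\<lambda>r. 1 / (h r)\<^sup>2) - 2 * of_int k\<bar> \<le> \<eta>)"
proof -
  note der = slit_motionD(1,2)[OF mot]
  have m: "0 < m" "m < 1" "\<And>t. m \<le> h t" and C: "0 \<le> C" using bd by (auto simp: slit_bounds_def)
  have h: "0 < h t" for t using m(1) m(3)[of t] by linarith
  have h0: "h t \<noteq> 0" for t using h[of t] by simp
  \<comment> \<open>Chosen so that a speed error of \<pi> \<eta>1 / m^2 over a time of at most 2
    stays below \<eta>, using \<pi> < 4.\<close>
  define \<eta>1 where "\<eta>1 = min (1 / 2) (\<eta> * m\<^sup>2 / 8)"
  have eta1: "0 < \<eta>1" "\<eta>1 \<le> \<eta> * m\<^sup>2 / 8" "\<eta>1 < 1" using eta m by (auto simp: \<eta>1_def min_less_iff_disj)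
  obtain J0 where J0: "1 \<le> J0" and
    ad: "\<And>s e x u t. bounce h s e x u \<Longrightarrow> e - s \<le> 2 \<Longrightarrow> J0 \<le> \<bar>mom h x u s\<bar> \<Longrightarrow>
    s \<le> t \<Longrightarrow> t \<le> e \<Longrightarrow> \<bar>\<bar>mom h x u t\<bar> - \<bar>mom h x u s\<bar>\<bar> \<le> \<eta>1"
    using adiabatic_mom[OF mot bd eta1(1)] by blast
  have "\<bar>\<bar>mom h x u e\<bar> - \<bar>mom h x u s\<bar>\<bar> \<le> \<eta> \<and>
    (\<exists>k::int. \<bar>ang h x u e - ang h x u s - \<bar>mom h x u s\<bar> * integral {s..e} (\<lambda>r. 1 / (h r)\<^sup>2) - 2 * of_int k\<bar> \<le> \<eta>)"
    if bo: "bounce h s e x u" and le2: "e - s \<le> 2" and J: "J0 \<le> \<bar>mom h x u s\<bar>" for s e x u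
  proof
    note se = bounceD(1)[OF bo]
    define j where "j = \<bar>mom h x u s\<bar>"
    have near: "\<bar>\<bar>mom h x u t\<bar> - j\<bar> \<le> \<eta>1" if "s \<le> t" "t \<le> e" for t
      using ad[OF bo le2 J that] by (simp add: j_def)
    have "\<eta> * m\<^sup>2 / 8 \<le> \<eta> * 1 / 8" using eta m by (intro divide_right_mono mult_left_mono) (auto simp: power_le_one)
    then show "\<bar>\<bar>mom h x u e\<bar> - \<bar>mom h x u s\<bar>\<bar> \<le> \<eta>" using near[of e] se eta1(2) eta unfolding j_def by linarith
    have nz: "mom h x u t \<noteq> 0" if "s \<le> t" "t \<le> e" for t
      using near[OF that] J J0 eta1(3) by (auto simp: j_def)
    \<comment> \<open>The integral starts before s so that its derivative at s is two-sided.\<close>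
    define \<Theta> where "\<Theta> r = integral {s - 1..r} (\<lambda>r. 1 / (h r)\<^sup>2)" for r
    have ch: "continuous_on S (\<lambda>r. 1 / (h r)\<^sup>2)" for S
      by (intro continuous_intros slit_motion_continuous(1)[OF mot]) (simp add: h0)
    have \<Theta>_der: "(\<Theta> has_real_derivative 1 / (h t)\<^sup>2) (at t)" if "s \<le> t" "t \<le> e" for t
    proof -
      have "(\<Theta> has_real_derivative 1 / (h t)\<^sup>2) (at t within {s - 1..e + 1})"
        unfolding \<Theta>_def by (rule integral_has_real_derivative[OF ch]) (use that in auto)
      then show ?thesis using that by (simp add: at_within_Icc_at)
    qed
    \<comment> \<open>Through \<open>cis\<close> the phase, reduced by its predicted value, is
      continuous across the moving wall, where the signed position jumps between 1 and -1.\<close>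
    define q where "q r X U = cis (pi * (sgn (h r * U - deriv h r * X) * X / h r - j * \<Theta> r))" for r X U
    define B where "B = pi * \<eta>1 / m\<^sup>2"
    have "norm (q e (x e) (u e) - q s (x s) (u s)) \<le> B * (e - s)"
    proof (rule bounce_bound[where k = q, OF bo])
      show "0 \<le> B" using eta1 m by (simp add: B_def)
    next
      fix t U assume t: "s \<le> t" "t \<le> e" "\<bar>h t * U - deriv h t * x t\<bar> = \<bar>mom h x u t\<bar>"
      have "h t * U - deriv h t * x t \<noteq> 0" using nz[OF t(1,2)] t(3) by auto
      then have "isCont (\<lambda>r. pi * (sgn (h r * U - deriv h r * (x t + (r - t) * U)) * (x t + (r - t) * U) / h r - j * \<Theta> r)) t"
        using h[of t] by (intro continuous_intros slit_motion_continuous(4,5)[OF mot] DERIV_isCont[OF \<Theta>_der] t) auto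
      then show "isCont (\<lambda>r. q r (x t + (r - t) * U) U) t"
        unfolding q_def by (rule isCont_o2) (rule isCont_cis)
    next
      fix t v assume "x t = h t"
      define p where "p = h t * v - deriv h t * h t"
      have "h t * (- v + 2 * deriv h t) - deriv h t * h t = - p" by (simp add: p_def algebra_simps)
      moreover have "cis (pi * (1 - a)) = cis (pi * (- 1 - a))" for a
      proof -
        have "cis (pi * (1 - a)) = cis (pi * (- 1 - a)) * cis (2 * pi)"
          by (simp only: cis_mult) (simp add: algebra_simps)
        then show ?thesis by simp
      qed
      ultimately show "q t (h t) (- v + 2 * deriv h t) = q t (h t) v"
        using h[of t] by (simp add: q_def p_def[symmetric] sgn_if)
    next
      fix t assume t: "s < t" "t < e" "0 < x t" "x t < h t"
      define P where "P = h t * u t - deriv h t * x t"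
      define \<sigma> where "\<sigma> = sgn P"
      have JP: "\<bar>P\<bar> = \<bar>mom h x u t\<bar>" by (simp add: P_def mom_def)
      have P0: "P \<noteq> 0" using nz[of t] t by (simp add: P_def mom_def)
      let ?p = "\<lambda>r. h r * u t - deriv h r * (x t + (r - t) * u t)"
      have "isCont (\<lambda>r. \<sigma> * ?p r) t" by (intro continuous_intros slit_motion_continuous(4,5)[OF mot])
      moreover have pos: "0 < \<sigma> * ?p t" using P0 by (simp add: P_def[symmetric] \<sigma>_def sgn_if)
      ultimately have "\<forall>\<^sub>F r in at t. 0 < \<sigma> * ?p r"
        unfolding isCont_def by (rule order_tendstoD)
      then have "\<forall>\<^sub>F r in nhds t. 0 < \<sigma> * ?p r"
        using pos by (auto simp: eventually_nhds_conv_at)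
      then have ev: "\<forall>\<^sub>F r in nhds t. r \<in> UNIV \<longrightarrow> cis (pi * (\<sigma> * (x t + (r - t) * u t) / h r - j * \<Theta> r))
          = q r (x t + (r - t) * u t) (u t)"
      proof eventually_elim
        case (elim r)
        then have "sgn (?p r) = \<sigma>"
          using P0 by (cases "?p r > 0"; cases "P > 0") (auto simp: \<sigma>_def sgn_if split: if_splits)
        then show ?case by (simp add: q_def)
      qed
      define D where "D = pi * ((\<bar>P\<bar> - j) / (h t)\<^sup>2)"
      have "((\<lambda>r. \<sigma> * (x t + (r - t) * u t) / h r) has_real_derivative \<sigma> * P / (h t)\<^sup>2) (at t)"
        by (rule derivative_eq_intros der refl | use h[of t] in \<open>simp add: P_def algebra_simps power2_eq_square\<close>)+
      moreover have "((\<lambda>r. j * \<Theta> r) has_real_derivative j * (1 / (h t)\<^sup>2)) (at t)"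
        by (rule DERIV_cmult[OF \<Theta>_der]) (use t in auto)
      ultimately have "((\<lambda>r. pi * (\<sigma> * (x t + (r - t) * u t) / h r - j * \<Theta> r)) has_real_derivative
          pi * (\<sigma> * P / (h t)\<^sup>2 - j * (1 / (h t)\<^sup>2))) (at t)"
        by (rule DERIV_cmult[OF DERIV_diff])
      moreover have "\<sigma> * P = \<bar>P\<bar>" by (simp add: \<sigma>_def sgn_if)
      then have "pi * (\<sigma> * P / (h t)\<^sup>2 - j * (1 / (h t)\<^sup>2)) = D"
        by (simp add: D_def diff_divide_distrib)
      ultimately have "((\<lambda>r. pi * (\<sigma> * (x t + (r - t) * u t) / h r - j * \<Theta> r)) has_real_derivative D) (at t)"
        by simp
      then have "((\<lambda>r. cis (pi * (\<sigma> * (x t + (r - t) * u t) / h r - j * \<Theta> r))) has_vector_derivative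
          D *\<^sub>R (\<i> * cis (pi * (\<sigma> * (x t + (t - t) * u t) / h t - j * \<Theta> t)))) (at t)"
        unfolding has_vector_derivative_def has_field_derivative_def
        by (intro has_derivative_eq_rhs[OF has_derivative_cis]) (auto simp: fun_eq_iff scaleR_conv_of_real)
      then have "((\<lambda>r. q r (x t + (r - t) * u t) (u t)) has_vector_derivative
          D *\<^sub>R (\<i> * cis (pi * (\<sigma> * (x t + (t - t) * u t) / h t - j * \<Theta> t)))) (at t)"
        using has_vector_derivative_cong_ev[OF ev] eventually_nhds_x_imp_x[OF ev] by simp
      moreover have "norm (D *\<^sub>R (\<i> * cis (pi * (\<sigma> * (x t + (t - t) * u t) / h t - j * \<Theta> t)))) \<le> B"
      proof -
        have "\<bar>\<bar>P\<bar> - j\<bar> \<le> \<eta>1" using near[of t] t by (simp add: JP)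
        moreover have "m\<^sup>2 \<le> (h t)\<^sup>2" using m by (intro power_mono) auto
        ultimately have "\<bar>\<bar>P\<bar> - j\<bar> / (h t)\<^sup>2 \<le> \<eta>1 / m\<^sup>2"
          using m by (intro frac_le) auto
        then have "pi * (\<bar>\<bar>P\<bar> - j\<bar> / (h t)\<^sup>2) \<le> pi * (\<eta>1 / m\<^sup>2)" by (intro mult_left_mono) auto
        then show ?thesis by (simp add: D_def B_def norm_mult abs_mult)
      qed
      ultimately show "\<exists>D. ((\<lambda>r. q r (x t + (r - t) * u t) (u t)) has_vector_derivative D) (at t) \<and> norm D \<le> B"
        by blast
    qed (use se in \<open>auto simp: q_def\<close>)
    moreover have "B * (e - s) \<le> \<eta>"
    proof -
      have B: "B \<le> 4 * (\<eta> / 8)"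
      proof -
        have "\<eta>1 / m\<^sup>2 \<le> \<eta> / 8" using eta1(2) m by (simp add: divide_le_eq)
        then have "pi * (\<eta>1 / m\<^sup>2) \<le> 4 * (\<eta> / 8)"
          using pi_less_4 eta1(1) by (intro mult_mono) auto
        then show ?thesis by (simp add: B_def)
      qed
      have "B * (e - s) \<le> 4 * (\<eta> / 8) * 2" using B le2 se eta by (intro mult_mono) auto
      then show ?thesis by simp
    qed
    ultimately have "norm (q e (x e) (u e) - q s (x s) (u s)) \<le> \<eta>" by linarith
    then have n: "norm (cis (pi * (ang h x u e - j * \<Theta> e) - pi * (ang h x u s - j * \<Theta> s)) - 1) \<le> \<eta>"
      unfolding q_def ang_def mom_def norm_cis_diff .
    have \<Theta>: "\<Theta> e = \<Theta> s + integral {s..e} (\<lambda>r. 1 / (h r)\<^sup>2)"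
      using Henstock_Kurzweil_Integration.integral_combine[of "s - 1" s e "\<lambda>r. 1 / (h r)\<^sup>2"] se
        integrable_continuous_real[OF ch] by (simp add: \<Theta>_def)
    have eq: "pi * (ang h x u e - j * \<Theta> e) - pi * (ang h x u s - j * \<Theta> s)
      = pi * (ang h x u e - ang h x u s - j * integral {s..e} (\<lambda>r. 1 / (h r)\<^sup>2))"
      unfolding \<Theta> by (simp add: algebra_simps)
    have "norm (cis (pi * (ang h x u e - ang h x u s - j * integral {s..e} (\<lambda>r. 1 / (h r)\<^sup>2))) - 1) \<le> \<eta>"
      using n unfolding eq .
    from cis_near_one[OF this]
    show "\<exists>k::int. \<bar>ang h x u e - ang h x u s - \<bar>mom h x u s\<bar> * integral {s..e} (\<lambda>r. 1 / (h r)\<^sup>2) - 2 * of_int k\<bar> \<le> \<eta>"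
      unfolding j_def .
  qed
  then show thesis by (rule that[OF J0])
qed

section \<open>Reflection of a chamber, and crude energy bounds\<close>

lemma bounceI:
  assumes "s \<le> e" "finite {t \<in> {s..e}. \<not> (0 < x t \<and> x t < h t)}"
    "\<And>t. s \<le> t \<Longrightarrow> t \<le> e \<Longrightarrow> 0 \<le> x t" "\<And>t. s \<le> t \<Longrightarrow> t \<le> e \<Longrightarrow> x t \<le> h t"
    "\<And>t. s \<le> t \<Longrightarrow> t < e \<Longrightarrow> \<exists>b>t. \<forall>r. t < r \<and> r < b \<longrightarrow> x r = x t + (r - t) * u t \<and> u r = u t"
    "\<And>t. s < t \<Longrightarrow> t \<le> e \<Longrightarrow> \<exists>a<t. \<exists>v. (\<forall>r. a < r \<and> r < t \<longrightarrow> x r = x t + (r - t) * v \<and> u r = v) \<and>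
        (u t = v \<and> 0 < x t \<and> x t < h t \<or> x t = 0 \<and> u t = - v \<or> x t = h t \<and> u t = - v + 2 * deriv h t)"
  shows "bounce h s e x u"
  unfolding bounce_def using assms by blast

lemma flip_deriv:
  assumes "slit_motion h"
  shows "deriv (\<lambda>t. 1 - h t) = (\<lambda>t. - deriv h t)"
proof
  fix t
  have "((\<lambda>t. 1 - h t) has_real_derivative 0 - deriv h t) (at t)"
    by (intro DERIV_diff DERIV_const slit_motionD(1)[OF assms])
  then show "deriv (\<lambda>t. 1 - h t) t = - deriv h t" by (simp add: DERIV_imp_deriv)
qed

lemma flip_deriv2:
  assumes "slit_motion h"
  shows "deriv (deriv (\<lambda>t. 1 - h t)) = (\<lambda>t. - deriv (deriv h) t)"
proof
  fix t
  have "((\<lambda>t. - deriv h t) has_real_derivative - deriv (deriv h) t) (at t)"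
    by (intro DERIV_minus slit_motionD(2)[OF assms])
  then show "deriv (deriv (\<lambda>t. 1 - h t)) t = - deriv (deriv h) t"
    by (simp add: flip_deriv[OF assms] DERIV_imp_deriv)
qed

lemma flip_slit_motion:
  assumes "slit_motion h"
  shows "slit_motion (\<lambda>t. 1 - h t)"
proof -
  have "(\<lambda>t. 1 - h t) differentiable (at t)" for t
    using slit_motionD(1)[OF assms, of t]
    by (intro derivative_intros) (auto simp: real_differentiable_def)
  moreover have "(\<lambda>t. - deriv h t) differentiable (at t)" for t
    using slit_motionD(2)[OF assms, of t]
    by (intro derivative_intros) (auto simp: real_differentiable_def)
  moreover have "continuous_on UNIV (\<lambda>t. - deriv (deriv h) t)"
    using slit_motionD(3)[OF assms] by (rule continuous_on_minus)
  ultimately show ?thesis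
    using slit_motionD(4-6)[OF assms] flip_deriv[OF assms] flip_deriv2[OF assms]
    by (simp add: slit_motion_def C2_def)
qed

lemma flip_slit_bounds:
  assumes "slit_motion h" "slit_bounds m C h"
  shows "slit_bounds m C (\<lambda>t. 1 - h t)"
proof -
  have b: "0 < m" "m < 1" "0 \<le> C" "m \<le> h t" "h t \<le> 1 - m" "\<bar>deriv h t\<bar> \<le> C" "\<bar>deriv (deriv h) t\<bar> \<le> C" for t
    using assms(2) unfolding slit_bounds_def by blast+
  have "m \<le> 1 - h t" "1 - h t \<le> 1 - m" for t using b(4,5)[of t] by linarith+
  moreover have "\<bar>deriv (\<lambda>t. 1 - h t) t\<bar> \<le> C" for t
    unfolding flip_deriv[OF assms(1)] using b(6) by simp
  moreover have "\<bar>deriv (deriv (\<lambda>t. 1 - h t)) t\<bar> \<le> C" for t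
    unfolding flip_deriv2[OF assms(1)] using b(7) by simp
  ultimately show ?thesis unfolding slit_bounds_def using b(1-3) by blast
qed

lemma mom_bounds:
  assumes "slit_bounds m C h" "0 \<le> x t" "x t \<le> 1"
  shows "m * \<bar>u t\<bar> - C \<le> \<bar>mom h x u t\<bar>" "\<bar>mom h x u t\<bar> \<le> \<bar>u t\<bar> + C"
proof -
  have b: "m \<le> h t" "h t \<le> 1" "0 < m" "\<bar>deriv h t\<bar> \<le> C" "0 \<le> C"
    using assms(1) by (auto simp: slit_bounds_def intro: order_trans[of "h t" "1 - m" 1])
  have "\<bar>deriv h t\<bar> * \<bar>x t\<bar> \<le> C * 1" using b assms by (intro mult_mono) auto
  moreover have "m * \<bar>u t\<bar> \<le> h t * \<bar>u t\<bar>"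
    by (rule mult_right_mono) (use b in auto)
  moreover have "h t * \<bar>u t\<bar> \<le> \<bar>u t\<bar>"
    by (rule mult_left_le_one_le) (use b in auto)
  moreover have "\<bar>h t * u t\<bar> = h t * \<bar>u t\<bar>" using b by (simp add: abs_mult)
  moreover have "\<bar>deriv h t * x t\<bar> = \<bar>deriv h t\<bar> * \<bar>x t\<bar>" by (simp add: abs_mult)
  ultimately show "m * \<bar>u t\<bar> - C \<le> \<bar>mom h x u t\<bar>" "\<bar>mom h x u t\<bar> \<le> \<bar>u t\<bar> + C"
    unfolding mom_def by linarith+
qed

text \<open>Speed and action determine each other up to a factor m and an additive C. The constant
  4C + 1 is the drift 2C + 1 of the action over time 2 plus C for each of the two
  conversions.\<close>

lemma bounce_energy:
  assumes mot: "slit_motion h" and bd: "slit_bounds m C h" and bo: "bounce h s e x u"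
    and le2: "e - s \<le> 2" and t: "s \<le> t" "t \<le> e"
  shows "m * \<bar>u s\<bar> - (4 * C + 1) \<le> \<bar>u t\<bar>" "\<bar>u t\<bar> \<le> (\<bar>u s\<bar> + (4 * C + 1)) / m"
proof -
  have C: "0 \<le> C" "0 < m" using bd by (auto simp: slit_bounds_def)
  have x: "0 \<le> x r \<and> x r \<le> 1" if "s \<le> r" "r \<le> e" for r
    using bounceD(3)[OF bo that] slit_motionD(6)[OF mot, of r] by auto
  have "\<bar>\<bar>mom h x u t\<bar> - \<bar>mom h x u s\<bar>\<bar> \<le> C * (t - s) + 1"
    by (rule mom_crude[OF mot bd bo]) (use t in auto)
  moreover have "C * (t - s) \<le> C * 2" using C t le2 by (intro mult_left_mono) auto
  moreover have "m * \<bar>u s\<bar> - C \<le> \<bar>mom h x u s\<bar>" "\<bar>mom h x u s\<bar> \<le> \<bar>u s\<bar> + C"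
    using mom_bounds[OF bd, of x s u] x[of s] t by auto
  moreover have "m * \<bar>u t\<bar> - C \<le> \<bar>mom h x u t\<bar>" "\<bar>mom h x u t\<bar> \<le> \<bar>u t\<bar> + C"
    using mom_bounds[OF bd, of x t u] x[of t] t by auto
  ultimately have "m * \<bar>u s\<bar> - (4 * C + 1) \<le> \<bar>u t\<bar>" "m * \<bar>u t\<bar> \<le> \<bar>u s\<bar> + (4 * C + 1)"
    by linarith+
  then show "m * \<bar>u s\<bar> - (4 * C + 1) \<le> \<bar>u t\<bar>" "\<bar>u t\<bar> \<le> (\<bar>u s\<bar> + (4 * C + 1)) / m"
    using C by (auto simp: field_simps)
qed

section \<open>Orbits between consecutive critical times\<close>

context slits begin

lemma germ_right:
  assumes "flight t0 b y w" "t0 \<le> t" "t < b"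
  shows "\<exists>e>t. \<forall>r. t < r \<and> r < e \<longrightarrow> \<not> collides f y r \<and> y r = y t + (r - t) * w t \<and> w r = w t"
proof (rule flight_germ_right[OF assms])
  fix e
  assume "t < e" and r: "\<And>r. t < r \<Longrightarrow> r < e \<Longrightarrow> \<not> collides f y r"
    "\<And>r. t < r \<Longrightarrow> r < e \<Longrightarrow> y r = y t + (r - t) * w t" "\<And>r. t < r \<Longrightarrow> r < e \<Longrightarrow> w r = w t"
  then show ?thesis by blast
qed

lemma germ_left:
  assumes "flight t0 b y w" "t0 < t" "t \<le> b"
  shows "\<exists>a u. t0 \<le> a \<and> a < t \<and> w t = reflect f t (y t) u \<and> w a = u \<and>
    (\<forall>r. a < r \<and> r < t \<longrightarrow> \<not> collides f y r \<and> y r = y t + (r - t) * u \<and> w r = u)"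
proof (rule flight_germ_left[OF assms])
  fix s u
  assume a: "t0 \<le> s" "s < t" "w t = reflect f t (y t) u" "w s = u"
    and r: "\<And>r. s < r \<Longrightarrow> r < t \<Longrightarrow> \<not> collides f y r"
    "\<And>r. s < r \<Longrightarrow> r < t \<Longrightarrow> y r = y t - (t - r) * u" "\<And>r. s < r \<Longrightarrow> r < t \<Longrightarrow> w r = u"
  have "\<forall>r. s < r \<and> r < t \<longrightarrow> \<not> collides f y r \<and> y r = y t + (r - t) * u \<and> w r = u"
    using r by (simp add: algebra_simps)
  then show ?thesis using a by blast
qed

end

context slits_bd begin

lemma orb_side:
  assumes o: "orb t0 v0 b y w" and t0: "0 \<le> t0" "t0 \<le> s" "e \<le> b" and n: "c n \<le> s" "e \<le> c (Suc n)"
    and rt: "s < r" "r < e" "s < t" "t < e"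
  shows "0 \<le> (y r - g n r) * (y t - g n t)"
proof -
  have *: "0 \<le> (y r - g n r) * (y t - g n t)" if "s < r" "r \<le> t" "t < e" for r t
  proof -
    have "0 \<le> (y r - f r) * (y t - f t)"
      by (rule orbD(7)[OF o]) (use that t0 n between_c(1)[of n] in auto)
    then show ?thesis using between_c(2)[of n r] between_c(2)[of n t] that n by auto
  qed
  show ?thesis
  proof (cases "r \<le> t")
    case True
    then show ?thesis using *[of r t] rt by blast
  next
    case False
    then have "0 \<le> (y t - g n t) * (y r - g n r)" using *[of t r] rt by simp
    then show ?thesis by (simp only: mult.commute)
  qed
qed

lemma orb_continuous: "orb t0 v0 b y w \<Longrightarrow> t0 \<le> s \<Longrightarrow> e \<le> b \<Longrightarrow> continuous_on {s..e} y"
  using flight_continuous[OF orbD(4)] by (rule continuous_on_subset) auto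

lemma continuous_gap:
  fixes F :: "real \<Rightarrow> real"
  assumes "continuous_on {s..e} F" "s < e" "t \<in> {s..e}" "F t < 0"
  obtains r where "s < r" "r < e" "F r < 0"
proof -
  have "\<not> (\<forall>q. q \<in> \<rat> \<longrightarrow> s < q \<longrightarrow> q < e \<longrightarrow> 0 \<le> F q)"
    using nonneg_from_rationals[OF assms(1) _ assms(2,3)] assms(4) by auto
  then show thesis using that by force
qed

text \<open>One point strictly below the slit decides the chamber for the whole interval: by
  continuity there is such a point in the interior, and the sign clause of \<open>orb\<close>
  spreads its side.\<close>

lemma orb_low:
  assumes o: "orb t0 v0 b y w" and t0: "0 \<le> t0" "t0 \<le> s" "e \<le> b" and n: "c n \<le> s" "e \<le> c (Suc n)"
    and se: "s < e" and lt: "t \<in> {s..e}" "y t < g n t" and r: "s < r" "r < e"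
  shows "y r \<le> g n r"
proof -
  have "continuous_on {s..e} (\<lambda>t. y t - g n t)"
    by (intro continuous_intros orb_continuous[OF o] t0 continuous_g)
  then obtain q where q: "s < q" "q < e" "y q - g n q < 0"
    using continuous_gap[of s e "\<lambda>t. y t - g n t" t] se lt by auto
  from orb_side[OF o t0 n q(1,2) r] q(3) show ?thesis by (auto simp: zero_le_mult_iff)
qed

lemma orb_up:
  assumes o: "orb t0 v0 b y w" and t0: "0 \<le> t0" "t0 \<le> s" "e \<le> b" and n: "c n \<le> s" "e \<le> c (Suc n)"
    and se: "s < e" and lt: "t \<in> {s..e}" "g n t < y t" and r: "s < r" "r < e"
  shows "g n r \<le> y r"
proof -
  have "continuous_on {s..e} (\<lambda>t. g n t - y t)"
    by (intro continuous_intros orb_continuous[OF o] t0 continuous_g)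
  then obtain q where q: "s < q" "q < e" "g n q - y q < 0"
    using continuous_gap[of s e "\<lambda>t. g n t - y t" t] se lt by auto
  from orb_side[OF o t0 n q(1,2) r] q(3) show ?thesis by (auto simp: zero_le_mult_iff)
qed

lemma limit_le_endpoints:
  fixes F :: "real \<Rightarrow> real"
  assumes "continuous_on {s..e} F" "\<And>r. s < r \<Longrightarrow> r < e \<Longrightarrow> 0 \<le> F r" "s < e" "t \<in> {s..e}"
  shows "0 \<le> F t"
  using nonneg_from_rationals[OF assms(1) _ assms(3,4)] assms(2) by auto

text \<open>Between critical times an orbit piece on one side of the slit is a bouncing ball in the
  sense of \<open>bounce\<close>; in the upper chamber the distance is measured from the
  ceiling.\<close>

lemma orb_bounce:
  assumes o: "orb t0 v0 b y w" and t0: "0 \<le> t0" "t0 \<le> s" "e \<le> b" and n: "c n \<le> s" "e \<le> c (Suc n)"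
    and se: "s < e"
  shows "(\<And>r. s < r \<Longrightarrow> r < e \<Longrightarrow> y r \<le> g n r) \<Longrightarrow> bounce (g n) s e y w"
    and "(\<And>r. s < r \<Longrightarrow> r < e \<Longrightarrow> g n r \<le> y r) \<Longrightarrow>
      bounce (\<lambda>t. 1 - g n t) s e (\<lambda>t. 1 - y t) (\<lambda>t. - w t)"
proof -
  note fli = orbD(4)[OF o]
  have cy: "continuous_on {s..e} y" by (rule orb_continuous[OF o t0(2,3)])
  have y01: "0 \<le> y t" "y t \<le> 1" if "s \<le> t" "t \<le> e" for t using orbD(5)[OF o, of t] that t0 by auto
  have g01: "0 < g n t" "g n t < 1" for t using slit_motionD(5,6)[OF mot_g] by auto
  have col: "collides f y t \<longleftrightarrow> y t = 0 \<or> y t = 1 \<or> y t = g n t" if "s < t" "t < e" for t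
    using between_c(2)[of n t] that n by (auto simp: collides_def)
  have fin: "finite {t \<in> {s..e}. y t = 0 \<or> y t = 1 \<or> y t = g n t}"
  proof (rule finite_subset)
    show "{t \<in> {s..e}. y t = 0 \<or> y t = 1 \<or> y t = g n t} \<subseteq> {s, e} \<union> {t \<in> {t0..b}. collides f y t}"
      using col t0 by (auto simp: less_le)
    show "finite ({s, e} \<union> {t \<in> {t0..b}. collides f y t})" using fli by (simp add: flight_def)
  qed
  have R: "\<exists>b>t. \<forall>r. t < r \<and> r < b \<longrightarrow> y r = y t + (r - t) * w t \<and> w r = w t" if "s \<le> t" "t < e" for t
    using germ_right[OF fli, of t] that t0 by auto
  have L: "\<exists>a<t. \<exists>v. (\<forall>r. a < r \<and> r < t \<longrightarrow> y r = y t + (r - t) * v \<and> w r = v) \<and>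
     ((y t = 0 \<or> y t = 1) \<and> w t = - v \<or> y t = g n t \<and> w t = - v + 2 * deriv (g n) t \<or>
      y t \<noteq> 0 \<and> y t \<noteq> 1 \<and> y t \<noteq> g n t \<and> w t = v)" if t: "s < t" "t \<le> e" for t
  proof -
    have tt: "t0 < t" "t \<le> b" using t t0 by simp_all
    obtain a v where a: "a < t" "w t = reflect f t (y t) v"
      "\<forall>r. a < r \<and> r < t \<longrightarrow> y r = y t + (r - t) * v \<and> w r = v"
      using germ_left[OF fli tt] by blast
    note a(3)
    moreover have "(y t = 0 \<or> y t = 1) \<and> w t = - v \<or> y t = g n t \<and> w t = - v + 2 * deriv (g n) t \<or>
      y t \<noteq> 0 \<and> y t \<noteq> 1 \<and> y t \<noteq> g n t \<and> w t = v"
    proof (cases "t < c (Suc n)")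
      case True
      then have "f t = g n t" "deriv f t = deriv (g n) t"
        using between_c(2)[of n t] deriv_f_between_c[of n t] t n by simp_all
      then show ?thesis using a(2) by (simp add: reflect_def)
    next
      case False
      \<comment> \<open>At the critical end point \<open>f\<close> need not agree with
        \<open>g n\<close> any longer, but the ball touches neither slit there, so only reflections
        at floor and ceiling are possible.\<close>
      then have "t = c (Suc n)" using t n by linarith
      then have "crit t" using crit_c[of "Suc n"] by simp
      then have "y t \<noteq> fL t" "y t \<noteq> fR t" using orbD(6)[OF o, of t] t t0 by auto
      then have "y t \<noteq> f t" "y t \<noteq> g n t" using f_cases[of t] g_cases[of n] by auto
      then show ?thesis using a(2) by (simp add: reflect_def)
    qed
    ultimately show ?thesis using a(1) by blast
  qed
  show "bounce (g n) s e y w" if low: "\<And>r. s < r \<Longrightarrow> r < e \<Longrightarrow> y r \<le> g n r"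
  proof -
    have le: "y t \<le> g n t" if "s \<le> t" "t \<le> e" for t
      using limit_le_endpoints[of s e "\<lambda>t. g n t - y t" t] low se that cy
      by (auto intro!: continuous_intros continuous_g)
    have "{t \<in> {s..e}. \<not> (0 < y t \<and> y t < g n t)} \<subseteq> {t \<in> {s..e}. y t = 0 \<or> y t = 1 \<or> y t = g n t}"
      using le y01 by (auto simp: less_le)
    then have finl: "finite {t \<in> {s..e}. \<not> (0 < y t \<and> y t < g n t)}" using fin by (rule finite_subset)
    have Ll: "\<exists>a<t. \<exists>v. (\<forall>r. a < r \<and> r < t \<longrightarrow> y r = y t + (r - t) * v \<and> w r = v) \<and>
        (w t = v \<and> 0 < y t \<and> y t < g n t \<or> y t = 0 \<and> w t = - v \<or> y t = g n t \<and> w t = - v + 2 * deriv (g n) t)"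
      if t: "s < t" "t \<le> e" for t
    proof -
      have "y t \<noteq> 1" "y t \<le> g n t" "0 \<le> y t" using le[of t] y01[of t] g01[of t] t by auto
      then have "0 < y t \<and> y t < g n t" if "y t \<noteq> 0" "y t \<noteq> g n t" using that by linarith
      then show ?thesis using L[OF t] \<open>y t \<noteq> 1\<close> by blast
    qed
    show ?thesis by (rule bounceI[OF less_imp_le[OF se] finl y01(1) le R Ll])
  qed
  show "bounce (\<lambda>t. 1 - g n t) s e (\<lambda>t. 1 - y t) (\<lambda>t. - w t)" if up: "\<And>r. s < r \<Longrightarrow> r < e \<Longrightarrow> g n r \<le> y r"
  proof -
    have le: "g n t \<le> y t" if "s \<le> t" "t \<le> e" for t
      using limit_le_endpoints[of s e "\<lambda>t. y t - g n t" t] up se that cy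
      by (auto intro!: continuous_intros continuous_g)
    have "{t \<in> {s..e}. \<not> (0 < 1 - y t \<and> 1 - y t < 1 - g n t)} \<subseteq> {t \<in> {s..e}. y t = 0 \<or> y t = 1 \<or> y t = g n t}"
      using le y01 by (auto simp: less_le)
    then have finu: "finite {t \<in> {s..e}. \<not> (0 < 1 - y t \<and> 1 - y t < 1 - g n t)}" using fin by (rule finite_subset)
    have Lu: "\<exists>a<t. \<exists>v. (\<forall>r. a < r \<and> r < t \<longrightarrow> 1 - y r = 1 - y t + (r - t) * v \<and> - w r = v) \<and>
        (- w t = v \<and> 0 < 1 - y t \<and> 1 - y t < 1 - g n t \<or> 1 - y t = 0 \<and> - w t = - v \<or>
         1 - y t = 1 - g n t \<and> - w t = - v + 2 * deriv (\<lambda>t. 1 - g n t) t)"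
      if t: "s < t" "t \<le> e" for t
    proof -
      obtain a v where a: "a < t" "\<forall>r. a < r \<and> r < t \<longrightarrow> y r = y t + (r - t) * v \<and> w r = v"
        "(y t = 0 \<or> y t = 1) \<and> w t = - v \<or> y t = g n t \<and> w t = - v + 2 * deriv (g n) t \<or>
          y t \<noteq> 0 \<and> y t \<noteq> 1 \<and> y t \<noteq> g n t \<and> w t = v" using L[OF t] by blast
      have "y t \<noteq> 0" "g n t \<le> y t" "y t \<le> 1" using le[of t] y01[of t] g01[of t] t by auto
      then have "- w t = - v \<and> 0 < 1 - y t \<and> 1 - y t < 1 - g n t \<or> 1 - y t = 0 \<and> - w t = - (- v) \<or>
         1 - y t = 1 - g n t \<and> - w t = - (- v) + 2 * deriv (\<lambda>t. 1 - g n t) t"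
        using a(3) by (auto simp: flip_deriv[OF mot_g])
      moreover have "\<forall>r. a < r \<and> r < t \<longrightarrow> 1 - y r = 1 - y t + (r - t) * (- v) \<and> - w r = - v"
        using a(2) by simp
      ultimately show ?thesis using a(1) by blast
    qed
    have Ru: "\<exists>b>t. \<forall>r. t < r \<and> r < b \<longrightarrow> 1 - y r = 1 - y t + (r - t) * - w t \<and> - w r = - w t"
      if tt: "s \<le> t" "t < e" for t
    proof -
      obtain b where b: "b > t" "\<forall>r. t < r \<and> r < b \<longrightarrow> y r = y t + (r - t) * w t \<and> w r = w t"
        using R[OF tt] by blast
      then show ?thesis by (intro exI[of _ b]) simp
    qed
    have yu: "0 \<le> 1 - y t" "1 - y t \<le> 1 - g n t" if "s \<le> t" "t \<le> e" for t
      using y01(2)[OF that] le[OF that] by simp_all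
    show ?thesis by (rule bounceI[OF less_imp_le[OF se] finu yu Ru Lu])
  qed
qed

lemma orb_segment_energy:
  assumes o: "orb t0 v0 b y w" and t0: "0 \<le> t0" "t0 \<le> s" "e \<le> b" and n: "c n \<le> s" "e \<le> c (Suc n)"
    and t: "s \<le> t" "t \<le> e"
  shows "m * \<bar>w s\<bar> - (4 * C + 1) \<le> \<bar>w t\<bar>" "\<bar>w t\<bar> \<le> (\<bar>w s\<bar> + (4 * C + 1)) / m"
proof -
  have "m * \<bar>w s\<bar> - (4 * C + 1) \<le> \<bar>w t\<bar> \<and> \<bar>w t\<bar> \<le> (\<bar>w s\<bar> + (4 * C + 1)) / m"
  proof (cases "s < e")
    case False
    then have "t = s" using t by simp
    have "m * \<bar>w s\<bar> \<le> 1 * \<bar>w s\<bar>" using mC by (intro mult_right_mono) auto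
    then show ?thesis using mC \<open>t = s\<close> by (simp add: field_simps)
  next
    case se: True
    have le2: "e - s \<le> 2" using c_Suc_le[of n] n by simp
    \<comment> \<open>Either some point is strictly below the slit, which puts the whole piece
      below, or none is and the piece is above.\<close>
    consider "\<exists>r\<in>{s<..<e}. y r < g n r" | "\<And>r. s < r \<Longrightarrow> r < e \<Longrightarrow> g n r \<le> y r" by force
    then show ?thesis
    proof cases
      case 1
      then obtain q where "s < q" "q < e" and q2: "y q < g n q" by (auto simp: Bex_def)
      then have q: "q \<in> {s..e}" "y q < g n q" by auto
      have "bounce (g n) s e y w"
        by (rule orb_bounce(1)[OF o t0 n se]) (rule orb_low[OF o t0 n se q])
      from bounce_energy[OF mot_g bd_g this le2 t] show ?thesis by simp
    next
      case 2
      then have "bounce (\<lambda>t. 1 - g n t) s e (\<lambda>t. 1 - y t) (\<lambda>t. - w t)"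
        by (intro orb_bounce(2)[OF o t0 n se])
      from bounce_energy[OF flip_slit_motion[OF mot_g] flip_slit_bounds[OF mot_g bd_g] this le2 t]
      show ?thesis by simp
    qed
  qed
  then show "m * \<bar>w s\<bar> - (4 * C + 1) \<le> \<bar>w t\<bar>" "\<bar>w t\<bar> \<le> (\<bar>w s\<bar> + (4 * C + 1)) / m" by auto
qed

text \<open>High energy persists over finitely many passages between the two parts of the table.\<close>

lemma orb_energy_ge:
  "\<exists>V0\<ge>0. \<forall>t0 v0 b y w n t. orb t0 v0 b y w \<and> 0 \<le> t0 \<and> c n \<le> t0 \<and> t0 < c (Suc n) \<and> V0 \<le> \<bar>v0\<bar> \<and>
     t0 \<le> t \<and> t \<le> b \<and> t \<le> c (Suc n + k) \<longrightarrow> W \<le> \<bar>w t\<bar>"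
proof (induction k arbitrary: W)
  case 0
  let ?V = "max 0 ((W + (4 * C + 1)) / m)"
  show ?case
  proof (intro exI[of _ ?V] conjI allI impI)
    fix t0 v0 b y w n t
    assume a: "orb t0 v0 b y w \<and> 0 \<le> t0 \<and> c n \<le> t0 \<and> t0 < c (Suc n) \<and> ?V \<le> \<bar>v0\<bar> \<and>
     t0 \<le> t \<and> t \<le> b \<and> t \<le> c (Suc n + 0)"
    then have "m * \<bar>w t0\<bar> - (4 * C + 1) \<le> \<bar>w t\<bar>"
      using orb_segment_energy(1)[of t0 v0 b y w t0 t n t] by auto
    moreover have "w t0 = v0" using a orbD(3) by blast
    moreover have "W + (4 * C + 1) \<le> m * \<bar>v0\<bar>" using a mC by (simp add: field_simps)
    ultimately show "W \<le> \<bar>w t\<bar>" by simp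
  qed simp
next
  case (Suc k)
  \<comment> \<open>The speed needed at the last critical time so that W is left after the loss on
    one more interval.\<close>
  define W' where "W' = max W ((W + (4 * C + 1)) / m)"
  obtain V0 where V0: "V0 \<ge> 0" "\<forall>t0 v0 b y w n t. orb t0 v0 b y w \<and> 0 \<le> t0 \<and> c n \<le> t0 \<and> t0 < c (Suc n) \<and> V0 \<le> \<bar>v0\<bar> \<and>
     t0 \<le> t \<and> t \<le> b \<and> t \<le> c (Suc n + k) \<longrightarrow> W' \<le> \<bar>w t\<bar>" using Suc.IH[of W'] by blast
  show ?case
  proof (intro exI[of _ V0] conjI allI impI)
    fix t0 v0 b y w n t
    assume a: "orb t0 v0 b y w \<and> 0 \<le> t0 \<and> c n \<le> t0 \<and> t0 < c (Suc n) \<and> V0 \<le> \<bar>v0\<bar> \<and>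
     t0 \<le> t \<and> t \<le> b \<and> t \<le> c (Suc n + Suc k)"
    define s where "s = c (Suc n + k)"
    have s: "t0 \<le> s" using a c_mono[of "Suc n" "Suc n + k"] by (simp add: s_def)
    show "W \<le> \<bar>w t\<bar>"
    proof (cases "t \<le> s")
      case True
      then have "W' \<le> \<bar>w t\<bar>" using V0(2) a unfolding s_def by blast
      then show ?thesis by (simp add: W'_def)
    next
      case False
      then have "W' \<le> \<bar>w s\<bar>" using V0(2)[rule_format, of t0 v0 b y w n s] a s by (auto simp: s_def)
      then have "W + (4 * C + 1) \<le> m * \<bar>w s\<bar>" using mC by (simp add: W'_def field_simps)
      moreover have "m * \<bar>w s\<bar> - (4 * C + 1) \<le> \<bar>w t\<bar>"
        using orb_segment_energy(1)[of t0 v0 b y w s t "Suc n + k" t] a s False by (auto simp: s_def)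
      ultimately show ?thesis by simp
    qed
  qed (rule V0)
qed

text \<open>An upper speed bound on bounded time intervals, later used to exclude accumulation of
  collisions.\<close>

lemma orb_energy_le:
  "\<exists>U'. \<forall>t0 v0 b y w n t. orb t0 v0 b y w \<and> 0 \<le> t0 \<and> c n \<le> t0 \<and> t0 < c (Suc n) \<and> \<bar>v0\<bar> \<le> U \<and>
     t0 \<le> t \<and> t \<le> b \<and> t \<le> c (Suc n + k) \<longrightarrow> \<bar>w t\<bar> \<le> U'"
proof (induction k)
  case 0
  show ?case
  proof (intro exI[of _ "(U + (4 * C + 1)) / m"] allI impI)
    fix t0 v0 b y w n t
    assume a: "orb t0 v0 b y w \<and> 0 \<le> t0 \<and> c n \<le> t0 \<and> t0 < c (Suc n) \<and> \<bar>v0\<bar> \<le> U \<and>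
     t0 \<le> t \<and> t \<le> b \<and> t \<le> c (Suc n + 0)"
    then have "\<bar>w t\<bar> \<le> (\<bar>w t0\<bar> + (4 * C + 1)) / m"
      using orb_segment_energy(2)[of t0 v0 b y w t0 t n t] by auto
    moreover have "w t0 = v0" using a orbD(3) by blast
    then have "(\<bar>w t0\<bar> + (4 * C + 1)) / m \<le> (U + (4 * C + 1)) / m" using a mC by (intro divide_right_mono) auto
    ultimately show "\<bar>w t\<bar> \<le> (U + (4 * C + 1)) / m" by simp
  qed
next
  case (Suc k)
  obtain U' where U': "\<forall>t0 v0 b y w n t. orb t0 v0 b y w \<and> 0 \<le> t0 \<and> c n \<le> t0 \<and> t0 < c (Suc n) \<and> \<bar>v0\<bar> \<le> U \<and>
     t0 \<le> t \<and> t \<le> b \<and> t \<le> c (Suc n + k) \<longrightarrow> \<bar>w t\<bar> \<le> U'" using Suc.IH by blast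
  show ?case
  proof (intro exI[of _ "max U' ((U' + (4 * C + 1)) / m)"] conjI allI impI)
    fix t0 v0 b y w n t
    assume a: "orb t0 v0 b y w \<and> 0 \<le> t0 \<and> c n \<le> t0 \<and> t0 < c (Suc n) \<and> \<bar>v0\<bar> \<le> U \<and>
     t0 \<le> t \<and> t \<le> b \<and> t \<le> c (Suc n + Suc k)"
    define s where "s = c (Suc n + k)"
    have s: "t0 \<le> s" using a c_mono[of "Suc n" "Suc n + k"] by (simp add: s_def)
    show "\<bar>w t\<bar> \<le> max U' ((U' + (4 * C + 1)) / m)"
    proof (cases "t \<le> s")
      case True
      then have "\<bar>w t\<bar> \<le> U'" using U' a unfolding s_def by blast
      then show ?thesis by simp
    next
      case False
      then have "\<bar>w s\<bar> \<le> U'" using U'[rule_format, of t0 v0 b y w n s] a s by (auto simp: s_def)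
      then have "(\<bar>w s\<bar> + (4 * C + 1)) / m \<le> (U' + (4 * C + 1)) / m" using mC by (intro divide_right_mono) auto
      moreover have "\<bar>w t\<bar> \<le> (\<bar>w s\<bar> + (4 * C + 1)) / m"
        using orb_segment_energy(2)[of t0 v0 b y w s t "Suc n + k" t] a s False by (auto simp: s_def)
      ultimately show ?thesis by simp
    qed
  qed
qed

end

section \<open>The null set of states leading to a hit at a critical time\<close>

lemma negligible_UN_nat:
  fixes S :: "nat \<Rightarrow> 'a::euclidean_space set"
  assumes "\<And>n. negligible (S n)"
  shows "negligible (\<Union>n. S n)"
  by (rule negligible_countable_Union) (use assms in auto)

context slits_bd begin

text \<open>Above twice the maximal slit speed the kick \<open>2 * deriv f\<close> cannot undo a
  reversal of the velocity; the extra 2 makes the backward collision map Lipschitz with explicit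
  constants.\<close>

definition wmin :: real where "wmin = 2 * C + 2"

text \<open>All horizontal curves in one family: 0 is the floor, 1 the ceiling, larger indices are
  slits. As \<open>g\<close> depends only on parity, the indices from 2 on cover both slits.\<close>

definition Yt :: "nat \<Rightarrow> real \<Rightarrow> real" where
  "Yt i = (if i = 0 then (\<lambda>_. 0) else if i = 1 then (\<lambda>_. 1) else g i)"

lemma Yt_bounds:
  "\<bar>Yt i s - Yt i t\<bar> \<le> C * \<bar>s - t\<bar>" "\<bar>deriv (Yt i) s - deriv (Yt i) t\<bar> \<le> C * \<bar>s - t\<bar>"
proof -
  have "\<bar>deriv (g i) s - deriv (g i) t\<bar> \<le> C * \<bar>s - t\<bar>"
  proof -
    have "norm (deriv (g i) s - deriv (g i) t) \<le> C * norm (s - t)"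
      by (rule field_differentiable_bound[of UNIV "deriv (g i)" "deriv (deriv (g i))"])
        (use slit_motionD(2)[OF mot_g] g_bd in auto)
    then show ?thesis by simp
  qed
  then show "\<bar>deriv (Yt i) s - deriv (Yt i) t\<bar> \<le> C * \<bar>s - t\<bar>"
    using mC(3) by (simp add: Yt_def)
  show "\<bar>Yt i s - Yt i t\<bar> \<le> C * \<bar>s - t\<bar>"
    using Lip_g[of i s t] mC(3) by (simp add: Yt_def)
qed

text \<open>
  \<open>step_rel i j\<close> relates the states (time, outgoing velocity) at two consecutive collisions with the
  horizontal curves \<open>Yt i\<close> and \<open>Yt j\<close>. It is locally Lipschitz backwards in time, so preimages of null
  sets are null.
\<close>

definition step_rel :: "nat \<Rightarrow> nat \<Rightarrow> real \<times> real \<Rightarrow> real \<times> real \<Rightarrow> bool" where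
  "step_rel i j x z \<longleftrightarrow> Yt i (fst x) + (fst z - fst x) * snd x = Yt j (fst z) \<and>
     snd z = - snd x + 2 * deriv (Yt j) (fst z) \<and> wmin \<le> \<bar>snd x\<bar>"

text \<open>States on curve i that after k further collisions fly along a line meeting some curve at
  the exact moment of a critical time. Collisions are tracked by the algebraic relation
  \<open>step_rel\<close> alone, which contains all real collision sequences of fast orbits.\<close>

fun Nul :: "nat \<Rightarrow> nat \<Rightarrow> (real \<times> real) set" where
  "Nul 0 i = {x. \<exists>n j. fst x < c n \<and> Yt i (fst x) + (c n - fst x) * snd x = Yt j (c n)}"
| "Nul (Suc k) i = {x. \<exists>j z. step_rel i j x z \<and> z \<in> Nul k j}"

text \<open>For a given departure time the velocity is determined, so the set is a graph over the
  time axis. It is presented as the image of the null line of zero velocity under a differentiable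
  map of the plane.\<close>

lemma negligible_graph_before:
  "negligible {x :: real \<times> real. fst x < a \<and> Yt i (fst x) + (a - fst x) * snd x = K}" (is "negligible ?S")
proof -
  let ?F = "\<lambda>x :: real \<times> real. (fst x, (K - Yt i (fst x)) / (a - fst x))"
  have neg: "negligible {x :: real \<times> real. fst x < a \<and> snd x = 0}"
  proof (rule negligible_subset[OF negligible_hyperplane[of "(0, 1) :: real \<times> real" 0]])
    show "(0, 1) \<noteq> (0 :: real \<times> real) \<or> (0::real) \<noteq> 0" by (simp add: zero_prod_def)
  qed (auto simp: inner_prod_def)
  have "negligible (?F ` {x. fst x < a \<and> snd x = 0})"
  proof (rule negligible_differentiable_image_negligible[OF _ neg])
    show "?F differentiable_on {x. fst x < a \<and> snd x = 0}"
      unfolding differentiable_on_def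
    proof
      fix x :: "real \<times> real" assume x: "x \<in> {x. fst x < a \<and> snd x = 0}"
      have f: "(\<lambda>x :: real \<times> real. fst x) differentiable (at x)"
        by (rule bounded_linear_imp_differentiable[OF bounded_linear_fst])
      have "Yt i differentiable (at t)" for t
      proof (cases "i = 0 \<or> i = 1")
        case True
        then show ?thesis by (auto simp: Yt_def)
      next
        case False
        then show ?thesis using slit_motionD(1)[OF mot_g, of i t]
          by (auto simp: Yt_def real_differentiable_def)
      qed
      then have "(\<lambda>x :: real \<times> real. Yt i (fst x)) differentiable (at x)"
        using differentiable_compose[of "Yt i" fst x UNIV] f by simp
      then have "(\<lambda>x. (K - Yt i (fst x)) / (a - fst x)) differentiable (at x)"
        using f x by (intro differentiable_divide differentiable_diff differentiable_const) auto
      then have "?F differentiable (at x)"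
        using f by (auto simp: differentiable_def intro: has_derivative_Pair)
      then show "?F differentiable (at x within {x. fst x < a \<and> snd x = 0})"
        by (rule differentiable_at_withinI)
    qed
  qed simp
  moreover have "?S \<subseteq> ?F ` {x. fst x < a \<and> snd x = 0}"
  proof
    fix x assume x: "x \<in> ?S"
    then have "(a - fst x) * snd x = K - Yt i (fst x)" "a - fst x \<noteq> 0" by auto
    then have "snd x = (K - Yt i (fst x)) / (a - fst x)" by (metis nonzero_mult_div_cancel_left)
    then have "x = ?F (fst x, 0)" by (simp add: prod_eq_iff)
    then show "x \<in> ?F ` {x. fst x < a \<and> snd x = 0}" using x by (intro image_eqI[of _ _ "(fst x, 0)"]) auto
  qed
  ultimately show ?thesis by (rule negligible_subset)
qed

text \<open>The velocity is recovered from the reflection law. The departure time is recovered from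
  the flight equation, where the speed bound gives |w| + C \<le> 3 (|w| - C) and |w| - C \<ge>
  1.\<close>

lemma step_rel_Lipschitz:
  assumes r: "step_rel i j (t, w) (t', w')" "step_rel i j (s, v) (s', v')"
  shows "\<bar>w - v\<bar> \<le> \<bar>w' - v'\<bar> + 2 * C * \<bar>t' - s'\<bar>"
    "\<bar>t - s\<bar> \<le> 3 * \<bar>t' - s'\<bar> + \<bar>s' - s\<bar> * \<bar>w - v\<bar>"
proof -
  note C = mC(3)
  have rt: "Yt i t + (t' - t) * w = Yt j t'" "w' = - w + 2 * deriv (Yt j) t'" "2 * C + 2 \<le> \<bar>w\<bar>"
    and rs: "Yt i s + (s' - s) * v = Yt j s'" "v' = - v + 2 * deriv (Yt j) s'"
    using r by (auto simp: step_rel_def wmin_def)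
  show "\<bar>w - v\<bar> \<le> \<bar>w' - v'\<bar> + 2 * C * \<bar>t' - s'\<bar>"
    using Yt_bounds(2)[of j t' s'] rt(2) rs(2) by (simp add: abs_if split: if_splits)
  have "(t - s) * w = (Yt i t - Yt i s) + (t' - s') * w + (s' - s) * (w - v) - (Yt j t' - Yt j s')"
    using rt(1) rs(1) by (simp add: algebra_simps)
  then have "\<bar>(t - s) * w\<bar> \<le> \<bar>Yt i t - Yt i s\<bar> + \<bar>(t' - s') * w\<bar> + \<bar>(s' - s) * (w - v)\<bar> + \<bar>Yt j t' - Yt j s'\<bar>"
    by linarith
  then have "\<bar>t - s\<bar> * \<bar>w\<bar> \<le> C * \<bar>t - s\<bar> + \<bar>t' - s'\<bar> * \<bar>w\<bar> + \<bar>s' - s\<bar> * \<bar>w - v\<bar> + C * \<bar>t' - s'\<bar>"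
    unfolding abs_mult using Yt_bounds(1)[of i t s] Yt_bounds(1)[of j t' s'] by linarith
  then have 1: "\<bar>t - s\<bar> * (\<bar>w\<bar> - C) \<le> \<bar>t' - s'\<bar> * (\<bar>w\<bar> + C) + \<bar>s' - s\<bar> * \<bar>w - v\<bar>"
    by (simp add: algebra_simps)
  have "\<bar>t' - s'\<bar> * (\<bar>w\<bar> + C) \<le> \<bar>t' - s'\<bar> * (3 * (\<bar>w\<bar> - C))"
    using rt(3) C by (intro mult_left_mono) auto
  moreover have "\<bar>s' - s\<bar> * \<bar>w - v\<bar> * 1 \<le> \<bar>s' - s\<bar> * \<bar>w - v\<bar> * (\<bar>w\<bar> - C)"
    using rt(3) C by (intro mult_left_mono) auto
  ultimately have "\<bar>t - s\<bar> * (\<bar>w\<bar> - C) \<le> (3 * \<bar>t' - s'\<bar> + \<bar>s' - s\<bar> * \<bar>w - v\<bar>) * (\<bar>w\<bar> - C)"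
    using 1 by (simp add: algebra_simps)
  then show "\<bar>t - s\<bar> \<le> 3 * \<bar>t' - s'\<bar> + \<bar>s' - s\<bar> * \<bar>w - v\<bar>"
    by (rule mult_right_le_imp_le) (use rt(3) C in linarith)
qed

text \<open>Going backwards over a collision is single-valued and Lipschitz, so a null set has a
  null preimage.\<close>

lemma negligible_step_preimage:
  assumes "negligible S"
  shows "negligible {x. \<exists>z. step_rel i j x z \<and> z \<in> S}"
proof -
  define D where "D = {z \<in> S. \<exists>x. step_rel i j x z}"
  have "\<forall>z\<in>D. \<exists>x. step_rel i j x z" by (simp add: D_def)
  then obtain \<Psi> where \<Psi>: "\<And>z. z \<in> D \<Longrightarrow> step_rel i j (\<Psi> z) z" by metis
  have sub: "{x. \<exists>z. step_rel i j x z \<and> z \<in> S} \<subseteq> \<Psi> ` D"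
  proof
    fix x assume "x \<in> {x. \<exists>z. step_rel i j x z \<and> z \<in> S}"
    then obtain z where z: "step_rel i j x z" "z \<in> S" by blast
    then have z: "step_rel i j x z" "z \<in> D" unfolding D_def by blast+
    obtain t w s v t' w' where eq: "x = (t, w)" "\<Psi> z = (s, v)" "z = (t', w')" by (metis surj_pair)
    have "w = v" using step_rel_Lipschitz(1)[of i j t w t' w' s v t' w'] z \<Psi>[OF z(2)] eq by simp
    moreover have "t = s" using step_rel_Lipschitz(2)[of i j t w t' w' s v t' w'] z \<Psi>[OF z(2)] eq \<open>w = v\<close> by simp
    ultimately show "x \<in> \<Psi> ` D" using eq z(2) by (intro image_eqI[of _ _ z]) auto
  qed
  have "negligible (\<Psi> ` D)"
  proof (rule negligible_locally_Lipschitz_image)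
    show "negligible D" by (rule negligible_subset[OF assms]) (auto simp: D_def)
    fix z0 assume z0: "z0 \<in> D"
    obtain s v s' v' where eq0: "\<Psi> z0 = (s, v)" "z0 = (s', v')" by (metis surj_pair)
    define B where "B = (\<bar>s' - s\<bar> + 1) * (1 + 2 * C) + 3"
    have "norm (\<Psi> z - \<Psi> z0) \<le> B * norm (z - z0)" if z: "z \<in> D" for z
    proof -
      obtain t w t' w' where eq: "\<Psi> z = (t, w)" "z = (t', w')" by (metis surj_pair)
      note L = step_rel_Lipschitz[of i j t w t' w' s v s' v']
      have w: "\<bar>w - v\<bar> \<le> \<bar>w' - v'\<bar> + 2 * C * \<bar>t' - s'\<bar>"
        and t: "\<bar>t - s\<bar> \<le> 3 * \<bar>t' - s'\<bar> + \<bar>s' - s\<bar> * \<bar>w - v\<bar>"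
        using L \<Psi>[OF z] \<Psi>[OF z0] eq eq0 by simp_all
      have "z - z0 = (t' - s', w' - v')" using eq eq0 by simp
      then have n: "\<bar>t' - s'\<bar> \<le> norm (z - z0)" "\<bar>w' - v'\<bar> \<le> norm (z - z0)"
        using norm_fst_le[of "t' - s'" "w' - v'"] norm_snd_le[of "w' - v'" "t' - s'"]
        by (simp_all only: real_norm_def)
      have "2 * C * \<bar>t' - s'\<bar> \<le> 2 * C * norm (z - z0)" using n mC(3) by (intro mult_left_mono) auto
      then have w': "\<bar>w - v\<bar> \<le> (1 + 2 * C) * norm (z - z0)" using w n by (simp add: algebra_simps)
      have "norm (\<Psi> z - \<Psi> z0) \<le> \<bar>t - s\<bar> + \<bar>w - v\<bar>"
        using norm_Pair_le[of "t - s" "w - v"] eq eq0 by simp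
      also have "\<dots> \<le> 3 * norm (z - z0) + (\<bar>s' - s\<bar> + 1) * \<bar>w - v\<bar>" using t n by (simp add: algebra_simps)
      also have "(\<bar>s' - s\<bar> + 1) * \<bar>w - v\<bar> \<le> (\<bar>s' - s\<bar> + 1) * ((1 + 2 * C) * norm (z - z0))"
        using w' by (intro mult_left_mono) auto
      finally show ?thesis by (simp add: B_def algebra_simps)
    qed
    then show "\<exists>T B. open T \<and> z0 \<in> T \<and> (\<forall>y\<in>D \<inter> T. norm (\<Psi> y - \<Psi> z0) \<le> B * norm (y - z0))"
      by (intro exI[of _ UNIV] exI[of _ B]) auto
  qed simp
  then show ?thesis using sub by (rule negligible_subset)
qed

lemma negligible_Nul: "negligible (Nul k i)"
proof (induction k arbitrary: i)
  case 0
  have "Nul 0 i = (\<Union>n. \<Union>j. {x. fst x < c n \<and> Yt i (fst x) + (c n - fst x) * snd x = Yt j (c n)})"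
    by auto
  moreover have "negligible (\<Union>n. \<Union>j. {x. fst x < c n \<and> Yt i (fst x) + (c n - fst x) * snd x = Yt j (c n)})"
    by (intro negligible_UN_nat negligible_graph_before)
  ultimately show ?case by simp
next
  case (Suc k)
  have "Nul (Suc k) i = (\<Union>j. {x. \<exists>z. step_rel i j x z \<and> z \<in> Nul k j})" by auto
  moreover have "negligible (\<Union>j. {x. \<exists>z. step_rel i j x z \<and> z \<in> Nul k j})"
    by (intro negligible_UN_nat negligible_step_preimage Suc.IH)
  ultimately show ?case by simp
qed

definition Null_set :: "(real \<times> real) set" where
  "Null_set = (\<Union>k. \<Union>i. Nul k i) \<union> {x. \<exists>n. fst x = c n}"

lemma negligible_Null_set: "negligible Null_set"
proof -
  have neg: "negligible {x :: real \<times> real. fst x = a}" for a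
  proof (rule negligible_subset[OF negligible_hyperplane[of "(1, 0) :: real \<times> real" a]])
    show "(1, 0) \<noteq> (0 :: real \<times> real) \<or> a \<noteq> 0" by (simp add: zero_prod_def)
  qed (auto simp: inner_prod_def)
  have "{x :: real \<times> real. \<exists>n. fst x = c n} = (\<Union>n. {x. fst x = c n})" by auto
  moreover have "negligible (\<Union>n. {x :: real \<times> real. fst x = c n})" by (intro negligible_UN_nat neg)
  moreover have "negligible (\<Union>k. \<Union>i. Nul k i)" by (intro negligible_UN_nat negligible_Nul)
  ultimately show ?thesis unfolding Null_set_def by (simp add: negligible_Un)
qed

text \<open>Induction on the number of collisions left until b: the first of them gives one
  \<open>step_rel\<close>.\<close>

lemma orb_chain_Nul:
  assumes o: "orb t0 v0 b y w" and t0: "0 \<le> t0" and b: "b < c N"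
    and en: "\<And>t. t0 \<le> t \<Longrightarrow> t \<le> b \<Longrightarrow> wmin \<le> \<bar>w t\<bar>"
    and fin: "y b + (c N - b) * w b = Yt j (c N)"
  shows "t0 \<le> s \<Longrightarrow> s \<le> b \<Longrightarrow> y s = Yt i s \<Longrightarrow> card {r \<in> {s<..b}. collides f y r} = k \<Longrightarrow> (s, w s) \<in> Nul k i"
proof (induction k arbitrary: s i)
  note fli = orbD(4)[OF o]
  have fin_set: "finite {r \<in> {s<..b}. collides f y r}" if "t0 \<le> s" for s
    by (rule finite_subset[of _ "{t \<in> {t0..b}. collides f y t}"]) (use fli that in \<open>auto simp: flight_def\<close>)
  {
    case 0
    have nc: "\<not> collides f y r" if "s < r" "r \<le> b" for r
    proof
      assume "collides f y r"
      then have "r \<in> {r \<in> {s<..b}. collides f y r}" using that by simp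
      moreover have "{r \<in> {s<..b}. collides f y r} = {}"
        using 0(4) fin_set[OF 0(1)] by (simp only: card_0_eq)
      ultimately show False by blast
    qed
    have "y b = y s + (b - s) * w s \<and> w b = w s"
    proof (cases "s < b")
      case True
      then show ?thesis using flightD[OF fli 0(1) True order_refl] nc reflect_not_collides[OF nc[OF True]] by simp
    next
      case False
      then show ?thesis using 0 by simp
    qed
    then have "Yt i s + (c N - s) * w s = Yt j (c N)" using fin 0(3) by (simp add: algebra_simps)
    moreover have "s < c N" using 0 b by simp
    ultimately have "\<exists>n j. s < c n \<and> Yt i s + (c n - s) * w s = Yt j (c n)" by blast
    then show ?case by simp
  next
    case (Suc k)
    define S where "S = {r \<in> {s<..b}. collides f y r}"
    have finS: "finite S" unfolding S_def by (rule fin_set[OF Suc.prems(1)])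
    have "S \<noteq> {}" using Suc.prems(4) unfolding S_def by (intro notI) (simp only: card.empty nat.distinct)
    define q where "q = Min S"
    have q: "q \<in> S" unfolding q_def by (rule Min_in[OF finS \<open>S \<noteq> {}\<close>])
    have q': "s < q" "q \<le> b" "collides f y q" using q by (auto simp: S_def)
    have nc: "\<not> collides f y r" if "s < r" "r < q" for r
    proof
      assume "collides f y r"
      then have "r \<in> S" using that q' by (auto simp: S_def)
      then have "q \<le> r" unfolding q_def by (rule Min_le[OF finS])
      then show False using that by simp
    qed
    have yq: "y q = y s + (q - s) * w s" "w q = reflect f q (y q) (w s)"
      using flightD[OF fli Suc.prems(1) q'(1,2)] nc by auto
    have "\<exists>j. y q = Yt j q \<and> w q = - w s + 2 * deriv (Yt j) q"
    proof -
      have "y q = 0 \<or> y q = 1 \<or> y q = f q \<and> y q \<noteq> 0 \<and> y q \<noteq> 1" using q'(3) by (auto simp: collides_def)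
      then show ?thesis
      proof (elim disjE conjE)
        assume "y q = 0"
        then show ?thesis using yq(2) by (intro exI[of _ 0]) (simp add: Yt_def reflect_def)
      next
        assume "y q = 1"
        then show ?thesis using yq(2) by (intro exI[of _ 1]) (simp add: Yt_def reflect_def)
      next
        assume a: "y q = f q" "y q \<noteq> 0" "y q \<noteq> 1"
        have ncq: "\<not> crit q" using orbD(6)[OF o, of q] q' Suc.prems(1) a(1) f_cases[of q] by auto
        have "c 0 \<le> q" using q' Suc.prems(1) t0 c0_neg by linarith
        then obtain n where n: "c n \<le> q" "q < c (Suc n)" by (rule locate_c)
        then have "c n < q" using ncq crit_c[of n] by (cases "c n = q") auto
        then have "f q = g n q" "deriv f q = deriv (g n) q"
          using between_c(2)[of n q] deriv_f_between_c[of n q] n by auto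
        \<comment> \<open>The shift by 2 preserves parity and avoids the indices of floor and
          ceiling.\<close>
        moreover have "Yt (n + 2) = g n" by (simp add: Yt_def g_def)
        ultimately show ?thesis using yq(2) a by (intro exI[of _ "n + 2"]) (simp add: reflect_def)
      qed
    qed
    then obtain j where j: "y q = Yt j q" "w q = - w s + 2 * deriv (Yt j) q" by blast
    have "{r \<in> {q<..b}. collides f y r} = S - {q}"
    proof (intro set_eqI iffI)
      fix r assume "r \<in> {r \<in> {q<..b}. collides f y r}"
      then show "r \<in> S - {q}" using q' by (auto simp: S_def)
    next
      fix r assume r: "r \<in> S - {q}"
      then have "\<not> r < q" using nc[of r] by (auto simp: S_def)
      then show "r \<in> {r \<in> {q<..b}. collides f y r}" using r by (auto simp: S_def)
    qed
    then have "card {r \<in> {q<..b}. collides f y r} = k"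
    proof -
      have "card S = Suc k" using Suc.prems(4) by (simp only: S_def)
      then show ?thesis using \<open>{r \<in> {q<..b}. collides f y r} = S - {q}\<close> q finS by simp
    qed
    then have "(q, w q) \<in> Nul k j" using Suc.IH[of q j] q' Suc.prems(1) j(1) by auto
    moreover have "step_rel i j (s, w s) (q, w q)"
      unfolding step_rel_def using yq(1) j Suc.prems(3) en[OF Suc.prems(1,2)] by simp
    ultimately show ?case by auto
  }
qed

end

section \<open>Existence of orbits off the null set\<close>

lemma dominant_sign: "\<bar>z\<bar> < \<bar>x\<bar> \<Longrightarrow> 0 < (z + x) * x" for x z :: real
  by (auto simp: zero_less_mult_iff abs_if split: if_splits)

lemma sign_chain: "0 \<le> a * p \<Longrightarrow> 0 < p * v \<Longrightarrow> 0 < v * z \<Longrightarrow> 0 \<le> a * z" for a p v z :: real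
  by (auto simp: zero_le_mult_iff zero_less_mult_iff)

context slits_bd begin

text \<open>Appends a straight flight without collisions before b'. A collision at b' itself is
  allowed, and the new velocity there is the reflected one.\<close>

lemma orb_extend_line:
  assumes o: "orb t0 v0 b y w" and t0: "0 \<le> t0" and bb: "b < b'"
    and nohit: "\<And>r. b < r \<Longrightarrow> r < b' \<Longrightarrow> y b + (r - b) * w b \<noteq> 0 \<and> y b + (r - b) * w b \<noteq> 1 \<and> y b + (r - b) * w b \<noteq> f r"
    and rng: "0 \<le> y b + (b' - b) * w b" "y b + (b' - b) * w b \<le> 1"
    and cr: "\<And>r. b < r \<Longrightarrow> r \<le> b' \<Longrightarrow> crit r \<Longrightarrow> y b + (r - b) * w b \<noteq> fL r \<and> y b + (r - b) * w b \<noteq> fR r"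
    and sg1: "\<And>s t. t0 \<le> s \<Longrightarrow> s \<le> b \<Longrightarrow> b < t \<Longrightarrow> t \<le> b' \<Longrightarrow> (\<And>r. s \<le> r \<Longrightarrow> r \<le> t \<Longrightarrow> \<not> crit r) \<Longrightarrow>
       0 \<le> (y s - f s) * (y b + (t - b) * w b - f t)"
    and sg2: "\<And>s t. b < s \<Longrightarrow> s \<le> t \<Longrightarrow> t \<le> b' \<Longrightarrow> (\<And>r. s \<le> r \<Longrightarrow> r \<le> t \<Longrightarrow> \<not> crit r) \<Longrightarrow>
       0 \<le> (y b + (s - b) * w b - f s) * (y b + (t - b) * w b - f t)"
  shows "\<exists>y w. orb t0 v0 b' y w"
proof -
  define l where "l r = y b + (r - b) * w b" for r
  define Y where "Y t = (if t \<le> b then y t else l t)" for t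
  define W where "W t = (if t \<le> b then w t else if t < b' then w b else reflect f b' (l b') (w b))" for t
  have t0b: "t0 \<le> b" by (rule orbD(1)[OF o])
  have Yl: "Y t = l t" if "b \<le> t" for t using that by (auto simp: Y_def l_def)
  have col_le: "collides f Y t \<longleftrightarrow> collides f y t" if "t \<le> b" for t
    using that by (simp add: collides_def Y_def)
  have nc: "\<not> collides f Y t" if "b < t" "t < b'" for t
    using nohit[OF that] that by (simp add: collides_def Y_def l_def)
  have fli: "flight t0 b' Y W"
    unfolding flight_def
  proof (rule conjI, goal_cases)
    case 1
    have "{t \<in> {t0..b'}. collides f Y t} \<subseteq> {t \<in> {t0..b}. collides f y t} \<union> {b'}"
    proof
      fix t assume "t \<in> {t \<in> {t0..b'}. collides f Y t}"
      then show "t \<in> {t \<in> {t0..b}. collides f y t} \<union> {b'}"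
        using nc[of t] col_le[of t] by (cases "t \<le> b"; cases "t = b'") auto
    qed
    then show ?case
      using orbD(4)[OF o] by (auto simp: flight_def intro: finite_subset)
  next
    case 2
    show ?case
    proof (intro allI impI)
    fix s t assume a: "t0 \<le> s \<and> s < t \<and> t \<le> b' \<and> (\<forall>r\<in>{s<..<t}. \<not> collides f Y r)"
    have fromb: "Y t = y b + (t - b) * w b \<and> W t = reflect f t (Y t) (w b)" if "b < t"
    proof (cases "t < b'")
      case True
      then show ?thesis using nc[OF that True] that
        by (simp add: Y_def W_def l_def reflect_not_collides) (simp add: Y_def[symmetric] reflect_def collides_def l_def Y_def)
    next
      case False
      then have "t = b'" using a by simp
      then show ?thesis using that by (simp add: Y_def W_def l_def)
    qed
    show "Y t = Y s + (t - s) * W s \<and> W t = reflect f t (Y t) (W s)"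
    proof (cases "t \<le> b")
      case True
      then have "\<And>r. s < r \<Longrightarrow> r < t \<Longrightarrow> \<not> collides f y r" using a col_le by auto
      then have "y t = y s + (t - s) * w s" "w t = reflect f t (y t) (w s)"
        using flightD[OF orbD(4)[OF o], of s t] a True by auto
      then show ?thesis using a True by (simp add: Y_def W_def)
    next
      case tb: False
      show ?thesis
      proof (cases "s \<le> b")
        case True
        have ysb: "y b = y s + (b - s) * w s \<and> w b = w s"
        proof (cases "s = b")
          case False
          then have sb: "s < b" using True by simp
          have "\<not> collides f y r" if "s < r" "r < b" for r
          proof -
            have "r \<in> {s<..<t}" using that tb by simp
            then show ?thesis using a col_le[of r] that by simp
          qed
          moreover have "\<not> collides f y b" using a col_le[of b] tb sb by auto
          ultimately show ?thesis
            using flightD[OF orbD(4)[OF o], of s b] a sb reflect_not_collides[of y b] by auto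
        qed simp
        have "y b + (t - b) * w b = y s + (t - s) * w s"
          using conjunct1[OF ysb] conjunct2[OF ysb] by (simp add: algebra_simps)
        then show ?thesis using fromb tb True ysb by (simp add: Y_def[of s] W_def[of s])
      next
        case False
        then have "Y s = y b + (s - b) * w b" "W s = w b" using a by (simp_all add: Y_def W_def l_def)
        then show ?thesis using fromb tb by (simp add: algebra_simps)
      qed
    qed
    qed
  qed
  show ?thesis
    unfolding orb_def
  proof (rule exI[of _ Y], rule exI[of _ W], intro conjI allI impI fli)
    show "t0 \<le> b'" using t0b bb by simp
    show "Y t0 = f t0" "W t0 = v0" using orbD(2,3)[OF o] t0b by (simp_all add: Y_def W_def)
    fix t assume t: "t0 \<le> t \<and> t \<le> b'"
    have "0 \<le> Y t \<and> Y t \<le> 1"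
    proof (cases "t \<le> b")
      case True
      then show ?thesis using orbD(5)[OF o, of t] t by (simp add: Y_def)
    next
      case False
      define \<theta> where "\<theta> = (t - b) / (b' - b)"
      have th: "0 \<le> \<theta>" "\<theta> \<le> 1" using False t bb by (auto simp: \<theta>_def field_simps)
      have "(t - b) = \<theta> * (b' - b)" using bb by (simp add: \<theta>_def)
      then have "(t - b) * w b = \<theta> * ((b' - b) * w b)" by (simp only: mult.assoc)
      then have "Y t = (1 - \<theta>) * y b + \<theta> * (y b + (b' - b) * w b)"
        using False unfolding Y_def l_def by (simp add: left_diff_distrib distrib_left)
      moreover have "0 \<le> (1 - \<theta>) * y b + \<theta> * (y b + (b' - b) * w b)"
        using th rng orbD(5)[OF o t0b]
        by (rule_tac add_nonneg_nonneg; rule_tac mult_nonneg_nonneg) auto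
      moreover have "(1 - \<theta>) * y b + \<theta> * (y b + (b' - b) * w b) \<le> (1 - \<theta>) * 1 + \<theta> * 1"
        using th rng orbD(5)[OF o t0b]
        by (rule_tac add_mono; rule_tac mult_left_mono) auto
      ultimately show ?thesis by simp
    qed
    then show "0 \<le> Y t" "Y t \<le> 1" by auto
  next
    fix t assume t: "t0 \<le> t \<and> t \<le> b' \<and> crit t"
    have "Y t \<noteq> fL t \<and> Y t \<noteq> fR t"
      using orbD(6)[OF o, of t] cr[of t] t by (cases "t \<le> b") (auto simp: Y_def l_def)
    then show "Y t \<noteq> fL t" "Y t \<noteq> fR t" by auto
  next
    fix s t assume a: "t0 \<le> s \<and> s \<le> t \<and> t \<le> b' \<and> (\<forall>r\<in>{s..t}. \<not> crit r)"
    show "0 \<le> (Y s - f s) * (Y t - f t)"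
    proof (cases "t \<le> b")
      case True
      then show ?thesis using orbD(7)[OF o, of s t] a by (simp add: Y_def)
    next
      case False
      then show ?thesis using sg1[of s t] sg2[of s t] a by (cases "s \<le> b") (auto simp: Y_def l_def)
    qed
  qed
qed

lemma orb_start:
  assumes "0 \<le> t0" "\<not> crit t0"
  shows "orb t0 v0 t0 (\<lambda>_. f t0) (\<lambda>_. v0)"
proof -
  have "{t \<in> {t0..t0}. collides f (\<lambda>_. f t0) t} \<subseteq> {t0}" by auto
  then have "flight t0 t0 (\<lambda>_. f t0) (\<lambda>_. v0)"
    unfolding flight_def using finite_subset by auto
  moreover have "0 \<le> f t0" "f t0 \<le> 1" using mot_f_bounds[of t0] by auto
  moreover have "0 \<le> (f t0 - f s) * (f t0 - f t)" if "t0 \<le> s" "s \<le> t" "t \<le> t0" for s t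
  proof -
    have "s = t0" using that by simp
    then show ?thesis by simp
  qed
  ultimately show ?thesis unfolding orb_def using assms by auto
qed

lemma left_velocity:
  assumes o: "orb t0 v0 b y w" and t0: "0 \<le> t0" "t0 < b"
    and en: "\<And>t. t0 \<le> t \<Longrightarrow> t \<le> b \<Longrightarrow> wmin \<le> \<bar>w t\<bar>"
  obtains a u where "t0 \<le> a" "a < b" "w b = reflect f b (y b) u" "wmin \<le> \<bar>u\<bar>"
    "\<And>r. a < r \<Longrightarrow> r < b \<Longrightarrow> y r = y b + (r - b) * u"
proof -
  obtain a u where a: "t0 \<le> a" "a < b" "w b = reflect f b (y b) u" "w a = u"
    "\<forall>r. a < r \<and> r < b \<longrightarrow> \<not> collides f y r \<and> y r = y b + (r - b) * u \<and> w r = u"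
    using germ_left[OF orbD(4)[OF o] t0(2) order_refl] by blast
  then have "wmin \<le> \<bar>u\<bar>" using en[of a] by auto
  then show thesis using that[of a u] a by blast
qed

lemma velocity_at_walls:
  assumes o: "orb t0 v0 b y w" and t0: "0 \<le> t0"
    and en: "\<And>t. t0 \<le> t \<Longrightarrow> t \<le> b \<Longrightarrow> wmin \<le> \<bar>w t\<bar>"
  shows "y b = 0 \<Longrightarrow> 0 < w b" "y b = 1 \<Longrightarrow> w b < 0"
proof -
  have W: "0 < wmin" using mC by (simp add: wmin_def)
  have ne: "t0 < b" if "y b = 0 \<or> y b = 1"
    using that orbD(1,2)[OF o] mot_f_bounds[of t0] by (cases "t0 = b") auto
  show "0 < w b" if y: "y b = 0"
  proof -
    obtain a u where a: "t0 \<le> a" "a < b" "w b = reflect f b (y b) u" "wmin \<le> \<bar>u\<bar>"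
      "\<And>r. a < r \<Longrightarrow> r < b \<Longrightarrow> y r = y b + (r - b) * u"
      using left_velocity[OF o t0 _ en] ne y by metis
    define r where "r = (a + b) / 2"
    have r: "a < r" "r < b" using a(2) by (auto simp: r_def)
    then have "0 \<le> (r - b) * u" using a(5)[OF r] orbD(5)[OF o, of r] a(1) y by auto
    then have "u \<le> 0" using r by (simp add: zero_le_mult_iff)
    then show ?thesis using a(3,4) y W by (simp add: reflect_def)
  qed
  show "w b < 0" if y: "y b = 1"
  proof -
    obtain a u where a: "t0 \<le> a" "a < b" "w b = reflect f b (y b) u" "wmin \<le> \<bar>u\<bar>"
      "\<And>r. a < r \<Longrightarrow> r < b \<Longrightarrow> y r = y b + (r - b) * u"
      using left_velocity[OF o t0 _ en] ne y by metis
    define r where "r = (a + b) / 2"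
    have r: "a < r" "r < b" using a(2) by (auto simp: r_def)
    then have "(r - b) * u \<le> 0" using a(5)[OF r] orbD(5)[OF o, of r] a(1) y by auto
    then have "0 \<le> u" using r by (simp add: mult_le_0_iff)
    then show ?thesis using a(3,4) y W by (simp add: reflect_def)
  qed
qed

text \<open>A line steeper than the slit's maximal speed crosses it transversally and lies on the
  side given by its direction.\<close>

lemma slit_line_sign:
  assumes "C < \<bar>u\<bar>" "r \<noteq> b"
  shows "0 < (g n b + (r - b) * u - g n r) * ((r - b) * u)"
proof -
  define x where "x = (r - b) * u"
  define z where "z = g n b - g n r"
  have "\<bar>z\<bar> \<le> C * \<bar>r - b\<bar>" using Lip_g[of n b r] by (simp add: z_def abs_minus_commute)
  also have "\<dots> < \<bar>u\<bar> * \<bar>r - b\<bar>" using assms by (intro mult_strict_right_mono) auto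
  finally have "\<bar>z\<bar> < \<bar>x\<bar>" by (simp add: x_def abs_mult mult.commute)
  then have "0 < (z + x) * x" by (rule dominant_sign)
  then show ?thesis by (simp add: x_def z_def algebra_simps)
qed

text \<open>A fast ball always leaves the curve it is on: walls have turned its velocity inwards,
  and from the slit it separates at once. So a short straight flight can be appended.\<close>

lemma orb_extend_right:
  assumes o: "orb t0 v0 b y w" and t0: "0 \<le> t0"
    and en: "\<And>t. t0 \<le> t \<Longrightarrow> t \<le> b \<Longrightarrow> wmin \<le> \<bar>w t\<bar>"
  shows "\<exists>b'>b. \<exists>y w. orb t0 v0 b' y w"
proof -
  have t0b: "t0 \<le> b" by (rule orbD(1)[OF o])
  have "c 0 \<le> b" using t0 t0b c0_neg by linarith
  then obtain n where n: "c n \<le> b" "b < c (Suc n)" by (rule locate_c)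
  define l where "l r = y b + (r - b) * w b" for r
  define D where "D r = l r - g n r" for r
  have W: "C < wmin" "2 * C < wmin" "0 < wmin" using mC by (auto simp: wmin_def)
  have wb: "wmin \<le> \<bar>w b\<bar>" using en t0b by simp
  have yb: "0 \<le> y b" "y b \<le> 1" using orbD(5)[OF o t0b] by auto
  have lim: "(l \<longlongrightarrow> y b) (at_right b)" unfolding l_def by (auto intro!: tendsto_eq_intros)
  have limD: "(D \<longlongrightarrow> y b - g n b) (at_right b)"
  proof -
    have "isCont (g n) b" by (rule slit_motion_continuous(4)[OF mot_g])
    then have "(g n \<longlongrightarrow> g n b) (at_right b)" unfolding isCont_def by (rule filterlim_mono) (auto simp: at_le)
    then show ?thesis unfolding D_def by (intro tendsto_diff lim)
  qed
  have gt: "\<forall>\<^sub>F r in at_right b. b < r" by (simp add: eventually_at_filter)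
  have ev0: "\<forall>\<^sub>F r in at_right b. l r \<noteq> 0"
  proof (cases "y b = 0")
    case True
    then have "0 < w b" using velocity_at_walls(1)[OF o t0 en] by blast
    then show ?thesis using gt by (auto simp: l_def True elim: eventually_mono)
  next
    case False
    then show ?thesis using tendsto_imp_eventually_ne[OF lim] by simp
  qed
  have ev1: "\<forall>\<^sub>F r in at_right b. l r \<noteq> 1"
  proof (cases "y b = 1")
    case True
    then have "w b < 0" using velocity_at_walls(2)[OF o t0 en] by blast
    then show ?thesis using gt by (auto simp: l_def True elim: eventually_mono)
  next
    case False
    then show ?thesis using tendsto_imp_eventually_ne[OF lim] by simp
  qed
  \<comment> \<open>Its sign is the side of the slit on which the ball is found right after
    b.\<close>
  define \<sigma> where "\<sigma> = (if y b = g n b then w b else y b - g n b)"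
  have evD: "\<forall>\<^sub>F r in at_right b. 0 < D r * \<sigma>"
  proof (cases "y b = g n b")
    case True
    show ?thesis using gt
    proof eventually_elim
      case (elim r)
      have "0 < (g n b + (r - b) * w b - g n r) * ((r - b) * w b)"
        by (rule slit_line_sign) (use W wb elim in auto)
      then have "0 < (r - b) * (D r * \<sigma>)" using True by (simp add: D_def l_def \<sigma>_def mult_ac)
      then show ?case using elim by (simp add: zero_less_mult_iff)
    qed
  next
    case False
    have "((\<lambda>r. D r * \<sigma>) \<longlongrightarrow> (y b - g n b) * \<sigma>) (at_right b)" by (intro tendsto_mult_right limD)
    moreover have "0 < (y b - g n b) * \<sigma>" using False by (simp add: \<sigma>_def zero_less_mult_iff) linarith
    ultimately show ?thesis by (rule order_tendstoD)
  qed
  have evc: "\<forall>\<^sub>F r in at_right b. r < c (Suc n)"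
    using n(2) by (intro order_tendstoD(2)[OF tendsto_ident_at])
  have "\<forall>\<^sub>F r in at_right b. l r \<noteq> 0 \<and> l r \<noteq> 1 \<and> 0 < D r * \<sigma> \<and> r < c (Suc n)"
    using ev0 ev1 evD evc by eventually_elim simp
  then obtain e where e: "b < e" "\<And>r. b < r \<Longrightarrow> r < e \<Longrightarrow> l r \<noteq> 0 \<and> l r \<noteq> 1 \<and> 0 < D r * \<sigma> \<and> r < c (Suc n)"
    unfolding eventually_at_right_field by blast
  define b' where "b' = (b + e) / 2"
  have b': "b < b'" "b' < e" using e(1) by (auto simp: b'_def)
  have fr: "f r = g n r" "\<not> crit r" if "b < r" "r < e" for r
    using between_c[of n r] e(2)[OF that] that n by auto
  have pos2: "0 \<le> D r * D t" if "b < r" "r < e" "b < t" "t < e" for r t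
  proof -
    have "0 < D r * \<sigma>" "0 < D t * \<sigma>" using e(2) that by auto
    then show ?thesis by (auto simp: zero_less_mult_iff zero_le_mult_iff)
  qed
  have l01: "0 < l b' \<and> l b' < 1"
  proof -
    have cl: "continuous_on {b..b'} l" unfolding l_def by (intro continuous_intros)
    have "l b' \<noteq> 0" "l b' \<noteq> 1" using e(2) b' by auto
    moreover have "\<not> l b' < 0"
    proof
      assume neg: "l b' < 0"
      show False
      proof (cases "y b = 0")
        case True
        then have "0 < w b" using velocity_at_walls(1)[OF o t0 en] by blast
        then have "0 < (b' - b) * w b" using b' by simp
        then show False using neg True by (simp add: l_def)
      next
        case False
        then have "l b > 0" using yb by (simp add: l_def)
        obtain z where "b \<le> z" "z \<le> b'" "l z = 0" using IVT2'[of l b' 0 b] neg \<open>l b > 0\<close> b' cl by auto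
        then show False using e(2)[of z] b' \<open>l b > 0\<close> by (cases "z = b") auto
      qed
    qed
    moreover have "\<not> 1 < l b'"
    proof
      assume big: "1 < l b'"
      show False
      proof (cases "y b = 1")
        case True
        then have "w b < 0" using velocity_at_walls(2)[OF o t0 en] by blast
        then have "(b' - b) * w b < 0" using b' by (simp add: mult_pos_neg)
        then show False using big True by (simp add: l_def)
      next
        case False
        then have "l b < 1" using yb by (simp add: l_def)
        obtain z where "b \<le> z" "z \<le> b'" "l z = 1" using IVT'[of l b 1 b'] big \<open>l b < 1\<close> b' cl by auto
        then show False using e(2)[of z] b' \<open>l b < 1\<close> by (cases "z = b") auto
      qed
    qed
    ultimately show ?thesis by linarith
  qed
  have "\<exists>y w. orb t0 v0 b' y w"
  proof (rule orb_extend_line[OF o t0 b'(1)])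
    fix r assume r: "b < r" "r < b'"
    then have "l r \<noteq> 0 \<and> l r \<noteq> 1" "D r \<noteq> 0" using e(2)[of r] b' by auto
    then show "y b + (r - b) * w b \<noteq> 0 \<and> y b + (r - b) * w b \<noteq> 1 \<and> y b + (r - b) * w b \<noteq> f r"
      using fr[of r] r b' by (auto simp: l_def D_def)
  next
    show "0 \<le> y b + (b' - b) * w b" "y b + (b' - b) * w b \<le> 1" using l01 by (auto simp: l_def)
  next
    fix r assume "b < r" "r \<le> b'" "crit r"
    then show "y b + (r - b) * w b \<noteq> fL r \<and> y b + (r - b) * w b \<noteq> fR r" using fr(2)[of r] b' by auto
  next
    fix s t assume st: "b < s" "s \<le> t" "t \<le> b'"
    have "0 \<le> D s * D t" by (rule pos2) (use st b' in auto)
    then show "0 \<le> (y b + (s - b) * w b - f s) * (y b + (t - b) * w b - f t)"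
      using fr(1)[of s] fr(1)[of t] st b' by (simp add: D_def l_def)
  next
    fix s t assume st: "t0 \<le> s" "s \<le> b" "b < t" "t \<le> b'" and nc: "\<And>r. s \<le> r \<Longrightarrow> r \<le> t \<Longrightarrow> \<not> crit r"
    have cb: "c n < b" using nc[of b] st n crit_c[of n] by (cases "c n = b") auto
    have fb: "f b = g n b" using between_c(2)[OF cb n(2)] .
    have Dt: "0 < D t * \<sigma>" using e(2)[of t] st b' by auto
    have "0 \<le> (y s - f s) * \<sigma>"
    proof (cases "y b = g n b")
      case False
      then show ?thesis using orbD(7)[OF o st(1,2) order_refl] nc st fb by (simp add: \<sigma>_def)
    next
      case True
      show ?thesis
      proof (cases "s = b")
        case True
        then show ?thesis using fb \<open>y b = g n b\<close> by simp
      next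
        case False
        then have sb: "s < b" using st by simp
        have "t0 < b" using sb st by simp
        then obtain a u where a: "t0 \<le> a" "a < b" "w b = reflect f b (y b) u" "wmin \<le> \<bar>u\<bar>"
          "\<And>r. a < r \<Longrightarrow> r < b \<Longrightarrow> y r = y b + (r - b) * u"
          using left_velocity[OF o t0 _ en] by metis
        have "y b \<noteq> 0" "y b \<noteq> 1" using True slit_motionD(5,6)[OF mot_g, of n b] by auto
        then have wu: "w b = - u + 2 * deriv (g n) b"
          using a(3) True fb deriv_f_between_c[OF cb n(2)] by (simp add: reflect_def)
        define q where "q = (max (max s a) (c n) + b) / 2"
        have q: "s < q" "a < q" "q < b" "c n < q" using sb a(2) cb by (auto simp: q_def)
        have "0 \<le> (y s - f s) * (y q - f q)"
          by (rule orbD(7)[OF o st(1)]) (use q nc st in auto)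
        moreover have yq: "y q - f q = g n b + (q - b) * u - g n q"
          using a(5)[of q] q True between_c(2)[of n q] n by simp
        have "0 < (g n b + (q - b) * u - g n q) * ((q - b) * u)"
          by (rule slit_line_sign) (use a(4) W q in auto)
        then have "0 < (b - q) * ((y q - f q) * (- u))" unfolding yq by (simp add: algebra_simps)
        then have "0 < (y q - f q) * (- u)" by (rule zero_less_mult_pos) (use q in simp)
        \<comment> \<open>The kick is smaller than the incoming speed, so the outgoing velocity is
          opposite to the incoming one and the ball returns to the side it came from.\<close>
        moreover have "0 < (- u) * w b"
        proof -
          have "\<bar>2 * deriv (g n) b\<bar> < \<bar>- u\<bar>" using a(4) W g_bd(3)[of n b] by simp
          then have "0 < (2 * deriv (g n) b + - u) * (- u)" by (rule dominant_sign)
          then show ?thesis unfolding wu by (simp add: mult.commute)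
        qed
        moreover have "\<sigma> = w b" using True by (simp add: \<sigma>_def)
        ultimately show ?thesis by (simp only:) (rule sign_chain)
      qed
    qed
    then have "0 \<le> (y s - f s) * D t"
      using Dt by (auto simp: zero_le_mult_iff zero_less_mult_iff)
    then show "0 \<le> (y s - f s) * (y b + (t - b) * w b - f t)"
      using fr(1)[of t] st b' by (simp add: D_def l_def)
  qed
  then show ?thesis using b'(1) by blast
qed

text \<open>Within a time too short to cross a chamber, two consecutive collisions would both be
  with the slit, which a ball faster than the slit cannot do. Hence a bounded speed excludes
  accumulation of collisions at e.\<close>

lemma orb_no_zeno:
  assumes t0: "0 \<le> t0" "t0 < e"
    and o: "\<And>b. t0 \<le> b \<Longrightarrow> b < e \<Longrightarrow> orb t0 v0 b y w"
    and en: "\<And>t. t0 \<le> t \<Longrightarrow> t < e \<Longrightarrow> wmin \<le> \<bar>w t\<bar> \<and> \<bar>w t\<bar> \<le> Wm"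
    and n: "c n < e" "e \<le> c (Suc n)"
  obtains b where "t0 < b" "c n < b" "b < e" "\<And>r. b \<le> r \<Longrightarrow> r < e \<Longrightarrow> \<not> collides f y r"
proof -
  have Wm: "0 < wmin" "C < wmin" "0 < Wm" using en[of t0] t0 mC by (auto simp: wmin_def)
  \<comment> \<open>During this time the ball travels less than m, the minimal distance between the
    slit and the walls.\<close>
  define d where "d = m / (Wm + 1)"
  have d: "0 < d" "d * Wm < m" using mC Wm by (auto simp: d_def field_simps)
  define b1 where "b1 = max (max t0 (c n)) (e - d)"
  have b1: "t0 \<le> b1" "c n \<le> b1" "b1 < e" "e - d \<le> b1" using t0 n d by (auto simp: b1_def)
  have no2: False if r: "b1 < r" "r < e" "collides f y r" and q: "r < q" "q < e" "collides f y q" for r q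
  proof -
    have oq: "orb t0 v0 q y w" using o[of q] b1 r q by simp
    note fli = orbD(4)[OF oq]
    define S where "S = {p \<in> {t0..q}. collides f y p} \<inter> {r<..q}"
    have finS: "finite S" using fli by (simp add: S_def flight_def)
    have "q \<in> S" using q r b1 by (simp add: S_def)
    then have "Min S \<in> S" using Min_in[OF finS] by blast
    define p where "p = Min S"
    have p: "r < p" "p \<le> q" "collides f y p" using \<open>Min S \<in> S\<close> by (auto simp: S_def p_def)
    have nc: "\<not> collides f y z" if "r < z" "z < p" for z
    proof
      assume "collides f y z"
      then have "z \<in> S" using that p r b1 by (auto simp: S_def)
      then have "p \<le> z" unfolding p_def by (rule Min_le[OF finS])
      then show False using that by simp
    qed
    have yp: "y p = y r + (p - r) * w r"
      using flightD(1)[OF fli _ p(1,2)] nc r b1 by auto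
    have wr: "wmin \<le> \<bar>w r\<bar>" "\<bar>w r\<bar> \<le> Wm" using en[of r] r b1 by auto
    have "\<bar>(p - r) * w r\<bar> \<le> d * Wm" unfolding abs_mult
      using wr p q r b1 by (intro mult_mono) auto
    then have near: "\<bar>y p - y r\<bar> < m" using d(2) yp by linarith
    have ne: "(p - r) * w r \<noteq> 0" using wr Wm p(1) by auto
    have fr: "f r = g n r" "f p = g n p" using between_c(2)[of n r] between_c(2)[of n p] r p q b1 n by auto
    have cr: "y r = 0 \<or> y r = 1 \<or> y r = g n r" "y p = 0 \<or> y p = 1 \<or> y p = g n p"
      using r(3) p(3) fr by (auto simp: collides_def)
    have "\<not> (y r = g n r \<and> y p = g n p)"
    proof
      assume "y r = g n r \<and> y p = g n p"
      then have "(p - r) * w r = g n p - g n r" using yp by linarith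
      then have "\<bar>(p - r) * w r\<bar> \<le> C * \<bar>p - r\<bar>" using Lip_g[of n p r] by simp
      then have "\<bar>p - r\<bar> * \<bar>w r\<bar> \<le> \<bar>p - r\<bar> * C" by (simp add: abs_mult mult.commute)
      then have "\<bar>w r\<bar> \<le> C" using p(1) by simp
      then show False using wr Wm by simp
    qed
    then show False using cr near ne yp g_bd(1,2)[of n r] g_bd(1,2)[of n p] mC(2) by auto
  qed
  show thesis
  proof (cases "\<exists>r. b1 < r \<and> r < e \<and> collides f y r")
    case True
    then obtain r where r: "b1 < r" "r < e" "collides f y r" by blast
    show thesis
    proof (rule that)
      show "t0 < (r + e) / 2" "c n < (r + e) / 2" "(r + e) / 2 < e" using r b1 by auto
      fix q assume "(r + e) / 2 \<le> q" "q < e"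
      then show "\<not> collides f y q" using no2[OF r, of q] r by auto
    qed
  next
    case False
    show thesis
    proof (rule that)
      show "t0 < (b1 + e) / 2" "c n < (b1 + e) / 2" "(b1 + e) / 2 < e" using b1 by auto
      fix q assume "(b1 + e) / 2 \<le> q" "q < e"
      then show "\<not> collides f y q" using False b1 by auto
    qed
  qed
qed

text \<open>The last flight before e has no collisions and is extended by continuity to e. The only
  obstruction would be a slit met at e when e is critical, and that places the initial condition in
  \<open>Null_set\<close>.\<close>

lemma orb_extend_limit:
  assumes t0: "0 \<le> t0" "t0 < e" and nn: "(t0, v0) \<notin> Null_set"
    and o: "\<And>b. t0 \<le> b \<Longrightarrow> b < e \<Longrightarrow> orb t0 v0 b y w"
    and en: "\<And>t. t0 \<le> t \<Longrightarrow> t < e \<Longrightarrow> wmin \<le> \<bar>w t\<bar> \<and> \<bar>w t\<bar> \<le> Wm"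
  shows "\<exists>y w. orb t0 v0 e y w"
proof -
  have "c 0 \<le> e" using t0 c0_neg by linarith
  then obtain n0 where n0: "c n0 \<le> e" "e < c (Suc n0)" by (rule locate_c)
  have "\<exists>n. c n < e \<and> e \<le> c (Suc n)"
  proof (cases "c n0 = e")
    case True
    then have "n0 \<noteq> 0" using t0 c0_neg by (cases n0) auto
    then obtain n where "n0 = Suc n" using not0_implies_Suc by blast
    then show ?thesis using True c_less_Suc[of n] by (intro exI[of _ n]) auto
  next
    case False
    then show ?thesis using n0 by (intro exI[of _ n0]) auto
  qed
  then obtain n where n: "c n < e" "e \<le> c (Suc n)" by blast
  obtain b where b: "t0 < b" "c n < b" "b < e" "\<And>r. b \<le> r \<Longrightarrow> r < e \<Longrightarrow> \<not> collides f y r"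
    using orb_no_zeno[OF t0 o en n] by blast
  define l where "l r = y b + (r - b) * w b" for r
  have ob: "orb t0 v0 b y w" using o b by simp
  have yl: "y r = l r" if r: "b \<le> r" "r < e" for r
  proof (cases "b = r")
    case False
    then have "b < r" using r by simp
    then show ?thesis
      using flightD(1)[OF orbD(4)[OF o[of r]], of b r] b r by (auto simp: l_def)
  qed (simp add: l_def)
  have fr: "f r = g n r" "\<not> crit r" if "b \<le> r" "r < e" for r
    using between_c[of n r] that b n by auto
  have cl: "continuous_on S l" for S unfolding l_def by (intro continuous_intros)
  show ?thesis
  proof (rule orb_extend_line[OF ob t0(1) b(3)])
    fix r assume r: "b < r" "r < e"
    then have "\<not> collides f y r" using b by simp
    then show "y b + (r - b) * w b \<noteq> 0 \<and> y b + (r - b) * w b \<noteq> 1 \<and> y b + (r - b) * w b \<noteq> f r"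
      using yl[of r] r by (auto simp: collides_def l_def)
  next
    have y01: "0 \<le> l r" "0 \<le> 1 - l r" if "b < r" "r < e" for r
      using orbD(5)[OF o[of r], of r] yl[of r] that b by auto
    have "0 \<le> l e" by (rule limit_le_endpoints[of b e]) (use y01 cl b in auto)
    then show "0 \<le> y b + (e - b) * w b" by (simp add: l_def)
    have "0 \<le> 1 - l e"
      by (rule limit_le_endpoints[of b e "\<lambda>r. 1 - l r"]) (use y01 cl b in \<open>auto intro!: continuous_intros\<close>)
    then show "y b + (e - b) * w b \<le> 1" by (simp add: l_def)
  next
    fix r assume r: "b < r" "r \<le> e" "crit r"
    then have re: "r = e" using fr(2)[of r] by force
    then have "e = c (Suc n)" using r n between_c(1)[of n e] by force
    show "y b + (r - b) * w b \<noteq> fL r \<and> y b + (r - b) * w b \<noteq> fR r"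
    proof (rule ccontr)
      assume "\<not> ?thesis"
      moreover have "Yt 2 = fL" "Yt 3 = fR" by (simp_all add: Yt_def g_def)
      ultimately have "\<exists>j. y b + (c (Suc n) - b) * w b = Yt j (c (Suc n))"
        unfolding re \<open>e = c (Suc n)\<close> by metis
      then obtain j where j: "y b + (c (Suc n) - b) * w b = Yt j (c (Suc n))" by blast
      have "\<exists>i. y t0 = Yt i t0"
        using orbD(2)[OF ob] f_cases[of t0] \<open>Yt 2 = fL\<close> \<open>Yt 3 = fR\<close> by metis
      then obtain i where i: "y t0 = Yt i t0" by blast
      have "(t0, w t0) \<in> Nul (card {r \<in> {t0<..b}. collides f y r}) i"
        by (rule orb_chain_Nul[OF ob t0(1) _ _ j order_refl _ i refl])
          (use b en \<open>e = c (Suc n)\<close> in auto)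
      then show False using nn orbD(3)[OF ob] by (auto simp: Null_set_def)
    qed
  next
    fix s t assume st: "b < s" "s \<le> t" "t \<le> e" and nc: "\<And>r. s \<le> r \<Longrightarrow> r \<le> t \<Longrightarrow> \<not> crit r"
    show "0 \<le> (y b + (s - b) * w b - f s) * (y b + (t - b) * w b - f t)"
    proof (cases "s = e")
      case True
      then have "t = s" using st by simp
      then show ?thesis by simp
    next
      case False
      then have se: "s < e" using st by simp
      show ?thesis
      proof (cases "t = e")
        case True
        have ec: "e < c (Suc n)" using nc[of e] True st n crit_c[of "Suc n"] by (cases "e = c (Suc n)") auto
        have "0 \<le> (l s - g n s) * (l e - g n e)"
        proof (rule limit_le_endpoints[of s e "\<lambda>t. (l s - g n s) * (l t - g n t)"])
          show "continuous_on {s..e} (\<lambda>t. (l s - g n s) * (l t - g n t))"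
            by (intro continuous_on_mult continuous_on_const continuous_on_diff cl continuous_g)
          fix t' assume t': "s < t'" "t' < e"
          have "0 \<le> (y s - f s) * (y t' - f t')"
            by (rule orbD(7)[OF o[of t']]) (use t' st b fr(2) in auto)
          then show "0 \<le> (l s - g n s) * (l t' - g n t')" using yl[of s] yl[of t'] fr(1)[of s] fr(1)[of t'] t' st by simp
        qed (use se in auto)
        then show ?thesis using True fr(1)[of s] between_c(2)[of n e] st se n ec by (simp add: l_def)
      next
        case False
        have "0 \<le> (y s - f s) * (y t - f t)"
          by (rule orbD(7)[OF o[of t]]) (use False st b nc in auto)
        then show ?thesis using yl[of s] yl[of t] False st se by (simp add: l_def)
      qed
    qed
  next
    fix s t assume st: "t0 \<le> s" "s \<le> b" "b < t" "t \<le> e" and nc: "\<And>r. s \<le> r \<Longrightarrow> r \<le> t \<Longrightarrow> \<not> crit r"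
    show "0 \<le> (y s - f s) * (y b + (t - b) * w b - f t)"
    proof (cases "t = e")
      case True
      have ec: "e < c (Suc n)" using nc[of e] True st n crit_c[of "Suc n"] by (cases "e = c (Suc n)") auto
      have "0 \<le> (y s - f s) * (l e - g n e)"
      proof (rule limit_le_endpoints[of b e "\<lambda>t. (y s - f s) * (l t - g n t)"])
        show "continuous_on {b..e} (\<lambda>t. (y s - f s) * (l t - g n t))"
          by (intro continuous_on_mult continuous_on_const continuous_on_diff cl continuous_g)
        fix t' assume t': "b < t'" "t' < e"
        have "0 \<le> (y s - f s) * (y t' - f t')"
          by (rule orbD(7)[OF o[of t']]) (use t' st b nc True in auto)
        then show "0 \<le> (y s - f s) * (l t' - g n t')" using yl[of t'] fr(1)[of t'] t' by simp
      qed (use b in auto)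
      then show ?thesis using True between_c(2)[of n e] n ec by (simp add: l_def)
    next
      case False
      have "0 \<le> (y s - f s) * (y t - f t)"
        by (rule orbD(7)[OF o[of t]]) (use False st b nc in auto)
      then show ?thesis using yl[of t] False st by (simp add: l_def)
    qed
  qed
qed

text \<open>Continuation: at the supremum of the reachable times an orbit exists by the limit lemma,
  and if this time were before B it could be extended. Speed bounds valid for all partial orbits are
  supplied as a hypothesis.\<close>

lemma orb_exists:
  assumes t0: "0 \<le> t0" "t0 \<le> B" and nn: "(t0, v0) \<notin> Null_set"
    and en: "\<forall>b y w t. b \<le> B \<and> orb t0 v0 b y w \<and> t0 \<le> t \<and> t \<le> b \<longrightarrow> wmin \<le> \<bar>w t\<bar> \<and> \<bar>w t\<bar> \<le> Wm"
  shows "\<exists>y w. orb t0 v0 B y w"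
proof (rule ccontr)
  assume no: "\<not> ?thesis"
  define S where "S = {b. t0 \<le> b \<and> b \<le> B \<and> (\<exists>y w. orb t0 v0 b y w)}"
  have "\<nexists>n. t0 = c n" using nn unfolding Null_set_def by auto
  then have nc: "\<not> crit t0" using crit_iff_c[of t0] t0 c0_neg by simp
  have SI: "b \<in> S" if "t0 \<le> b" "b \<le> B" "orb t0 v0 b y w" for b y w
    unfolding S_def using that by blast
  have SD: "t0 \<le> b" "b \<le> B" "\<exists>y w. orb t0 v0 b y w" if "b \<in> S" for b
    using that unfolding S_def by blast+
  have t0S: "t0 \<in> S" by (rule SI[OF order_refl t0(2) orb_start[OF t0(1) nc]])
  have bdd: "bdd_above S" by (rule bdd_aboveI[of _ B]) (rule SD(2))
  define e where "e = Sup S"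
  have e: "t0 \<le> e" unfolding e_def by (rule cSup_upper[OF t0S bdd])
  have eB: "e \<le> B" unfolding e_def by (rule cSup_least) (use t0S SD(2) in blast)+
  let ?y = "Yc (t0, v0)" and ?w = "Wc (t0, v0)"
  have cand: "orb t0 v0 b ?y ?w" if b: "t0 \<le> b" "b < e" for b
  proof -
    have "\<exists>b'\<in>S. b < b'" by (rule less_cSupD) (use t0S b in \<open>auto simp: e_def\<close>)
    then obtain b' where b': "b' \<in> S" "b < b'" by blast
    then obtain y w where "orb t0 v0 b' y w" using SD(3) by blast
    then show ?thesis by (rule orb_cand[OF _ t0(1) b(1) b'(2)])
  qed
  have "\<exists>y w. orb t0 v0 e y w"
  proof (cases "t0 = e")
    case True
    then show ?thesis using SD(3)[OF t0S] by simp
  next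
    case False
    then have t0e: "t0 < e" using e by simp
    have en': "wmin \<le> \<bar>?w t\<bar> \<and> \<bar>?w t\<bar> \<le> Wm" if "t0 \<le> t" "t < e" for t
      using en[rule_format, of t ?y ?w t] cand[OF that] that eB by simp
    show ?thesis by (rule orb_extend_limit[OF t0(1) t0e nn cand en'])
  qed
  then obtain y w where o: "orb t0 v0 e y w" by blast
  have "e < B"
  proof (rule ccontr)
    assume "\<not> e < B"
    then have "e = B" using eB by simp
    then show False using no o by blast
  qed
  have "wmin \<le> \<bar>w t\<bar>" if "t0 \<le> t" "t \<le> e" for t
    using en[rule_format, of e y w t] eB o that by simp
  then have "\<exists>b'>e. \<exists>y w. orb t0 v0 b' y w" by (rule orb_extend_right[OF o t0(1)])
  then obtain b' y' w' where b': "e < b'" "orb t0 v0 b' y' w'" by blast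
  have "orb t0 v0 (min b' B) y' w'" by (rule orb_restrict[OF b'(2)]) (use e b' t0 in auto)
  then have "min b' B \<in> S" by (rule SI[rotated 2]) (use e b' \<open>e < B\<close> in auto)
  then have "min b' B \<le> e" unfolding e_def by (rule cSup_upper[OF _ bdd])
  then show False using b'(1) \<open>e < B\<close> by simp
qed

end

section \<open>Covers of small measure, and survival under linear maps with strips\<close>

definition cov :: "real set \<Rightarrow> real \<Rightarrow> bool" where
  "cov X r \<longleftrightarrow> (\<exists>S\<in>lmeasurable. X \<subseteq> S \<and> measure lebesgue S \<le> r)"

lemma cov_mono: "cov Y r \<Longrightarrow> X \<subseteq> Y \<Longrightarrow> r \<le> r' \<Longrightarrow> cov X r'"
  unfolding cov_def by (meson order_trans)

lemma cov_interval:
  assumes "X \<subseteq> {a..b}" "0 \<le> r" "b - a \<le> r"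
  shows "cov X r"
proof -
  have "{a..b} \<in> lmeasurable" by simp
  moreover have "measure lebesgue {a..b} \<le> r" using assms by (cases "a \<le> b") auto
  ultimately show ?thesis using assms(1) unfolding cov_def by blast
qed

lemma cov_UN:
  assumes "finite K" "\<And>k. k \<in> K \<Longrightarrow> cov (X k) (r k)"
  shows "cov (\<Union>k\<in>K. X k) (\<Sum>k\<in>K. r k)"
proof -
  obtain S where S: "\<And>k. k \<in> K \<Longrightarrow> S k \<in> lmeasurable \<and> X k \<subseteq> S k \<and> measure lebesgue (S k) \<le> r k"
    using assms(2) unfolding cov_def by metis
  have "(\<Union>k\<in>K. S k) \<in> lmeasurable" using S assms(1) by (intro fmeasurable.finite_UN) auto
  moreover have "measure lebesgue (\<Union>k\<in>K. S k) \<le> (\<Sum>k\<in>K. r k)"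
  proof -
    have "measure lebesgue (\<Union>k\<in>K. S k) \<le> (\<Sum>k\<in>K. measure lebesgue (S k))"
      by (rule measure_UNION_le[OF assms(1)]) (use S in auto)
    also have "\<dots> \<le> (\<Sum>k\<in>K. r k)" using S by (intro sum_mono) auto
    finally show ?thesis .
  qed
  moreover have "(\<Union>k\<in>K. X k) \<subseteq> (\<Union>k\<in>K. S k)" using S by blast
  ultimately show ?thesis unfolding cov_def by blast
qed

lemma sum_disjoint_intervals_le:
  fixes l u :: "int \<Rightarrow> real"
  assumes "finite K" "a \<le> b" "\<And>k. k \<in> K \<Longrightarrow> a \<le> l k \<and> l k \<le> u k \<and> u k \<le> b"
    and "\<And>k k'. k \<in> K \<Longrightarrow> k' \<in> K \<Longrightarrow> k \<noteq> k' \<Longrightarrow> u k \<le> l k' \<or> u k' \<le> l k"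
  shows "(\<Sum>k\<in>K. u k - l k) \<le> b - a"
proof -
  let ?I = "\<lambda>k. {l k<..<u k}"
  have "(\<Sum>k\<in>K. u k - l k) = (\<Sum>k\<in>K. measure lborel (?I k))"
    using assms(3) by (intro sum.cong) auto
  also have "\<dots> = measure lborel (\<Union>k\<in>K. ?I k)"
  proof (rule measure_finite_Union[symmetric])
    show "disjoint_family_on ?I K"
      unfolding disjoint_family_on_def
    proof (intro ballI impI)
      fix k k' assume "k \<in> K" "k' \<in> K" "k \<noteq> k'"
      from assms(4)[OF this] show "?I k \<inter> ?I k' = {}" by auto
    qed
  qed (use assms in auto)
  also have "\<dots> \<le> measure lborel {a..b}"
  proof (rule measure_mono_fmeasurable)
    show "(\<Union>k\<in>K. ?I k) \<subseteq> {a..b}"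
    proof
      fix z assume "z \<in> (\<Union>k\<in>K. ?I k)"
      then obtain k where "k \<in> K" "l k < z" "z < u k" by auto
      then show "z \<in> {a..b}" using assms(3)[of k] by auto
    qed
  qed (use assms in \<open>auto simp: fmeasurable_def\<close>)
  also have "\<dots> = b - a" using assms by simp
  finally show ?thesis .
qed

lemma nat_pred_induct:
  assumes "\<And>N. (N \<noteq> 0 \<Longrightarrow> P (N - 1)) \<Longrightarrow> P N"
  shows "P (N :: nat)"
proof (induction N)
  case 0
  show ?case by (rule assms) simp
next
  case (Suc N)
  show ?case by (rule assms) (use Suc in simp)
qed

text \<open>Level i carries a 2x2 matrix acting on (phase, action) and a set of admissible
  directions of line segments. The matrices preserve these sets, and the bound on phase components
  limits how many strips a segment of parameter length at most 1 can meet.\<close>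

locale linear_survival =
  fixes \<kappa> :: real and A B C D :: "nat \<Rightarrow> real" and dirs :: "nat \<Rightarrow> (real \<times> real) set"
  assumes kappa: "0 < \<kappa>" "\<kappa> < 1"
    and dirs_step: "\<And>i p q. (p, q) \<in> dirs i \<Longrightarrow> (A i * p + B i * q, C i * p + D i * q) \<in> dirs (Suc i)"
    and dirs_bdd: "\<And>i. \<exists>M. \<forall>d\<in>dirs i. \<bar>fst d\<bar> \<le> M"
begin

text \<open>
  A point \<open>(\<phi>, J)\<close> survives level i if its phase is within \<kappa> of an even integer; it is then moved
  by the i-th matrix, after subtracting that integer from the phase.
\<close>

fun LS :: "nat \<Rightarrow> nat \<Rightarrow> real \<Rightarrow> real \<Rightarrow> bool" where
  "LS 0 i \<phi> J \<longleftrightarrow> True"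
| "LS (Suc n) i \<phi> J \<longleftrightarrow> (\<exists>k::int. \<bar>\<phi> - 2 * of_int k\<bar> \<le> \<kappa> \<and>
     LS n (Suc i) (A i * (\<phi> - 2 * of_int k) + B i * J) (C i * (\<phi> - 2 * of_int k) + D i * J))"

fun diter :: "nat \<Rightarrow> nat \<Rightarrow> real \<times> real \<Rightarrow> real \<times> real" where
  "diter 0 i d = d"
| "diter (Suc n) i d = diter n (Suc i) (A i * fst d + B i * snd d, C i * fst d + D i * snd d)"

lemma diter_Suc:
  "diter (Suc n) i d = (A (i + n) * fst (diter n i d) + B (i + n) * snd (diter n i d),
     C (i + n) * fst (diter n i d) + D (i + n) * snd (diter n i d))"
proof (induction n arbitrary: i d)
  case (Suc n)
  show ?case unfolding diter.simps(2)[of "Suc n"] Suc.IH[of "Suc i"] by simp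
qed simp

lemma LS_antimono: "n \<le> n' \<Longrightarrow> LS n' i \<phi> J \<Longrightarrow> LS n i \<phi> J"
proof (induction n arbitrary: n' i \<phi> J)
  case (Suc n)
  then obtain n'' where n'': "n' = Suc n''" "n \<le> n''" by (cases n') auto
  with Suc.prems(2) obtain k :: int where k: "\<bar>\<phi> - 2 * of_int k\<bar> \<le> \<kappa>"
    "LS n'' (Suc i) (A i * (\<phi> - 2 * of_int k) + B i * J) (C i * (\<phi> - 2 * of_int k) + D i * J)" by auto
  from Suc.IH[OF n''(2) k(2)] k(1) show ?case by auto
qed simp

definition surv :: "nat \<Rightarrow> nat \<Rightarrow> real \<times> real \<Rightarrow> real \<Rightarrow> real \<Rightarrow> real \<Rightarrow> real \<Rightarrow> real set" where
  "surv n i d \<phi> J a b = {s \<in> {a..b}. LS n i (\<phi> + s * fst d) (J + s * snd d)}"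

text \<open>After enough steps at most the proportion q of any segment survives, up to an
  arbitrarily small absolute error, uniformly in the segment.\<close>

definition surv_bound :: "real \<Rightarrow> bool" where
  "surv_bound q \<longleftrightarrow> (\<forall>i. \<forall>\<eta>>0. \<exists>n. \<forall>d\<in>dirs i. \<forall>\<phi> J a b. a \<le> b \<and> b - a \<le> 1 \<longrightarrow>
     cov (surv n i d \<phi> J a b) (q * (b - a) + \<eta>))"

text \<open>A strip has width 2\<kappa>; half of an adjacent gap has width 1 - \<kappa>. The ratio
  of the strip to the strip with one such half gap is 2\<kappa> / (1 + \<kappa>).\<close>

definition th :: real where "th = 2 * \<kappa> / (1 + \<kappa>)"

lemma th: "0 < th" "th < 1"
  using kappa by (auto simp: th_def field_simps)

lemma surv_bound_1: "surv_bound 1"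
  unfolding surv_bound_def surv_def
  by (intro allI impI exI[of _ 0] ballI cov_interval) auto

text \<open>
  If an interval meets at least two strips, every strip in it is adjacent to a gap inside the interval.
\<close>

lemma strip_portion:
  fixes \<alpha> \<phi> a b :: real and k k' :: int
  assumes al: "\<alpha> \<noteq> 0" and ne: "k \<noteq> k'"
    and k: "\<exists>s\<in>{a..b}. \<bar>\<phi> + s * \<alpha> - 2 * of_int k\<bar> \<le> \<kappa>"
    and k': "\<exists>s\<in>{a..b}. \<bar>\<phi> + s * \<alpha> - 2 * of_int k'\<bar> \<le> \<kappa>"
  defines "z \<equiv> (2 * of_int k - \<phi>) / \<alpha>" and "\<delta> \<equiv> 1 / \<bar>\<alpha>\<bar>"
  shows "max a (z - \<kappa> * \<delta>) \<le> min b (z + \<kappa> * \<delta>)"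
    and "min b (z + \<kappa> * \<delta>) - max a (z - \<kappa> * \<delta>) \<le> th * (min b (z + \<delta>) - max a (z - \<delta>))"
proof -
  have d: "0 < \<delta>" using al by (simp add: \<delta>_def)
  have dist: "\<bar>s - (2 * of_int j - \<phi>) / \<alpha>\<bar> = \<delta> * \<bar>\<phi> + s * \<alpha> - 2 * of_int j\<bar>" for s and j :: int
  proof -
    have "s - (2 * of_int j - \<phi>) / \<alpha> = (\<phi> + s * \<alpha> - 2 * of_int j) / \<alpha>" using al by (simp add: field_simps)
    then show ?thesis by (simp add: \<delta>_def abs_divide)
  qed
  obtain s where s: "s \<in> {a..b}" "\<bar>s - z\<bar> \<le> \<kappa> * \<delta>"
    using k dist[of _ k] d unfolding z_def by (metis mult.commute mult_left_mono less_imp_le)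
  obtain s' where s': "s' \<in> {a..b}" "\<bar>s' - (2 * of_int k' - \<phi>) / \<alpha>\<bar> \<le> \<kappa> * \<delta>"
    using k' dist[of _ k'] d by (metis mult.commute mult_left_mono less_imp_le)
  have kd: "0 < \<kappa> * \<delta>" "\<kappa> * \<delta> < \<delta>" using d kappa by auto
  show 1: "max a (z - \<kappa> * \<delta>) \<le> min b (z + \<kappa> * \<delta>)" using s kd by auto
  have "\<bar>(2 * of_int k' - \<phi>) / \<alpha> - z\<bar> = \<delta> * \<bar>2 * of_int k' - 2 * of_int k\<bar>"
    unfolding z_def \<delta>_def using al by (simp add: diff_divide_distrib[symmetric] abs_divide)
  also have "\<dots> \<ge> \<delta> * 2"
  proof (rule mult_left_mono)
    have "1 \<le> \<bar>k' - k\<bar>" using ne by linarith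
    then have "(1::real) \<le> \<bar>of_int k' - of_int k\<bar>" by (metis of_int_1_le_iff of_int_abs of_int_diff)
    then show "2 \<le> \<bar>2 * real_of_int k' - 2 * real_of_int k\<bar>" by linarith
  qed (use d in simp)
  \<comment> \<open>Another strip meets the interval, so the interval reaches at least the distance
    \<delta> beyond the centre z on one side and contains a whole half gap there.\<close>
  finally have far: "\<delta> \<le> \<bar>s' - z\<bar>" using s'(2) kd by linarith
  let ?S = "min b (z + \<kappa> * \<delta>) - max a (z - \<kappa> * \<delta>)"
  let ?T = "min b (z + \<delta>) - max a (z - \<delta>)"
  have S: "?S \<le> 2 * (\<kappa> * \<delta>)" by linarith
  have T: "?S + (\<delta> - \<kappa> * \<delta>) \<le> ?T" using far s'(1) kd kappa by (auto simp: abs_if min_def max_def split: if_splits)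
  have "(1 - th) * ?S \<le> (1 - th) * (2 * (\<kappa> * \<delta>))" using S th by (intro mult_left_mono) auto
  also have "\<dots> = th * (\<delta> - \<kappa> * \<delta>)" using kappa by (simp add: th_def field_simps)
  finally have "?S \<le> th * (?S + (\<delta> - \<kappa> * \<delta>))" by (simp add: algebra_simps)
  also have "\<dots> \<le> th * ?T" using T th by (intro mult_left_mono) auto
  finally show "?S \<le> th * ?T" .
qed

lemma surv_step:
  "surv (Suc n) i d \<phi> J a b = (\<Union>k::int. {s \<in> {a..b}. \<bar>\<phi> + s * fst d - 2 * of_int k\<bar> \<le> \<kappa> \<and>
     s \<in> surv n (Suc i) (A i * fst d + B i * snd d, C i * fst d + D i * snd d)
       (A i * (\<phi> - 2 * of_int k) + B i * J) (C i * (\<phi> - 2 * of_int k) + D i * J) a b})"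
proof -
  have "A i * (\<phi> + s * fst d - 2 * of_int k) + B i * (J + s * snd d) =
      A i * (\<phi> - 2 * of_int k) + B i * J + s * (A i * fst d + B i * snd d)"
    "C i * (\<phi> + s * fst d - 2 * of_int k) + D i * (J + s * snd d) =
      C i * (\<phi> - 2 * of_int k) + D i * J + s * (C i * fst d + D i * snd d)" for s and k :: int
    by (simp_all add: algebra_simps)
  then show ?thesis unfolding surv_def by auto
qed

text \<open>Induction on the number of steps until the phase direction becomes steep. If the segment
  meets two strips, each strip is a proportion at most \<open>th\<close> of its cell and q applies
  inside it. If it meets only one, either the direction is already steep and the strip covers a
  parameter set of length at most \<eta>, or the segment is passed to the next level without
  loss.\<close>

lemma surv_bound_step_aux:
  assumes U: "surv_bound q" and q: "0 \<le> q" and \<eta>: "0 < \<eta>"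
  shows "\<exists>n. \<forall>d\<in>dirs i. (\<exists>p\<le>N. 2 / \<eta> \<le> \<bar>fst (diter p i d)\<bar>) \<longrightarrow> (\<forall>\<phi> J a b. a \<le> b \<and> b - a \<le> 1 \<longrightarrow>
     cov (surv n i d \<phi> J a b) (th * q * (b - a) + \<eta>))"
proof (induction N arbitrary: i rule: nat_pred_induct)
  fix N i
  assume IH: "\<And>i. N \<noteq> 0 \<Longrightarrow> \<exists>n. \<forall>d\<in>dirs i. (\<exists>p\<le>N - 1. 2 / \<eta> \<le> \<bar>fst (diter p i d)\<bar>) \<longrightarrow> (\<forall>\<phi> J a b. a \<le> b \<and> b - a \<le> 1 \<longrightarrow>
     cov (surv n i d \<phi> J a b) (th * q * (b - a) + \<eta>))"
  obtain M where M: "\<forall>d\<in>dirs i. \<bar>fst d\<bar> \<le> M" using dirs_bdd by blast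
  \<comment> \<open>Upper bound for the number of strips met; each of them may contribute an error
    \<eta> / \<open>M'\<close>.\<close>
  define M' where "M' = \<bar>M\<bar> + 2"
  have M': "0 < M'" by (simp add: M'_def)
  have "0 < \<eta> / M'" using \<eta> M' by simp
  then obtain n1 where n1: "\<forall>d\<in>dirs (Suc i). \<forall>\<phi> J a b. a \<le> b \<and> b - a \<le> 1 \<longrightarrow>
     cov (surv n1 (Suc i) d \<phi> J a b) (q * (b - a) + \<eta> / M')"
    using U unfolding surv_bound_def by blast
  obtain n2 where n2: "N \<noteq> 0 \<longrightarrow> (\<forall>d\<in>dirs (Suc i). (\<exists>p\<le>N - 1. 2 / \<eta> \<le> \<bar>fst (diter p (Suc i) d)\<bar>) \<longrightarrow> (\<forall>\<phi> J a b. a \<le> b \<and> b - a \<le> 1 \<longrightarrow>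
     cov (surv n2 (Suc i) d \<phi> J a b) (th * q * (b - a) + \<eta>)))"
    using IH[of "Suc i"] by (cases "N = 0") auto
  define n where "n = max n1 n2"
  have sub1: "surv n j d \<phi> J a b \<subseteq> surv n1 j d \<phi> J a b" and sub2: "surv n j d \<phi> J a b \<subseteq> surv n2 j d \<phi> J a b" for j d \<phi> J a b
    unfolding surv_def n_def using LS_antimono[of n1 "max n1 n2"] LS_antimono[of n2 "max n1 n2"] by auto
  show "\<exists>n. \<forall>d\<in>dirs i. (\<exists>p\<le>N. 2 / \<eta> \<le> \<bar>fst (diter p i d)\<bar>) \<longrightarrow> (\<forall>\<phi> J a b. a \<le> b \<and> b - a \<le> 1 \<longrightarrow>
     cov (surv n i d \<phi> J a b) (th * q * (b - a) + \<eta>))"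
  proof (intro exI[of _ "Suc n"] ballI impI allI)
    fix d \<phi> J and a b :: real
    assume d: "d \<in> dirs i" and big: "\<exists>p\<le>N. 2 / \<eta> \<le> \<bar>fst (diter p i d)\<bar>" and ab: "a \<le> b \<and> b - a \<le> 1"
    define \<alpha> where "\<alpha> = fst d"
    define d' where "d' = (A i * fst d + B i * snd d, C i * fst d + D i * snd d)"
    have d': "d' \<in> dirs (Suc i)" using dirs_step[of "fst d" "snd d" i] d by (simp add: d'_def)
    define P where "P k = A i * (\<phi> - 2 * of_int k) + B i * J" for k :: int
    define Q where "Q k = C i * (\<phi> - 2 * of_int k) + D i * J" for k :: int
    define K where "K = {k::int. \<exists>s\<in>{a..b}. \<bar>\<phi> + s * \<alpha> - 2 * of_int k\<bar> \<le> \<kappa>}"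
    have al: "\<bar>\<alpha>\<bar> \<le> \<bar>M\<bar>" using M d by (force simp: \<alpha>_def)
    have nn: "0 \<le> th * q * (b - a)" using th q ab by auto
    have sv: "surv (Suc n) i d \<phi> J a b = (\<Union>k\<in>K. {s \<in> {a..b}. \<bar>\<phi> + s * \<alpha> - 2 * of_int k\<bar> \<le> \<kappa> \<and> s \<in> surv n (Suc i) d' (P k) (Q k) a b})"
      unfolding surv_step K_def \<alpha>_def d'_def P_def Q_def by blast
    show "cov (surv (Suc n) i d \<phi> J a b) (th * q * (b - a) + \<eta>)"
    proof (cases "\<exists>k\<in>K. \<exists>k'\<in>K. k \<noteq> k'")
      case False
      show ?thesis
      proof (cases "K = {}")
        case True
        then have "surv (Suc n) i d \<phi> J a b \<subseteq> {1..0}" unfolding sv by auto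
        then show ?thesis by (rule cov_interval) (use nn \<eta> in auto)
      next
        case Kne: False
        then obtain k where "k \<in> K" by blast
        then have K: "K = {k}" using False by blast
        show ?thesis
        proof (cases "2 / \<eta> \<le> \<bar>\<alpha>\<bar>")
          case True
          then have a0: "\<alpha> \<noteq> 0" using \<eta> by (auto simp: divide_le_0_iff)
          have inc: "surv (Suc n) i d \<phi> J a b \<subseteq> {(2 * of_int k - \<phi>) / \<alpha> - \<kappa> / \<bar>\<alpha>\<bar> .. (2 * of_int k - \<phi>) / \<alpha> + \<kappa> / \<bar>\<alpha>\<bar>}"
          proof
            fix s assume "s \<in> surv (Suc n) i d \<phi> J a b"
            then have "\<bar>\<phi> + s * \<alpha> - 2 * of_int k\<bar> \<le> \<kappa>" unfolding sv K by auto
            moreover have "s - (2 * of_int k - \<phi>) / \<alpha> = (\<phi> + s * \<alpha> - 2 * of_int k) / \<alpha>"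
              using a0 by (simp add: field_simps)
            ultimately have "\<bar>s - (2 * of_int k - \<phi>) / \<alpha>\<bar> \<le> \<kappa> / \<bar>\<alpha>\<bar>"
              by (simp add: abs_divide divide_right_mono)
            then show "s \<in> {(2 * of_int k - \<phi>) / \<alpha> - \<kappa> / \<bar>\<alpha>\<bar> .. (2 * of_int k - \<phi>) / \<alpha> + \<kappa> / \<bar>\<alpha>\<bar>}"
              by (auto simp: abs_le_iff)
          qed
          have "\<kappa> / \<bar>\<alpha>\<bar> + \<kappa> / \<bar>\<alpha>\<bar> \<le> \<eta>"
          proof -
            have "2 * \<kappa> \<le> 2 * 1" using kappa by simp
            also have "\<dots> \<le> \<eta> * \<bar>\<alpha>\<bar>" using True \<eta> by (simp add: field_simps)
            finally show ?thesis using a0 by (simp add: add_divide_distrib[symmetric] divide_le_eq)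
          qed
          then show ?thesis using nn \<eta> by (intro cov_interval[OF inc]) auto
        next
          case small: False
          from big obtain p where p: "p \<le> N" "2 / \<eta> \<le> \<bar>fst (diter p i d)\<bar>" by blast
          \<comment> \<open>The direction is not yet steep, so the steep iterate comes later and the
            next level needs one step less.\<close>
          have "p \<noteq> 0" using p(2) small by (intro notI) (simp add: \<alpha>_def)
          then obtain p' where p': "p = Suc p'" using not0_implies_Suc by blast
          have "\<exists>p\<le>N - 1. 2 / \<eta> \<le> \<bar>fst (diter p (Suc i) d')\<bar>"
            using p p' by (intro exI[of _ p']) (auto simp: d'_def)
          moreover have "N \<noteq> 0" using p p' by simp
          ultimately have "cov (surv n2 (Suc i) d' (P k) (Q k) a b) (th * q * (b - a) + \<eta>)"
            using n2 d' ab by blast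
          then show ?thesis
          proof (rule cov_mono)
            show "surv (Suc n) i d \<phi> J a b \<subseteq> surv n2 (Suc i) d' (P k) (Q k) a b"
              unfolding sv K using sub2[of "Suc i" d' "P k" "Q k" a b] by auto
          qed simp
        qed
      qed
    next
      case True
      then obtain k1 k2 where k12: "k1 \<in> K" "k2 \<in> K" "k1 \<noteq> k2" by blast
      have a0: "\<alpha> \<noteq> 0"
      proof
        assume "\<alpha> = 0"
        then have "\<bar>\<phi> - 2 * of_int k1\<bar> \<le> \<kappa>" "\<bar>\<phi> - 2 * of_int k2\<bar> \<le> \<kappa>" using k12 by (auto simp: K_def)
        then have "\<bar>2 * real_of_int k1 - 2 * of_int k2\<bar> < 2" using kappa by linarith
        then have "\<bar>real_of_int (k1 - k2)\<bar> < 1" by simp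
        then show False using k12(3) by linarith
      qed
      have Ksub: "K \<subseteq> {\<lceil>(\<phi> + a * \<alpha>) / 2 - (\<bar>M\<bar> + 1) / 2\<rceil>..\<lfloor>(\<phi> + a * \<alpha>) / 2 + (\<bar>M\<bar> + 1) / 2\<rfloor>}"
      proof
        fix k assume "k \<in> K"
        then obtain s where s: "a \<le> s" "s \<le> b" "\<bar>\<phi> + s * \<alpha> - 2 * of_int k\<bar> \<le> \<kappa>" by (auto simp: K_def)
        have "\<bar>(s - a) * \<alpha>\<bar> \<le> 1 * \<bar>M\<bar>" unfolding abs_mult using s ab al by (intro mult_mono) auto
        moreover define u v where "u = (s - a) * \<alpha>" and "v = \<phi> + a * \<alpha>"
        moreover have "\<phi> + s * \<alpha> = v + u" by (simp add: u_def v_def algebra_simps)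
        ultimately have "\<bar>u\<bar> \<le> \<bar>M\<bar>" "\<bar>v + u - 2 * of_int k\<bar> \<le> \<kappa>" using s(3) by simp_all
        then have "\<bar>v - 2 * of_int k\<bar> \<le> \<bar>M\<bar> + 1" using kappa by arith
        moreover have "of_int k - v / 2 = - (v - 2 * of_int k) / 2" by simp
        ultimately have "\<bar>of_int k - v / 2\<bar> \<le> (\<bar>M\<bar> + 1) / 2"
          by (simp only: abs_divide abs_minus_cancel) simp
        then have "\<bar>of_int k - (\<phi> + a * \<alpha>) / 2\<bar> \<le> (\<bar>M\<bar> + 1) / 2" by (simp only: v_def)
        then show "k \<in> {\<lceil>(\<phi> + a * \<alpha>) / 2 - (\<bar>M\<bar> + 1) / 2\<rceil>..\<lfloor>(\<phi> + a * \<alpha>) / 2 + (\<bar>M\<bar> + 1) / 2\<rfloor>}"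
          by (simp only: atLeastAtMost_iff ceiling_le_iff le_floor_iff) linarith
      qed
      then have finK: "finite K" by (rule finite_subset) simp
      have "real (card K) \<le> M'"
      proof -
        let ?l = "\<lceil>(\<phi> + a * \<alpha>) / 2 - (\<bar>M\<bar> + 1) / 2\<rceil>" and ?u = "\<lfloor>(\<phi> + a * \<alpha>) / 2 + (\<bar>M\<bar> + 1) / 2\<rfloor>"
        have lu: "?l \<le> ?u" using Ksub k12(1) by force
        have "card K \<le> card {?l..?u}" using Ksub by (intro card_mono) auto
        then have "real (card K) \<le> of_int (?u - ?l + 1)" using lu by simp
        also have "\<dots> \<le> ((\<phi> + a * \<alpha>) / 2 + (\<bar>M\<bar> + 1) / 2) - ((\<phi> + a * \<alpha>) / 2 - (\<bar>M\<bar> + 1) / 2) + 1"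
          using of_int_floor_le[of "(\<phi> + a * \<alpha>) / 2 + (\<bar>M\<bar> + 1) / 2"]
            le_of_int_ceiling[of "(\<phi> + a * \<alpha>) / 2 - (\<bar>M\<bar> + 1) / 2"] unfolding of_int_add of_int_diff of_int_1 by linarith
        also have "\<dots> = M'" by (simp add: M'_def field_simps)
        finally show ?thesis .
      qed
      define \<delta> where "\<delta> = 1 / \<bar>\<alpha>\<bar>"
      define z where "z k = (2 * of_int k - \<phi>) / \<alpha>" for k :: int
      define l where "l k = max a (z k - \<kappa> * \<delta>)" for k
      define u where "u k = min b (z k + \<kappa> * \<delta>)" for k
      have lu: "l k \<le> u k" "u k - l k \<le> th * (min b (z k + \<delta>) - max a (z k - \<delta>))" if "k \<in> K" for k
      proof -
        obtain k' where k': "k' \<in> K" "k \<noteq> k'" using k12 by metis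
        show "l k \<le> u k" "u k - l k \<le> th * (min b (z k + \<delta>) - max a (z k - \<delta>))"
          using strip_portion[OF a0 k'(2), of a b \<phi>] that k'(1)
          unfolding K_def l_def u_def z_def \<delta>_def by blast+
      qed
      have piece: "cov {s \<in> {a..b}. \<bar>\<phi> + s * \<alpha> - 2 * of_int k\<bar> \<le> \<kappa> \<and> s \<in> surv n (Suc i) d' (P k) (Q k) a b}
          (q * (u k - l k) + \<eta> / M')" if k: "k \<in> K" for k
      proof (rule cov_mono)
        have "u k - l k \<le> 1" using ab min.cobounded1[of b "z k + \<kappa> * \<delta>"] max.cobounded1[of a "z k - \<kappa> * \<delta>"]
          unfolding l_def u_def by linarith
        then show "cov (surv n1 (Suc i) d' (P k) (Q k) (l k) (u k)) (q * (u k - l k) + \<eta> / M')"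
          using n1 d' lu(1)[OF k] by blast
        show "{s \<in> {a..b}. \<bar>\<phi> + s * \<alpha> - 2 * of_int k\<bar> \<le> \<kappa> \<and> s \<in> surv n (Suc i) d' (P k) (Q k) a b}
          \<subseteq> surv n1 (Suc i) d' (P k) (Q k) (l k) (u k)"
        proof
          fix s assume s: "s \<in> {s \<in> {a..b}. \<bar>\<phi> + s * \<alpha> - 2 * of_int k\<bar> \<le> \<kappa> \<and> s \<in> surv n (Suc i) d' (P k) (Q k) a b}"
          have "s - z k = (\<phi> + s * \<alpha> - 2 * of_int k) / \<alpha>" using a0 by (simp add: z_def field_simps)
          then have "\<bar>s - z k\<bar> \<le> \<kappa> * \<delta>" using s by (simp add: abs_divide \<delta>_def divide_right_mono)
          then have "s \<in> {l k..u k}" using s by (auto simp: l_def u_def abs_le_iff)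
          moreover have "s \<in> surv n1 (Suc i) d' (P k) (Q k) a b" using s sub1 by blast
          ultimately show "s \<in> surv n1 (Suc i) d' (P k) (Q k) (l k) (u k)" by (auto simp: surv_def)
        qed
      qed simp
      have "cov (surv (Suc n) i d \<phi> J a b) (\<Sum>k\<in>K. q * (u k - l k) + \<eta> / M')"
        unfolding sv by (rule cov_UN[OF finK piece])
      moreover have "(\<Sum>k\<in>K. q * (u k - l k) + \<eta> / M') \<le> th * q * (b - a) + \<eta>"
      proof -
        \<comment> \<open>The cells of half-width \<delta> around the strip centres do not overlap,
          since the centres are at least 2 \<delta> apart.\<close>
        have "(\<Sum>k\<in>K. min b (z k + \<delta>) - max a (z k - \<delta>)) \<le> b - a"
        proof (rule sum_disjoint_intervals_le[OF finK])
          fix k assume "k \<in> K"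
          then have "0 \<le> th * (min b (z k + \<delta>) - max a (z k - \<delta>))" using lu[of k] by linarith
          then show "a \<le> max a (z k - \<delta>) \<and> max a (z k - \<delta>) \<le> min b (z k + \<delta>) \<and> min b (z k + \<delta>) \<le> b"
            using th by (auto simp: zero_le_mult_iff)
        next
          fix k k' :: int assume "k \<noteq> k'"
          then have "1 \<le> \<bar>k - k'\<bar>" by linarith
          then have "(1::real) \<le> \<bar>of_int k - of_int k'\<bar>" by (metis of_int_1_le_iff of_int_abs of_int_diff)
          then have "\<delta> * 2 \<le> \<delta> * \<bar>2 * of_int k - 2 * of_int k'\<bar>" by (intro mult_left_mono) (auto simp: \<delta>_def)
          also have "\<dots> = \<bar>z k - z k'\<bar>"
            unfolding z_def \<delta>_def using a0 by (simp add: diff_divide_distrib[symmetric] abs_divide)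
          finally show "min b (z k + \<delta>) \<le> max a (z k' - \<delta>) \<or> min b (z k' + \<delta>) \<le> max a (z k - \<delta>)"
            by (auto simp: abs_if min_le_iff_disj le_max_iff_disj split: if_splits)
        qed (use ab in auto)
        then have 1: "th * (\<Sum>k\<in>K. min b (z k + \<delta>) - max a (z k - \<delta>)) \<le> th * (b - a)"
          using th by (intro mult_left_mono) auto
        have "(\<Sum>k\<in>K. u k - l k) \<le> (\<Sum>k\<in>K. th * (min b (z k + \<delta>) - max a (z k - \<delta>)))"
          by (intro sum_mono lu)
        also have "\<dots> = th * (\<Sum>k\<in>K. min b (z k + \<delta>) - max a (z k - \<delta>))" by (simp only: sum_distrib_left)
        finally have "(\<Sum>k\<in>K. u k - l k) \<le> th * (b - a)" using 1 by linarith
        then have "q * (\<Sum>k\<in>K. u k - l k) \<le> q * (th * (b - a))" using q by (intro mult_left_mono)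
        moreover have "real (card K) * (\<eta> / M') \<le> M' * (\<eta> / M')"
          using \<open>real (card K) \<le> M'\<close> \<eta> M' by (intro mult_right_mono) auto
        moreover have "M' * (\<eta> / M') = \<eta>" using M' by simp
        moreover have "(\<Sum>k\<in>K. q * (u k - l k) + \<eta> / M') = q * (\<Sum>k\<in>K. u k - l k) + real (card K) * (\<eta> / M')"
          by (simp only: sum.distrib sum_distrib_left sum_constant)
        ultimately show ?thesis by (simp only: mult_ac)
      qed
      ultimately show ?thesis using cov_mono by blast
    qed
  qed
qed

lemma surv_bound_step:
  assumes U: "surv_bound q" and q: "0 \<le> q"
    and grow: "\<And>i L. \<exists>N. \<forall>d\<in>dirs i. \<exists>p\<le>N. L \<le> \<bar>fst (diter p i d)\<bar>"
  shows "surv_bound (th * q)"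
  unfolding surv_bound_def
proof (intro allI impI)
  fix i :: nat and \<eta> :: real assume \<eta>: "0 < \<eta>"
  obtain N where N: "\<forall>d\<in>dirs i. \<exists>p\<le>N. 2 / \<eta> \<le> \<bar>fst (diter p i d)\<bar>" using grow by blast
  obtain n where "\<forall>d\<in>dirs i. (\<exists>p\<le>N. 2 / \<eta> \<le> \<bar>fst (diter p i d)\<bar>) \<longrightarrow> (\<forall>\<phi> J a b. a \<le> b \<and> b - a \<le> 1 \<longrightarrow>
     cov (surv n i d \<phi> J a b) (th * q * (b - a) + \<eta>))"
    using surv_bound_step_aux[OF U q \<eta>] by blast
  then show "\<exists>n. \<forall>d\<in>dirs i. \<forall>\<phi> J a b. a \<le> b \<and> b - a \<le> 1 \<longrightarrow>
     cov (surv n i d \<phi> J a b) (th * q * (b - a) + \<eta>)"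
    using N by blast
qed

text \<open>Each application of \<open>surv_bound_step\<close> multiplies the surviving proportion
  by \<open>th < 1\<close>.\<close>

theorem survivors_vanish:
  assumes grow: "\<And>i L. \<exists>N. \<forall>d\<in>dirs i. \<exists>p\<le>N. L \<le> \<bar>fst (diter p i d)\<bar>" and \<eta>: "0 < \<eta>"
  shows "\<exists>n. \<forall>d\<in>dirs i. \<forall>\<phi> J a b. a \<le> b \<and> b - a \<le> 1 \<longrightarrow> cov (surv n i d \<phi> J a b) \<eta>"
proof -
  have "surv_bound (th ^ j)" for j
  proof (induction j)
    case (Suc j)
    have "surv_bound (th * th ^ j)"
      by (rule surv_bound_step[OF Suc _ grow]) (use th in simp)
    then show ?case by simp
  qed (simp add: surv_bound_1)
  moreover obtain j where j: "th ^ j < \<eta> / 2" using real_arch_pow_inv[of "\<eta> / 2" th] th \<eta> by auto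
  ultimately have "surv_bound (th ^ j)" by blast
  then obtain n where n: "\<forall>d\<in>dirs i. \<forall>\<phi> J a b. a \<le> b \<and> b - a \<le> 1 \<longrightarrow>
     cov (surv n i d \<phi> J a b) (th ^ j * (b - a) + \<eta> / 2)"
    unfolding surv_bound_def using \<eta> half_gt_zero[OF \<eta>] by blast
  have "cov (surv n i d \<phi> J a b) \<eta>" if "d \<in> dirs i" "a \<le> b" "b - a \<le> 1" for d \<phi> J a b
  proof (rule cov_mono)
    show "cov (surv n i d \<phi> J a b) (th ^ j * (b - a) + \<eta> / 2)" using n that by blast
    have "th ^ j * (b - a) \<le> th ^ j * 1" using that th by (intro mult_left_mono) auto
    then show "th ^ j * (b - a) + \<eta> / 2 \<le> \<eta>" using j by linarith
  qed simp
  then show ?thesis by blast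
qed

text \<open>
  Orbits of the linear system shadow approximate orbits whose phases stay in the smaller strips of
  half-width \<open>\<kappa>0\<close>.
\<close>

lemma LS_shadow:
  assumes \<Lambda>: "1 \<le> \<Lambda>" "\<And>i. \<bar>A i\<bar> + \<bar>B i\<bar> \<le> \<Lambda>" "\<And>i. \<bar>C i\<bar> + \<bar>D i\<bar> \<le> \<Lambda>" and \<eta>: "0 \<le> \<eta>"
  shows "0 \<le> e \<Longrightarrow> (e + \<eta>) * (\<Lambda> + 1) ^ N \<le> \<kappa> - \<kappa>0 \<Longrightarrow>
    (\<And>j. j < N \<Longrightarrow> \<bar>F (i + j)\<bar> \<le> \<kappa>0) \<Longrightarrow>
    (\<And>j. Suc j < N \<Longrightarrow> \<exists>k::int. \<bar>F (Suc (i + j)) - (A (i + j) * F (i + j) + B (i + j) * G (i + j)) - 2 * of_int k\<bar> \<le> \<eta>) \<Longrightarrow>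
    (\<And>j. Suc j < N \<Longrightarrow> \<bar>G (Suc (i + j)) - (C (i + j) * F (i + j) + D (i + j) * G (i + j))\<bar> \<le> \<eta>) \<Longrightarrow>
    (\<exists>k::int. \<bar>\<phi> - F i - 2 * of_int k\<bar> \<le> e) \<Longrightarrow> \<bar>J - G i\<bar> \<le> e \<Longrightarrow> LS N i \<phi> J"
proof (induction N arbitrary: i \<phi> J e)
  case 0
  then show ?case by simp
next
  case (Suc N)
  obtain k :: int where k: "\<bar>\<phi> - F i - 2 * of_int k\<bar> \<le> e" using Suc.prems(6) by blast
  have pow1: "1 \<le> (\<Lambda> + 1) ^ N" using \<Lambda>(1) by (intro one_le_power) simp
  have pow: "(e + \<eta>) * 1 \<le> (e + \<eta>) * (\<Lambda> + 1) ^ Suc N"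
    using Suc.prems(1) \<eta> \<Lambda>(1) by (intro mult_left_mono one_le_power) auto
  then have "e + \<eta> \<le> \<kappa> - \<kappa>0" using order_trans[OF pow Suc.prems(2)] by simp
  then have "e \<le> \<kappa> - \<kappa>0" using \<eta> by linarith
  moreover have "\<bar>F i\<bar> \<le> \<kappa>0" using Suc.prems(3)[of 0] by simp
  ultimately have phik: "\<bar>\<phi> - 2 * of_int k\<bar> \<le> \<kappa>" using k by linarith
  define x where "x = \<phi> - 2 * of_int k - F i"
  define z where "z = J - G i"
  have xz: "\<bar>x\<bar> \<le> e" "\<bar>z\<bar> \<le> e" using k Suc.prems(7) by (auto simp: x_def z_def)
  have lin: "\<bar>p * x + q * z\<bar> \<le> \<Lambda> * e" if "\<bar>p\<bar> + \<bar>q\<bar> \<le> \<Lambda>" for p q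
  proof -
    have "\<bar>p * x + q * z\<bar> \<le> \<bar>p\<bar> * \<bar>x\<bar> + \<bar>q\<bar> * \<bar>z\<bar>" by (simp add: abs_mult[symmetric] abs_triangle_ineq)
    also have "\<dots> \<le> \<bar>p\<bar> * e + \<bar>q\<bar> * e" using xz by (intro add_mono mult_left_mono) auto
    also have "\<dots> = (\<bar>p\<bar> + \<bar>q\<bar>) * e" by (simp add: distrib_right)
    also have "\<dots> \<le> \<Lambda> * e" using that Suc.prems(1) by (intro mult_right_mono)
    finally show ?thesis .
  qed
  show ?case
  proof (cases N)
    case 0
    then show ?thesis using phik by auto
  next
    case (Suc N')
    let ?p = "A i * (\<phi> - 2 * of_int k) + B i * J" and ?q = "C i * (\<phi> - 2 * of_int k) + D i * J"
    have pe: "?p - (A i * F i + B i * G i) = A i * x + B i * z" "?q - (C i * F i + D i * G i) = C i * x + D i * z"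
      by (simp_all add: x_def z_def algebra_simps)
    have "LS N (Suc i) ?p ?q"
    proof (rule Suc.IH[of "\<Lambda> * e + \<eta>"])
      show "0 \<le> \<Lambda> * e + \<eta>" using Suc.prems(1) \<Lambda>(1) \<eta> by simp
      \<comment> \<open>One step turns the error e into at most \<Lambda> e + \<eta>, so e + \<eta>
        grows at most by the factor \<Lambda> + 1; this is why the budget is (e + \<eta>) (\<Lambda>
        + 1)^N.\<close>
      have "\<Lambda> * e + \<eta> + \<eta> \<le> (e + \<eta>) * (\<Lambda> + 1)"
        using Suc.prems(1) \<Lambda>(1) \<eta> mult_right_mono[of 1 \<Lambda> \<eta>] by (simp add: algebra_simps)
      then have "(\<Lambda> * e + \<eta> + \<eta>) * (\<Lambda> + 1) ^ N \<le> (e + \<eta>) * (\<Lambda> + 1) * (\<Lambda> + 1) ^ N"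
        using pow1 by (intro mult_right_mono) auto
      then show "(\<Lambda> * e + \<eta> + \<eta>) * (\<Lambda> + 1) ^ N \<le> \<kappa> - \<kappa>0" using Suc.prems(2) by (simp add: mult.assoc)
      show "\<bar>F (Suc i + j)\<bar> \<le> \<kappa>0" if "j < N" for j using Suc.prems(3)[of "Suc j"] that by simp
      show "\<exists>k::int. \<bar>F (Suc (Suc i + j)) - (A (Suc i + j) * F (Suc i + j) + B (Suc i + j) * G (Suc i + j)) - 2 * of_int k\<bar> \<le> \<eta>"
        if "Suc j < N" for j using Suc.prems(4)[of "Suc j"] that by simp
      show "\<bar>G (Suc (Suc i + j)) - (C (Suc i + j) * F (Suc i + j) + D (Suc i + j) * G (Suc i + j))\<bar> \<le> \<eta>"
        if "Suc j < N" for j using Suc.prems(5)[of "Suc j"] that by simp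
      obtain k' :: int where k': "\<bar>F (Suc i) - (A i * F i + B i * G i) - 2 * of_int k'\<bar> \<le> \<eta>"
        using Suc.prems(4)[of 0] \<open>N = Suc N'\<close> by auto
      have "\<bar>?p - F (Suc i) - 2 * of_int (- k')\<bar> \<le> \<Lambda> * e + \<eta>"
        using lin[OF \<Lambda>(2), of i] k' pe(1) by simp
      then show "\<exists>k::int. \<bar>?p - F (Suc i) - 2 * of_int k\<bar> \<le> \<Lambda> * e + \<eta>" by blast
      have "\<bar>G (Suc i) - (C i * F i + D i * G i)\<bar> \<le> \<eta>" using Suc.prems(5)[of 0] \<open>N = Suc N'\<close> by auto
      then show "\<bar>?q - G (Suc i)\<bar> \<le> \<Lambda> * e + \<eta>" using lin[OF \<Lambda>(3), of i] pe(2) by linarith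
    qed
    then show ?thesis using phik by auto
  qed
qed

end

section \<open>Phase and action of a ball in the lower chamber\<close>

lemma mom_jump:
  assumes "h1 t \<noteq> 0"
  shows "mom h2 x u t = (h2 t / h1 t) * mom h1 x u t - (deriv h2 t * h1 t - deriv h1 t * h2 t) * x t / h1 t"
  using assms by (simp add: mom_def field_simps)

lemma jump_coeff_bound:
  assumes "slit_bounds m C h1" "slit_bounds m C h2" "0 \<le> x t" "x t \<le> 1"
  shows "\<bar>(deriv h2 t * h1 t - deriv h1 t * h2 t) * x t / h1 t\<bar> \<le> 2 * C / m"
proof -
  have b: "0 < m" "0 \<le> C" "m \<le> h1 t" "h1 t \<le> 1" "m \<le> h2 t" "h2 t \<le> 1" "\<bar>deriv h1 t\<bar> \<le> C" "\<bar>deriv h2 t\<bar> \<le> C"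
    using assms(1,2) by (auto simp: slit_bounds_def intro: order_trans[of _ "1 - m" 1])
  have "\<bar>deriv h2 t * h1 t\<bar> \<le> C * 1" "\<bar>deriv h1 t * h2 t\<bar> \<le> C * 1"
    unfolding abs_mult using b by (intro mult_mono; simp)+
  then have "\<bar>deriv h2 t * h1 t - deriv h1 t * h2 t\<bar> \<le> 2 * C" by linarith
  then have "\<bar>(deriv h2 t * h1 t - deriv h1 t * h2 t) * x t\<bar> \<le> 2 * C * 1"
    unfolding abs_mult using assms(3,4) b by (intro mult_mono) auto
  then have "\<bar>(deriv h2 t * h1 t - deriv h1 t * h2 t) * x t\<bar> / \<bar>h1 t\<bar> \<le> 2 * C / m"
    using b by (intro frac_le) auto
  then show ?thesis by (simp only: abs_divide)
qed

lemma adiabatic_ex: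
  assumes mot: "slit_motion h" and bd: "slit_bounds m C h" and eta: "0 < \<eta>"
  shows "\<exists>J0\<ge>1. \<forall>s e x u. bounce h s e x u \<and> e - s \<le> 2 \<and> J0 \<le> \<bar>mom h x u s\<bar> \<longrightarrow>
    \<bar>\<bar>mom h x u e\<bar> - \<bar>mom h x u s\<bar>\<bar> \<le> \<eta> \<and>
    (\<exists>k::int. \<bar>ang h x u e - ang h x u s - \<bar>mom h x u s\<bar> * integral {s..e} (\<lambda>r. 1 / (h r)\<^sup>2) - 2 * of_int k\<bar> \<le> \<eta>)"
    (is "\<exists>J0\<ge>1. \<forall>s e x u. ?B s e x u J0 \<longrightarrow> ?R s e x u")
proof (rule adiabatic[OF mot bd eta])
  fix J0
  assume J0: "1 \<le> J0" and r: "\<And>s e x u. bounce h s e x u \<Longrightarrow> e - s \<le> 2 \<Longrightarrow> J0 \<le> \<bar>mom h x u s\<bar> \<Longrightarrow> ?R s e x u"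
  have "\<forall>s e x u. ?B s e x u J0 \<longrightarrow> ?R s e x u"
  proof (intro allI impI)
    fix s e x u assume "?B s e x u J0"
    then show "?R s e x u" by (elim conjE) (rule r)
  qed
  then show ?thesis using J0 by (intro exI[of _ J0] conjI)
qed

context slits_bd begin

definition hm :: "nat \<Rightarrow> real" where "hm i = g i (c (Suc i))"
definition hp :: "nat \<Rightarrow> real" where "hp i = g (Suc i) (c (Suc i))"
definition rr :: "nat \<Rightarrow> real" where "rr i = hm i / hp i"
definition aa :: "nat \<Rightarrow> real" where
  "aa i = deriv (g (Suc i)) (c (Suc i)) * hm i - deriv (g i) (c (Suc i)) * hp i"
definition bb :: "nat \<Rightarrow> real" where
  "bb i = integral {c (Suc i)..c (Suc (Suc i))} (\<lambda>s. 1 / (g (Suc i) s)\<^sup>2)"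
text \<open>The transition of (phase, action) from just before one critical time to just before the
  next: the jump with rows (r, 0) and (-a, 1/r), followed by the shear adding b times the action to
  the phase. Here r is the ratio of the slit heights before and after, and a, b are the quantities
  a_i' and \<alpha>' or \<beta>' of the trace formula.\<close>

definition matA :: "nat \<Rightarrow> real" where "matA i = rr i - aa i * bb i"
definition matB :: "nat \<Rightarrow> real" where "matB i = bb i / rr i"
definition matC :: "nat \<Rightarrow> real" where "matC i = - aa i"
definition matD :: "nat \<Rightarrow> real" where "matD i = 1 / rr i"

text \<open>Phase and action are recorded with respect to the slit that is about to become
  irrelevant.\<close>

definition ph_at :: "(real \<Rightarrow> real) \<Rightarrow> (real \<Rightarrow> real) \<Rightarrow> nat \<Rightarrow> real" where
  "ph_at y w i = ang (g i) y w (c (Suc i))"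
definition en_at :: "(real \<Rightarrow> real) \<Rightarrow> (real \<Rightarrow> real) \<Rightarrow> nat \<Rightarrow> real" where
  "en_at y w i = \<bar>mom (g i) y w (c (Suc i))\<bar>"

lemma h_bounds: "m \<le> hm i" "hm i \<le> 1" "m \<le> hp i" "hp i \<le> 1" "0 < hm i" "0 < hp i"
  using g_bd(1,2)[of i "c (Suc i)"] g_bd(1,2)[of "Suc i" "c (Suc i)"] mC
  by (auto simp: hm_def hp_def)

lemma m_le_quot: "m \<le> hp i / hm i" "hp i / hm i \<le> 1 / m"
proof -
  have m0: "0 < m" using mC by simp
  have "m / 1 \<le> hp i / hm i" by (rule frac_le) (use h_bounds[of i] m0 in auto)
  then show "m \<le> hp i / hm i" by simp
  show "hp i / hm i \<le> 1 / m" by (rule frac_le) (use h_bounds[of i] m0 in auto)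
qed

lemma adiabatic_g:
  assumes "0 < \<eta>"
  shows "\<exists>J0\<ge>1. \<forall>i s e y w. bounce (g i) s e y w \<and> e - s \<le> 2 \<and> J0 \<le> \<bar>mom (g i) y w s\<bar> \<longrightarrow>
    \<bar>\<bar>mom (g i) y w e\<bar> - \<bar>mom (g i) y w s\<bar>\<bar> \<le> \<eta> \<and>
    (\<exists>k::int. \<bar>ang (g i) y w e - ang (g i) y w s - \<bar>mom (g i) y w s\<bar> * integral {s..e} (\<lambda>r. 1 / (g i r)\<^sup>2) - 2 * of_int k\<bar> \<le> \<eta>)"
    (is "\<exists>J0\<ge>1. \<forall>i. ?P J0 (g i)")
proof -
  have mono: "?P J' h" if P: "?P J h" and le: "J \<le> J'" for J J' h
  proof (intro allI impI)
    fix s e :: real and y w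
    assume a: "bounce h s e y w \<and> e - s \<le> 2 \<and> J' \<le> \<bar>mom h y w s\<bar>"
    have "bounce h s e y w \<and> e - s \<le> 2 \<and> J \<le> \<bar>mom h y w s\<bar>" using a order_trans[OF le] by (elim conjE) (intro conjI)
    then show "\<bar>\<bar>mom h y w e\<bar> - \<bar>mom h y w s\<bar>\<bar> \<le> \<eta> \<and>
      (\<exists>k::int. \<bar>ang h y w e - ang h y w s - \<bar>mom h y w s\<bar> * integral {s..e} (\<lambda>r. 1 / (h r)\<^sup>2) - 2 * of_int k\<bar> \<le> \<eta>)"
      by (rule P[rule_format])
  qed
  from adiabatic_ex[OF motL bdL assms] obtain J1 where J1: "J1 \<ge> 1" "?P J1 fL" by (elim exE conjE) (rule that)
  from adiabatic_ex[OF motR bdR assms] obtain J2 where J2: "J2 \<ge> 1" "?P J2 fR" by (elim exE conjE) (rule that)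
  have P1: "?P (max J1 J2) fL" by (rule mono[OF J1(2)]) simp
  have P2: "?P (max J1 J2) fR" by (rule mono[OF J2(2)]) simp
  have "?P (max J1 J2) (g i)" for i
  proof (cases "g i = fL")
    case True
    show ?thesis unfolding True by (rule P1)
  next
    case False
    then have eq: "g i = fR" using g_cases[of i] by blast
    show ?thesis unfolding eq by (rule P2)
  qed
  then have all: "\<forall>i. ?P (max J1 J2) (g i)" by (rule allI)
  have "1 \<le> max J1 J2" using J1(1) by simp
  then show ?thesis by (intro exI[of _ "max J1 J2"] conjI all)
qed

text \<open>Position and velocity are continuous while the slit changes. At high energy the sign of
  the momentum is kept, so the change is exactly linear in phase and action.\<close>

lemma low_jump:
  assumes y: "0 \<le> y (c (Suc i))" "y (c (Suc i)) \<le> 1"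
    and G: "2 * C / m + 1 \<le> m * en_at y w i"
  shows "\<bar>mom (g (Suc i)) y w (c (Suc i))\<bar> = matC i * ph_at y w i + matD i * en_at y w i"
    "ang (g (Suc i)) y w (c (Suc i)) = rr i * ph_at y w i"
    "m * en_at y w i - 2 * C / m \<le> \<bar>mom (g (Suc i)) y w (c (Suc i))\<bar>"
proof -
  define t where "t = c (Suc i)"
  define P where "P = mom (g i) y w t"
  define Q where "Q = mom (g (Suc i)) y w t"
  define z where "z = aa i * y t / hm i"
  have h: "g i t = hm i" "g (Suc i) t = hp i" by (simp_all add: hm_def hp_def t_def)
  have hb: "0 < hm i" "0 < hp i" using h_bounds by auto
  have Q: "Q = (hp i / hm i) * P - z"
    using mom_jump[of "g i" t "g (Suc i)" y w] hb unfolding P_def Q_def z_def aa_def h t_def[symmetric] by simp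
  have "\<bar>z\<bar> \<le> 2 * C / m"
    using jump_coeff_bound[OF bd_g[of i] bd_g[of "Suc i"], of y t] y
    unfolding z_def aa_def h t_def[symmetric] by simp
  moreover have mP: "m * \<bar>P\<bar> \<le> \<bar>(hp i / hm i) * P\<bar>"
    unfolding abs_mult using m_le_quot[of i] hb by (intro mult_right_mono) auto
  moreover have en: "en_at y w i = \<bar>P\<bar>" by (simp add: en_at_def P_def t_def)
  ultimately have dom: "\<bar>- z\<bar> < \<bar>(hp i / hm i) * P\<bar>" using G by simp
  have P0: "P \<noteq> 0" using dom by auto
  have "0 < (- z + (hp i / hm i) * P) * ((hp i / hm i) * P)" by (rule dominant_sign[OF dom])
  then have "0 < (hp i / hm i) * (Q * P)" unfolding Q by (simp add: algebra_simps)
  then have "0 < Q * P" by (rule zero_less_mult_pos) (use hb in simp)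
  then have sg: "sgn Q = sgn P" by (auto simp: zero_less_mult_iff sgn_if)
  have "\<bar>Q\<bar> = sgn P * Q" using sg by (metis abs_sgn mult.commute)
  also have "\<dots> = (hp i / hm i) * \<bar>P\<bar> - aa i * (sgn P * y t / hm i)"
    unfolding Q z_def by (simp add: algebra_simps abs_sgn)
  also have "\<dots> = matC i * ph_at y w i + matD i * en_at y w i"
    unfolding en by (simp add: matC_def matD_def rr_def ph_at_def ang_def P_def t_def[symmetric] h)
  finally show "\<bar>mom (g (Suc i)) y w (c (Suc i))\<bar> = matC i * ph_at y w i + matD i * en_at y w i"
    by (simp add: Q_def t_def)
  have "ang (g (Suc i)) y w t = sgn P * y t / hp i" using sg by (simp add: ang_def Q_def P_def h)
  also have "\<dots> = rr i * (sgn P * y t / hm i)" using hb by (simp add: rr_def)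
  finally show "ang (g (Suc i)) y w (c (Suc i)) = rr i * ph_at y w i"
    by (simp add: ph_at_def ang_def P_def t_def[symmetric] h)
  show "m * en_at y w i - 2 * C / m \<le> \<bar>mom (g (Suc i)) y w (c (Suc i))\<bar>"
    using mP \<open>\<bar>z\<bar> \<le> 2 * C / m\<close> Q unfolding en Q_def[unfolded t_def, symmetric] by linarith
qed

text \<open>The exact jump followed by the adiabatic estimate on the next interval; the winding
  number of \<open>adiabatic\<close> is the integer k.\<close>

lemma low_step:
  assumes "0 < \<eta>"
  shows "\<exists>J0\<ge>1. \<forall>i t0 v0 b y w. orb t0 v0 b y w \<and> 0 \<le> t0 \<and> t0 \<le> c (Suc i) \<and> c (Suc (Suc i)) \<le> b \<and>
    y (c (Suc i)) < hp i \<and> J0 \<le> en_at y w i \<longrightarrow>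
    \<bar>en_at y w (Suc i) - (matC i * ph_at y w i + matD i * en_at y w i)\<bar> \<le> \<eta> \<and>
    (\<exists>k::int. \<bar>ph_at y w (Suc i) - (matA i * ph_at y w i + matB i * en_at y w i) - 2 * of_int k\<bar> \<le> \<eta>)"
proof -
  have m: "0 < m" "0 \<le> C" using mC by auto
  obtain J1 where J1: "1 \<le> J1" and ad: "\<forall>i s e y w. bounce (g i) s e y w \<and> e - s \<le> 2 \<and> J1 \<le> \<bar>mom (g i) y w s\<bar> \<longrightarrow>
    \<bar>\<bar>mom (g i) y w e\<bar> - \<bar>mom (g i) y w s\<bar>\<bar> \<le> \<eta> \<and>
    (\<exists>k::int. \<bar>ang (g i) y w e - ang (g i) y w s - \<bar>mom (g i) y w s\<bar> * integral {s..e} (\<lambda>r. 1 / (g i r)\<^sup>2) - 2 * of_int k\<bar> \<le> \<eta>)"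
    by (rule exE[OF adiabatic_g[OF assms]]) (elim conjE, rule that)
  \<comment> \<open>The jump costs a factor m and the additive 2C / m; at least \<open>J1\<close> is
    left for the adiabatic estimate.\<close>
  define J0 where "J0 = 1 + (J1 + 2 * C / m + 1) / m"
  have J0: "1 \<le> J0" "J1 + 2 * C / m + 1 \<le> m * J0" using m J1 by (auto simp: J0_def field_simps)
  show ?thesis
  proof (intro exI[of _ J0] conjI allI impI J0(1))
    fix i t0 v0 b y w
    assume a: "orb t0 v0 b y w \<and> 0 \<le> t0 \<and> t0 \<le> c (Suc i) \<and> c (Suc (Suc i)) \<le> b \<and>
      y (c (Suc i)) < hp i \<and> J0 \<le> en_at y w i"
    define s e where "s = c (Suc i)" and "e = c (Suc (Suc i))"
    have se: "s < e" "e - s \<le> 2" using c_less_Suc[of "Suc i"] c_Suc_le[of "Suc i"] by (simp_all add: s_def e_def)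
    have o: "orb t0 v0 b y w" and t0: "0 \<le> t0" "t0 \<le> s" "e \<le> b" using a by (auto simp: s_def e_def)
    have n: "c (Suc i) \<le> s" "e \<le> c (Suc (Suc i))" by (simp_all add: s_def e_def)
    have lt: "s \<in> {s..e}" "y s < g (Suc i) s" using a se by (auto simp: hp_def s_def)
    have bo: "bounce (g (Suc i)) s e y w"
      by (rule orb_bounce(1)[OF o t0 n se(1)]) (rule orb_low[OF o t0 n se(1) lt])
    have y: "0 \<le> y (c (Suc i))" "y (c (Suc i)) \<le> 1" using orbD(5)[OF o, of s] t0 se by (auto simp: s_def)
    have "m * J0 \<le> m * en_at y w i" using a m by (intro mult_left_mono) auto
    then have G: "J1 + 2 * C / m + 1 \<le> m * en_at y w i" using J0(2) by linarith
    then have G': "2 * C / m + 1 \<le> m * en_at y w i" using J1 by linarith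
    note lj = low_jump[OF y G']
    define P where "P = \<bar>mom (g (Suc i)) y w s\<bar>"
    have P: "P = matC i * ph_at y w i + matD i * en_at y w i" using lj(1) by (simp add: P_def s_def)
    have "J1 \<le> \<bar>mom (g (Suc i)) y w s\<bar>" using lj(3) G by (simp add: s_def)
    then have concl: "\<bar>\<bar>mom (g (Suc i)) y w e\<bar> - P\<bar> \<le> \<eta> \<and>
      (\<exists>k::int. \<bar>ang (g (Suc i)) y w e - ang (g (Suc i)) y w s - P * integral {s..e} (\<lambda>r. 1 / (g (Suc i) r)\<^sup>2) - 2 * of_int k\<bar> \<le> \<eta>)"
      using ad[rule_format, of "Suc i" s e y w] bo se(2) unfolding P_def by blast
    have e1: "en_at y w (Suc i) = \<bar>mom (g (Suc i)) y w e\<bar>" "ph_at y w (Suc i) = ang (g (Suc i)) y w e"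
      by (simp_all add: en_at_def ph_at_def e_def)
    show "\<bar>en_at y w (Suc i) - (matC i * ph_at y w i + matD i * en_at y w i)\<bar> \<le> \<eta>"
      using concl unfolding e1 P by blast
    have "matA i * ph_at y w i + matB i * en_at y w i = ang (g (Suc i)) y w s + P * integral {s..e} (\<lambda>r. 1 / (g (Suc i) r)\<^sup>2)"
      unfolding lj(2)[folded s_def] P bb_def[of i, folded s_def e_def, symmetric]
      by (simp add: matA_def matB_def matC_def matD_def algebra_simps)
    then have eq: "ph_at y w (Suc i) - (matA i * ph_at y w i + matB i * en_at y w i) =
      ang (g (Suc i)) y w e - ang (g (Suc i)) y w s - P * integral {s..e} (\<lambda>r. 1 / (g (Suc i) r)\<^sup>2)"
      unfolding e1 by linarith
    show "\<exists>k::int. \<bar>ph_at y w (Suc i) - (matA i * ph_at y w i + matB i * en_at y w i) - 2 * of_int k\<bar> \<le> \<eta>"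
      using concl unfolding eq by blast
  qed
qed

text \<open>A ball leaving the slit faster than the slit moves enters the chamber indicated by the
  sign of its velocity.\<close>

lemma start_germ:
  assumes o: "orb t0 v0 b y w" and t0: "0 \<le> t0" "c n < t0" "t0 < c (Suc n)" "c (Suc n) \<le> b" and v: "C < \<bar>v0\<bar>"
  obtains r where "t0 < r" "r < c (Suc n)" "0 < (y r - g n r) * v0"
proof -
  have "t0 < b" using t0 by simp
  then obtain e where e: "e > t0" "\<forall>r. t0 < r \<and> r < e \<longrightarrow> y r = y t0 + (r - t0) * w t0"
    using germ_right[OF orbD(4)[OF o] order_refl] by blast
  define r where "r = (t0 + min e (c (Suc n))) / 2"
  have r: "t0 < r" "r < e" "r < c (Suc n)" using e(1) t0 by (auto simp: r_def min_def)
  have "f t0 = g n t0" using between_c(2) t0 by blast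
  then have yr: "y r = g n t0 + (r - t0) * v0" using e(2) r orbD(2,3)[OF o] by simp
  have "0 < (g n t0 + (r - t0) * v0 - g n r) * ((r - t0) * v0)"
    by (rule slit_line_sign) (use v r in auto)
  then have "0 < (r - t0) * ((y r - g n r) * v0)" unfolding yr by (simp add: mult_ac)
  then have "0 < (y r - g n r) * v0" by (rule zero_less_mult_pos) (use r in simp)
  then show thesis using that r by blast
qed

text \<open>A ball sent down from the slit starts with phase -1, and its action depends affinely on
  the initial velocity. This makes slices of constant initial time into line segments.\<close>

lemma low_start:
  assumes "0 < \<eta>"
  shows "\<exists>V0\<ge>0. \<forall>n t0 v0 b y w. orb t0 v0 b y w \<and> 0 \<le> t0 \<and> c n < t0 \<and> t0 < c (Suc n) \<and> c (Suc n) \<le> b \<and> v0 \<le> - V0 \<longrightarrow>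
    \<bar>en_at y w n - g n t0 * (deriv (g n) t0 - v0)\<bar> \<le> \<eta> \<and>
    (\<exists>k::int. \<bar>ph_at y w n - (- 1 + g n t0 * (deriv (g n) t0 - v0) * integral {t0..c (Suc n)} (\<lambda>r. 1 / (g n r)\<^sup>2)) - 2 * of_int k\<bar> \<le> \<eta>)"
proof -
  have m: "0 < m" "0 \<le> C" using mC by auto
  obtain J1 where J1: "1 \<le> J1" and ad: "\<forall>i s e y w. bounce (g i) s e y w \<and> e - s \<le> 2 \<and> J1 \<le> \<bar>mom (g i) y w s\<bar> \<longrightarrow>
    \<bar>\<bar>mom (g i) y w e\<bar> - \<bar>mom (g i) y w s\<bar>\<bar> \<le> \<eta> \<and>
    (\<exists>k::int. \<bar>ang (g i) y w e - ang (g i) y w s - \<bar>mom (g i) y w s\<bar> * integral {s..e} (\<lambda>r. 1 / (g i r)\<^sup>2) - 2 * of_int k\<bar> \<le> \<eta>)"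
    by (rule exE[OF adiabatic_g[OF assms]]) (elim conjE, rule that)
  define V0 where "V0 = C + J1 / m + 1"
  have V0: "0 \<le> V0" "C < V0" "J1 \<le> m * (V0 - C)" using m J1 by (auto simp: V0_def field_simps)
  show ?thesis
  proof (intro exI[of _ V0] conjI allI impI V0(1))
    fix n t0 v0 b y w
    assume a: "orb t0 v0 b y w \<and> 0 \<le> t0 \<and> c n < t0 \<and> t0 < c (Suc n) \<and> c (Suc n) \<le> b \<and> v0 \<le> - V0"
    define e where "e = c (Suc n)"
    have o: "orb t0 v0 b y w" and t0: "0 \<le> t0" "t0 \<le> t0" "e \<le> b" using a by (auto simp: e_def)
    have n: "c n \<le> t0" "e \<le> c (Suc n)" and te: "t0 < e" using a by (auto simp: e_def)
    have le2: "e - t0 \<le> 2" using c_Suc_le[of n] n by (simp add: e_def)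
    obtain r where r: "t0 < r" "r < e" "0 < (y r - g n r) * v0"
      using start_germ[OF o t0(1), of n] a V0 by (force simp: e_def)
    then have lt: "r \<in> {t0..e}" "y r < g n r" using a V0 by (auto simp: zero_less_mult_iff)
    have bo: "bounce (g n) t0 e y w"
      by (rule orb_bounce(1)[OF o t0 n te]) (rule orb_low[OF o t0 n te lt])
    have ft: "f t0 = g n t0" using between_c(2)[of n t0] a by blast
    have yw: "y t0 = g n t0" "w t0 = v0" using orbD(2,3)[OF o] ft by auto
    define d where "d = deriv (g n) t0 - v0"
    have d: "V0 - C \<le> d" using g_bd(3)[of n t0] a by (simp add: d_def abs_le_iff)
    have gpos: "m \<le> g n t0" "0 < g n t0" using g_bd(1)[of n t0] m by auto
    have mom0: "mom (g n) y w t0 = - (g n t0 * d)" by (simp add: mom_def yw d_def algebra_simps)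
    have dpos: "0 < d" using d V0 by simp
    then have abs0: "\<bar>mom (g n) y w t0\<bar> = g n t0 * d" unfolding mom0 using gpos by simp
    have "m * (V0 - C) \<le> g n t0 * d" using gpos d V0 m by (intro mult_mono) auto
    then have big: "J1 \<le> \<bar>mom (g n) y w t0\<bar>" using V0 abs0 by simp
    have "sgn (mom (g n) y w t0) = - 1" unfolding mom0 using mult_pos_pos[OF gpos(2) dpos] by simp
    then have ang0: "ang (g n) y w t0 = - 1" using gpos by (simp add: ang_def yw)
    have concl: "\<bar>\<bar>mom (g n) y w e\<bar> - g n t0 * d\<bar> \<le> \<eta> \<and>
      (\<exists>k::int. \<bar>ang (g n) y w e - (- 1) - g n t0 * d * integral {t0..e} (\<lambda>r. 1 / (g n r)\<^sup>2) - 2 * of_int k\<bar> \<le> \<eta>)"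
      using ad[rule_format, of n t0 e y w] bo le2 big unfolding abs0 ang0 by blast
    show "\<bar>en_at y w n - g n t0 * (deriv (g n) t0 - v0)\<bar> \<le> \<eta>"
      using concl unfolding en_at_def e_def d_def by blast
    have eq: "ph_at y w n - (- 1 + g n t0 * (deriv (g n) t0 - v0) * integral {t0..c (Suc n)} (\<lambda>r. 1 / (g n r)\<^sup>2))
      = ang (g n) y w e - (- 1) - g n t0 * d * integral {t0..e} (\<lambda>r. 1 / (g n r)\<^sup>2)"
      unfolding ph_at_def e_def d_def by linarith
    show "\<exists>k::int. \<bar>ph_at y w n - (- 1 + g n t0 * (deriv (g n) t0 - v0) * integral {t0..c (Suc n)} (\<lambda>r. 1 / (g n r)\<^sup>2)) - 2 * of_int k\<bar> \<le> \<eta>"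
      using concl unfolding eq by blast
  qed
qed

end

section \<open>The trapping upper chamber\<close>

locale trap = slits_bd +
  assumes upper: "upper_trapping lam x0 fL fR"
begin

lemma h_period: "hm (Suc (Suc i)) = hm i" "hp (Suc (Suc i)) = hp i"
  by (simp_all add: hm_def hp_def c_Suc_Suc g_Suc_Suc slit_motionD(4)[OF mot_g])

text \<open>This is the trapping hypothesis at the two critical times of one period, continued
  periodically.\<close>

lemma hp_less_hm: "hp i < hm i"
proof (induction i rule: induct_nat_012)
  case (ge2 n)
  then show ?case by (simp add: h_period)
qed (use upper in \<open>auto simp: upper_trapping_def hm_def hp_def g_def c_def\<close>)

lemma hm_less_1: "hm i < 1"
  using g_bd(2)[of i "c (Suc i)"] mC by (simp add: hm_def)

text \<open>The constants of this lemma and the next are uniform because only two values of i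
  matter. This one gives the half-width of the strip of phases that can stay below, the next one the
  energy gain above.\<close>

lemma ex_contraction: "\<exists>\<kappa>0. 0 < \<kappa>0 \<and> \<kappa>0 < 1 \<and> (\<forall>i. hp i \<le> \<kappa>0 * hm i)"
proof -
  define q where "q i = hp i / hm i" for i
  have q: "0 < q i" "q i < 1" "hp i = q i * hm i" for i
    using hp_less_hm[of i] h_bounds[of i] by (auto simp: q_def)
  have "hp i \<le> max (q 0) (q 1) * hm i" for i
  proof (induction i rule: induct_nat_012)
    case (ge2 n)
    then show ?case by (simp add: h_period)
  next
    case 1
    have "q 1 * hm 1 \<le> max (q 0) (q 1) * hm 1" using h_bounds[of 1] by (intro mult_right_mono) auto
    then show ?case using q(3)[of 1] by simp
  next
    case 0
    have "q 0 * hm 0 \<le> max (q 0) (q 1) * hm 0" using h_bounds[of 0] by (intro mult_right_mono) auto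
    then show ?case using q(3)[of 0] by simp
  qed
  then show ?thesis using q by (intro exI[of _ "max (q 0) (q 1)"]) (auto simp: less_max_iff_disj)
qed

lemma ex_expansion: "\<exists>\<rho>0>1. \<forall>i. \<rho>0 * (1 - hm i) \<le> 1 - hp i"
proof -
  define q where "q i = (1 - hp i) / (1 - hm i)" for i
  have q: "1 < q i" "1 - hp i = q i * (1 - hm i)" for i
    using hp_less_hm[of i] hm_less_1[of i] by (auto simp: q_def)
  have "min (q 0) (q 1) * (1 - hm i) \<le> 1 - hp i" for i
  proof (induction i rule: induct_nat_012)
    case (ge2 n)
    then show ?case by (simp add: h_period)
  next
    case 1
    have "min (q 0) (q 1) * (1 - hm 1) \<le> q 1 * (1 - hm 1)" using hm_less_1[of 1] by (intro mult_right_mono) auto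
    then show ?case using q(2)[of 1] by simp
  next
    case 0
    have "min (q 0) (q 1) * (1 - hm 0) \<le> q 0 * (1 - hm 0)" using hm_less_1[of 0] by (intro mult_right_mono) auto
    then show ?case using q(2)[of 0] by simp
  qed
  then show ?thesis using q by (intro exI[of _ "min (q 0) (q 1)"]) auto
qed

definition upm :: "(real \<Rightarrow> real) \<Rightarrow> (real \<Rightarrow> real) \<Rightarrow> nat \<Rightarrow> real \<Rightarrow> real" where
  "upm y w n t = \<bar>mom (\<lambda>t. 1 - g n t) (\<lambda>t. 1 - y t) (\<lambda>t. - w t) t\<bar>"

lemma upm_bounds:
  assumes "0 \<le> y t" "y t \<le> 1"
  shows "m * \<bar>w t\<bar> - C \<le> upm y w n t" "upm y w n t \<le> \<bar>w t\<bar> + C"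
  using mom_bounds[OF flip_slit_bounds[OF mot_g[of n] bd_g[of n]], where x = "\<lambda>t. 1 - y t" and t = t and u = "\<lambda>t. - w t"] assms
  by (auto simp: upm_def)

lemma up_segment:
  assumes o: "orb t0 v0 b y w" and t0: "0 \<le> t0" "t0 \<le> c (Suc j)" and up: "hp j < y (c (Suc j))"
    and t: "c (Suc j) \<le> t" "t \<le> b" "t \<le> c (Suc (Suc j))"
  shows "g (Suc j) t \<le> y t" "\<bar>upm y w (Suc j) t - upm y w (Suc j) (c (Suc j))\<bar> \<le> 2 * C + 1"
proof -
  define s where "s = c (Suc j)"
  have "g (Suc j) t \<le> y t \<and> \<bar>upm y w (Suc j) t - upm y w (Suc j) s\<bar> \<le> 2 * C + 1"
  proof (cases "t = s")
    case True
    then show ?thesis using up mC by (simp add: hp_def s_def)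
  next
    case False
    then have st: "s < t" using t by (simp add: s_def)
    have pre: "0 \<le> t0" "t0 \<le> s" "t \<le> b" "c (Suc j) \<le> s" "t \<le> c (Suc (Suc j))" using t0 t by (simp_all add: s_def)
    have lt: "s \<in> {s..t}" "g (Suc j) s < y s" using up st by (auto simp: hp_def s_def)
    have le: "g (Suc j) r \<le> y r" if "s < r" "r < t" for r by (rule orb_up[OF o pre st lt that])
    have bo: "bounce (\<lambda>t. 1 - g (Suc j) t) s t (\<lambda>t. 1 - y t) (\<lambda>t. - w t)"
      by (rule orb_bounce(2)[OF o pre st]) (rule le)
    have "continuous_on {s..t} (\<lambda>t. y t - g (Suc j) t)"
      by (intro continuous_intros orb_continuous[OF o] pre continuous_g)
    then have "0 \<le> y t - g (Suc j) t"
      by (rule limit_le_endpoints) (use le st in auto)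
    moreover have "\<bar>upm y w (Suc j) t - upm y w (Suc j) s\<bar> \<le> C * (t - s) + 1"
      unfolding upm_def
      by (rule mom_crude[OF flip_slit_motion[OF mot_g] flip_slit_bounds[OF mot_g bd_g] bo]) (use st in auto)
    moreover have "C * (t - s) \<le> C * 2"
      using c_Suc_le[of "Suc j"] t mC by (intro mult_left_mono) (auto simp: s_def)
    ultimately show ?thesis by linarith
  qed
  then show "g (Suc j) t \<le> y t" "\<bar>upm y w (Suc j) t - upm y w (Suc j) (c (Suc j))\<bar> \<le> 2 * C + 1"
    by (simp_all add: s_def)
qed

text \<open>Up to the next critical time the ball is above the current slit, of height
  \<open>hm\<close> there, and the new slit is lower.\<close>

lemma trapped_stay:
  assumes o: "orb t0 v0 b y w" and t0: "0 \<le> t0" "t0 \<le> c (Suc i)" and up: "hp i < y (c (Suc i))"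
  shows "c (Suc (i + k)) \<le> b \<Longrightarrow> hp (i + k) < y (c (Suc (i + k)))"
proof (induction k)
  case (Suc k)
  have le: "c (Suc (i + k)) \<le> c (Suc (Suc (i + k)))" using c_less_Suc by (rule less_imp_le)
  then have "hp (i + k) < y (c (Suc (i + k)))" using Suc by simp
  moreover have "t0 \<le> c (Suc (i + k))" using t0 c_mono[of "Suc i" "Suc (i + k)"] by simp
  ultimately have "g (Suc (i + k)) (c (Suc (Suc (i + k)))) \<le> y (c (Suc (Suc (i + k))))"
    using up_segment(1)[OF o t0(1)] le Suc.prems by simp
  then show ?case using hp_less_hm[of "Suc (i + k)"] by (simp add: hm_def)
qed (use up in simp)

text \<open>The change of slit rescales the action by the ratio of the chamber heights, up to a term
  bounded independently of the energy.\<close>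

lemma up_jump:
  assumes "0 \<le> y (c (Suc j))" "y (c (Suc j)) \<le> 1"
  shows "(1 - hp j) / (1 - hm j) * upm y w j (c (Suc j)) - 2 * C / m \<le> upm y w (Suc j) (c (Suc j))"
    "upm y w (Suc j) (c (Suc j)) \<le> upm y w j (c (Suc j)) / m + 2 * C / m"
proof -
  define t where "t = c (Suc j)"
  define h1 where "h1 = (\<lambda>t. 1 - g j t)"
  define h2 where "h2 = (\<lambda>t. 1 - g (Suc j) t)"
  define x where "x = (\<lambda>t. 1 - y t)"
  define u where "u = (\<lambda>t. - w t)"
  have b: "slit_bounds m C h1" "slit_bounds m C h2"
    unfolding h1_def h2_def by (rule flip_slit_bounds[OF mot_g bd_g])+
  have h: "h1 t = 1 - hm j" "h2 t = 1 - hp j" by (simp_all add: h1_def h2_def hm_def hp_def t_def)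
  have pos: "m \<le> 1 - hm j" "0 < 1 - hm j" "0 < 1 - hp j" "1 - hp j \<le> 1"
    using hm_less_1[of j] hp_less_hm[of j] h_bounds[of j] g_bd(2)[of j "c (Suc j)"] by (auto simp: hm_def)
  define q where "q = (1 - hp j) / (1 - hm j)"
  have q: "0 < q" "q \<le> 1 / m" unfolding q_def using pos mC by (auto intro!: frac_le)
  define z where "z = (deriv h2 t * h1 t - deriv h1 t * h2 t) * x t / h1 t"
  have "mom h2 x u t = q * mom h1 x u t - z"
    unfolding q_def z_def h[symmetric] by (rule mom_jump) (use pos h in simp)
  moreover have "\<bar>z\<bar> \<le> 2 * C / m"
    unfolding z_def by (rule jump_coeff_bound[OF b]) (use assms in \<open>auto simp: x_def t_def\<close>)
  moreover have "\<bar>q * mom h1 x u t\<bar> = q * \<bar>mom h1 x u t\<bar>" using q by (simp add: abs_mult)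
  ultimately have "q * \<bar>mom h1 x u t\<bar> - 2 * C / m \<le> \<bar>mom h2 x u t\<bar>" "\<bar>mom h2 x u t\<bar> \<le> q * \<bar>mom h1 x u t\<bar> + 2 * C / m"
    by linarith+
  moreover have "q * \<bar>mom h1 x u t\<bar> \<le> 1 / m * \<bar>mom h1 x u t\<bar>" using q by (intro mult_right_mono) auto
  moreover have "upm y w j (c (Suc j)) = \<bar>mom h1 x u t\<bar>" "upm y w (Suc j) (c (Suc j)) = \<bar>mom h2 x u t\<bar>"
    by (simp_all add: upm_def h1_def h2_def x_def u_def t_def)
  ultimately show "(1 - hp j) / (1 - hm j) * upm y w j (c (Suc j)) - 2 * C / m \<le> upm y w (Suc j) (c (Suc j))"
    "upm y w (Suc j) (c (Suc j)) \<le> upm y w j (c (Suc j)) / m + 2 * C / m"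
    unfolding q_def[symmetric] by simp_all
qed

lemma c_le_add: "c (n + p) \<le> c n + real p + 1"
proof (induction p rule: induct_nat_012)
  case 1
  then show ?case using c_Suc_le[of n] by simp
next
  case (ge2 p)
  then show ?case using c_Suc_Suc[of "n + p"] by simp
qed simp

text \<open>Each passage multiplies the action by at least \<rho>0 > 1 up to a bounded error, which
  a large action absorbs at the price of a smaller factor \<rho> > 1. Speeds are then compared with
  actions. The rate is ln \<rho> because passages occur at least as often as once per unit time on
  average.\<close>

lemma trapped_growth:
  "\<exists>K>0. \<exists>\<zeta>>0. \<exists>W. \<forall>t0 v0 b y w i T t. orb t0 v0 b y w \<and> 0 \<le> t0 \<and> t0 \<le> c (Suc i) \<and>
     hp i < y (c (Suc i)) \<and> W \<le> \<bar>w (c (Suc i))\<bar> \<and> c (Suc i) \<le> T \<and> T \<le> t \<and> t \<le> b \<longrightarrow>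
     wmin \<le> \<bar>w t\<bar> \<and> \<bar>w T\<bar> / K * exp (\<zeta> * (t - T)) \<le> \<bar>w t\<bar>"
proof -
  obtain \<rho>0 where r0: "1 < \<rho>0" "\<And>i. \<rho>0 * (1 - hm i) \<le> 1 - hp i" using ex_expansion by blast
  \<comment> \<open>Error of one passage: the jump term plus the drift on an interval of length at
    most 2.\<close>
  define D where "D = 2 * C / m + 2 * C + 1"
  have D: "1 \<le> D" "2 * C + 1 \<le> D" using mC by (auto simp: D_def)
  define \<rho> where "\<rho> = (1 + \<rho>0) / 2"
  have rho: "1 < \<rho>" using r0 by (simp add: \<rho>_def)
  \<comment> \<open>The first summand lets \<rho> absorb D, the second keeps the speed above
    \<open>wmin\<close> and at least half the action, the last bounds the speed from above by the
    action.\<close>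
  define L where "L = 2 * D / (\<rho>0 - 1) + 2 * wmin + 2 * C + (D + C)"
  have wm: "0 < wmin" using mC by (simp add: wmin_def)
  have "0 \<le> 2 * D / (\<rho>0 - 1)" using D r0 by simp
  then have L: "2 * D / (\<rho>0 - 1) \<le> L" "2 * wmin + 2 * C \<le> L" "D + C \<le> L" "0 < L"
    using wm mC D by (auto simp: L_def)
  define W where "W = (L + C) / m"
  \<comment> \<open>The speed at T is at most 2 E / m^2 and the speed at t at least half the final
    action, which gives 4 / m^2; the factor \<rho>^2 pays for the two units of time by which the
    number of passages may fall short of t - T.\<close>
  define K where "K = 4 * \<rho>\<^sup>2 / m\<^sup>2"
  have K: "0 < K" using rho mC by (simp add: K_def)
  have ze: "0 < ln \<rho>" using rho by simp
  have "wmin \<le> \<bar>w t\<bar> \<and> \<bar>w T\<bar> / K * exp (ln \<rho> * (t - T)) \<le> \<bar>w t\<bar>"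
    if o: "orb t0 v0 b y w" and t0: "0 \<le> t0" "t0 \<le> c (Suc i)" and up: "hp i < y (c (Suc i))"
      and W: "W \<le> \<bar>w (c (Suc i))\<bar>" and T: "c (Suc i) \<le> T" "T \<le> t" "t \<le> b" for t0 v0 b y w i T t
  proof -
    define E where "E j = upm y w j (c (Suc j))" for j
    have y01: "0 \<le> y r" "y r \<le> 1" if "c (Suc i) \<le> r" "r \<le> b" for r
      using orbD(5)[OF o, of r] that t0 by auto
    have cij: "c (Suc i) \<le> c (Suc j)" if "i \<le> j" for j using c_mono that by simp
    have up': "hp j < y (c (Suc j))" if "i \<le> j" "c (Suc j) \<le> b" for j
      using trapped_stay[OF o t0 up, of "j - i"] that by simp
    have low: "\<rho>0 * E j - D \<le> upm y w (Suc j) r" and high: "upm y w (Suc j) r \<le> E j / m + D"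
      if j: "i \<le> j" and r: "c (Suc j) \<le> r" "r \<le> b" "r \<le> c (Suc (Suc j))" for j r
    proof -
      have jb: "c (Suc j) \<le> b" using r by simp
      have yj: "0 \<le> y (c (Suc j))" "y (c (Suc j)) \<le> 1" using y01[of "c (Suc j)"] cij[OF j] jb by auto
      have s: "\<bar>upm y w (Suc j) r - upm y w (Suc j) (c (Suc j))\<bar> \<le> 2 * C + 1"
        by (rule up_segment(2)[OF o t0(1) _ up'[OF j jb] r]) (use t0 cij[OF j] in simp)
      have "\<rho>0 \<le> (1 - hp j) / (1 - hm j)" using r0(2)[of j] hm_less_1[of j] by (simp add: field_simps)
      then have "\<rho>0 * E j \<le> (1 - hp j) / (1 - hm j) * E j"
        by (rule mult_right_mono) (simp add: E_def upm_def)
      then show "\<rho>0 * E j - D \<le> upm y w (Suc j) r"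
        using up_jump(1)[of y j w, OF yj] s unfolding E_def[symmetric] D_def by linarith
      show "upm y w (Suc j) r \<le> E j / m + D"
        using up_jump(2)[of y j w, OF yj] s unfolding E_def[symmetric] D_def by linarith
    qed
    have gain: "\<rho> * e \<le> \<rho>0 * e - D" if "L \<le> e" for e
    proof -
      have "D = (\<rho>0 - 1) / 2 * (2 * D / (\<rho>0 - 1))" using r0(1) by simp
      also have "\<dots> \<le> (\<rho>0 - 1) / 2 * e" using r0(1) L(1) that by (intro mult_left_mono) auto
      finally show ?thesis by (simp add: \<rho>_def field_simps)
    qed
    have gain': "e \<le> \<rho> * e" if "L \<le> e" for e using mult_right_mono[of 1 \<rho> e] rho L(4) that by simp
    have Ei: "L \<le> E i"
    proof -
      have "m * \<bar>w (c (Suc i))\<bar> - C \<le> E i" unfolding E_def by (rule upm_bounds) (use y01 T in auto)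
      moreover have "m * W \<le> m * \<bar>w (c (Suc i))\<bar>" using W mC by (intro mult_left_mono) auto
      moreover have "m * W = L + C" using mC by (simp add: W_def)
      ultimately show ?thesis by linarith
    qed
    have EL: "i \<le> j \<Longrightarrow> c (Suc j) \<le> b \<Longrightarrow> L \<le> E j" for j
    proof (induction j rule: dec_induct)
      case (step j)
      have cj: "c (Suc j) \<le> c (Suc (Suc j))" using c_less_Suc by (rule less_imp_le)
      then have Lj: "L \<le> E j" using step by simp
      have "\<rho>0 * E j - D \<le> E (Suc j)" unfolding E_def[of "Suc j"] by (rule low[OF step(1) cj step(4)]) simp
      then show ?case using gain[OF Lj] gain'[OF Lj] Lj by linarith
    qed (use Ei in simp)
    have Epow: "i \<le> k \<Longrightarrow> k \<le> j \<Longrightarrow> c (Suc j) \<le> b \<Longrightarrow> \<rho> ^ (j - k) * E k \<le> E j" for j k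
    proof (induction "j - k" arbitrary: j)
      case 0
      then show ?case by simp
    next
      case (Suc n)
      then obtain j' where j': "j = Suc j'" "k \<le> j'" by (cases j) auto
      have cj: "c (Suc j') \<le> c (Suc (Suc j'))" using c_less_Suc by (rule less_imp_le)
      then have jb: "c (Suc j') \<le> b" using Suc.prems j' by simp
      have ij: "i \<le> j'" using Suc.prems j' by simp
      have "\<rho> ^ (j' - k) * E k \<le> E j'" using Suc.hyps j' Suc.prems(1) jb by auto
      then have "\<rho> * (\<rho> ^ (j' - k) * E k) \<le> \<rho> * E j'" using rho by (intro mult_left_mono) auto
      also have "\<dots> \<le> \<rho>0 * E j' - D" by (rule gain[OF EL[OF ij jb]])
      also have "\<dots> \<le> E j" unfolding j'(1) E_def[of "Suc j'"]
        by (rule low[OF ij cj]) (use Suc.prems j' in auto)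
      finally show ?case using j' by (simp add: Suc_diff_le)
    qed
    have ex: "\<exists>j\<ge>i. c (Suc j) \<le> r \<and> r < c (Suc (Suc j))" if "c (Suc i) \<le> r" for r
    proof -
      have "c 0 \<le> r" using that c_mono[of 0 "Suc i"] by simp
      from locate_c[OF this] obtain n where n: "c n \<le> r" "r < c (Suc n)" by blast
      have "Suc i < Suc n" using n that c_mono[of "Suc n" "Suc i"] by (meson leI le_less_trans not_less)
      then obtain j where "n = Suc j" "i \<le> j" by (cases n) auto
      then show ?thesis using n by blast
    qed
    obtain k where k: "i \<le> k" "c (Suc k) \<le> T" "T < c (Suc (Suc k))" using ex[OF T(1)] by blast
    obtain j where j: "i \<le> j" "c (Suc j) \<le> t" "t < c (Suc (Suc j))" using ex[of t] T by auto
    have kj: "k \<le> j"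
    proof (rule ccontr)
      assume "\<not> k \<le> j"
      then have "c (Suc (Suc j)) \<le> c (Suc k)" by (intro c_mono) simp
      then show False using j k T by simp
    qed
    have jb: "c (Suc j) \<le> b" and kb: "c (Suc k) \<le> b" using j k T by auto
    have it: "c (Suc i) \<le> t" using T by simp
    have "\<rho> * E j \<le> upm y w (Suc j) t"
      using low[OF j(1,2) T(3)] j(3) gain[OF EL[OF j(1) jb]] by simp
    also have "upm y w (Suc j) t \<le> \<bar>w t\<bar> + C" by (rule upm_bounds) (use y01 it T in auto)
    finally have wt: "E j / 2 \<le> \<bar>w t\<bar>" "wmin \<le> \<bar>w t\<bar>"
      using gain'[OF EL[OF j(1) jb]] EL[OF j(1) jb] L(2) wm mC(3) by linarith+
    have "m * \<bar>w T\<bar> - C \<le> upm y w (Suc k) T" by (rule upm_bounds) (use y01 T in auto)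
    also have "\<dots> \<le> E k / m + D" by (rule high[OF k(1,2)]) (use k T in auto)
    finally have "m * \<bar>w T\<bar> \<le> E k / m + (D + C)" by simp
    moreover have "D + C \<le> E k / m"
    proof -
      have "D + C \<le> E k" using EL[OF k(1) kb] L(3) by simp
      also have "E k * m \<le> E k * 1" using mC EL[OF k(1) kb] L(4) by (intro mult_left_mono) auto
      then have "E k \<le> E k / m" using mC(1) by (simp only: pos_le_divide_eq mult_1_right)
      finally show ?thesis .
    qed
    ultimately have "m * \<bar>w T\<bar> \<le> 2 * E k / m" by simp
    then have wT: "\<bar>w T\<bar> * m\<^sup>2 \<le> 2 * E k" using mC by (simp add: field_simps power2_eq_square)
    \<comment> \<open>There are two critical times per period 2, so j - k passages take at most j -
      k + 2 units of time, counting the unfinished intervals at both ends.\<close>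
    have "t - T \<le> real (j - k) + 2"
      using c_le_add[of "Suc k" "Suc (j - k)"] kj k(2) j(3) by simp
    then have "exp (ln \<rho> * (t - T)) \<le> exp (ln \<rho> * (real (j - k) + 2))"
      using ze by (simp only: exp_le_cancel_iff) (intro mult_left_mono, auto)
    also have "\<dots> = \<rho> ^ (j - k) * \<rho>\<^sup>2"
    proof -
      have "exp (ln \<rho> * (real (j - k) + 2)) = exp (ln \<rho> * real (j - k + 2))" by simp
      also have "\<dots> = \<rho> ^ (j - k + 2)" using rho by (simp only: exp_of_nat2_mult exp_ln)
      finally show ?thesis by (simp only: power_add)
    qed
    finally have ex: "exp (ln \<rho> * (t - T)) \<le> \<rho> ^ (j - k) * \<rho>\<^sup>2" .
    have "\<bar>w T\<bar> / K * exp (ln \<rho> * (t - T)) \<le> \<bar>w T\<bar> / K * (\<rho> ^ (j - k) * \<rho>\<^sup>2)"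
      using K by (intro mult_left_mono[OF ex]) auto
    also have "\<dots> = (\<bar>w T\<bar> * m\<^sup>2) * \<rho> ^ (j - k) / 4"
      using mC rho by (simp add: K_def field_simps)
    also have "\<dots> \<le> (2 * E k) * \<rho> ^ (j - k) / 4"
      using rho by (intro divide_right_mono mult_right_mono[OF wT]) auto
    also have "\<dots> = \<rho> ^ (j - k) * E k / 2" by simp
    also have "\<dots> \<le> E j / 2" using Epow[OF k(1) kj jb] by simp
    also have "\<dots> \<le> \<bar>w t\<bar>" by (rule wt)
    finally show ?thesis using wt by blast
  qed
  note main = this
  show ?thesis
  proof (rule exI[of _ K], rule conjI[OF K], rule exI[of _ "ln \<rho>"], rule conjI[OF ze], rule exI[of _ W],
      intro allI impI, elim conjE)
    fix t0 v0 b y w i T t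
    assume a: "orb t0 v0 b y w" "0 \<le> t0" "t0 \<le> c (Suc i)" "hp i < y (c (Suc i))" "W \<le> \<bar>w (c (Suc i))\<bar>"
      "c (Suc i) \<le> T" "T \<le> t" "t \<le> b"
    show "wmin \<le> \<bar>w t\<bar> \<and> \<bar>w T\<bar> / K * exp (ln \<rho> * (t - T)) \<le> \<bar>w t\<bar>" by (rule main[OF a])
  qed
qed

end

section \<open>Hyperbolicity of the period matrix and vanishing of survivors\<close>

locale hyperbolic_pair =
  fixes A B C D :: "nat \<Rightarrow> real"
  assumes per: "\<And>i. A (Suc (Suc i)) = A i" "\<And>i. B (Suc (Suc i)) = B i" "\<And>i. C (Suc (Suc i)) = C i" "\<And>i. D (Suc (Suc i)) = D i"
    and Bpos: "\<And>i. 0 < B i" and det: "\<And>i. A i * D i - B i * C i = 1"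
    and trace: "2 < \<bar>A 1 * A 0 + B 1 * C 0 + C 1 * B 0 + D 1 * D 0\<bar>"
begin

lemma parity:
  shows "even i \<Longrightarrow> A i = A 0 \<and> B i = B 0 \<and> C i = C 0 \<and> D i = D 0"
    and "odd i \<Longrightarrow> A i = A 1 \<and> B i = B 1 \<and> C i = C 1 \<and> D i = D 1"
  by (induction i rule: induct_nat_012) (auto simp: per)

text \<open>The period matrix has determinant 1 and |trace| > 2, hence a real eigenvalue of modulus
  greater than 1; the functional is a left eigenvector.\<close>

lemma expanded_functional:
  "\<exists>\<mu> l k. 1 < \<bar>\<mu>\<bar> \<and> (l \<noteq> 0 \<or> k \<noteq> 0) \<and> (\<forall>p q. l * (A 1 * (A 0 * p + B 0 * q) + B 1 * (C 0 * p + D 0 * q)) +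
     k * (C 1 * (A 0 * p + B 0 * q) + D 1 * (C 0 * p + D 0 * q)) = \<mu> * (l * p + k * q))"
proof -
  define a where "a = A 1 * A 0 + B 1 * C 0"
  define b where "b = A 1 * B 0 + B 1 * D 0"
  define r where "r = C 1 * A 0 + D 1 * C 0"
  define d where "d = C 1 * B 0 + D 1 * D 0"
  define t where "t = a + d"
  have t: "2 < \<bar>t\<bar>" using trace by (simp add: t_def a_def d_def algebra_simps)
  have "a * d - b * r = (A 1 * D 1 - B 1 * C 1) * (A 0 * D 0 - B 0 * C 0)"
    by (simp add: a_def b_def r_def d_def algebra_simps)
  then have one: "a * d - b * r = 1" by (simp add: det)
  \<comment> \<open>The root of larger modulus of the characteristic polynomial x^2 - t x +
    1.\<close>
  define \<mu> where "\<mu> = (t + sgn t * sqrt (t\<^sup>2 - 4)) / 2"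
  have t4: "0 \<le> t\<^sup>2 - 4"
  proof -
    have "2\<^sup>2 \<le> \<bar>t\<bar>\<^sup>2" using t by (intro power_mono) auto
    then show ?thesis by simp
  qed
  have sg: "(sgn t)\<^sup>2 = 1" using t by (auto simp: sgn_if)
  have "(2 * \<mu> - t)\<^sup>2 = t\<^sup>2 - 4"
  proof -
    have "2 * \<mu> - t = sgn t * sqrt (t\<^sup>2 - 4)" by (simp add: \<mu>_def field_simps)
    then show ?thesis using t4 sg by (simp only: power_mult_distrib real_sqrt_pow2 mult_1)
  qed
  then have mu: "\<mu> * \<mu> = t * \<mu> - 1" by (simp add: power2_eq_square algebra_simps)
  define q where "q = sqrt (t\<^sup>2 - 4)"
  have q: "0 \<le> q" using t4 by (simp add: q_def)
  have big: "1 < \<bar>\<mu>\<bar>"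
  proof (cases "0 < t")
    case True
    then have "\<mu> = (t + q) / 2" by (simp add: \<mu>_def q_def)
    then show ?thesis using True t q by simp
  next
    case False
    then have "\<mu> = (t - q) / 2" using t by (simp add: \<mu>_def q_def)
    then show ?thesis using False t q by simp
  qed
  have mu': "\<mu> * \<mu> = (a + d) * \<mu> - 1" using mu by (simp add: t_def)
  \<comment> \<open>The left eigenvector (r, \<mu> - a) can vanish; then (\<mu> - d, b) is used,
    nonzero since \<mu> = a = d would give \<mu>^2 = 1.\<close>
  have ex: "\<exists>l k. (l \<noteq> 0 \<or> k \<noteq> 0) \<and> l * a + k * r = \<mu> * l \<and> l * b + k * d = \<mu> * k"
  proof (cases "r = 0 \<and> \<mu> = a")
    case False
    have "r * b + (\<mu> - a) * d = \<mu> * (\<mu> - a)" using mu' one by (simp add: algebra_simps)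
    then show ?thesis using False by (intro exI[of _ r] exI[of _ "\<mu> - a"]) (auto simp: algebra_simps)
  next
    case True
    have ne: "\<mu> - d \<noteq> 0"
    proof
      assume "\<mu> - d = 0"
      then have "\<mu> * \<mu> = 1" using True one by simp
      then have "\<bar>\<mu>\<bar> * \<bar>\<mu>\<bar> = 1" by (simp add: abs_mult[symmetric])
      moreover have "1 * 1 < \<bar>\<mu>\<bar> * \<bar>\<mu>\<bar>" using big by (intro mult_strict_mono) auto
      ultimately show False by simp
    qed
    have "(\<mu> - d) * a + b * r = \<mu> * (\<mu> - d)" using mu' one by (simp add: algebra_simps)
    then show ?thesis using ne by (intro exI[of _ "\<mu> - d"] exI[of _ b]) (auto simp: algebra_simps)
  qed
  then obtain l k where lk: "l \<noteq> 0 \<or> k \<noteq> 0" "l * a + k * r = \<mu> * l" "l * b + k * d = \<mu> * k" by blast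
  have "l * (A 1 * (A 0 * p + B 0 * q) + B 1 * (C 0 * p + D 0 * q)) +
     k * (C 1 * (A 0 * p + B 0 * q) + D 1 * (C 0 * p + D 0 * q)) = \<mu> * (l * p + k * q)" for p q
  proof -
    have "l * (A 1 * (A 0 * p + B 0 * q) + B 1 * (C 0 * p + D 0 * q)) +
      k * (C 1 * (A 0 * p + B 0 * q) + D 1 * (C 0 * p + D 0 * q)) = (l * a + k * r) * p + (l * b + k * d) * q"
      by (simp add: a_def b_def r_def d_def algebra_simps)
    then show ?thesis unfolding lk by (simp add: algebra_simps)
  qed
  then show ?thesis using big lk(1) by blast
qed

text \<open>One functional for each parity, so that no single step decreases its absolute value and
  any two steps multiply it by \<mu>.\<close>

lemma expanded_functionals:
  "\<exists>\<mu> u v U. 1 < \<mu> \<and> (\<forall>i. u i \<noteq> 0 \<or> v i \<noteq> 0) \<and> (\<forall>i. \<bar>u i\<bar> \<le> U \<and> \<bar>v i\<bar> \<le> U) \<and>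
     (\<forall>i p q. \<bar>u i * p + v i * q\<bar> \<le> \<bar>u (Suc i) * (A i * p + B i * q) + v (Suc i) * (C i * p + D i * q)\<bar>) \<and>
     (\<forall>i p q. \<bar>u i * (A (Suc i) * (A i * p + B i * q) + B (Suc i) * (C i * p + D i * q)) +
        v i * (C (Suc i) * (A i * p + B i * q) + D (Suc i) * (C i * p + D i * q))\<bar> = \<mu> * \<bar>u i * p + v i * q\<bar>) \<and>
     (\<forall>i. u (Suc (Suc i)) = u i \<and> v (Suc (Suc i)) = v i)"
proof -
  obtain \<mu> l k where mu: "1 < \<bar>\<mu>\<bar>" and lk: "l \<noteq> 0 \<or> k \<noteq> 0"
    and eig: "\<And>p q. l * (A 1 * (A 0 * p + B 0 * q) + B 1 * (C 0 * p + D 0 * q)) +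
     k * (C 1 * (A 0 * p + B 0 * q) + D 1 * (C 0 * p + D 0 * q)) = \<mu> * (l * p + k * q)"
    using expanded_functional by blast
  \<comment> \<open>The eigenfunctional pulled back through the odd matrix.\<close>
  define l' where "l' = l * A 1 + k * C 1"
  define k' where "k' = l * B 1 + k * D 1"
  have l'k': "l' * p + k' * q = l * (A 1 * p + B 1 * q) + k * (C 1 * p + D 1 * q)" for p q
    by (simp add: l'_def k'_def algebra_simps)
  have ne: "l' \<noteq> 0 \<or> k' \<noteq> 0"
  proof (rule ccontr)
    assume "\<not> ?thesis"
    then have z: "l * A 1 + k * C 1 = 0" "l * B 1 + k * D 1 = 0" by (auto simp: l'_def k'_def)
    have "l * (A 1 * D 1 - B 1 * C 1) = D 1 * (l * A 1 + k * C 1) - C 1 * (l * B 1 + k * D 1)"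
      "k * (A 1 * D 1 - B 1 * C 1) = A 1 * (l * B 1 + k * D 1) - B 1 * (l * A 1 + k * C 1)"
      by (simp_all add: algebra_simps)
    then have "l = 0" "k = 0" unfolding z det by simp_all
    then show False using lk by simp
  qed
  define u where "u i = (if even i then l else l')" for i :: nat
  define v where "v i = (if even i then k else k')" for i :: nat
  let ?U = "\<bar>l\<bar> + \<bar>l'\<bar> + \<bar>k\<bar> + \<bar>k'\<bar>"
  have one: "\<bar>u i * p + v i * q\<bar> \<le> \<bar>u (Suc i) * (A i * p + B i * q) + v (Suc i) * (C i * p + D i * q)\<bar>" for i p q
  proof (cases "even i")
    case True
    then have "u (Suc i) * (A i * p + B i * q) + v (Suc i) * (C i * p + D i * q) = \<mu> * (l * p + k * q)"
      using parity(1)[of i] by (simp add: u_def v_def l'k' eig[unfolded One_nat_def])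
    moreover have "1 * \<bar>l * p + k * q\<bar> \<le> \<bar>\<mu>\<bar> * \<bar>l * p + k * q\<bar>" using mu by (intro mult_right_mono) auto
    ultimately show ?thesis using True by (simp add: u_def v_def abs_mult)
  next
    case False
    then show ?thesis using parity(2)[of i] by (simp add: u_def v_def l'k')
  qed
  have two: "u i * (A (Suc i) * (A i * p + B i * q) + B (Suc i) * (C i * p + D i * q)) +
        v i * (C (Suc i) * (A i * p + B i * q) + D (Suc i) * (C i * p + D i * q)) = \<mu> * (u i * p + v i * q)" for i p q
  proof (cases "even i")
    case True
    then show ?thesis using parity(1)[of i] parity(2)[of "Suc i"] by (simp add: u_def v_def eig[unfolded One_nat_def])
  next
    case False
    then show ?thesis using parity(2)[of i] parity(1)[of "Suc i"] by (simp add: u_def v_def l'k' eig[unfolded One_nat_def])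
  qed
  have two': "\<bar>u i * (A (Suc i) * (A i * p + B i * q) + B (Suc i) * (C i * p + D i * q)) +
        v i * (C (Suc i) * (A i * p + B i * q) + D (Suc i) * (C i * p + D i * q))\<bar> = \<bar>\<mu>\<bar> * \<bar>u i * p + v i * q\<bar>" for i p q
    unfolding two abs_mult ..
  have uv: "u i \<noteq> 0 \<or> v i \<noteq> 0" "\<bar>u i\<bar> \<le> ?U \<and> \<bar>v i\<bar> \<le> ?U" "u (Suc (Suc i)) = u i \<and> v (Suc (Suc i)) = v i" for i
    using ne lk by (cases "even i"; simp add: u_def v_def)+
  show ?thesis
    by (rule exI[of _ "\<bar>\<mu>\<bar>"], rule exI[of _ u], rule exI[of _ v], rule exI[of _ ?U])
      (intro conjI[OF mu] conjI allI uv one two')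
qed

text \<open>Only the phase component of a direction matters for the strips. If it stayed bounded at
  two successive steps, B > 0 would bound the action component as well, against the growth of the
  functional. So the phase component becomes arbitrarily large and \<open>survivors_vanish\<close>
  applies.\<close>

lemma survivors_small:
  assumes kappa: "0 < \<kappa>" "\<kappa> < 1"
  shows "\<exists>u v :: nat \<Rightarrow> real. (\<forall>i. u i \<noteq> 0 \<or> v i \<noteq> 0) \<and> (\<forall>\<delta>>0. \<forall>R. \<forall>\<eta>>0. \<forall>i. \<exists>N. \<forall>p q \<phi> J.
    \<delta> \<le> \<bar>u i * p + v i * q\<bar> \<and> \<bar>p\<bar> \<le> R \<and> \<bar>q\<bar> \<le> R \<longrightarrow>
    cov {s \<in> {0..1}. linear_survival.LS \<kappa> A B C D N i (\<phi> + s * p) (J + s * q)} \<eta>)"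
proof -
  obtain \<mu> u v U where mu: "1 < \<mu>" and uv: "\<forall>i. u i \<noteq> 0 \<or> v i \<noteq> 0" and U: "\<forall>i. \<bar>u i\<bar> \<le> U \<and> \<bar>v i\<bar> \<le> U"
    and one: "\<forall>i p q. \<bar>u i * p + v i * q\<bar> \<le> \<bar>u (Suc i) * (A i * p + B i * q) + v (Suc i) * (C i * p + D i * q)\<bar>"
    and two: "\<forall>i p q. \<bar>u i * (A (Suc i) * (A i * p + B i * q) + B (Suc i) * (C i * p + D i * q)) +
        v i * (C (Suc i) * (A i * p + B i * q) + D (Suc i) * (C i * p + D i * q))\<bar> = \<mu> * \<bar>u i * p + v i * q\<bar>"
    and uvper: "\<forall>i. u (Suc (Suc i)) = u i \<and> v (Suc (Suc i)) = v i"
    using expanded_functionals by (elim exE conjE) (rule that)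
  have U0: "0 \<le> U" using U by (meson abs_ge_zero order_trans)
  define Z where "Z i = \<bar>A i\<bar> + \<bar>B i\<bar> + \<bar>C i\<bar> + \<bar>D i\<bar>" for i
  define \<Lambda> where "\<Lambda> = 1 + Z 0 + Z 1"
  have \<Lambda>: "1 \<le> \<Lambda>" "\<bar>A i\<bar> + \<bar>B i\<bar> \<le> \<Lambda>" "\<bar>C i\<bar> + \<bar>D i\<bar> \<le> \<Lambda>" for i
    using parity[of i] by (cases "even i"; simp add: \<Lambda>_def Z_def)+
  define \<beta> where "\<beta> = min (B 0) (B 1)"
  have beta: "0 < \<beta>" "\<beta> \<le> B i" for i using parity[of i] Bpos by (cases "even i"; simp add: \<beta>_def)+
  have bnd: "\<bar>a * p + b * q\<bar> \<le> \<Lambda> * M" if "\<bar>a\<bar> + \<bar>b\<bar> \<le> \<Lambda>" "\<bar>p\<bar> \<le> M" "\<bar>q\<bar> \<le> M" for a b p q M :: real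
  proof -
    have "\<bar>a * p + b * q\<bar> \<le> \<bar>a\<bar> * \<bar>p\<bar> + \<bar>b\<bar> * \<bar>q\<bar>" by (simp add: abs_mult[symmetric] abs_triangle_ineq)
    also have "\<dots> \<le> \<bar>a\<bar> * M + \<bar>b\<bar> * M" using that by (intro add_mono mult_left_mono) auto
    also have "\<dots> = (\<bar>a\<bar> + \<bar>b\<bar>) * M" by (simp add: distrib_right)
    also have "\<dots> \<le> \<Lambda> * M" using that by (intro mult_right_mono) auto
    finally show ?thesis .
  qed
  have main: "\<exists>N. \<forall>p q \<phi> J. \<delta> \<le> \<bar>u i * p + v i * q\<bar> \<and> \<bar>p\<bar> \<le> R \<and> \<bar>q\<bar> \<le> R \<longrightarrow>
    cov {s \<in> {0..1}. linear_survival.LS \<kappa> A B C D N i (\<phi> + s * p) (J + s * q)} \<eta>"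
    if de: "0 < \<delta>" and et: "0 < \<eta>" for \<delta> R \<eta> i
  proof -
    define Rd where "Rd j = \<bar>R\<bar> * \<Lambda> ^ j" for j :: nat
    \<comment> \<open>The lower bound on the functional persists because no step decreases it; the
      growing radius \<open>Rd j\<close> bounds the components at level j.\<close>
    define dirs where "dirs j = {d. \<delta> \<le> \<bar>u j * fst d + v j * snd d\<bar> \<and> \<bar>fst d\<bar> \<le> Rd j \<and> \<bar>snd d\<bar> \<le> Rd j}" for j
    have RdS: "Rd (Suc j) = \<Lambda> * Rd j" for j by (simp add: Rd_def)
    interpret linear_survival \<kappa> A B C D dirs
    proof unfold_locales
      fix j p q assume pq: "(p, q) \<in> dirs j"
      then have "\<delta> \<le> \<bar>u j * p + v j * q\<bar>" "\<bar>p\<bar> \<le> Rd j" "\<bar>q\<bar> \<le> Rd j" by (auto simp: dirs_def)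
      moreover have "\<bar>u j * p + v j * q\<bar> \<le> \<bar>u (Suc j) * (A j * p + B j * q) + v (Suc j) * (C j * p + D j * q)\<bar>"
        using one by blast
      ultimately show "(A j * p + B j * q, C j * p + D j * q) \<in> dirs (Suc j)"
        unfolding dirs_def by (simp add: RdS bnd \<Lambda>)
    next
      fix j show "\<exists>M. \<forall>d\<in>dirs j. \<bar>fst d\<bar> \<le> M" by (intro exI[of _ "Rd j"]) (auto simp: dirs_def)
    qed (use kappa in auto)
    have grow: "\<exists>N. \<forall>d\<in>dirs j. \<exists>p\<le>N. L \<le> \<bar>fst (diter p j d)\<bar>" for j L
    proof -
      \<comment> \<open>Bound for the functional on a direction whose phase components at two
        successive steps are at most |L|.\<close>
      define G where "G = U * (\<bar>L\<bar> + (1 + \<Lambda>) * \<bar>L\<bar> / \<beta>)"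
      obtain k where k: "G / \<delta> < \<mu> ^ k" using real_arch_pow[OF mu] by blast
      have "\<exists>p\<le>Suc (2 * k). L \<le> \<bar>fst (diter p j d)\<bar>" if d: "d \<in> dirs j" for d
      proof (rule ccontr)
        assume "\<not> ?thesis"
        then have small: "\<bar>fst (diter p j d)\<bar> \<le> \<bar>L\<bar>" if "p \<le> Suc (2 * k)" for p
          using that by (meson abs_ge_self less_le_trans not_le less_imp_le)
        have ell: "\<mu> ^ n * \<delta> \<le> \<bar>u (j + 2 * n) * fst (diter (2 * n) j d) + v (j + 2 * n) * snd (diter (2 * n) j d)\<bar>" for n
        proof (induction n)
          case 0
          then show ?case using d by (simp add: dirs_def)
        next
          case (Suc n)
          let ?x = "fst (diter (2 * n) j d)" and ?y = "snd (diter (2 * n) j d)"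
          have "\<mu> ^ Suc n * \<delta> = \<mu> * (\<mu> ^ n * \<delta>)" by simp
          also have "\<dots> \<le> \<mu> * \<bar>u (j + 2 * n) * ?x + v (j + 2 * n) * ?y\<bar>"
            using mu by (intro mult_left_mono[OF Suc]) auto
          also have "\<dots> = \<bar>u (j + 2 * Suc n) * fst (diter (2 * Suc n) j d) + v (j + 2 * Suc n) * snd (diter (2 * Suc n) j d)\<bar>"
            using two[rule_format, of "j + 2 * n" ?x ?y] uvper by (simp add: diter_Suc del: diter.simps)
          finally show ?case .
        qed
        let ?x = "fst (diter (2 * k) j d)" and ?y = "snd (diter (2 * k) j d)"
        have "fst (diter (Suc (2 * k)) j d) = A (j + 2 * k) * ?x + B (j + 2 * k) * ?y"
          by (simp add: diter_Suc del: diter.simps)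
        then have "B (j + 2 * k) * ?y = fst (diter (Suc (2 * k)) j d) - A (j + 2 * k) * ?x" by simp
        moreover have "\<bar>A (j + 2 * k) * ?x\<bar> \<le> \<Lambda> * \<bar>L\<bar>"
          unfolding abs_mult using small[of "2 * k"] \<Lambda>(2)[of "j + 2 * k"] \<Lambda>(1) by (intro mult_mono) auto
        ultimately have "\<bar>B (j + 2 * k) * ?y\<bar> \<le> (1 + \<Lambda>) * \<bar>L\<bar>"
          using small[of "Suc (2 * k)"] by (simp add: distrib_right)
        moreover have "\<beta> * \<bar>?y\<bar> \<le> \<bar>B (j + 2 * k) * ?y\<bar>"
          unfolding abs_mult using beta(2)[of "j + 2 * k"] by (intro mult_right_mono) auto
        ultimately have "\<beta> * \<bar>?y\<bar> \<le> (1 + \<Lambda>) * \<bar>L\<bar>" by simp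
        then have y: "\<bar>?y\<bar> \<le> (1 + \<Lambda>) * \<bar>L\<bar> / \<beta>" using beta(1) by (simp add: field_simps)
        have x: "\<bar>?x\<bar> \<le> \<bar>L\<bar>" by (rule small) simp
        have "\<bar>u (j + 2 * k) * ?x + v (j + 2 * k) * ?y\<bar> \<le> \<bar>u (j + 2 * k)\<bar> * \<bar>?x\<bar> + \<bar>v (j + 2 * k)\<bar> * \<bar>?y\<bar>"
          by (simp add: abs_mult[symmetric] abs_triangle_ineq)
        also have "\<dots> \<le> U * \<bar>L\<bar> + U * ((1 + \<Lambda>) * \<bar>L\<bar> / \<beta>)"
          using U U0 x y by (intro add_mono mult_mono) auto
        also have "\<dots> = G" by (simp only: G_def distrib_left)
        finally have "\<mu> ^ k * \<delta> \<le> G" using ell[of k] by linarith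
        then show False using k de by (simp add: field_simps)
      qed
      then show ?thesis by blast
    qed
    obtain N where N: "\<forall>d\<in>dirs i. \<forall>\<phi> J a b. a \<le> b \<and> b - a \<le> 1 \<longrightarrow> cov (surv N i d \<phi> J a b) \<eta>"
      using survivors_vanish[OF grow et] by blast
    show ?thesis
    proof (intro exI[of _ N] allI impI)
      fix p q \<phi> J assume a: "\<delta> \<le> \<bar>u i * p + v i * q\<bar> \<and> \<bar>p\<bar> \<le> R \<and> \<bar>q\<bar> \<le> R"
      have "\<bar>R\<bar> * 1 \<le> \<bar>R\<bar> * \<Lambda> ^ i" using \<Lambda>(1) by (intro mult_left_mono one_le_power) auto
      then have "(p, q) \<in> dirs i" using a by (auto simp: dirs_def Rd_def)
      then have "cov (surv N i (p, q) \<phi> J 0 1) \<eta>" using N by simp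
      then show "cov {s \<in> {0..1}. LS N i (\<phi> + s * p) (J + s * q)} \<eta>" by (simp add: surv_def)
    qed
  qed
  show ?thesis
    by (intro exI[of _ u] exI[of _ v] conjI uv allI impI main)
qed

end

section \<open>The trace formula as the trace of the period matrix\<close>

context slits begin

lemma Lim_slit:
  "Lim (at_left (c (Suc n))) f = g n (c (Suc n))" "Lim (at_right (c n)) f = g n (c n)"
  "Lim (at_left (c (Suc n))) (deriv f) = deriv (g n) (c (Suc n))" "Lim (at_right (c n)) (deriv f) = deriv (g n) (c n)"
proof -
  have l: "\<forall>\<^sub>F r in at_left (c (Suc n)). c n < r \<and> r < c (Suc n)"
    using c_less_Suc[of n] by (auto simp: eventually_at_left)
  have r: "\<forall>\<^sub>F r in at_right (c n). c n < r \<and> r < c (Suc n)"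
    using c_less_Suc[of n] by (auto simp: eventually_at_right)
  have ev: "Lim F h = k (a::real)" if "F = at_left a \<or> F = at_right a" "\<forall>\<^sub>F r in F. c n < r \<and> r < c (Suc n)"
    "\<And>r. c n < r \<Longrightarrow> r < c (Suc n) \<Longrightarrow> k r = h r" "isCont k a" for F a and h k :: "real \<Rightarrow> real"
  proof (rule tendsto_Lim)
    show "F \<noteq> bot" using that(1) by (elim disjE; hypsubst; simp)
    have "(k \<longlongrightarrow> k a) F"
      using that(1,4) by (auto simp: isCont_def intro: tendsto_within_subset filterlim_mono[OF _ order_refl at_le])
    moreover have "\<forall>\<^sub>F r in F. k r = h r" using that(2) by (rule eventually_mono) (use that(3) in auto)
    ultimately show "(h \<longlongrightarrow> k a) F" by (rule Lim_transform_eventually)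
  qed
  note cont = slit_motion_continuous(4,5)[OF mot_g]
  show "Lim (at_left (c (Suc n))) f = g n (c (Suc n))"
    by (rule ev[OF _ l]) (use between_c(2) cont in auto)
  show "Lim (at_right (c n)) f = g n (c n)"
    by (rule ev[OF _ r]) (use between_c(2) cont in auto)
  show "Lim (at_left (c (Suc n))) (deriv f) = deriv (g n) (c (Suc n))"
    by (rule ev[OF _ l]) (use deriv_f_between_c cont in auto)
  show "Lim (at_right (c n)) (deriv f) = deriv (g n) (c n)"
    by (rule ev[OF _ r]) (use deriv_f_between_c cont in auto)
qed

end

context trap begin

lemma integral_slit:
  assumes "c n \<le> a" "b \<le> c (Suc n)"
  shows "integral {a..b} (\<lambda>s. 1 / (f s)\<^sup>2) = integral {a..b} (\<lambda>s. 1 / (g n s)\<^sup>2)"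
proof (rule integral_spike[of "{c n, c (Suc n)}"])
  fix s assume "s \<in> {a..b} - {c n, c (Suc n)}"
  then have "f s = g n s" using assms by (intro between_c(2)) auto
  then show "1 / (g n s)\<^sup>2 = 1 / (f s)\<^sup>2" by simp
qed simp

lemma g_nonzero: "g n s \<noteq> 0"
  using g_bd(1)[of n s] mC by auto

lemma inv_g_integrable: "(\<lambda>s. 1 / (g n s)\<^sup>2) integrable_on {a..b}"
  by (rule integrable_continuous_real) (intro continuous_intros continuous_g, use g_nonzero in auto)

text \<open>The one-sided limits are values of the smooth \<open>g n\<close>, and the two integrals
  forming \<alpha>' join, after a shift by one period, to the integral over one interval between
  critical times.\<close>

lemma TrL_eq: "TrL lam x0 fL fR = matA 1 * matA 0 + matB 1 * matC 0 + matC 1 * matB 0 + matD 1 * matD 0"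
proof -
  have c: "c 1 = t1" "c (Suc 0) = t1" "c (Suc 1) = t2" "c (Suc (Suc 0)) = t2" "c (Suc (Suc (Suc 0))) = t1 + 2"
    "c 0 = t2 - 2" by (simp_all add: c_def)
  have g: "g 0 = fL" "g 1 = fR" "g (Suc 0) = fR" "g (Suc 1) = fL" "g (Suc (Suc 0)) = fL" by (simp_all add: g_def)
  have L: "Lim (at_left t1) f = hm 0" "Lim (at_right t1) f = hp 0" "Lim (at_left t2) f = hm 1" "Lim (at_right t2) f = hp 1"
    "Lim (at_left t1) (deriv f) = deriv (g 0) (c 1)" "Lim (at_right t1) (deriv f) = deriv (g 1) (c 1)"
    "Lim (at_left t2) (deriv f) = deriv (g 1) (c 2)" "Lim (at_right t2) (deriv f) = deriv (g 2) (c 2)"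
    using Lim_slit[of 0] Lim_slit[of 1] Lim_slit[of 2] by (simp_all add: hm_def hp_def c g numeral_2_eq_2)
  have be: "integral {t1..t2} (\<lambda>s. 1 / (f s)\<^sup>2) = bb 0"
    using integral_slit[of 1 t1 t2] by (simp add: bb_def c g)
  have i1: "integral {0..t1} (\<lambda>s. 1 / (f s)\<^sup>2) = integral {0..t1} (\<lambda>s. 1 / (fL s)\<^sup>2)"
    using integral_slit[of 0 0 t1] c0_neg by (simp add: c g)
  \<comment> \<open>The part on [0, t1] is moved by one period so that it continues the part on
    [t2, 2].\<close>
  also have "\<dots> = integral {0..t1} ((\<lambda>s. 1 / (fL s)\<^sup>2) \<circ> (+) 2)"
    using slit_motionD(4)[OF motL] by (simp add: comp_def add.commute)
  also have "\<dots> = integral {2..t1 + 2} (\<lambda>s. 1 / (fL s)\<^sup>2)"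
    using integral_shift_Icc_real[of 0 t1 "\<lambda>s. 1 / (fL s)\<^sup>2" 2] by simp
  finally have i1: "integral {0..t1} (\<lambda>s. 1 / (f s)\<^sup>2) = integral {2..t1 + 2} (\<lambda>s. 1 / (fL s)\<^sup>2)" .
  have i2: "integral {t2..2} (\<lambda>s. 1 / (f s)\<^sup>2) = integral {t2..2} (\<lambda>s. 1 / (fL s)\<^sup>2)"
    using integral_slit[of 2 t2 2] t12 by (simp add: c g numeral_2_eq_2)
  have "integral {t2..2} (\<lambda>s. 1 / (fL s)\<^sup>2) + integral {2..t1 + 2} (\<lambda>s. 1 / (fL s)\<^sup>2) = integral {t2..t1 + 2} (\<lambda>s. 1 / (fL s)\<^sup>2)"
    by (rule Henstock_Kurzweil_Integration.integral_combine) (use t12 inv_g_integrable[of 0, unfolded g] in auto)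
  then have al: "integral {0..t1} (\<lambda>s. 1 / (f s)\<^sup>2) + integral {t2..2} (\<lambda>s. 1 / (f s)\<^sup>2) = bb 1"
    unfolding i1 i2 by (simp add: bb_def c g)
  have aa: "aa 0 = deriv (g 1) (c 1) * hm 0 - deriv (g 0) (c 1) * hp 0"
    "aa 1 = deriv (g 2) (c 2) * hm 1 - deriv (g 1) (c 2) * hp 1"
    by (simp_all add: aa_def numeral_2_eq_2)
  have rr: "hm 0 / hp 0 = rr 0" "hm 1 / hp 1 = rr 1" "hp 0 / hm 0 = 1 / rr 0" "hp 1 / hm 1 = 1 / rr 1"
    by (simp_all add: rr_def)
  have "TrL lam x0 fL fR = (rr 0 - aa 0 * bb 0) * (rr 1 - aa 1 * bb 1) +
      (1 / rr 0 - aa 0 * bb 1) * (1 / rr 1 - aa 1 * bb 0) - aa 0 * aa 1 * bb 1 * bb 0"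
    unfolding TrL_def Let_def L be al aa[symmetric] rr ..
  then show ?thesis
    unfolding matA_def matB_def matC_def matD_def by (simp add: algebra_simps)
qed

text \<open>Determinant 1 is immediate from the factorisation into jump and shear; positivity of
  \<open>matB\<close> comes from the integrand being at least 1.\<close>

lemma mat_hyperbolic:
  assumes "2 < \<bar>TrL lam x0 fL fR\<bar>"
  shows "hyperbolic_pair matA matB matC matD"
proof unfold_locales
  have bper: "bb (Suc (Suc i)) = bb i" for i
  proof -
    have "bb (Suc (Suc i)) = integral {c (Suc i) + 2..c (Suc (Suc i)) + 2} (\<lambda>s. 1 / (g (Suc i) s)\<^sup>2)"
      by (simp add: bb_def c_Suc_Suc g_Suc_Suc)
    also have "\<dots> = integral {c (Suc i)..c (Suc (Suc i))} ((\<lambda>s. 1 / (g (Suc i) s)\<^sup>2) \<circ> (+) 2)"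
      by (rule integral_shift_Icc_real[symmetric])
    also have "\<dots> = bb i"
      using slit_motionD(4)[OF mot_g] by (simp add: bb_def comp_def add.commute)
    finally show ?thesis .
  qed
  have aper: "aa (Suc (Suc i)) = aa i" "rr (Suc (Suc i)) = rr i" for i
    by (simp_all add: aa_def rr_def h_period c_Suc_Suc g_Suc_Suc slit_motion_periodic_deriv(1)[OF mot_g])
  have rpos: "0 < rr i" for i using h_bounds[of i] by (simp add: rr_def)
  show "matA (Suc (Suc i)) = matA i" "matB (Suc (Suc i)) = matB i" "matC (Suc (Suc i)) = matC i" "matD (Suc (Suc i)) = matD i" for i
    by (simp_all add: matA_def matB_def matC_def matD_def bper aper)
  show "0 < matB i" for i
  proof -
    let ?a = "c (Suc i)" and ?b = "c (Suc (Suc i))"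
    have "integral {?a..?b} (\<lambda>s. 1) \<le> bb i"
      unfolding bb_def
    proof (rule integral_le[OF integrable_const_ivl inv_g_integrable])
      fix s
      have "(g (Suc i) s)\<^sup>2 \<le> 1\<^sup>2" using g_bd(1,2)[of "Suc i" s] mC by (intro power_mono) auto
      then show "1 \<le> 1 / (g (Suc i) s)\<^sup>2" using g_nonzero by simp
    qed
    then have "0 < bb i" using c_less_Suc[of "Suc i"] by simp
    then show ?thesis using rpos by (simp add: matB_def)
  qed
  show "matA i * matD i - matB i * matC i = 1" for i
    using rpos[of i] by (simp add: matA_def matB_def matC_def matD_def field_simps)
  show "2 < \<bar>matA 1 * matA 0 + matB 1 * matC 0 + matC 1 * matB 0 + matD 1 * matD 0\<bar>"
    using assms unfolding TrL_eq .
qed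

end

context hyperbolic_pair begin

lemma row_sums: "\<exists>\<Lambda>\<ge>1. \<forall>i. \<bar>A i\<bar> + \<bar>B i\<bar> \<le> \<Lambda> \<and> \<bar>C i\<bar> + \<bar>D i\<bar> \<le> \<Lambda>"
proof -
  define Z where "Z i = \<bar>A i\<bar> + \<bar>B i\<bar> + \<bar>C i\<bar> + \<bar>D i\<bar>" for i
  have "\<bar>A i\<bar> + \<bar>B i\<bar> \<le> 1 + Z 0 + Z 1 \<and> \<bar>C i\<bar> + \<bar>D i\<bar> \<le> 1 + Z 0 + Z 1" for i
    using parity[of i] by (cases "even i"; simp add: Z_def)
  moreover have "1 \<le> 1 + Z 0 + Z 1" by (simp add: Z_def)
  ultimately show ?thesis by blast
qed

end

section \<open>Escape from the lower chamber\<close>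

locale trap_hyp = trap +
  fixes \<kappa>0 :: real
  assumes tr: "2 < \<bar>TrL lam x0 fL fR\<bar>"
    and kap: "0 < \<kappa>0" "\<kappa>0 < 1" "\<And>i. hp i \<le> \<kappa>0 * hm i"
begin

text \<open>A strip half-width strictly between \<kappa>0 and 1; the margin
  \<open>kk - \<kappa>0\<close> is the error budget for shadowing.\<close>

definition kk :: real where "kk = (1 + \<kappa>0) / 2"

lemma kk: "0 < kk" "kk < 1" "\<kappa>0 < kk"
  using kap by (auto simp: kk_def)

sublocale mat: hyperbolic_pair matA matB matC matD
  by (rule mat_hyperbolic[OF tr])

text \<open>This instance supplies \<open>LS\<close>, its monotonicity in the number of steps and
  the shadowing lemma. None of these involves directions, so the direction sets are empty; survival
  estimates come from \<open>survivors_small\<close>.\<close>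

sublocale surv: linear_survival kk matA matB matC matD "\<lambda>_. {}"
  by unfold_locales (use kk in auto)

text \<open>Initial action of a ball sent down from the slit. With \<open>AA\<close> below, its
  phase at the first critical time is about -1 + \<open>act\<close> * \<open>AA\<close>.\<close>

definition act :: "nat \<Rightarrow> real \<Rightarrow> real \<Rightarrow> real" where
  "act n t0 v0 = g n t0 * (deriv (g n) t0 - v0)"

definition AA :: "nat \<Rightarrow> real \<Rightarrow> real" where
  "AA n t0 = integral {t0..c (Suc n)} (\<lambda>r. 1 / (g n r)\<^sup>2)"

text \<open>A fast ball that stays below for N passages has all its phases in the strip of
  half-width \<kappa>0, so the linear orbit with the idealised initial data survives N levels in the
  slightly wider strips.\<close>

lemma surv_LS:
  "\<exists>V0\<ge>0. \<forall>n t0 v0 b y w. orb t0 v0 b y w \<and> 0 \<le> t0 \<and> c n < t0 \<and> t0 < c (Suc n) \<and> c (Suc n + N) \<le> b \<and>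
     v0 \<le> - V0 \<and> (\<forall>j<N. y (c (Suc (n + j))) < hp (n + j)) \<longrightarrow> surv.LS N n (- 1 + act n t0 v0 * AA n t0) (act n t0 v0)"
proof -
  obtain \<Lambda> where \<Lambda>: "1 \<le> \<Lambda>" "\<And>i. \<bar>matA i\<bar> + \<bar>matB i\<bar> \<le> \<Lambda>" "\<And>i. \<bar>matC i\<bar> + \<bar>matD i\<bar> \<le> \<Lambda>"
    using mat.row_sums by blast
  define P where "P = (\<Lambda> + 1) ^ N"
  have P: "0 < P" using \<Lambda>(1) by (simp add: P_def)
  \<comment> \<open>The initial error and the error per step are both \<eta>, so the accumulated
    error uses exactly the margin \<open>kk - \<kappa>0\<close>.\<close>
  define \<eta> where "\<eta> = (kk - \<kappa>0) / (2 * P)"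
  have "(\<eta> + \<eta>) * P = kk - \<kappa>0" using P by (simp add: \<eta>_def)
  then have eta: "0 < \<eta>" "(\<eta> + \<eta>) * (\<Lambda> + 1) ^ N \<le> kk - \<kappa>0" using kk P by (auto simp: \<eta>_def P_def)
  obtain V1 where V1: "0 \<le> V1" and start: "\<forall>n t0 v0 b y w. orb t0 v0 b y w \<and> 0 \<le> t0 \<and> c n < t0 \<and> t0 < c (Suc n) \<and> c (Suc n) \<le> b \<and> v0 \<le> - V1 \<longrightarrow>
    \<bar>en_at y w n - g n t0 * (deriv (g n) t0 - v0)\<bar> \<le> \<eta> \<and>
    (\<exists>k::int. \<bar>ph_at y w n - (- 1 + g n t0 * (deriv (g n) t0 - v0) * integral {t0..c (Suc n)} (\<lambda>r. 1 / (g n r)\<^sup>2)) - 2 * of_int k\<bar> \<le> \<eta>)"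
    by (rule exE[OF low_start[OF eta(1)]]) (elim conjE, rule that)
  obtain J1 where J1: "1 \<le> J1" and step: "\<forall>i t0 v0 b y w. orb t0 v0 b y w \<and> 0 \<le> t0 \<and> t0 \<le> c (Suc i) \<and> c (Suc (Suc i)) \<le> b \<and>
    y (c (Suc i)) < hp i \<and> J1 \<le> en_at y w i \<longrightarrow>
    \<bar>en_at y w (Suc i) - (matC i * ph_at y w i + matD i * en_at y w i)\<bar> \<le> \<eta> \<and>
    (\<exists>k::int. \<bar>ph_at y w (Suc i) - (matA i * ph_at y w i + matB i * en_at y w i) - 2 * of_int k\<bar> \<le> \<eta>)"
    by (rule exE[OF low_step[OF eta(1)]]) (elim conjE, rule that)
  obtain V2 where V2: "0 \<le> V2" and en: "\<forall>t0 v0 b y w n t. orb t0 v0 b y w \<and> 0 \<le> t0 \<and> c n \<le> t0 \<and> t0 < c (Suc n) \<and> V2 \<le> \<bar>v0\<bar> \<and>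
     t0 \<le> t \<and> t \<le> b \<and> t \<le> c (Suc n + N) \<longrightarrow> (J1 + C) / m \<le> \<bar>w t\<bar>"
    by (rule exE[OF orb_energy_ge[of N "(J1 + C) / m"]]) (elim conjE, rule that)
  have main: "surv.LS N n (- 1 + act n t0 v0 * AA n t0) (act n t0 v0)"
    if o: "orb t0 v0 b y w" and t0: "0 \<le> t0" "c n < t0" "t0 < c (Suc n)" and b: "c (Suc n + N) \<le> b"
      and v: "v0 \<le> - max V1 V2" and lt: "\<And>j. j < N \<Longrightarrow> y (c (Suc (n + j))) < hp (n + j)" for n t0 v0 b y w
  proof -
    have cb: "c (Suc (n + j)) \<le> b" "t0 \<le> c (Suc (n + j))" if "j \<le> N" for j
      using b t0 c_mono[of "Suc (n + j)" "Suc n + N"] c_mono[of "Suc n" "Suc (n + j)"] that by auto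
    have y: "0 \<le> y (c (Suc (n + j)))" "y (c (Suc (n + j))) \<le> 1" if "j \<le> N" for j
      using orbD(5)[OF o, of "c (Suc (n + j))"] cb[OF that] by auto
    have st: "\<bar>en_at y w n - act n t0 v0\<bar> \<le> \<eta> \<and>
      (\<exists>k::int. \<bar>ph_at y w n - (- 1 + act n t0 v0 * AA n t0) - 2 * of_int k\<bar> \<le> \<eta>)"
      unfolding act_def AA_def by (rule start[rule_format]) (use o t0 cb[of 0] v in auto)
    then obtain k where k: "\<bar>ph_at y w n - (- 1 + act n t0 v0 * AA n t0) - 2 * of_int k\<bar> \<le> \<eta>" by blast
    have J: "J1 \<le> en_at y w (n + j)" if "j \<le> N" for j
    proof -
      have le: "c (Suc (n + j)) \<le> c (Suc n + N)" using that by (intro c_mono) simp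
      have "(J1 + C) / m \<le> \<bar>w (c (Suc (n + j)))\<bar>"
        by (rule en[rule_format, of t0 v0 b y w n]) (use o t0 cb[OF that] v V2 le in auto)
      then have "J1 + C \<le> m * \<bar>w (c (Suc (n + j)))\<bar>" using mC by (simp add: field_simps)
      moreover have "m * \<bar>w (c (Suc (n + j)))\<bar> - C \<le> en_at y w (n + j)"
        unfolding en_at_def by (rule mom_bounds(1)[OF bd_g]) (use y[OF that] in auto)
      ultimately show ?thesis by linarith
    qed
    have stp: "\<bar>en_at y w (Suc (n + j)) - (matC (n + j) * ph_at y w (n + j) + matD (n + j) * en_at y w (n + j))\<bar> \<le> \<eta> \<and>
      (\<exists>k::int. \<bar>ph_at y w (Suc (n + j)) - (matA (n + j) * ph_at y w (n + j) + matB (n + j) * en_at y w (n + j)) - 2 * of_int k\<bar> \<le> \<eta>)"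
      if j: "Suc j < N" for j
      by (rule step[rule_format, of t0 v0 b y w]) (use o t0(1) cb[of j] cb[of "Suc j"] lt[of j] J[of j] j in auto)
    have ph: "\<bar>ph_at y w (n + j)\<bar> \<le> \<kappa>0" if j: "j < N" for j
    proof -
      have "\<bar>ph_at y w (n + j)\<bar> \<le> y (c (Suc (n + j))) / hm (n + j)"
        using y[of j] j h_bounds(5)[of "n + j"]
        by (simp add: ph_at_def ang_def hm_def abs_mult sgn_if)
      also have "\<dots> \<le> (\<kappa>0 * hm (n + j)) / hm (n + j)"
        using lt[OF j] kap(3)[of "n + j"] h_bounds(5)[of "n + j"] by (intro divide_right_mono) auto
      also have "\<dots> = \<kappa>0" using h_bounds(5)[of "n + j"] by simp
      finally show ?thesis .
    qed
    show ?thesis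
    proof (rule surv.LS_shadow[of \<Lambda> \<eta> \<eta> N \<kappa>0 "ph_at y w" n "en_at y w"])
      have "\<bar>- 1 + act n t0 v0 * AA n t0 - ph_at y w n - 2 * of_int (- k)\<bar> \<le> \<eta>" using k by simp
      then show "\<exists>k::int. \<bar>- 1 + act n t0 v0 * AA n t0 - ph_at y w n - 2 * of_int k\<bar> \<le> \<eta>" by blast
      show "\<bar>act n t0 v0 - en_at y w n\<bar> \<le> \<eta>" using st by linarith
    qed (use \<Lambda> eta ph stp in auto)
  qed
  show ?thesis
    by (rule exI[of _ "max V1 V2"]) (use main V1 in auto)
qed

text \<open>A ball sent up is above the slit at the first critical time, hence above the lower new
  one. A ball sent down whose linear orbit does not survive must be found above the new slit at one
  of the N critical times.\<close>

lemma trapped_level: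
  "\<exists>V0\<ge>0. \<forall>n t0 v0 b y w. orb t0 v0 b y w \<and> 0 \<le> t0 \<and> c n < t0 \<and> t0 < c (Suc n) \<and> c (Suc n + N) \<le> b \<and>
     V0 \<le> \<bar>v0\<bar> \<and> (0 < v0 \<or> \<not> surv.LS N n (- 1 + act n t0 v0 * AA n t0) (act n t0 v0)) \<longrightarrow>
     (\<exists>i. n \<le> i \<and> i \<le> n + N \<and> hp i < y (c (Suc i)))"
proof -
  obtain V1 where V1: "0 \<le> V1" and s: "\<forall>n t0 v0 b y w. orb t0 v0 b y w \<and> 0 \<le> t0 \<and> c n < t0 \<and> t0 < c (Suc n) \<and> c (Suc n + N) \<le> b \<and>
     v0 \<le> - V1 \<and> (\<forall>j<N. y (c (Suc (n + j))) < hp (n + j)) \<longrightarrow> surv.LS N n (- 1 + act n t0 v0 * AA n t0) (act n t0 v0)"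
    using surv_LS[of N] by (elim exE conjE) (rule that)
  have main: "\<exists>i. n \<le> i \<and> i \<le> n + N \<and> hp i < y (c (Suc i))"
    if o: "orb t0 v0 b y w" and t0: "0 \<le> t0" "c n < t0" "t0 < c (Suc n)" and b: "c (Suc n + N) \<le> b"
      and v: "max V1 (C + 1) \<le> \<bar>v0\<bar>" and alt: "0 < v0 \<or> \<not> surv.LS N n (- 1 + act n t0 v0 * AA n t0) (act n t0 v0)"
    for n t0 v0 b y w
  proof (cases "0 < v0")
    case True
    define e where "e = c (Suc n)"
    have eb: "e \<le> b" using b c_mono[of "Suc n" "Suc n + N"] by (simp add: e_def)
    obtain r where r: "t0 < r" "r < e" "0 < (y r - g n r) * v0"
      using start_germ[OF o t0] v eb by (force simp: e_def)
    then have gr: "r \<in> {t0..e}" "g n r < y r" using True by (auto simp: zero_less_mult_iff)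
    have pre: "0 \<le> t0" "t0 \<le> t0" "e \<le> b" "c n \<le> t0" "e \<le> c (Suc n)" "t0 < e" using t0 eb by (auto simp: e_def)
    have "continuous_on {t0..e} (\<lambda>t. y t - g n t)"
      by (intro continuous_intros orb_continuous[OF o] pre continuous_g)
    then have "0 \<le> y e - g n e"
      by (rule limit_le_endpoints) (use orb_up[OF o pre gr] pre in auto)
    then have "hp n < y (c (Suc n))" using hp_less_hm[of n] by (simp add: hm_def e_def)
    then show ?thesis by (intro exI[of _ n]) simp
  next
    case False
    then have "v0 \<le> - V1" using v by simp
    then have "\<not> (\<forall>j<N. y (c (Suc (n + j))) < hp (n + j))"
      using s[rule_format, of t0 v0 b y w n] o t0 b alt False by blast
    then obtain j where j: "j < N" "hp (n + j) \<le> y (c (Suc (n + j)))" by (auto simp: not_less)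
    have "t0 \<le> c (Suc (n + j))" "c (Suc (n + j)) \<le> b"
      using t0 b c_mono[of "Suc n" "Suc (n + j)"] c_mono[of "Suc (n + j)" "Suc n + N"] j by auto
    then have "y (c (Suc (n + j))) \<noteq> fL (c (Suc (n + j))) \<and> y (c (Suc (n + j))) \<noteq> fR (c (Suc (n + j)))"
      using orbD(6)[OF o _ _ crit_c] by blast
    \<comment> \<open>Equality would be a contact with the slit at a critical time, which orbits
      avoid.\<close>
    then have "y (c (Suc (n + j))) \<noteq> hp (n + j)" using g_cases[of "Suc (n + j)"] by (auto simp: hp_def)
    then show ?thesis using j by (intro exI[of _ "n + j"]) auto
  qed
  show ?thesis
    by (rule exI[of _ "max V1 (C + 1)"]) (use main V1 in auto)
qed

text \<open>Before trapping, the speed stays large because only N passages are involved; afterwards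
  it grows. This gives the a priori bounds needed for global existence, and the growth estimate from
  a time depending only on N.\<close>

lemma growth_criterion:
  "\<exists>K>0. \<exists>\<zeta>>0. \<forall>N. \<exists>V0. \<forall>V\<ge>V0. \<forall>n t0 v0. n \<le> 2 \<and> c n < t0 \<and> t0 < c (Suc n) \<and> (t0, v0) \<in> initial_conds V \<and>
     (t0, v0) \<notin> Null_set \<and> (0 < v0 \<or> \<not> surv.LS N n (- 1 + act n t0 v0 * AA n t0) (act n t0 v0)) \<longrightarrow>
     (t0, v0) \<in> growing_conds lam x0 fL fR K \<zeta> (real N + 6) V"
proof -
  obtain K \<zeta> W where K: "0 < K" "0 < \<zeta>" and gr: "\<forall>t0 v0 b y w i T t. orb t0 v0 b y w \<and> 0 \<le> t0 \<and> t0 \<le> c (Suc i) \<and>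
     hp i < y (c (Suc i)) \<and> W \<le> \<bar>w (c (Suc i))\<bar> \<and> c (Suc i) \<le> T \<and> T \<le> t \<and> t \<le> b \<longrightarrow>
     wmin \<le> \<bar>w t\<bar> \<and> \<bar>w T\<bar> / K * exp (\<zeta> * (t - T)) \<le> \<bar>w t\<bar>"
    using trapped_growth by (elim exE conjE) (rule that)
  have main: "\<exists>V0. \<forall>V\<ge>V0. \<forall>n t0 v0. n \<le> 2 \<and> c n < t0 \<and> t0 < c (Suc n) \<and> (t0, v0) \<in> initial_conds V \<and>
     (t0, v0) \<notin> Null_set \<and> (0 < v0 \<or> \<not> surv.LS N n (- 1 + act n t0 v0 * AA n t0) (act n t0 v0)) \<longrightarrow>
     (t0, v0) \<in> growing_conds lam x0 fL fR K \<zeta> (real N + 6) V" for N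
  proof -
    obtain V1 where V1: "0 \<le> V1" and lev: "\<forall>n t0 v0 b y w. orb t0 v0 b y w \<and> 0 \<le> t0 \<and> c n < t0 \<and> t0 < c (Suc n) \<and> c (Suc n + N) \<le> b \<and>
       V1 \<le> \<bar>v0\<bar> \<and> (0 < v0 \<or> \<not> surv.LS N n (- 1 + act n t0 v0 * AA n t0) (act n t0 v0)) \<longrightarrow>
       (\<exists>i. n \<le> i \<and> i \<le> n + N \<and> hp i < y (c (Suc i)))"
      using trapped_level[of N] by (elim exE conjE) (rule that)
    obtain V2 where V2: "0 \<le> V2" and en: "\<forall>t0 v0 b y w n t. orb t0 v0 b y w \<and> 0 \<le> t0 \<and> c n \<le> t0 \<and> t0 < c (Suc n) \<and> V2 \<le> \<bar>v0\<bar> \<and>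
       t0 \<le> t \<and> t \<le> b \<and> t \<le> c (Suc n + N) \<longrightarrow> max wmin W \<le> \<bar>w t\<bar>"
      by (rule exE[OF orb_energy_ge[of N "max wmin W"]]) (elim conjE, rule that)
    have x: "(t0, v0) \<in> growing_conds lam x0 fL fR K \<zeta> (real N + 6) V"
      if V: "max V1 V2 \<le> V" and n: "n \<le> 2" "c n < t0" "t0 < c (Suc n)" and ic: "(t0, v0) \<in> initial_conds V"
        and nn: "(t0, v0) \<notin> Null_set"
        and alt: "0 < v0 \<or> \<not> surv.LS N n (- 1 + act n t0 v0 * AA n t0) (act n t0 v0)" for V n t0 v0
    proof -
      have t0: "0 \<le> t0" "t0 < 2" and v: "V1 \<le> \<bar>v0\<bar>" "V2 \<le> \<bar>v0\<bar>" using ic V by (auto simp: initial_conds_def)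
      have late: "wmin \<le> \<bar>w t\<bar> \<and> (c (Suc n + N) \<le> T \<longrightarrow> \<bar>w T\<bar> / K * exp (\<zeta> * (t - T)) \<le> \<bar>w t\<bar>)"
        if o: "orb t0 v0 b y w" and t: "c (Suc n + N) \<le> t" "t \<le> b" and T: "T \<le> t" for b y w T t
      proof -
        have cb: "c (Suc n + N) \<le> b" using t by simp
        then obtain i where i: "n \<le> i" "i \<le> n + N" "hp i < y (c (Suc i))"
          using lev[rule_format, of t0 v0 b y w n] o t0 n v alt by blast
        have ci: "c (Suc i) \<le> c (Suc n + N)" "t0 \<le> c (Suc i)"
          using c_mono[of "Suc i" "Suc n + N"] c_mono[of "Suc n" "Suc i"] i n by auto
        have "max wmin W \<le> \<bar>w (c (Suc i))\<bar>"
          by (rule en[rule_format, of t0 v0 b y w n]) (use o t0 n v ci cb in auto)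
        then have W: "W \<le> \<bar>w (c (Suc i))\<bar>" by simp
        have "wmin \<le> \<bar>w t\<bar> \<and> \<bar>w S\<bar> / K * exp (\<zeta> * (t - S)) \<le> \<bar>w t\<bar>" if "c (Suc n + N) \<le> S" "S \<le> t" for S
          by (rule gr[rule_format, of t0 v0 b y w i]) (use o t0(1) ci i W t that in auto)
        then show ?thesis using t T by blast
      qed
      \<comment> \<open>The upper speed bound depends on B, but only its existence matters for
        excluding accumulation of collisions.\<close>
      have exB: "\<exists>y w. orb t0 v0 B y w" if B: "t0 \<le> B" for B
      proof -
        obtain k :: nat where k: "B + 2 < real k" using reals_Archimedean2 by blast
        obtain Wm where le: "\<forall>t0 v0' b y w n t. orb t0 v0' b y w \<and> 0 \<le> t0 \<and> c n \<le> t0 \<and> t0 < c (Suc n) \<and> \<bar>v0'\<bar> \<le> \<bar>v0\<bar> \<and>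
          t0 \<le> t \<and> t \<le> b \<and> t \<le> c (Suc n + k) \<longrightarrow> \<bar>w t\<bar> \<le> Wm"
          by (rule exE[OF orb_energy_le[of "\<bar>v0\<bar>" k]]) (rule that)
        have ck: "B \<le> c (Suc n + k)" using c_ge[of "Suc n + k"] k by simp
        have "wmin \<le> \<bar>w t\<bar> \<and> \<bar>w t\<bar> \<le> Wm" if o: "orb t0 v0 b y w" and b: "b \<le> B" "t0 \<le> t" "t \<le> b" for b y w t
        proof
          show "\<bar>w t\<bar> \<le> Wm" by (rule le[rule_format, of t0 v0 b y w n]) (use o t0 n b ck in auto)
          show "wmin \<le> \<bar>w t\<bar>"
          proof (cases "t \<le> c (Suc n + N)")
            case True
            have "max wmin W \<le> \<bar>w t\<bar>" by (rule en[rule_format, of t0 v0 b y w n]) (use o t0 n v b True in auto)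
            then show ?thesis by simp
          next
            case False
            then show ?thesis using late[OF o, of t t] b by simp
          qed
        qed
        then show ?thesis by (intro orb_exists[OF t0(1) B nn, of Wm]) blast
      qed
      have "orbit lam x0 fL fR t0 v0 (Yc (t0, v0)) (Wc (t0, v0))"
        by (rule orbit_glue[OF exB t0(1)])
      moreover have "\<bar>Wc (t0, v0) (t0 + (real N + 6))\<bar> / K * exp (\<zeta> * (t - (real N + 6))) \<le> \<bar>Wc (t0, v0) (t0 + t)\<bar>"
        if t: "real N + 6 \<le> t" for t
      proof -
        obtain y w where o: "orb t0 v0 (t0 + t + 1) y w" using exB[of "t0 + t + 1"] t by auto
        \<comment> \<open>Since n is at most 2 and \<open>c k\<close> at most k + 2, trapping has
          happened by time N + 5.\<close>
        have cN: "c (Suc n + N) \<le> t0 + (real N + 6)" using c_le_real[of "Suc n + N"] n t0 by simp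
        have "\<bar>w (t0 + (real N + 6))\<bar> / K * exp (\<zeta> * (t0 + t - (t0 + (real N + 6)))) \<le> \<bar>w (t0 + t)\<bar>"
          using late[OF o, of "t0 + t" "t0 + (real N + 6)"] cN t by simp
        moreover have "w (t0 + t) = Wc (t0, v0) (t0 + t)" "w (t0 + (real N + 6)) = Wc (t0, v0) (t0 + (real N + 6))"
          by (rule orb_eq_cand(2)[OF o t0(1)]; use t in simp)+
        ultimately show ?thesis by simp
      qed
      ultimately show ?thesis using ic unfolding growing_conds_def by blast
    qed
    show ?thesis
      by (rule exI[of _ "max V1 V2"]) (use x in blast)
  qed
  show ?thesis
    by (rule exI[of _ K], rule conjI[OF K(1)], rule exI[of _ \<zeta>], rule conjI[OF K(2)]) (intro allI main)
qed

end

section \<open>Estimates on slices of constant initial time\<close>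

lemma cov_negligible: "negligible Z \<Longrightarrow> cov Z 0"
  unfolding cov_def by (auto simp: negligible_imp_measure0 negligible_imp_measurable intro!: bexI[of _ Z])

lemma cov_Un:
  assumes "cov X r" "cov Y q" shows "cov (X \<union> Y) (r + q)"
proof -
  have "cov (\<Union>k\<in>{True, False}. if k then X else Y) (\<Sum>k\<in>{True, False}. if k then r else q)"
    by (rule cov_UN) (use assms in auto)
  then show ?thesis by (simp add: Un_commute)
qed

text \<open>Fubini for a null set: almost all of its vertical slices are null.\<close>

lemma null_slices:
  fixes S :: "(real \<times> real) set"
  assumes "negligible S"
  shows "\<exists>Z. negligible Z \<and> (\<forall>t. t \<notin> Z \<longrightarrow> negligible {v. (t, v) \<in> S})"
proof -
  have "S \<in> null_sets lebesgue" using assms by (simp add: negligible_iff_null_sets)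
  then have "AE x in lebesgue. x \<notin> S" by (rule AE_not_in)
  then have "AE x in lborel. x \<notin> S" by (simp add: AE_completion_iff)
  then have "AE x in lborel \<Otimes>\<^sub>M lborel. x \<notin> S" unfolding lborel_prod .
  then have "AE t in lborel. AE v in lborel. (t, v) \<notin> S" by (rule lborel_pair.AE_pair)
  then obtain Z where Z: "{t \<in> space lborel. \<not> (AE v in lborel. (t, v) \<notin> S)} \<subseteq> Z" "emeasure lborel Z = 0" "Z \<in> sets lborel"
    by (rule AE_E)
  have "negligible Z" using Z by (simp add: negligible_iff_null_sets null_sets_def)
  moreover have "negligible {v. (t, v) \<in> S}" if "t \<notin> Z" for t
  proof -
    have "AE v in lborel. (t, v) \<notin> S" using Z(1) that by auto
    then obtain N where N: "{v \<in> space lborel. \<not> (t, v) \<notin> S} \<subseteq> N" "emeasure lborel N = 0" "N \<in> sets lborel"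
      by (rule AE_E)
    have "negligible N" using N by (simp add: negligible_iff_null_sets null_sets_def)
    then show ?thesis by (rule negligible_subset) (use N(1) in auto)
  qed
  ultimately show ?thesis by blast
qed

lemma negligible_affine_preimage:
  fixes Z :: "real set"
  assumes "negligible Z" "\<bar>\<sigma>\<bar> = 1"
  shows "negligible {s. \<sigma> * (V + s) \<in> Z}"
proof -
  have "negligible ((\<lambda>v. \<sigma> * v - V) ` Z)"
    by (rule negligible_differentiable_image_negligible[OF _ assms(1)])
      (auto simp: differentiable_on_def intro!: derivative_intros differentiable_diff differentiable_mult)
  moreover have "{s. \<sigma> * (V + s) \<in> Z} \<subseteq> (\<lambda>v. \<sigma> * v - V) ` Z"
  proof
    fix s assume "s \<in> {s. \<sigma> * (V + s) \<in> Z}"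
    moreover have "\<sigma> * \<sigma> = 1" using assms(2) by (metis abs_mult_self_eq mult_1)
    then have "s = \<sigma> * (\<sigma> * (V + s)) - V" by (simp add: mult.assoc[symmetric])
    ultimately show "s \<in> (\<lambda>v. \<sigma> * v - V) ` Z" by blast
  qed
  ultimately show ?thesis by (rule negligible_subset)
qed

context trap begin

lemma inv_g_ge_1: "1 \<le> 1 / (g n s)\<^sup>2" "1 / (g n s)\<^sup>2 \<le> 1 / m\<^sup>2"
proof -
  have "(g n s)\<^sup>2 \<le> 1\<^sup>2" "m\<^sup>2 \<le> (g n s)\<^sup>2" using g_bd(1,2)[of n s] mC by (intro power_mono; simp)+
  then show "1 \<le> 1 / (g n s)\<^sup>2" "1 / (g n s)\<^sup>2 \<le> 1 / m\<^sup>2"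
    using g_nonzero mC by (auto intro!: divide_left_mono)
qed

end

context trap_hyp begin

lemma AA_diff:
  assumes "t \<le> t'" "t' \<le> c (Suc n)"
  shows "t' - t \<le> AA n t - AA n t'"
proof -
  have "AA n t = integral {t..t'} (\<lambda>r. 1 / (g n r)\<^sup>2) + AA n t'"
    unfolding AA_def
    by (rule Henstock_Kurzweil_Integration.integral_combine[symmetric]) (use assms inv_g_integrable in auto)
  moreover have "integral {t..t'} (\<lambda>r. 1) \<le> integral {t..t'} (\<lambda>r. 1 / (g n r)\<^sup>2)"
    by (rule integral_le[OF integrable_const_ivl inv_g_integrable inv_g_ge_1(1)])
  ultimately show ?thesis using assms by simp
qed

lemma AA_bounds:
  assumes "c n \<le> t" "t \<le> c (Suc n)"
  shows "0 \<le> AA n t" "AA n t \<le> 2 / m\<^sup>2"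
proof -
  have "AA n (c (Suc n)) = 0" by (simp add: AA_def)
  then show "0 \<le> AA n t" using AA_diff[OF assms(2) order_refl] assms by simp
  have "AA n t \<le> integral {t..c (Suc n)} (\<lambda>r. 1 / m\<^sup>2)"
    unfolding AA_def by (rule integral_le[OF inv_g_integrable integrable_const_ivl inv_g_ge_1(2)])
  also have "\<dots> = (c (Suc n) - t) * (1 / m\<^sup>2)" using assms by simp
  also have "\<dots> \<le> 2 * (1 / m\<^sup>2)" using c_Suc_le[of n] assms mC by (intro mult_right_mono) auto
  finally show "AA n t \<le> 2 / m\<^sup>2" by simp
qed

text \<open>The direction of the slice at time t is proportional to (\<open>AA n t\<close>, 1). As a
  function of t, \<open>AA n\<close> decreases with slope at most -1, so for u nonzero the
  functional is small only on a short interval; for u = 0 it is the nonzero constant v.\<close>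

lemma exceptional_times:
  assumes uv: "u \<noteq> 0 \<or> v \<noteq> (0 :: real)" and e: "0 < \<epsilon>"
  shows "\<exists>\<delta>>0. cov {t. c n < t \<and> t < c (Suc n) \<and> \<bar>u * AA n t + v\<bar> < \<delta> / m} \<epsilon>"
proof (cases "u = 0")
  case True
  then have "{t. c n < t \<and> t < c (Suc n) \<and> \<bar>u * AA n t + v\<bar> < (m * \<bar>v\<bar>) / m} \<subseteq> {1..0}" using mC by auto
  then have "cov {t. c n < t \<and> t < c (Suc n) \<and> \<bar>u * AA n t + v\<bar> < (m * \<bar>v\<bar>) / m} \<epsilon>"
    by (rule cov_interval) (use e in auto)
  then show ?thesis using True uv mC by (intro exI[of _ "m * \<bar>v\<bar>"]) auto
next
  case False
  define \<delta> where "\<delta> = m * (\<bar>u\<bar> * \<epsilon> / 4)"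
  have d: "0 < \<delta>" "\<delta> / m = \<bar>u\<bar> * \<epsilon> / 4" using False e mC by (auto simp: \<delta>_def)
  define E where "E = {t. c n < t \<and> t < c (Suc n) \<and> \<bar>u * AA n t + v\<bar> < \<delta> / m}"
  have close: "\<bar>t - t'\<bar> \<le> \<epsilon> / 2" if t: "t \<in> E" "t' \<in> E" for t t'
  proof -
    have "\<bar>t - t'\<bar> \<le> \<bar>AA n t - AA n t'\<bar>"
      using AA_diff[of t t' n] AA_diff[of t' t n] t by (cases "t \<le> t'") (auto simp: E_def)
    then have "\<bar>u\<bar> * \<bar>t - t'\<bar> \<le> \<bar>u\<bar> * \<bar>AA n t - AA n t'\<bar>" by (rule mult_left_mono) simp
    also have "\<dots> = \<bar>(u * AA n t + v) - (u * AA n t' + v)\<bar>" by (simp add: abs_mult[symmetric] right_diff_distrib)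
    also have "\<dots> \<le> 2 * (\<bar>u\<bar> * \<epsilon> / 4)"
    proof -
      have "\<bar>u * AA n t + v\<bar> < \<bar>u\<bar> * \<epsilon> / 4" "\<bar>u * AA n t' + v\<bar> < \<bar>u\<bar> * \<epsilon> / 4"
        using t by (simp_all only: E_def d(2) mem_Collect_eq)
      then show ?thesis by linarith
    qed
    finally have "\<bar>u\<bar> * \<bar>t - t'\<bar> \<le> \<bar>u\<bar> * (\<epsilon> / 2)" by (simp add: mult_ac)
    then show ?thesis using False by (simp only: mult_le_cancel_left zero_less_abs_iff) auto
  qed
  have "cov E \<epsilon>"
  proof (cases "E = {}")
    case True
    then show ?thesis using e by (intro cov_interval[of E 1 0]) auto
  next
    case False
    then obtain t where t: "t \<in> E" by blast
    have "E \<subseteq> {t - \<epsilon> / 2..t + \<epsilon> / 2}"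
    proof
      fix x assume "x \<in> E"
      then have "\<bar>x - t\<bar> \<le> \<epsilon> / 2" using t by (rule close)
      then show "x \<in> {t - \<epsilon> / 2..t + \<epsilon> / 2}" unfolding atLeastAtMost_iff by linarith
    qed
    then show ?thesis by (rule cov_interval) (use e in auto)
  qed
  then show ?thesis using d(1) unfolding E_def by blast
qed

text \<open>Velocities pointing up are good off a null set; those pointing down are bad only on the
  null set or where the linear orbit survives N passages, a set of small measure unless t is
  exceptional. K and \<zeta> are fixed before \<epsilon>; N, and with it T, depends on
  \<epsilon>.\<close>

lemma small_slices:
  "\<exists>K>0. \<exists>\<zeta>>0. \<forall>\<epsilon>>0. \<exists>V0. \<exists>T\<ge>0. \<exists>E. cov E \<epsilon> \<and> (\<forall>V\<ge>V0. \<forall>t\<in>{0..<2} - E. \<forall>\<sigma>. \<bar>\<sigma>\<bar> = 1 \<longrightarrow>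
     cov {s \<in> {0..1}. (t, \<sigma> * (V + s)) \<in> initial_conds V - growing_conds lam x0 fL fR K \<zeta> T V} \<epsilon>)"
proof -
  obtain K \<zeta> where K: "0 < K" "0 < \<zeta>" and gr: "\<forall>N. \<exists>V0. \<forall>V\<ge>V0. \<forall>n t0 v0. n \<le> 2 \<and> c n < t0 \<and> t0 < c (Suc n) \<and> (t0, v0) \<in> initial_conds V \<and>
     (t0, v0) \<notin> Null_set \<and> (0 < v0 \<or> \<not> surv.LS N n (- 1 + act n t0 v0 * AA n t0) (act n t0 v0)) \<longrightarrow>
     (t0, v0) \<in> growing_conds lam x0 fL fR K \<zeta> (real N + 6) V"
    using growth_criterion by (elim exE conjE) (rule that)
  obtain u v :: "nat \<Rightarrow> real" where uv: "\<forall>i. u i \<noteq> 0 \<or> v i \<noteq> 0" and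
    small: "\<forall>\<delta>>0. \<forall>R. \<forall>\<eta>>0. \<forall>i. \<exists>N. \<forall>p q \<phi> J. \<delta> \<le> \<bar>u i * p + v i * q\<bar> \<and> \<bar>p\<bar> \<le> R \<and> \<bar>q\<bar> \<le> R \<longrightarrow>
      cov {s \<in> {0..1}. surv.LS N i (\<phi> + s * p) (J + s * q)} \<eta>"
    using mat.survivors_small[OF kk(1,2)] by (elim exE conjE) (rule that)
  obtain Z where Z: "negligible Z" and Zs: "\<forall>t. t \<notin> Z \<longrightarrow> negligible {v. (t, v) \<in> Null_set}"
    using null_slices[OF negligible_Null_set] by blast
  \<comment> \<open>Bounds both components of the slice direction, since \<open>AA\<close> is at
    most 2 / m^2 and the slit height at most 1.\<close>
  define R where "R = 2 / m\<^sup>2 + 1"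
  have main: "\<exists>V0. \<exists>T\<ge>0. \<exists>E. cov E \<epsilon> \<and> (\<forall>V\<ge>V0. \<forall>t\<in>{0..<2} - E. \<forall>\<sigma>. \<bar>\<sigma>\<bar> = 1 \<longrightarrow>
     cov {s \<in> {0..1}. (t, \<sigma> * (V + s)) \<in> initial_conds V - growing_conds lam x0 fL fR K \<zeta> T V} \<epsilon>)"
    if e: "0 < \<epsilon>" for \<epsilon> :: real
  proof -
    have "\<forall>n. \<exists>\<delta>>0. cov {t. c n < t \<and> t < c (Suc n) \<and> \<bar>u n * AA n t + v n\<bar> < \<delta> / m} (\<epsilon> / 3)"
    proof
      fix n show "\<exists>\<delta>>0. cov {t. c n < t \<and> t < c (Suc n) \<and> \<bar>u n * AA n t + v n\<bar> < \<delta> / m} (\<epsilon> / 3)"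
        by (rule exceptional_times) (use uv e in auto)
    qed
    from choice[OF this] obtain \<delta> where
      \<delta>: "\<forall>n. 0 < \<delta> n \<and> cov {t. c n < t \<and> t < c (Suc n) \<and> \<bar>u n * AA n t + v n\<bar> < \<delta> n / m} (\<epsilon> / 3)"
      by (elim exE) (rule that)
    have de: "0 < \<delta> n"
      and covE: "cov {t. c n < t \<and> t < c (Suc n) \<and> \<bar>u n * AA n t + v n\<bar> < \<delta> n / m} (\<epsilon> / 3)" for n
      by (rule conjunct1[OF \<delta>[rule_format]], rule conjunct2[OF \<delta>[rule_format]])
    have "\<forall>n. \<exists>N. \<forall>p q \<phi> J. \<delta> n \<le> \<bar>u n * p + v n * q\<bar> \<and> \<bar>p\<bar> \<le> R \<and> \<bar>q\<bar> \<le> R \<longrightarrow>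
      cov {s \<in> {0..1}. surv.LS N n (\<phi> + s * p) (J + s * q)} \<epsilon>"
      by (rule allI, rule small[rule_format, OF de e])
    from choice[OF this] obtain NN where NN: "\<forall>n p q \<phi> J. \<delta> n \<le> \<bar>u n * p + v n * q\<bar> \<and> \<bar>p\<bar> \<le> R \<and> \<bar>q\<bar> \<le> R \<longrightarrow>
      cov {s \<in> {0..1}. surv.LS (NN n) n (\<phi> + s * p) (J + s * q)} \<epsilon>"
      by (elim exE) (rule that)
    \<comment> \<open>One number of passages for all three starting intervals: survival of more
      levels implies survival of fewer, so any common upper bound serves.\<close>
    define N where "N = (\<Sum>n\<le>2. NN n)"
    have NNle: "NN n \<le> N" if "n \<le> 2" for n
      unfolding N_def by (rule member_le_sum) (use that in auto)
    define E where "E = (\<Union>n\<le>2. {t. c n < t \<and> t < c (Suc n) \<and> \<bar>u n * AA n t + v n\<bar> < \<delta> n / m}) \<union> Z"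
    have "cov E ((\<Sum>n\<le>(2::nat). \<epsilon> / 3) + 0)"
      unfolding E_def by (intro cov_Un cov_UN covE cov_negligible Z finite_atMost)
    moreover have "(\<Sum>n\<le>(2::nat). \<epsilon> / 3) + 0 = \<epsilon>" by simp
    ultimately have cE: "cov E \<epsilon>" by simp
    from gr[rule_format, of N] obtain V1 where V1: "\<forall>V\<ge>V1. \<forall>n t0 v0. n \<le> 2 \<and> c n < t0 \<and> t0 < c (Suc n) \<and> (t0, v0) \<in> initial_conds V \<and>
       (t0, v0) \<notin> Null_set \<and> (0 < v0 \<or> \<not> surv.LS N n (- 1 + act n t0 v0 * AA n t0) (act n t0 v0)) \<longrightarrow>
       (t0, v0) \<in> growing_conds lam x0 fL fR K \<zeta> (real N + 6) V"
      by (elim exE) (rule that)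
    have sl: "cov {s \<in> {0..1}. (t, \<sigma> * (V + s)) \<in> initial_conds V - growing_conds lam x0 fL fR K \<zeta> (real N + 6) V} \<epsilon>"
      (is "cov ?X \<epsilon>")
      if V: "max V1 1 \<le> V" and t: "t \<in> {0..<2} - E" and sg: "\<bar>\<sigma>\<bar> = 1" for V t \<sigma>
    proof -
      have tZ: "t \<notin> Z" using t by (auto simp: E_def)
      have neg: "negligible {s. (t, \<sigma> * (V + s)) \<in> Null_set}"
        using negligible_affine_preimage[of "{v. (t, v) \<in> Null_set}" \<sigma> V] Zs tZ sg by simp
      have tc: "t \<noteq> c n" for n
      proof
        assume "t = c n"
        then have "{v. (t, v) \<in> Null_set} = UNIV" unfolding Null_set_def by auto
        then show False using Zs tZ non_negligible_UNIV by metis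
      qed
      have "c 0 \<le> t" using t c0_neg by simp
      from locate_c[OF this] obtain n where n: "c n \<le> t" "t < c (Suc n)" by blast
      have n': "c n < t" using n(1) tc[of n] by simp
      have n2: "n \<le> 2"
      proof (rule ccontr)
        assume "\<not> n \<le> 2"
        then have "c 3 \<le> c n" by (intro c_mono) simp
        moreover have "c 3 > 2" using t12 by (simp add: c_def)
        ultimately show False using n(1) t by simp
      qed
      have V': "V1 \<le> V" "1 \<le> V" using V by auto
      show ?thesis
      proof (cases "\<sigma> = 1")
        case True
        have "?X \<subseteq> {s. (t, \<sigma> * (V + s)) \<in> Null_set}"
        proof
          fix s assume s: "s \<in> ?X"
          then have "0 < \<sigma> * (V + s)" using V' True by auto
          then show "s \<in> {s. (t, \<sigma> * (V + s)) \<in> Null_set}"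
            using V1[rule_format, of V n t "\<sigma> * (V + s)"] s V' n n' n2 by blast
        qed
        then show ?thesis by (rule cov_mono[OF cov_negligible[OF neg]]) (use e in simp)
      next
        case False
        then have sm: "\<sigma> = - 1" using sg by (auto simp: abs_if split: if_splits)
        define q where "q = g n t"
        \<comment> \<open>On this slice phase and action are \<phi> + s p and J + s q, with
          direction q times (\<open>AA n t\<close>, 1).\<close>
        define p where "p = q * AA n t"
        define J where "J = q * (deriv (g n) t + V)"
        define \<phi> where "\<phi> = - 1 + J * AA n t"
        have q: "m \<le> q" "\<bar>q\<bar> \<le> 1" "0 < q" using g_bd(1,2)[of n t] mC by (auto simp: q_def)
        have A: "0 \<le> AA n t" "AA n t \<le> 2 / m\<^sup>2" using AA_bounds n n' by auto
        have "\<bar>p\<bar> \<le> 1 * (2 / m\<^sup>2)" unfolding p_def abs_mult using q A by (intro mult_mono) auto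
        then have p: "\<bar>p\<bar> \<le> R" "\<bar>q\<bar> \<le> R" using q mC by (auto simp: R_def intro: order_trans)
        have "\<delta> n / m \<le> \<bar>u n * AA n t + v n\<bar>"
        proof (rule ccontr)
          assume "\<not> ?thesis"
          then have "t \<in> {t. c n < t \<and> t < c (Suc n) \<and> \<bar>u n * AA n t + v n\<bar> < \<delta> n / m}"
            using n n' by simp
          moreover have "n \<in> {..2}" using n2 by simp
          ultimately have "t \<in> E" unfolding E_def by blast
          then show False using t by blast
        qed
        then have "m * (\<delta> n / m) \<le> q * \<bar>u n * AA n t + v n\<bar>"
          using q mC de[of n] by (intro mult_mono) auto
        then have "\<delta> n \<le> \<bar>q * (u n * AA n t + v n)\<bar>" using mC q by (simp add: abs_mult)
        then have dl: "\<delta> n \<le> \<bar>u n * p + v n * q\<bar>" by (simp add: p_def algebra_simps)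
        have cv: "cov {s \<in> {0..1}. surv.LS (NN n) n (\<phi> + s * p) (J + s * q)} \<epsilon>"
          by (rule NN[rule_format]) (intro conjI dl p)
        have "?X \<subseteq> {s \<in> {0..1}. surv.LS (NN n) n (\<phi> + s * p) (J + s * q)} \<union> {s. (t, \<sigma> * (V + s)) \<in> Null_set}"
        proof
          fix s assume s: "s \<in> ?X"
          have act: "act n t (\<sigma> * (V + s)) = J + s * q"
            by (simp add: act_def J_def q_def sm algebra_simps)
          have ph: "- 1 + (J + s * q) * AA n t = \<phi> + s * p" by (simp add: \<phi>_def p_def algebra_simps)
          show "s \<in> {s \<in> {0..1}. surv.LS (NN n) n (\<phi> + s * p) (J + s * q)} \<union> {s. (t, \<sigma> * (V + s)) \<in> Null_set}"
          proof (cases "(t, \<sigma> * (V + s)) \<in> Null_set")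
            case nn: False
            have "surv.LS N n (\<phi> + s * p) (J + s * q)"
              using V1[rule_format, of V n t "\<sigma> * (V + s)"] s V' n n' n2 nn unfolding act ph by blast
            then have "surv.LS (NN n) n (\<phi> + s * p) (J + s * q)" by (rule surv.LS_antimono[OF NNle[OF n2]])
            then show ?thesis using s by blast
          qed simp
        qed
        then show ?thesis by (rule cov_mono[OF cov_Un[OF cv cov_negligible[OF neg]]]) simp
      qed
    qed
    show ?thesis
      by (rule exI[of _ "max V1 1"], rule exI[of _ "real N + 6"], rule conjI, simp, rule exI[of _ E], rule conjI[OF cE])
        (intro allI impI ballI sl)
  qed
  show ?thesis
    by (rule exI[of _ K], rule conjI[OF K(1)], rule exI[of _ \<zeta>], rule conjI[OF K(2)]) (intro allI impI main)
qed

end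

section \<open>Symmetry under turning the table upside down\<close>

context slits begin

lemma slit_flip: "slit lam x0 (\<lambda>t. 1 - fL t) (\<lambda>t. 1 - fR t) t = 1 - f t"
  by (simp add: slit_def)

text \<open>Restricted to noncritical times, where \<open>f\<close> is differentiable; elsewhere
  \<open>deriv\<close> need not denote a derivative.\<close>

lemma deriv_slit_flip:
  assumes "0 \<le> t" "\<not> crit t"
  shows "deriv (slit lam x0 (\<lambda>t. 1 - fL t) (\<lambda>t. 1 - fR t)) t = - deriv f t"
proof -
  have "c 0 \<le> t" using assms(1) c0_neg by simp
  from locate_c[OF this] obtain n where n: "c n \<le> t" "t < c (Suc n)" by blast
  have "c n \<noteq> t" using crit_c[of n] assms(2) by auto
  then have n': "c n < t" using n by simp
  have "(f has_real_derivative deriv f t) (at t)"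
    unfolding deriv_f_between_c[OF n' n(2)]
    using DERIV_cong_ev[OF refl eventually_between_c[OF n' n(2)] refl] slit_motionD(1)[OF mot_g] by blast
  then have "((\<lambda>t. 1 - f t) has_real_derivative 0 - deriv f t) (at t)"
    by (intro DERIV_diff DERIV_const)
  moreover have "slit lam x0 (\<lambda>t. 1 - fL t) (\<lambda>t. 1 - fR t) = (\<lambda>t. 1 - f t)"
    by (rule ext) (rule slit_flip)
  ultimately show ?thesis by (simp add: DERIV_imp_deriv)
qed

text \<open>At critical times the reflection law never involves the derivative of the slit, because
  orbits do not touch it there.\<close>

lemma orbit_flip:
  assumes t0: "0 \<le> t0" and o: "orbit lam x0 (\<lambda>t. 1 - fL t) (\<lambda>t. 1 - fR t) t0 v0 y w"
  shows "orbit lam x0 fL fR t0 (- v0) (\<lambda>t. 1 - y t) (\<lambda>t. - w t)"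
proof -
  define F where "F = slit lam x0 (\<lambda>t. 1 - fL t) (\<lambda>t. 1 - fR t)"
  have F: "F t = 1 - f t" for t by (simp add: F_def slit_flip)
  have o: "y t0 = F t0" "w t0 = v0" "\<And>t. t0 \<le> t \<Longrightarrow> 0 \<le> y t \<and> y t \<le> 1"
    "\<And>t. t0 \<le> t \<Longrightarrow> crit t \<Longrightarrow> y t \<noteq> 1 - fL t \<and> y t \<noteq> 1 - fR t"
    "\<And>b. finite {t \<in> {t0..b}. collides F y t}"
    "\<And>s t. t0 \<le> s \<Longrightarrow> s < t \<Longrightarrow> \<forall>r\<in>{s<..<t}. \<not> collides F y r \<Longrightarrow>
         y t = y s + (t - s) * w s \<and> w t = reflect F t (y t) (w s)"
    "\<And>s t. t0 \<le> s \<Longrightarrow> s \<le> t \<Longrightarrow> \<forall>r\<in>{s..t}. \<not> crit r \<Longrightarrow> 0 \<le> (y s - F s) * (y t - F t)"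
    using o unfolding orbit_def Let_def F_def[symmetric] by blast+
  have col: "collides f (\<lambda>t. 1 - y t) t \<longleftrightarrow> collides F y t" for t
    unfolding collides_def F by auto
  have refl: "reflect f t (1 - y t) (- u) = - reflect F t (y t) u" if t: "t0 \<le> t" for t u
  proof (cases "crit t")
    case True
    then have "y t \<noteq> F t" using o(4)[OF t] f_cases[of t] by (auto simp: F)
    then show ?thesis by (auto simp: reflect_def F)
  next
    case False
    then have "deriv F t = - deriv f t" using deriv_slit_flip[of t] t t0 by (simp add: F_def)
    then show ?thesis by (auto simp: reflect_def F)
  qed
  show ?thesis
    unfolding orbit_def Let_def
  proof (intro conjI allI impI)
    show "1 - y t0 = f t0" using o(1) F by simp
    show "- w t0 = - v0" using o(2) by simp
    show "0 \<le> 1 - y t" "1 - y t \<le> 1" if "t0 \<le> t" for t using o(3)[OF that] by auto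
    show "1 - y t \<noteq> fL t" "1 - y t \<noteq> fR t" if "t0 \<le> t" "crit t" for t using o(4)[OF that] by auto
    show "finite {t \<in> {t0..b}. collides f (\<lambda>t. 1 - y t) t}" for b unfolding col by (rule o(5))
    fix s t
    show "1 - y t = 1 - y s + (t - s) * - w s" "- w t = reflect f t (1 - y t) (- w s)"
      if "t0 \<le> s \<and> s < t \<and> (\<forall>r\<in>{s<..<t}. \<not> collides f (\<lambda>t. 1 - y t) r)"
      using o(6)[of s t] that refl[of t "w s"] unfolding col by auto
    assume "t0 \<le> s \<and> s \<le> t \<and> (\<forall>r\<in>{s..t}. \<not> crit r)"
    then have "0 \<le> (y s - F s) * (y t - F t)" using o(7)[of s t] by blast
    then show "0 \<le> (1 - y s - f s) * (1 - y t - f t)" unfolding F by (simp add: algebra_simps)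
  qed
qed

lemma growing_conds_flip:
  assumes "(t0, v0) \<in> growing_conds lam x0 (\<lambda>t. 1 - fL t) (\<lambda>t. 1 - fR t) K \<zeta> T V"
  shows "(t0, - v0) \<in> growing_conds lam x0 fL fR K \<zeta> T V"
proof -
  obtain y w where i: "(t0, v0) \<in> initial_conds V" and o: "orbit lam x0 (\<lambda>t. 1 - fL t) (\<lambda>t. 1 - fR t) t0 v0 y w"
    and gr: "\<forall>t\<ge>T. \<bar>w (t0 + T)\<bar> / K * exp (\<zeta> * (t - T)) \<le> \<bar>w (t0 + t)\<bar>"
    using assms unfolding growing_conds_def by blast
  have i': "(t0, - v0) \<in> initial_conds V" "0 \<le> t0" using i by (auto simp: initial_conds_def)
  have "orbit lam x0 fL fR t0 (- v0) (\<lambda>t. 1 - y t) (\<lambda>t. - w t)" by (rule orbit_flip[OF i'(2) o])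
  moreover have "\<forall>t\<ge>T. \<bar>- w (t0 + T)\<bar> / K * exp (\<zeta> * (t - T)) \<le> \<bar>- w (t0 + t)\<bar>" using gr by simp
  ultimately show ?thesis using i'(1) unfolding growing_conds_def by blast
qed

lemma flip_slits: "slits lam x0 (\<lambda>t. 1 - fL t) (\<lambda>t. 1 - fR t)"
  by unfold_locales (use lam x0 flip_slit_motion motL motR in auto)

lemma Lim_slit_crit:
  "Lim (at_left t1) f = fL t1" "Lim (at_right t1) f = fR t1" "Lim (at_left t2) f = fR t2" "Lim (at_right t2) f = fL t2"
  "Lim (at_left t1) (deriv f) = deriv fL t1" "Lim (at_right t1) (deriv f) = deriv fR t1"
  "Lim (at_left t2) (deriv f) = deriv fR t2" "Lim (at_right t2) (deriv f) = deriv fL t2"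
proof -
  have "c 1 = t1" "c (Suc 0) = t1" "c (Suc 1) = t2" "c 2 = t2" by (simp_all add: c_def)
  moreover have "g 0 = fL" "g 1 = fR" "g 2 = fL" by (simp_all add: g_def)
  ultimately show "Lim (at_left t1) f = fL t1" "Lim (at_right t1) f = fR t1" "Lim (at_left t2) f = fR t2"
    "Lim (at_right t2) f = fL t2" "Lim (at_left t1) (deriv f) = deriv fL t1" "Lim (at_right t1) (deriv f) = deriv fR t1"
    "Lim (at_left t2) (deriv f) = deriv fR t2" "Lim (at_right t2) (deriv f) = deriv fL t2"
    using Lim_slit(1,3)[of 0] Lim_slit(2,4)[of 1] Lim_slit(1,3)[of 1] Lim_slit(2,4)[of 2] by simp_all
qed

text \<open>Under f to 1 - f the derivatives change sign, which turns a_i' into a_i.\<close>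

lemma TrL_flip: "TrL lam x0 (\<lambda>t. 1 - fL t) (\<lambda>t. 1 - fR t) = TrU lam x0 fL fR"
proof -
  interpret F: slits lam x0 "\<lambda>t. 1 - fL t" "\<lambda>t. 1 - fR t" by (rule flip_slits)
  have S: "(\<lambda>s. 1 / (slit lam x0 (\<lambda>t. 1 - fL t) (\<lambda>t. 1 - fR t) s)\<^sup>2) = (\<lambda>s. 1 / (1 - f s)\<^sup>2)"
    by (rule ext) (simp only: slit_flip)
  have N: "- p * x - - q * z = q * z - p * x" for p q x z :: real by simp
  show ?thesis
    unfolding TrL_def TrU_def Let_def F.Lim_slit_crit Lim_slit_crit S flip_deriv[OF motL] flip_deriv[OF motR] N ..
qed

end

section \<open>From slices to planar measure\<close>

lemma cov_emeasure_affine: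
  assumes "cov {s \<in> {0..1}. (t, \<sigma> * (V + s)) \<in> S} r" "\<bar>\<sigma>\<bar> = 1" "0 \<le> r"
  shows "\<exists>A\<in>sets lebesgue. emeasure lebesgue A \<le> ennreal r \<and> (\<forall>v. (t, v) \<in> S \<longrightarrow> V \<le> \<sigma> * v \<longrightarrow> \<sigma> * v \<le> V + 1 \<longrightarrow> v \<in> A)"
proof -
  obtain X where X: "X \<in> lmeasurable" "{s \<in> {0..1}. (t, \<sigma> * (V + s)) \<in> S} \<subseteq> X" "measure lebesgue X \<le> r"
    using assms(1) unfolding cov_def by blast
  have ss: "\<sigma> * \<sigma> = 1" using assms(2) by (metis abs_mult_self_eq mult_1)
  have "\<sigma> \<noteq> 0" using assms(2) by auto
  let ?A = "(\<lambda>x. \<sigma> *\<^sub>R x + \<sigma> * V) ` X"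
  have "emeasure lebesgue ?A = \<bar>\<sigma>\<bar> ^ DIM(real) * emeasure lebesgue X"
    by (rule emeasure_lebesgue_affine)
  also have "\<dots> = emeasure lebesgue X" using assms(2) by simp
  also have "\<dots> = ennreal (measure lebesgue X)" using X(1) by (simp add: emeasure_eq_measure2)
  also have "\<dots> \<le> ennreal r" using X(3) by (rule ennreal_leI)
  finally have e: "emeasure lebesgue ?A \<le> ennreal r" .
  have m: "?A \<in> sets lebesgue"
    by (rule differentiable_image_in_sets_lebesgue) (use X(1) in \<open>auto intro!: derivative_intros\<close>)
  have "v \<in> ?A" if "(t, v) \<in> S" "V \<le> \<sigma> * v" "\<sigma> * v \<le> V + 1" for v
  proof -
    have v: "\<sigma> * (\<sigma> * v) = v" using ss by (simp add: mult.assoc[symmetric])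
    have "V + (\<sigma> * v - V) = \<sigma> * v" by simp
    then have eq: "\<sigma> * (V + (\<sigma> * v - V)) = v" by (simp only: v)
    have "\<sigma> * v - V \<in> {s \<in> {0..1}. (t, \<sigma> * (V + s)) \<in> S}"
      unfolding mem_Collect_eq eq using that by simp
    then have "\<sigma> * v - V \<in> X" using X(2) by blast
    moreover have "v = \<sigma> *\<^sub>R (\<sigma> * v - V) + \<sigma> * V" using v by (simp add: right_diff_distrib)
    ultimately show ?thesis by blast
  qed
  then show ?thesis using e m by blast
qed

text \<open>Over an open set of measure at most 2 \<epsilon> containing the exceptional times the
  slices have measure at most 2; elsewhere in [0,2) they have measure at most 2 \<epsilon>, one
  \<epsilon> for each sign of the velocity. Together this is 4 \<epsilon> + 4 \<epsilon>.\<close>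

lemma measure_from_slices:
  assumes S: "S \<in> sets borel" "S \<subseteq> initial_conds V" and e: "0 < \<epsilon>" and E: "cov E \<epsilon>"
    and sl: "\<And>t \<sigma>. t \<in> {0..<2} - E \<Longrightarrow> \<bar>\<sigma>\<bar> = 1 \<Longrightarrow> cov {s \<in> {0..1}. (t, \<sigma> * (V + s)) \<in> S} \<epsilon>"
  shows "S \<in> lmeasurable \<and> measure lebesgue S \<le> 8 * \<epsilon>"
proof -
  obtain X where X: "X \<in> lmeasurable" "E \<subseteq> X" "measure lebesgue X \<le> \<epsilon>" using E unfolding cov_def by blast
  have "X \<in> sets lebesgue" using X(1) by (simp add: fmeasurable_def)
  \<comment> \<open>An open cover of the exceptional times is Borel, as the integrand in Fubini
    requires.\<close>
  then obtain T where T: "open T" "X \<subseteq> T" "T - X \<in> lmeasurable" "emeasure lebesgue (T - X) < ennreal \<epsilon>"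
    using sets_lebesgue_outer_open e by blast
  have Tb: "T \<in> sets borel" using T(1) by simp
  have mT: "emeasure lborel T \<le> ennreal (2 * \<epsilon>)"
  proof -
    have "emeasure lborel T = emeasure lebesgue (X \<union> (T - X))" using Tb T(2) by (simp add: Un_absorb1)
    also have "\<dots> \<le> emeasure lebesgue X + emeasure lebesgue (T - X)"
      by (rule emeasure_subadditive) (use X(1) T(3) in \<open>auto simp only: fmeasurable_def mem_Collect_eq\<close>)
    also have "emeasure lebesgue X = ennreal (measure lebesgue X)" using X(1) by (simp add: emeasure_eq_measure2)
    also have "\<dots> + emeasure lebesgue (T - X) \<le> ennreal \<epsilon> + ennreal \<epsilon>"
      using X(3) T(4) by (intro add_mono ennreal_leI) auto
    also have "\<dots> = ennreal (2 * \<epsilon>)" using e by (simp add: ennreal_plus[symmetric] del: ennreal_plus)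
    finally show ?thesis .
  qed
  have inc: "0 \<le> t \<and> t < 2 \<and> (V \<le> v \<and> v \<le> V + 1 \<or> V \<le> - v \<and> - v \<le> V + 1)" if "(t, v) \<in> S" for t v
  proof -
    have "(t, v) \<in> initial_conds V" using S(2) that by (rule subsetD)
    then show ?thesis by (auto simp: initial_conds_def abs_if split: if_splits)
  qed
  have Sb: "S \<in> sets (lborel \<Otimes>\<^sub>M lborel)" using S(1) unfolding lborel_prod sets_lborel .
  have slb: "Pair t -` S \<in> sets borel" for t using sets_Pair1[OF Sb, of t] by simp
  have bound: "emeasure lborel (Pair t -` S) \<le> 2 * indicator T t + ennreal (2 * \<epsilon>) * indicator {0..2} t" for t
  proof (cases "t \<in> {0..<2}")
    case False
    then have "(t, v) \<notin> S" for v using inc[of t v] by auto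
    then have "Pair t -` S = {}" by auto
    then show ?thesis by simp
  next
    case t: True
    show ?thesis
    proof (cases "t \<in> T")
      case True
      have "emeasure lborel (Pair t -` S) \<le> emeasure lborel ({V..V + 1} \<union> {- V - 1..- V})"
      proof (rule emeasure_mono)
        show "Pair t -` S \<subseteq> {V..V + 1} \<union> {- V - 1..- V}"
        proof
          fix v assume "v \<in> Pair t -` S"
          then show "v \<in> {V..V + 1} \<union> {- V - 1..- V}" using inc[of t v] by auto
        qed
      qed simp
      also have "\<dots> \<le> emeasure lborel {V..V + 1} + emeasure lborel {- V - 1..- V}"
        by (rule emeasure_subadditive) auto
      also have "\<dots> = 2" by simp
      also have "\<dots> \<le> 2 * indicator T t + ennreal (2 * \<epsilon>) * indicator {0..2} t"
        using True by simp
      finally show ?thesis .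
    next
      case False
      then have tE: "t \<in> {0..<2} - E" using t X(2) T(2) by blast
      obtain A where A: "A \<in> sets lebesgue" "emeasure lebesgue A \<le> ennreal \<epsilon>"
        "\<forall>v. (t, v) \<in> S \<longrightarrow> V \<le> 1 * v \<longrightarrow> 1 * v \<le> V + 1 \<longrightarrow> v \<in> A"
        by (rule bexE[OF cov_emeasure_affine[OF sl[OF tE, of 1]]]) (use e in \<open>auto intro: that\<close>)
      obtain B where B: "B \<in> sets lebesgue" "emeasure lebesgue B \<le> ennreal \<epsilon>"
        "\<forall>v. (t, v) \<in> S \<longrightarrow> V \<le> - 1 * v \<longrightarrow> - 1 * v \<le> V + 1 \<longrightarrow> v \<in> B"
        by (rule bexE[OF cov_emeasure_affine[OF sl[OF tE, of "- 1"]]]) (use e in \<open>auto intro: that\<close>)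
      have "emeasure lborel (Pair t -` S) = emeasure lebesgue (Pair t -` S)" using slb[of t] by simp
      also have "\<dots> \<le> emeasure lebesgue (A \<union> B)"
      proof (rule emeasure_mono)
        show "Pair t -` S \<subseteq> A \<union> B"
        proof
          fix v assume "v \<in> Pair t -` S"
          then have v: "(t, v) \<in> S" by simp
          then show "v \<in> A \<union> B" using inc[OF v] A(3)[rule_format, OF v] B(3)[rule_format, OF v] by auto
        qed
      qed (use A B in auto)
      also have "\<dots> \<le> emeasure lebesgue A + emeasure lebesgue B"
        by (rule emeasure_subadditive) (use A B in auto)
      also have "\<dots> \<le> ennreal \<epsilon> + ennreal \<epsilon>" using A B by (intro add_mono)
      also have "\<dots> = ennreal (2 * \<epsilon>)" using e by (simp add: ennreal_plus[symmetric] del: ennreal_plus)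
      finally show ?thesis using t False by simp
    qed
  qed
  have "emeasure lborel S = emeasure (lborel \<Otimes>\<^sub>M lborel) S" by (simp add: lborel_prod)
  also have "\<dots> = (\<integral>\<^sup>+ t. emeasure lborel (Pair t -` S) \<partial>lborel)"
    by (rule lborel.emeasure_pair_measure_alt[OF Sb])
  also have "\<dots> \<le> (\<integral>\<^sup>+ t. 2 * indicator T t + ennreal (2 * \<epsilon>) * indicator {0..2} t \<partial>lborel)"
    by (rule nn_integral_mono) (rule bound)
  also have "\<dots> = 2 * emeasure lborel T + ennreal (2 * \<epsilon>) * emeasure lborel {0..2::real}"
    using Tb by (subst nn_integral_add) (auto simp: nn_integral_cmult_indicator)
  also have "\<dots> \<le> ennreal 2 * ennreal (2 * \<epsilon>) + ennreal (2 * \<epsilon>) * ennreal 2"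
    using mT by (intro add_mono mult_mono) auto
  also have "\<dots> = ennreal (2 * (2 * \<epsilon>) + 2 * \<epsilon> * 2)"
  proof -
    have "ennreal (2 * (2 * \<epsilon>)) = ennreal 2 * ennreal (2 * \<epsilon>)" by (rule ennreal_mult') simp
    moreover have "ennreal (2 * \<epsilon> * 2) = ennreal (2 * \<epsilon>) * ennreal 2" by (rule ennreal_mult'') simp
    moreover have "ennreal (2 * (2 * \<epsilon>) + 2 * \<epsilon> * 2) = ennreal (2 * (2 * \<epsilon>)) + ennreal (2 * \<epsilon> * 2)"
      by (rule ennreal_plus) (use e in auto)
    ultimately show ?thesis by (simp only:)
  qed
  also have "\<dots> = ennreal (8 * \<epsilon>)" by simp
  finally have le: "emeasure lborel S \<le> ennreal (8 * \<epsilon>)" .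
  then have le': "emeasure lebesgue S \<le> ennreal (8 * \<epsilon>)" using S(1) by simp
  have "S \<in> sets lebesgue" using S(1) by auto
  then have "S \<in> lmeasurable" using le' by (intro fmeasurableI) (auto intro: le_less_trans ennreal_less_top)
  moreover have "measure lebesgue S \<le> 8 * \<epsilon>"
    unfolding measure_def using le' e by (intro enn2real_leI) auto
  ultimately show ?thesis by blast
qed

section \<open>Both trapping cases and the final estimate\<close>

lemma upper_small_slices:
  assumes s: "slits lam x0 fL fR" and u: "upper_trapping lam x0 fL fR" and tr: "2 < \<bar>TrL lam x0 fL fR\<bar>"
  shows "\<exists>K>0. \<exists>\<zeta>>0. \<forall>\<epsilon>>0. \<exists>V0. \<exists>T\<ge>0. \<exists>E. cov E \<epsilon> \<and> (\<forall>V\<ge>V0. \<forall>t\<in>{0..<2} - E. \<forall>\<sigma>. \<bar>\<sigma>\<bar> = 1 \<longrightarrow>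
     cov {s \<in> {0..1}. (t, \<sigma> * (V + s)) \<in> initial_conds V - growing_conds lam x0 fL fR K \<zeta> T V} \<epsilon>)"
proof -
  interpret slits lam x0 fL fR by (rule s)
  obtain m C where bd: "slit_bounds m C fL" "slit_bounds m C fR"
    using slit_motion_common_bounds[OF motL motR] by blast
  interpret trap lam x0 fL fR m C by unfold_locales (use bd u in auto)
  obtain \<kappa>0 where k: "0 < \<kappa>0 \<and> \<kappa>0 < 1 \<and> (\<forall>i. hp i \<le> \<kappa>0 * hm i)" using ex_contraction by blast
  interpret trap_hyp lam x0 fL fR m C \<kappa>0 by unfold_locales (use tr k in auto)
  show ?thesis by (rule small_slices)
qed

lemma small_slices_either:
  assumes s: "slits lam x0 fL fR" and "lower_trapping lam x0 fL fR \<or> upper_trapping lam x0 fL fR"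
    and tr: "2 < \<bar>Tr lam x0 fL fR\<bar>"
  shows "\<exists>K>0. \<exists>\<zeta>>0. \<forall>\<epsilon>>0. \<exists>V0. \<exists>T\<ge>0. \<exists>E. cov E \<epsilon> \<and> (\<forall>V\<ge>V0. \<forall>t\<in>{0..<2} - E. \<forall>\<sigma>. \<bar>\<sigma>\<bar> = 1 \<longrightarrow>
     cov {s \<in> {0..1}. (t, \<sigma> * (V + s)) \<in> initial_conds V - growing_conds lam x0 fL fR K \<zeta> T V} \<epsilon>)"
proof (cases "lower_trapping lam x0 fL fR")
  case False
  then show ?thesis using upper_small_slices[OF s] assms by (simp add: Tr_def)
next
  case True
  interpret slits lam x0 fL fR by (rule s)
  let ?L = "\<lambda>t. 1 - fL t" and ?R = "\<lambda>t. 1 - fR t"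
  have up: "upper_trapping lam x0 ?L ?R" using True by (simp add: upper_trapping_def lower_trapping_def)
  have tr': "2 < \<bar>TrL lam x0 ?L ?R\<bar>" using tr True unfolding TrL_flip by (simp add: Tr_def)
  obtain K \<zeta> where K: "0 < K" "0 < \<zeta>" and sl: "\<forall>\<epsilon>>0. \<exists>V0. \<exists>T\<ge>0. \<exists>E. cov E \<epsilon> \<and> (\<forall>V\<ge>V0. \<forall>t\<in>{0..<2} - E. \<forall>\<sigma>. \<bar>\<sigma>\<bar> = 1 \<longrightarrow>
     cov {s \<in> {0..1}. (t, \<sigma> * (V + s)) \<in> initial_conds V - growing_conds lam x0 ?L ?R K \<zeta> T V} \<epsilon>)"
    using upper_small_slices[OF flip_slits up tr'] by (elim exE conjE) (rule that)
  \<comment> \<open>The flip changes the sign of the velocity, so the slice with sign \<sigma>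
    corresponds to the flipped slice with sign -\<sigma>.\<close>
  have sub: "{s \<in> {0..1}. (t, \<sigma> * (V + s)) \<in> initial_conds V - growing_conds lam x0 fL fR K \<zeta> T V} \<subseteq>
    {s \<in> {0..1}. (t, - \<sigma> * (V + s)) \<in> initial_conds V - growing_conds lam x0 ?L ?R K \<zeta> T V}" for t \<sigma> V T
  proof
    fix s assume s: "s \<in> {s \<in> {0..1}. (t, \<sigma> * (V + s)) \<in> initial_conds V - growing_conds lam x0 fL fR K \<zeta> T V}"
    have "(t, - \<sigma> * (V + s)) \<notin> growing_conds lam x0 ?L ?R K \<zeta> T V"
    proof
      assume "(t, - \<sigma> * (V + s)) \<in> growing_conds lam x0 ?L ?R K \<zeta> T V"
      then have "(t, - (- \<sigma> * (V + s))) \<in> growing_conds lam x0 fL fR K \<zeta> T V" by (rule growing_conds_flip)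
      then show False using s by simp
    qed
    moreover have "(t, - \<sigma> * (V + s)) \<in> initial_conds V" using s by (simp add: initial_conds_def)
    ultimately show "s \<in> {s \<in> {0..1}. (t, - \<sigma> * (V + s)) \<in> initial_conds V - growing_conds lam x0 ?L ?R K \<zeta> T V}"
      using s by simp
  qed
  have "\<exists>V0. \<exists>T\<ge>0. \<exists>E. cov E \<epsilon> \<and> (\<forall>V\<ge>V0. \<forall>t\<in>{0..<2} - E. \<forall>\<sigma>. \<bar>\<sigma>\<bar> = 1 \<longrightarrow>
     cov {s \<in> {0..1}. (t, \<sigma> * (V + s)) \<in> initial_conds V - growing_conds lam x0 fL fR K \<zeta> T V} \<epsilon>)"
    if e: "0 < \<epsilon>" for \<epsilon> :: real
  proof -
    from sl[rule_format, OF e] obtain V0 T E where T: "0 \<le> T" and E: "cov E \<epsilon>"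
      and cv: "\<forall>V\<ge>V0. \<forall>t\<in>{0..<2} - E. \<forall>\<sigma>. \<bar>\<sigma>\<bar> = 1 \<longrightarrow>
        cov {s \<in> {0..1}. (t, \<sigma> * (V + s)) \<in> initial_conds V - growing_conds lam x0 ?L ?R K \<zeta> T V} \<epsilon>"
      by (elim exE conjE) (rule that)
    have res: "cov {s \<in> {0..1}. (t, \<sigma> * (V + s)) \<in> initial_conds V - growing_conds lam x0 fL fR K \<zeta> T V} \<epsilon>"
      if "V0 \<le> V" "t \<in> {0..<2} - E" "\<bar>\<sigma>\<bar> = 1" for V t \<sigma>
    proof (rule cov_mono[OF _ sub order_refl])
      show "cov {s \<in> {0..1}. (t, - \<sigma> * (V + s)) \<in> initial_conds V - growing_conds lam x0 ?L ?R K \<zeta> T V} \<epsilon>"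
        by (rule cv[rule_format, OF that(1,2)]) (use that(3) in simp)
    qed
    show ?thesis
      by (rule exI[of _ V0], rule exI[of _ T], rule conjI[OF T], rule exI[of _ E], rule conjI[OF E]) (intro allI impI ballI res)
  qed
  note res = this
  show ?thesis
    by (rule exI[of _ K], rule conjI[OF K(1)], rule exI[of _ \<zeta>], rule conjI[OF K(2)]) (intro allI impI res)
qed

theorem theorem2:
  fixes lam x0 :: real and fL fR :: "real \<Rightarrow> real"
  assumes "0 < lam" "lam < 1" "0 \<le> x0" "x0 < lam"
    and "slit_motion fL" "slit_motion fR"
    and "lower_trapping lam x0 fL fR \<or> upper_trapping lam x0 fL fR"
    and "\<bar>Tr lam x0 fL fR\<bar> > 2"
  shows "\<exists>K>0. \<exists>\<zeta>>0. \<forall>\<epsilon>>0. \<exists>V0. \<exists>T\<ge>0. \<forall>V\<ge>V0.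
           initial_conds V - growing_conds lam x0 fL fR K \<zeta> T V \<in> lmeasurable \<and>
           measure lebesgue (initial_conds V - growing_conds lam x0 fL fR K \<zeta> T V) < \<epsilon>"
proof -
  interpret slits lam x0 fL fR by unfold_locales (use assms in auto)
  obtain K \<zeta> where K: "0 < K" "0 < \<zeta>" and sl: "\<forall>\<epsilon>>0. \<exists>V0. \<exists>T\<ge>0. \<exists>E. cov E \<epsilon> \<and> (\<forall>V\<ge>V0. \<forall>t\<in>{0..<2} - E. \<forall>\<sigma>. \<bar>\<sigma>\<bar> = 1 \<longrightarrow>
     cov {s \<in> {0..1}. (t, \<sigma> * (V + s)) \<in> initial_conds V - growing_conds lam x0 fL fR K \<zeta> T V} \<epsilon>)"
    using small_slices_either[OF slits_axioms assms(7,8)] by (elim exE conjE) (rule that)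
  have "\<exists>V0. \<exists>T\<ge>0. \<forall>V\<ge>V0. initial_conds V - growing_conds lam x0 fL fR K \<zeta> T V \<in> lmeasurable \<and>
     measure lebesgue (initial_conds V - growing_conds lam x0 fL fR K \<zeta> T V) < \<epsilon>" if e: "0 < \<epsilon>" for \<epsilon> :: real
  proof -
    \<comment> \<open>With \<epsilon> / 9 the bound 8 \<epsilon> / 9 is strictly less than
      \<epsilon>.\<close>
    have e9: "0 < \<epsilon> / 9" using e by simp
    from sl[rule_format, OF e9] obtain V0 T E where T: "0 \<le> T" and E: "cov E (\<epsilon> / 9)"
      and cv: "\<forall>V\<ge>V0. \<forall>t\<in>{0..<2} - E. \<forall>\<sigma>. \<bar>\<sigma>\<bar> = 1 \<longrightarrow>
        cov {s \<in> {0..1}. (t, \<sigma> * (V + s)) \<in> initial_conds V - growing_conds lam x0 fL fR K \<zeta> T V} (\<epsilon> / 9)"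
      by (elim exE conjE) (rule that)
    have res: "initial_conds V - growing_conds lam x0 fL fR K \<zeta> T V \<in> lmeasurable \<and>
      measure lebesgue (initial_conds V - growing_conds lam x0 fL fR K \<zeta> T V) < \<epsilon>" if V: "V0 \<le> V" for V
    proof -
      have "initial_conds V - growing_conds lam x0 fL fR K \<zeta> T V \<in> lmeasurable \<and>
        measure lebesgue (initial_conds V - growing_conds lam x0 fL fR K \<zeta> T V) \<le> 8 * (\<epsilon> / 9)"
        by (rule measure_from_slices[OF borel_bad_conds(2)[OF T K(1) less_imp_le[OF K(2)]] Diff_subset e9 E])
          (rule cv[rule_format, OF V])
      then show ?thesis using e by linarith
    qed
    show ?thesis
      by (rule exI[of _ V0], rule exI[of _ T], rule conjI[OF T]) (rule allI, rule impI, rule res)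
  qed
  note res = this
  show ?thesis
    by (rule exI[of _ K], rule conjI[OF K(1)], rule exI[of _ \<zeta>], rule conjI[OF K(2)]) (rule allI, rule impI, rule res)
qed

end
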